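(* Let $A$ be a split finite-dimensional algebra over a field $k$, and let $M$ be an $A$-module of composition length $m$. Then \[ \mathrm{b}_A(M)\leq 2^{m^2}. \]
   Context: Modules are finite-dimensional right modules. $A$ is split if $\operatorname{End}_A(S)\simeq k$ as $k$-algebras for every simple $A$-module $S$. A brick is a module whose endomorphism ring is a division ring. For a brick $B$, $\mathsf{Filt}\,B$ is the class of modules admitting a finite filtration by submodules all of whose successive factors are isomorphic to $B$ (including the zero module). A brick chain filtration of $M$ is a chain of submodules $0=M_0\subsetneq M_1\subsetneq\cdots\subsetneq M_t=M$ for which there exist bricks $B_1,\ldots,B_t$ with $M_i/M_{i-1}\in\mathsf{Filt}\,B_i$ for all $i$ and $\operatorname{Hom}_A(B_i,B_j)=0$ for all $i<j$. $\mathrm{b}_A(M)$ is the number of chains of submodules $(M_i)_{i=0}^t$ (any $t$) that are brick chain filtrations of $M$, with $\mathrm{b}_A(0)=1$. *)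

theory Defs
  imports "HOL-Algebra.QuotRing" "Jordan_Normal_Form.Missing_VectorSpace"
begin

section \<open>Finite-dimensional algebras and their modules\<close>

text \<open>
  An algebra over a field \<open>K\<close> is a record of type \<open>('k, 'a) module\<close>: its ring fields carry the
  (not necessarily commutative, possibly zero) ring structure, and \<open>smult\<close> is the action of \<open>K\<close>.
\<close>

locale fd_algebra = vectorspace K A + A?: ring A
  for K :: "'k ring" and A :: "('k, 'a) module" +
  assumes smult_mult_left:
      "\<lbrakk>c \<in> carrier K; x \<in> carrier A; y \<in> carrier A\<rbrakk>
        \<Longrightarrow> (c \<odot>\<^bsub>A\<^esub> x) \<otimes>\<^bsub>A\<^esub> y = c \<odot>\<^bsub>A\<^esub> (x \<otimes>\<^bsub>A\<^esub> y)"
    and smult_mult_right: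
      "\<lbrakk>c \<in> carrier K; x \<in> carrier A; y \<in> carrier A\<rbrakk>
        \<Longrightarrow> x \<otimes>\<^bsub>A\<^esub> (c \<odot>\<^bsub>A\<^esub> y) = c \<odot>\<^bsub>A\<^esub> (x \<otimes>\<^bsub>A\<^esub> y)"
    and fin_dim_algebra: "vectorspace.fin_dim K A"

text \<open>
  A right \<open>A\<close>-module is a record of type \<open>('a, 'm) module\<close> in which \<open>a \<odot> x\<close> stands for \<open>x a\<close>;
  hence the reversed order in the associativity law below. The fields \<open>mult\<close> and \<open>one\<close> of such
  a record are irrelevant. The field \<open>K\<close> acts through \<open>x c = x (c 1)\<close>.
\<close>

definition scalar_restriction ::
    "('k, 'a) module \<Rightarrow> ('a, 'm) module \<Rightarrow> ('k, 'm) module" where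
  "scalar_restriction A M =
    \<lparr>carrier = carrier M, mult = mult M, one = one M, zero = zero M, add = add M,
     smult = (\<lambda>c x. (c \<odot>\<^bsub>A\<^esub> \<one>\<^bsub>A\<^esub>) \<odot>\<^bsub>M\<^esub> x)\<rparr>"

locale right_module = A?: ring A + M?: abelian_group M
  for A :: "('k, 'a) module" and M :: "('a, 'm) module" +
  assumes act_closed:
      "\<lbrakk>a \<in> carrier A; x \<in> carrier M\<rbrakk> \<Longrightarrow> a \<odot>\<^bsub>M\<^esub> x \<in> carrier M"
    and act_distr_ring:
      "\<lbrakk>a \<in> carrier A; b \<in> carrier A; x \<in> carrier M\<rbrakk>
        \<Longrightarrow> (a \<oplus>\<^bsub>A\<^esub> b) \<odot>\<^bsub>M\<^esub> x = a \<odot>\<^bsub>M\<^esub> x \<oplus>\<^bsub>M\<^esub> b \<odot>\<^bsub>M\<^esub> x"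
    and act_distr_module:
      "\<lbrakk>a \<in> carrier A; x \<in> carrier M; y \<in> carrier M\<rbrakk>
        \<Longrightarrow> a \<odot>\<^bsub>M\<^esub> (x \<oplus>\<^bsub>M\<^esub> y) = a \<odot>\<^bsub>M\<^esub> x \<oplus>\<^bsub>M\<^esub> a \<odot>\<^bsub>M\<^esub> y"
    and act_mult:
      "\<lbrakk>a \<in> carrier A; b \<in> carrier A; x \<in> carrier M\<rbrakk>
        \<Longrightarrow> (a \<otimes>\<^bsub>A\<^esub> b) \<odot>\<^bsub>M\<^esub> x = b \<odot>\<^bsub>M\<^esub> (a \<odot>\<^bsub>M\<^esub> x)"
    and act_one: "x \<in> carrier M \<Longrightarrow> \<one>\<^bsub>A\<^esub> \<odot>\<^bsub>M\<^esub> x = x"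

lemma scalar_restriction_vectorspace:
  assumes "fd_algebra K A" and "right_module A M"
  shows "vectorspace K (scalar_restriction A M)"
proof -
  interpret FA: fd_algebra K A by fact
  interpret RM: right_module A M by fact
  have "abelian_group (scalar_restriction A M)"
    by (rule abelian_groupI)
      (auto simp: scalar_restriction_def RM.M.a_ac intro: RM.M.l_neg)
  moreover have one: "c \<odot>\<^bsub>A\<^esub> \<one>\<^bsub>A\<^esub> \<in> carrier A" if "c \<in> carrier K" for c
    using that by simp
  moreover have "(c \<otimes>\<^bsub>K\<^esub> d) \<odot>\<^bsub>A\<^esub> \<one>\<^bsub>A\<^esub> = (d \<odot>\<^bsub>A\<^esub> \<one>\<^bsub>A\<^esub>) \<otimes>\<^bsub>A\<^esub> (c \<odot>\<^bsub>A\<^esub> \<one>\<^bsub>A\<^esub>)"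
    if "c \<in> carrier K" "d \<in> carrier K" for c d
    using that one FA.smult_mult_right[of c "d \<odot>\<^bsub>A\<^esub> \<one>\<^bsub>A\<^esub>" "\<one>\<^bsub>A\<^esub>"]
    by (simp add: FA.module.smult_assoc1)
  ultimately have "module K (scalar_restriction A M)"
    by (intro moduleI FA.module.R.is_cring)
      (simp_all add: scalar_restriction_def RM.act_closed RM.act_distr_ring RM.act_distr_module
        RM.act_mult RM.act_one FA.module.smult_l_distr)
  then show ?thesis
    by (simp add: vectorspace_def FA.field.field_axioms)
qed

definition fd_right_module ::
    "'k ring \<Rightarrow> ('k, 'a) module \<Rightarrow> ('a, 'm) module \<Rightarrow> bool" where
  "fd_right_module K A M \<longleftrightarrow>
    right_module A M \<and> vectorspace.fin_dim K (scalar_restriction A M)"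

text \<open>
  Up to isomorphism every finite-dimensional module has its carrier inside the type of
  coordinate sequences over \<open>K\<close>. Wherever modules have to be quantified over (all simple modules,
  existence of bricks), they range over this type.
\<close>

type_synonym ('k, 'a) coord_module = "('a, nat \<Rightarrow> 'k) module"

definition modules_isomorphic ::
    "('k, 'a) module \<Rightarrow> ('a, 'm) module \<Rightarrow> ('a, 'n) module \<Rightarrow> bool" where
  "modules_isomorphic A M N \<longleftrightarrow>
    (\<exists>f \<in> module_hom A M N. bij_betw f (carrier M) (carrier N))"

definition hom_zero ::
    "('k, 'a) module \<Rightarrow> ('a, 'm) module \<Rightarrow> ('a, 'n) module \<Rightarrow> bool" where
  "hom_zero A M N \<longleftrightarrow> (\<forall>f \<in> module_hom A M N. \<forall>x \<in> carrier M. f x = \<zero>\<^bsub>N\<^esub>)"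

text \<open>The name \<open>submodule\<close> is also used by the imported vector space theory, for modules over
  commutative rings only.\<close>

abbreviation rsubmodule ::
    "('k, 'a) module \<Rightarrow> ('a, 'm) module \<Rightarrow> 'm set \<Rightarrow> bool" where
  "rsubmodule A M N \<equiv> Module.submodule N A M"

definition quotient_module :: "('a, 'm) module \<Rightarrow> 'm set \<Rightarrow> ('a, 'm set) module" where
  "quotient_module M N =
    \<lparr>carrier = a_rcosets\<^bsub>M\<^esub> N, mult = (\<lambda>_ _. N), one = N, zero = N, add = set_add M,
     smult = (\<lambda>a C. \<Union>x\<in>C. N +>\<^bsub>M\<^esub> (a \<odot>\<^bsub>M\<^esub> x))\<rparr>"

definition simple_module ::
    "'k ring \<Rightarrow> ('k, 'a) module \<Rightarrow> ('a, 'm) module \<Rightarrow> bool" where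
  "simple_module K A S \<longleftrightarrow>
    fd_right_module K A S \<and> carrier S \<noteq> {\<zero>\<^bsub>S\<^esub>} \<and>
    (\<forall>N. rsubmodule A S N \<longrightarrow> N = {\<zero>\<^bsub>S\<^esub>} \<or> N = carrier S)"


section \<open>Endomorphism algebras, split algebras and bricks\<close>

text \<open>Endomorphisms are represented by functions that are extensional on the carrier, so that
  equality of endomorphisms is equality of functions.\<close>

definition endo_algebra ::
    "('k, 'a) module \<Rightarrow> ('a, 'm) module \<Rightarrow> ('k, 'm \<Rightarrow> 'm) module" where
  "endo_algebra A M =
    \<lparr>carrier = module_hom A M M \<inter> extensional (carrier M),
     mult = compose (carrier M),
     one = (\<lambda>x\<in>carrier M. x),
     zero = (\<lambda>x\<in>carrier M. \<zero>\<^bsub>M\<^esub>),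
     add = (\<lambda>f g. \<lambda>x\<in>carrier M. f x \<oplus>\<^bsub>M\<^esub> g x),
     smult = (\<lambda>c f. \<lambda>x\<in>carrier M. (c \<odot>\<^bsub>A\<^esub> \<one>\<^bsub>A\<^esub>) \<odot>\<^bsub>M\<^esub> f x)\<rparr>"

definition self_algebra :: "'k ring \<Rightarrow> ('k, 'k) module" where
  "self_algebra K =
    \<lparr>carrier = carrier K, mult = mult K, one = one K, zero = zero K, add = add K,
     smult = mult K\<rparr>"

definition algebras_isomorphic ::
    "'k ring \<Rightarrow> ('k, 'a) module \<Rightarrow> ('k, 'b) module \<Rightarrow> bool" where
  "algebras_isomorphic K E F \<longleftrightarrow>
    (\<exists>h \<in> ring_iso E F. \<forall>c \<in> carrier K. \<forall>x \<in> carrier E. h (c \<odot>\<^bsub>E\<^esub> x) = c \<odot>\<^bsub>F\<^esub> h x)"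

definition split_algebra :: "'k ring \<Rightarrow> ('k, 'a) module \<Rightarrow> bool" where
  "split_algebra K A \<longleftrightarrow>
    (\<forall>S :: ('k, 'a) coord_module. simple_module K A S \<longrightarrow>
      algebras_isomorphic K (endo_algebra A S) (self_algebra K))"

locale skew_field = ring R for R (structure) +
  assumes skew_field_Units: "Units R = carrier R - {\<zero>}"

definition brick ::
    "'k ring \<Rightarrow> ('k, 'a) module \<Rightarrow> ('a, 'm) module \<Rightarrow> bool" where
  "brick K A B \<longleftrightarrow> fd_right_module K A B \<and> skew_field (endo_algebra A B)"


section \<open>Filtrations\<close>

text \<open>A filtration of length \<open>t\<close> is the list \<open>[M\<^sub>0, \<dots>, M\<^sub>t]\<close> of its \<open>t + 1\<close> members; its factors
  are numbered \<open>0, \<dots>, t - 1\<close>.\<close>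

definition filtration ::
    "('k, 'a) module \<Rightarrow> ('a, 'm) module \<Rightarrow> 'm set list \<Rightarrow> bool" where
  "filtration A M Ms \<longleftrightarrow>
    Ms \<noteq> [] \<and> hd Ms = {\<zero>\<^bsub>M\<^esub>} \<and> last Ms = carrier M \<and>
    (\<forall>N \<in> set Ms. rsubmodule A M N) \<and> sorted_wrt (\<subseteq>) Ms"

definition factor ::
    "('a, 'm) module \<Rightarrow> 'm set list \<Rightarrow> nat \<Rightarrow> ('a, 'm set) module" where
  "factor M Ms i = quotient_module (M\<lparr>carrier := Ms ! Suc i\<rparr>) (Ms ! i)"

definition has_composition_length ::
    "'k ring \<Rightarrow> ('k, 'a) module \<Rightarrow> ('a, 'm) module \<Rightarrow> nat \<Rightarrow> bool" where
  "has_composition_length K A M m \<longleftrightarrow>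
    (\<exists>Ms. filtration A M Ms \<and> length Ms = Suc m \<and>
      (\<forall>i < m. simple_module K A (factor M Ms i)))"

definition Filt ::
    "'k ring \<Rightarrow> ('k, 'a) module \<Rightarrow> ('a, 'b) module \<Rightarrow> ('a, 'm) module set" where
  "Filt K A B =
    {X. fd_right_module K A X \<and>
      (\<exists>Xs. filtration A X Xs \<and>
        (\<forall>i < length Xs - 1. modules_isomorphic A (factor X Xs i) B))}"

definition brick_chain_filtration ::
    "'k ring \<Rightarrow> ('k, 'a) module \<Rightarrow> ('a, 'm) module \<Rightarrow> 'm set list \<Rightarrow> bool" where
  "brick_chain_filtration K A M Ms \<longleftrightarrow>
    filtration A M Ms \<and> sorted_wrt (\<subset>) Ms \<and>
    (\<exists>B :: nat \<Rightarrow> ('k, 'a) coord_module.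
      (\<forall>i < length Ms - 1. brick K A (B i) \<and> factor M Ms i \<in> Filt K A (B i)) \<and>
      (\<forall>j < length Ms - 1. \<forall>i < j. hom_zero A (B i) (B j)))"

definition brick_chain_number ::
    "'k ring \<Rightarrow> ('k, 'a) module \<Rightarrow> ('a, 'm) module \<Rightarrow> nat" where
  "brick_chain_number K A M = card {Ms. brick_chain_filtration K A M Ms}"

end

theory Submission
  imports Complex_Main "HOL-Library.Multiset" Defs
begin

text \<open>
  All members \<open>U\<close> of a brick chain filtration satisfy \<open>Hom(U, M / U) = 0\<close>. Cutting down by an element \<open>e\<close> that acts on \<open>M\<close> as an
  idempotent of rank one on every composition factor (it exists since \<open>A\<close> is split), a submodule \<open>U\<close> is determined by the subspace \<open>U e\<close>
  of the \<open>m\<close>-dimensional space \<open>M e\<close>. Fix a submodule \<open>Z\<close> with pivot set \<open>J0\<close> and a set \<open>J\<close> of pivots containing \<open>J0\<close>.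
  The submodules \<open>U\<close> containing \<open>Z\<close> with pivot set \<open>J\<close> are the common zeros of quadrics in \<open>|J - J0| (m - |J|)\<close> variables, and the
  tangent space at \<open>U\<close> embeds into \<open>Hom(U, M / U)\<close>; so those with \<open>Hom(U, M / U) = 0\<close> are nondegenerate zeros, of which
  there are at most \<open>2\<close> to the number of variables. Summing over \<open>J\<close> and inducting gives at most \<open>2\<close> to the \<open>(m - |J0|)\<^sup>2\<close> chains
  of such submodules from \<open>Z\<close> to \<open>M\<close>.

  The bound on the number of zeros \<open>z i\<close> over an arbitrary field: the products of powers of quadrics with independent differentials at \<open>z i\<close>
  and a polynomial separating \<open>z i\<close> from the other zeros have linearly independent jets, and the dimension of the space of polynomials
  of degree at most \<open>2 s + D\<close> in \<open>n\<close> variables is asymptotically \<open>2\<^sup>n\<close> times that of degree at most \<open>s\<close>.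
\<close>

section \<open>Linear equations over a field\<close>

text \<open>The field may be finite or not algebraically closed, and the quadrics that cut out a
  family of submodules need not form a complete intersection, so a classical Bezout argument does
  not apply directly. Nondegeneracy is witnessed at each zero separately, and the count uses nothing
  else. The vanishing of Hom(U, M / U) comes from the order in the chain: U is filtered by the
  earlier factors, M / U by the later ones, and an earlier brick has no nonzero map to a later one.
  Splitness enters through the endomorphisms of simple modules: they are scalars, so density yields
  an element of rank one on each composition factor, and M e has exactly one dimension per factor.
  Relative to Z only |J - J0| of the |J| echelon rows are free, and this is what closes the
  recursion: with n = m - |J0| and J0 strictly inside J, the exponents for one step and for the rest
  of the chain add up to (m - |J|) n \<le> (n - 1) n, and the remaining n pays for the at most 2^n
  choices of J.\<close>

context field begin

lemma finsum_eq_zero: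
  assumes "\<And>x. x \<in> S \<Longrightarrow> f x = \<zero>"
  shows "(\<Oplus>x\<in>S. f x) = \<zero>"
proof -
  have "(\<Oplus>x\<in>S. f x) = (\<Oplus>x\<in>S. \<zero>)"
    by (rule finsum_cong') (use assms in auto)
  then show ?thesis by simp
qed

lemma finsum_single:
  assumes "finite S" "s \<in> S" "f s \<in> carrier R" "\<And>x. x \<in> S \<Longrightarrow> x \<noteq> s \<Longrightarrow> f x = \<zero>"
  shows "(\<Oplus>x\<in>S. f x) = f s"
proof -
  have S: "S = insert s (S - {s})" using assms(2) by auto
  have "(\<Oplus>x\<in>insert s (S - {s}). f x) = f s \<oplus> (\<Oplus>x\<in>S - {s}. f x)"
    by (rule finsum_insert) (use assms in auto)
  also have "(\<Oplus>x\<in>S - {s}. f x) = \<zero>"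
    by (rule finsum_eq_zero) (use assms in auto)
  finally show ?thesis using S assms(3) by simp
qed

lemma finsum_commute:
  assumes "finite S" "finite T" "\<And>x y. x \<in> S \<Longrightarrow> y \<in> T \<Longrightarrow> f x y \<in> carrier R"
  shows "(\<Oplus>x\<in>S. \<Oplus>y\<in>T. f x y) = (\<Oplus>y\<in>T. \<Oplus>x\<in>S. f x y)"
  using assms(1,3)
proof (induction S rule: finite_induct)
  case empty
  then show ?case by (simp add: finsum_eq_zero)
next
  case (insert s S)
  have "(\<Oplus>y\<in>T. \<Oplus>x\<in>insert s S. f x y) = (\<Oplus>y\<in>T. f s y \<oplus> (\<Oplus>x\<in>S. f x y))"
    by (rule finsum_cong') (use insert in \<open>auto simp: Pi_def intro!: finsum_insert add.m_closed finsum_closed\<close>)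
  also have "\<dots> = (\<Oplus>y\<in>T. f s y) \<oplus> (\<Oplus>y\<in>T. \<Oplus>x\<in>S. f x y)"
    by (rule finsum_addf) (use insert in \<open>auto simp: Pi_def intro!: finsum_closed\<close>)
  finally show ?case
    using insert by (subst finsum_insert) (auto simp: Pi_def intro!: finsum_closed)
qed

text \<open>Elimination, by induction on the equations: an equation with a nonzero coefficient at
  \<open>a0\<close> is used up to eliminate that unknown, which leaves one equation and one unknown
  fewer.\<close>

lemma homogeneous_system:
  assumes "finite G" "finite S" "card G < card S"
    and "\<And>a g. a \<in> S \<Longrightarrow> g \<in> G \<Longrightarrow> c a g \<in> carrier R"
  shows "\<exists>y. (\<forall>a\<in>S. y a \<in> carrier R) \<and> (\<exists>a\<in>S. y a \<noteq> \<zero>) \<and>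
    (\<forall>g\<in>G. (\<Oplus>a\<in>S. y a \<otimes> c a g) = \<zero>)"
  using assms
proof (induction G arbitrary: S c rule: finite_induct)
  case empty
  then have "S \<noteq> {}" by auto
  then show ?case by (intro exI[of _ "\<lambda>_. \<one>"]) auto
next
  case (insert g G)
  show ?case
  proof (cases "\<forall>a\<in>S. c a g = \<zero>")
    case True
    obtain y where "\<forall>a\<in>S. y a \<in> carrier R" "\<exists>a\<in>S. y a \<noteq> \<zero>"
      "\<forall>h\<in>G. (\<Oplus>a\<in>S. y a \<otimes> c a h) = \<zero>"
      using insert.IH[of S c] insert.prems insert.hyps by auto
    then show ?thesis
      using True by (intro exI[of _ y]) (auto intro!: finsum_eq_zero)
  next
    case False
    then obtain a0 where a0: "a0 \<in> S" "c a0 g \<noteq> \<zero>" by blast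
    define T where "T = S - {a0}"
    have S: "S = insert a0 T" "a0 \<notin> T" "finite T"
      using a0 insert.prems by (auto simp: T_def)
    define r where "r a = c a g \<otimes> inv (c a0 g)" for a
    have c [simp]: "c a h \<in> carrier R" if "a \<in> S" "h \<in> insert g G" for a h
      using insert.prems(3) that by auto
    have inv: "inv (c a0 g) \<in> carrier R" "inv (c a0 g) \<otimes> c a0 g = \<one>"
      using a0 by (auto simp: field_Units)
    have r [simp]: "r a \<in> carrier R" if "a \<in> S" for a
      using that inv by (simp add: r_def)
    \<comment> \<open>The system after elimination of \<open>a0\<close>. Its coefficients in
      equation \<open>g\<close> itself are zero, so \<open>g\<close> holds whatever the remaining
      unknowns are.\<close>
    define c' where "c' a h = c a h \<ominus> r a \<otimes> c a0 h" for a h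
    have "card G < card T"
      using insert.prems(2) insert.hyps S by simp
    then obtain y' where y': "\<forall>a\<in>T. y' a \<in> carrier R" "\<exists>a\<in>T. y' a \<noteq> \<zero>"
      "\<forall>h\<in>G. (\<Oplus>a\<in>T. y' a \<otimes> c' a h) = \<zero>"
      using insert.IH[of T c'] S a0 by (auto simp: c'_def)
    \<comment> \<open>This value of the eliminated unknown makes the sum over \<open>S\<close> with
      coefficients \<open>c\<close> equal to the sum over \<open>T\<close> with coefficients
      \<open>c'\<close>, for every equation at once.\<close>
    define y0 where "y0 = \<ominus> (\<Oplus>a\<in>T. y' a \<otimes> r a)"
    have y0: "y0 \<in> carrier R"
      using y' S by (auto simp: y0_def intro!: finsum_closed)
    define y where "y = y'(a0 := y0)"
    have y_carrier: "\<forall>a\<in>S. y a \<in> carrier R" using y0 y' S by (auto simp: y_def)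
    have eq: "(\<Oplus>a\<in>S. y a \<otimes> c a h) = (\<Oplus>a\<in>T. y' a \<otimes> c' a h)" if h: "h \<in> insert g G" for h
    proof -
      have "(\<Oplus>a\<in>T. y' a \<otimes> c' a h) = (\<Oplus>a\<in>T. y' a \<otimes> c a h \<oplus> (\<ominus> (y' a \<otimes> r a)) \<otimes> c a0 h)"
        by (rule finsum_cong')
          (use S y' h a0 in \<open>auto simp: c'_def minus_eq r_distr l_minus r_minus m_assoc\<close>)
      also have "\<dots> = (\<Oplus>a\<in>T. y' a \<otimes> c a h) \<oplus> (\<Oplus>a\<in>T. (\<ominus> (y' a \<otimes> r a)) \<otimes> c a0 h)"
        by (rule finsum_addf) (use S y' h a0 in \<open>auto simp: Pi_def\<close>)
      also have "(\<Oplus>a\<in>T. (\<ominus> (y' a \<otimes> r a)) \<otimes> c a0 h) = (\<Oplus>a\<in>T. \<ominus> (y' a \<otimes> r a)) \<otimes> c a0 h"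
        by (rule finsum_ldistr[symmetric]) (use S y' h a0 in \<open>auto simp: Pi_def\<close>)
      also have "(\<Oplus>a\<in>T. \<ominus> (y' a \<otimes> r a)) = (\<Oplus>a\<in>T. \<ominus> \<one> \<otimes> (y' a \<otimes> r a))"
        by (rule finsum_cong') (use S y' h a0 in \<open>auto simp: Pi_def l_minus\<close>)
      also have "\<dots> = \<ominus> \<one> \<otimes> (\<Oplus>a\<in>T. y' a \<otimes> r a)"
        by (rule finsum_rdistr[symmetric]) (use S y' h a0 in \<open>auto simp: Pi_def\<close>)
      also have "\<dots> = y0"
        unfolding y0_def using S y' by (subst l_minus) (auto simp: Pi_def intro!: finsum_closed)
      finally have 1: "(\<Oplus>a\<in>T. y' a \<otimes> c' a h) = (\<Oplus>a\<in>T. y' a \<otimes> c a h) \<oplus> y0 \<otimes> c a0 h" .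
      have "(\<Oplus>a\<in>S. y a \<otimes> c a h) = y0 \<otimes> c a0 h \<oplus> (\<Oplus>a\<in>T. y a \<otimes> c a h)"
        unfolding S(1) using S y_carrier y0 h by (subst finsum_insert) (auto simp: y_def)
      also have "(\<Oplus>a\<in>T. y a \<otimes> c a h) = (\<Oplus>a\<in>T. y' a \<otimes> c a h)"
        by (rule finsum_cong') (use S y' h in \<open>auto simp: y_def\<close>)
      finally show ?thesis
        unfolding 1 using S y' y0 h by (subst a_comm) (auto simp: Pi_def intro!: finsum_closed)
    qed
    have "(\<Oplus>a\<in>S. y a \<otimes> c a h) = \<zero>" if "h \<in> insert g G" for h
    proof (cases "h = g")
      case True
      have "c' a g = \<zero>" if "a \<in> S" for a
        using that a0 inv by (simp add: c'_def r_def m_assoc r_neg minus_eq)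
      then show ?thesis using y' S True by (subst eq[OF that]) (auto intro!: finsum_eq_zero)
    next
      case False
      then show ?thesis using y' that eq by auto
    qed
    moreover have "\<exists>a\<in>S. y a \<noteq> \<zero>"
      using y'(2) S by (auto simp: y_def)
    ultimately show ?thesis using y_carrier by blast
  qed
qed

text \<open>Finite-dimensional duality: a subspace of the functions on \<open>P\<close> that no
  nonzero functional annihilates is the whole space. It will turn the separation of tangent vectors
  into quadrics with prescribed differentials.\<close>

lemma separating_subspace:
  assumes "finite P" "D \<noteq> {}"
    and "\<And>d p. d \<in> D \<Longrightarrow> p \<in> P \<Longrightarrow> d p \<in> carrier R"
    and "\<And>d d' k. d \<in> D \<Longrightarrow> d' \<in> D \<Longrightarrow> k \<in> carrier R \<Longrightarrow> (\<lambda>p. d p \<oplus> k \<otimes> d' p) \<in> D"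
    and "\<And>y. (\<And>p. p \<in> P \<Longrightarrow> y p \<in> carrier R) \<Longrightarrow> (\<exists>p\<in>P. y p \<noteq> \<zero>) \<Longrightarrow>
      \<exists>d\<in>D. (\<Oplus>p\<in>P. d p \<otimes> y p) \<noteq> \<zero>"
    and "\<And>p. p \<in> P \<Longrightarrow> t p \<in> carrier R"
  shows "\<exists>d\<in>D. \<forall>p\<in>P. d p = t p"
  using assms
proof (induction P arbitrary: D t rule: finite_induct)
  case empty
  then show ?case by blast
next
  case (insert r P)
  note car = insert.prems(2) and comb = insert.prems(3) and sep = insert.prems(4) and t = insert.prems(5)
  obtain d0 where d0: "d0 \<in> D" "(\<Oplus>p\<in>insert r P. d0 p \<otimes> (if p = r then \<one> else \<zero>)) \<noteq> \<zero>"
    using sep[of "\<lambda>p. if p = r then \<one> else \<zero>"] by fastforce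
  have "(\<Oplus>p\<in>insert r P. d0 p \<otimes> (if p = r then \<one> else \<zero>)) = d0 r \<otimes> (if r = r then \<one> else \<zero>)"
    by (rule finsum_single) (use insert.hyps car d0 in auto)
  with d0 car have d0r: "d0 r \<noteq> \<zero>" by auto
  have inv: "inv (d0 r) \<in> carrier R" "inv (d0 r) \<otimes> d0 r = \<one>"
    using d0r car[OF d0(1)] by (auto simp: field_Units)
  define D' where "D' = {d \<in> D. d r = \<zero>}"
  have kill: "(\<lambda>p. d p \<oplus> (\<ominus> (d r \<otimes> inv (d0 r))) \<otimes> d0 p) \<in> D'" if "d \<in> D" for d
    unfolding D'_def using that d0 inv car
    by (auto intro!: comb simp: l_minus m_assoc r_neg)
  have "\<exists>d\<in>D'. \<forall>p\<in>P. d p = t p \<ominus> (t r \<otimes> inv (d0 r)) \<otimes> d0 p"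
  proof (rule insert.IH)
    show "D' \<noteq> {}" using kill[OF d0(1)] by blast
    show "d p \<in> carrier R" if "d \<in> D'" "p \<in> P" for d p
      using that car by (auto simp: D'_def)
    show "(\<lambda>p. d p \<oplus> k \<otimes> d' p) \<in> D'" if "d \<in> D'" "d' \<in> D'" "k \<in> carrier R" for d d' k
      using that comb by (auto simp: D'_def)
    show "t p \<ominus> (t r \<otimes> inv (d0 r)) \<otimes> d0 p \<in> carrier R" if "p \<in> P" for p
      using that t car d0 inv by auto
    fix y assume y: "\<And>p. p \<in> P \<Longrightarrow> y p \<in> carrier R" "\<exists>p\<in>P. y p \<noteq> \<zero>"
    define s where "s = (\<Oplus>p\<in>P. d0 p \<otimes> y p)"
    have s: "s \<in> carrier R" unfolding s_def using y car d0 by (auto intro!: finsum_closed)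
    \<comment> \<open>The functional \<open>y\<close> is extended by the value at \<open>r\<close>
      for which it kills \<open>d0\<close>. It then takes on \<open>d\<close> the value that
      \<open>y\<close> takes on the reduction of \<open>d\<close> modulo \<open>d0\<close>, which
      lies in \<open>D'\<close>.\<close>
    define y' where "y' = y(r := \<ominus> (inv (d0 r) \<otimes> s))"
    have y': "y' p \<in> carrier R" if "p \<in> insert r P" for p
      using that y inv s by (auto simp: y'_def)
    have "\<exists>p\<in>insert r P. y' p \<noteq> \<zero>" using y(2) insert.hyps unfolding y'_def by (metis fun_upd_apply insertCI)
    with sep[of y'] y' obtain d where d: "d \<in> D" "(\<Oplus>p\<in>insert r P. d p \<otimes> y' p) \<noteq> \<zero>"
      by blast
    define e where "e = (\<lambda>p. d p \<oplus> (\<ominus> (d r \<otimes> inv (d0 r))) \<otimes> d0 p)"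
    have eD: "e \<in> D'" unfolding e_def by (rule kill[OF d(1)])
    have split: "(\<Oplus>p\<in>insert r P. d p \<otimes> y' p) = d r \<otimes> y' r \<oplus> (\<Oplus>p\<in>P. d p \<otimes> y p)"
    proof -
      have "(\<Oplus>p\<in>P. d p \<otimes> y' p) = (\<Oplus>p\<in>P. d p \<otimes> y p)"
        by (rule finsum_cong') (use insert.hyps y car d in \<open>auto simp: y'_def\<close>)
      then show ?thesis
        using insert.hyps y' car d by (subst finsum_insert) auto
    qed
    have "(\<Oplus>p\<in>P. e p \<otimes> y p)
        = (\<Oplus>p\<in>P. d p \<otimes> y p \<oplus> (\<ominus> (d r \<otimes> inv (d0 r))) \<otimes> (d0 p \<otimes> y p))"
      by (rule finsum_cong')
        (use y car d d0 inv in \<open>auto simp: e_def l_distr m_assoc l_minus\<close>)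
    also have "\<dots> = (\<Oplus>p\<in>P. d p \<otimes> y p) \<oplus> (\<Oplus>p\<in>P. (\<ominus> (d r \<otimes> inv (d0 r))) \<otimes> (d0 p \<otimes> y p))"
      by (rule finsum_addf) (use y car d d0 inv in \<open>auto simp: Pi_def\<close>)
    also have "(\<Oplus>p\<in>P. (\<ominus> (d r \<otimes> inv (d0 r))) \<otimes> (d0 p \<otimes> y p)) = (\<ominus> (d r \<otimes> inv (d0 r))) \<otimes> s"
      unfolding s_def
      by (rule finsum_rdistr[symmetric]) (use insert.hyps y car d d0 inv in \<open>auto simp: Pi_def\<close>)
    also have "\<dots> = d r \<otimes> y' r"
      using car d inv s by (simp add: y'_def l_minus r_minus m_assoc)
    finally have "(\<Oplus>p\<in>P. e p \<otimes> y p) = (\<Oplus>p\<in>insert r P. d p \<otimes> y' p)"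
      unfolding split using car d y y' by (subst a_comm) (auto intro!: finsum_closed)
    with d(2) show "\<exists>d\<in>D'. (\<Oplus>p\<in>P. d p \<otimes> y p) \<noteq> \<zero>" by (metis eD)
  qed
  then obtain d where d: "d \<in> D'" "\<forall>p\<in>P. d p = t p \<ominus> (t r \<otimes> inv (d0 r)) \<otimes> d0 p" by blast
  have "(\<lambda>p. d p \<oplus> (t r \<otimes> inv (d0 r)) \<otimes> d0 p) \<in> D"
    using d d0 inv t by (intro comb) (auto simp: D'_def)
  moreover have "d p \<oplus> (t r \<otimes> inv (d0 r)) \<otimes> d0 p = t p" if p: "p \<in> insert r P" for p
  proof (cases "p = r")
    case True
    have "d r = \<zero>" using d(1) by (simp add: D'_def)
    then show ?thesis using True t inv car[OF d0(1)] by (simp add: m_assoc)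
  next
    case False
    with p have "p \<in> P" by simp
    then have "d p = t p \<ominus> (t r \<otimes> inv (d0 r)) \<otimes> d0 p" using d(2) by blast
    moreover have "(t r \<otimes> inv (d0 r)) \<otimes> d0 p \<in> carrier R" "t p \<in> carrier R"
      using t inv car[OF d0(1)] p by auto
    ultimately show ?thesis by (simp only: minus_eq a_assoc a_inv_closed l_neg r_zero)
  qed
  ultimately show ?case by (intro bexI[rotated] ballI)
qed

end

section \<open>Jet spaces and separating polynomials\<close>

locale jet_space = field R for R (structure) +
  fixes P :: "'p set" and z :: "'i \<Rightarrow> 'p \<Rightarrow> 'a"
  assumes finite_vars: "finite P"
    and z_closed [simp]: "z i p \<in> carrier R"
begin

text \<open>\<open>u i \<alpha>\<close> plays the part of the coefficient of \<open>X\<^sup>\<alpha>\<close> in the Taylor expansion of a polynomial at the point \<open>z i\<close>;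
  accordingly \<open>var p\<close> is multiplication by the variable \<open>p\<close>.\<close>

definition jets :: "('i \<Rightarrow> 'p multiset \<Rightarrow> 'a) set" where
  "jets = {u. \<forall>i \<alpha>. u i \<alpha> \<in> carrier R}"

definition shift :: "'p \<Rightarrow> ('i \<Rightarrow> 'p multiset \<Rightarrow> 'a) \<Rightarrow> 'i \<Rightarrow> 'p multiset \<Rightarrow> 'a" where
  "shift p u i \<alpha> = (if p \<in># \<alpha> then u i (\<alpha> - {#p#}) else \<zero>)"

definition var :: "'p \<Rightarrow> ('i \<Rightarrow> 'p multiset \<Rightarrow> 'a) \<Rightarrow> 'i \<Rightarrow> 'p multiset \<Rightarrow> 'a" where
  "var p u i \<alpha> = z i p \<otimes> u i \<alpha> \<oplus> shift p u i \<alpha>"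

definition unit_jet :: "'i \<Rightarrow> 'p multiset \<Rightarrow> 'a" where
  "unit_jet i \<alpha> = (if \<alpha> = {#} then \<one> else \<zero>)"

text \<open>The Taylor expansions of the monomial with exponent \<gamma> at all points: the
  expansions of 1 are multiplied by the variables in some order, and \<open>var_commute\<close>
  makes the order irrelevant.\<close>

definition monom_jet :: "'p multiset \<Rightarrow> 'i \<Rightarrow> 'p multiset \<Rightarrow> 'a" where
  "monom_jet \<gamma> = fold var (SOME xs. mset xs = \<gamma>) unit_jet"

text \<open>The polynomials of degree at most \<open>t\<close>, known only through their Taylor
  expansions at all the points. Being a polynomial means that the expansions at different points
  belong together; a general element of \<open>jets\<close> has no such coherence.\<close>

inductive_set poly_jets :: "nat \<Rightarrow> ('i \<Rightarrow> 'p multiset \<Rightarrow> 'a) set" for t where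
  monom: "set_mset \<gamma> \<subseteq> P \<Longrightarrow> size \<gamma> \<le> t \<Longrightarrow> monom_jet \<gamma> \<in> poly_jets t"
| comb: "u \<in> poly_jets t \<Longrightarrow> v \<in> poly_jets t \<Longrightarrow> k \<in> carrier R \<Longrightarrow>
    (\<lambda>i \<alpha>. u i \<alpha> \<oplus> k \<otimes> v i \<alpha>) \<in> poly_jets t"

lemma jetsD: "u \<in> jets \<Longrightarrow> u i \<alpha> \<in> carrier R"
  by (simp add: jets_def)

lemma shift_jets [simp]: "u \<in> jets \<Longrightarrow> shift p u \<in> jets"
  by (simp add: jets_def shift_def)

lemma var_jets [simp]: "u \<in> jets \<Longrightarrow> var p u \<in> jets"
  using shift_jets[of u p] by (auto simp: jets_def var_def)

lemma shift_commute: "shift p (shift q u) = shift q (shift p u)"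
proof (intro ext)
  fix i \<alpha>
  have "\<alpha> - {#p#} - {#q#} = \<alpha> - {#q#} - {#p#}" by (rule diff_right_commute)
  then show "shift p (shift q u) i \<alpha> = shift q (shift p u) i \<alpha>"
    by (cases "p = q") (simp_all add: shift_def in_diff_count)
qed

lemma shift_var:
  "u \<in> jets \<Longrightarrow> shift p (var q u) i \<alpha> = z i q \<otimes> shift p u i \<alpha> \<oplus> shift p (shift q u) i \<alpha>"
  by (simp add: shift_def[of p] var_def)

text \<open>The product (z_p + X_p)(z_q + X_q) sorted by order. Its symmetry gives commutation, and
  its three parts become value, differential and quadratic part of a quadric.\<close>

lemma var_var:
  assumes "u \<in> jets"
  shows "var p (var q u) i \<alpha> = (z i p \<otimes> z i q) \<otimes> u i \<alpha> \<oplus>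
    (z i p \<otimes> shift q u i \<alpha> \<oplus> z i q \<otimes> shift p u i \<alpha>) \<oplus> shift p (shift q u) i \<alpha>"
  using jetsD[OF assms, of i] jetsD[OF shift_jets[OF assms], of _ i]
    jetsD[OF shift_jets[OF shift_jets[OF assms]], of _ _ i]
  by (simp add: var_def[of p] shift_var[OF assms]) (simp add: var_def r_distr m_assoc a_assoc)

lemma var_commute: "u \<in> jets \<Longrightarrow> var p (var q u) = var q (var p u)"
proof (intro ext)
  fix i \<alpha>
  assume u: "u \<in> jets"
  have "z i p \<otimes> shift q u i \<alpha> \<oplus> z i q \<otimes> shift p u i \<alpha> = z i q \<otimes> shift p u i \<alpha> \<oplus> z i p \<otimes> shift q u i \<alpha>"
    using jetsD[OF shift_jets[OF u], of _ i] by (simp add: a_comm)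
  then show "var p (var q u) i \<alpha> = var q (var p u) i \<alpha>"
    by (simp only: var_var[OF u] shift_commute[of p q] m_comm[OF z_closed z_closed, of i p i q])
qed

lemma unit_jet [simp]: "unit_jet \<in> jets"
  by (simp add: jets_def unit_jet_def)

lemma fold_var_jets [simp]: "u \<in> jets \<Longrightarrow> fold var xs u \<in> jets"
  by (induction xs arbitrary: u) auto

lemma monom_jet_mset: "monom_jet (mset xs) = fold var xs unit_jet"
  unfolding monom_jet_def
proof (rule fold_permuted_eq[where P = "\<lambda>u. u \<in> jets"])
  show "mset (SOME ys. mset ys = mset xs) = mset xs"
    by (rule someI[of "\<lambda>ys. mset ys = mset xs"]) simp
qed (auto simp: var_commute)

lemma var_monom_jet: "var p (monom_jet \<gamma>) = monom_jet (add_mset p \<gamma>)"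
proof -
  obtain xs where "mset xs = \<gamma>" using ex_mset by blast
  then show ?thesis
    using monom_jet_mset[of xs] monom_jet_mset[of "xs @ [p]"] by simp
qed

lemma monom_jet_jets [simp]: "monom_jet \<gamma> \<in> jets"
  by (simp add: monom_jet_def)

lemma poly_jets_jets: "u \<in> poly_jets t \<Longrightarrow> u \<in> jets"
proof (induction rule: poly_jets.induct)
  case (comb u v k)
  then show ?case using jetsD[of u] jetsD[of v] by (auto simp: jets_def)
qed simp

lemma poly_jets_mono: "u \<in> poly_jets s \<Longrightarrow> s \<le> t \<Longrightarrow> u \<in> poly_jets t"
  by (induction rule: poly_jets.induct) (auto intro: poly_jets.intros)

lemma unit_jet_poly: "unit_jet \<in> poly_jets t"
  using poly_jets.monom[of "{#}" t] monom_jet_mset[of "[]"] by simp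

lemma zero_poly_jets: "(\<lambda>i \<alpha>. \<zero>) \<in> poly_jets t"
proof -
  have "(\<lambda>i \<alpha>. unit_jet i \<alpha> \<oplus> \<ominus> \<one> \<otimes> unit_jet i \<alpha>) \<in> poly_jets t"
    by (intro poly_jets.comb unit_jet_poly) auto
  moreover have "unit_jet i \<alpha> \<oplus> \<ominus> \<one> \<otimes> unit_jet i \<alpha> = \<zero>" for i \<alpha>
    by (simp add: unit_jet_def r_neg)
  ultimately show ?thesis by simp
qed

lemma scale_poly_jets:
  assumes "u \<in> poly_jets t" "k \<in> carrier R"
  shows "(\<lambda>i \<alpha>. k \<otimes> u i \<alpha>) \<in> poly_jets t"
  using poly_jets.comb[OF zero_poly_jets assms] jetsD[OF poly_jets_jets[OF assms(1)]] assms(2) by simp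

lemma add_poly_jets:
  assumes "u \<in> poly_jets t" "v \<in> poly_jets t"
  shows "(\<lambda>i \<alpha>. u i \<alpha> \<oplus> v i \<alpha>) \<in> poly_jets t"
  using poly_jets.comb[OF assms one_closed] jetsD[OF poly_jets_jets[OF assms(2)]] by simp

lemma finsum_poly_jets:
  assumes "finite S" "\<And>s. s \<in> S \<Longrightarrow> f s \<in> poly_jets t"
  shows "(\<lambda>i \<alpha>. \<Oplus>s\<in>S. f s i \<alpha>) \<in> poly_jets t"
  using assms
proof (induction S rule: finite_induct)
  case empty
  then show ?case by (simp add: zero_poly_jets)
next
  case (insert s S)
  have "(\<lambda>i \<alpha>. \<Oplus>s\<in>insert s S. f s i \<alpha>) = (\<lambda>i \<alpha>. f s i \<alpha> \<oplus> (\<Oplus>s\<in>S. f s i \<alpha>))"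
    using insert by (intro ext finsum_insert) (auto intro: jetsD[OF poly_jets_jets])
  then show ?case using insert add_poly_jets by simp
qed

lemma var_poly_jets: "u \<in> poly_jets t \<Longrightarrow> p \<in> P \<Longrightarrow> var p u \<in> poly_jets (Suc t)"
proof (induction rule: poly_jets.induct)
  case (monom \<gamma>)
  then show ?case by (auto simp: var_monom_jet intro!: poly_jets.monom)
next
  case (comb u v k)
  have uv: "u i \<alpha> \<in> carrier R" "v i \<alpha> \<in> carrier R" for i \<alpha>
    using comb.hyps jetsD[OF poly_jets_jets] by auto
  have "var p (\<lambda>i \<alpha>. u i \<alpha> \<oplus> k \<otimes> v i \<alpha>) = (\<lambda>i \<alpha>. var p u i \<alpha> \<oplus> k \<otimes> var p v i \<alpha>)"
    using comb uv
    by (intro ext) (simp add: var_def shift_def r_distr m_lcomm a_ac)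
  then show ?case using comb by (auto intro: poly_jets.comb)
qed

abbreviation monoms :: "nat \<Rightarrow> 'p multiset set" where
  "monoms t \<equiv> {\<gamma>. set_mset \<gamma> \<subseteq> P \<and> size \<gamma> \<le> t}"

lemma finite_monoms: "finite (monoms t)"
proof -
  have "monoms t = (\<Union>s\<le>t. multisets_of_size P s)"
    by (auto simp: multisets_of_size_def)
  then show ?thesis using finite_vars by auto
qed

text \<open>The point of the statement is the order of quantifiers: one family of coefficients
  serves all points \<open>i\<close> and all exponents \<alpha>.\<close>

lemma poly_jets_coeffs:
  "u \<in> poly_jets t \<Longrightarrow> \<exists>c. (\<forall>\<gamma>. c \<gamma> \<in> carrier R) \<and>
    (\<forall>i \<alpha>. u i \<alpha> = (\<Oplus>\<gamma>\<in>monoms t. c \<gamma> \<otimes> monom_jet \<gamma> i \<alpha>))"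
proof (induction rule: poly_jets.induct)
  case (monom \<gamma>)
  show ?case
  proof (intro exI[of _ "\<lambda>\<delta>. if \<delta> = \<gamma> then \<one> else \<zero>"] conjI allI)
    fix i \<alpha>
    have "(\<Oplus>\<delta>\<in>monoms t. (if \<delta> = \<gamma> then \<one> else \<zero>) \<otimes> monom_jet \<delta> i \<alpha>) =
      (if \<gamma> = \<gamma> then \<one> else \<zero>) \<otimes> monom_jet \<gamma> i \<alpha>"
      by (rule finsum_single) (use finite_monoms monom jetsD[OF monom_jet_jets] in auto)
    with jetsD[OF monom_jet_jets] show "monom_jet \<gamma> i \<alpha> =
        (\<Oplus>\<delta>\<in>monoms t. (if \<delta> = \<gamma> then \<one> else \<zero>) \<otimes> monom_jet \<delta> i \<alpha>)"
      by simp
  qed simp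
next
  case (comb u v k)
  then obtain c d where c: "\<forall>\<gamma>. c \<gamma> \<in> carrier R"
      "\<forall>i \<alpha>. u i \<alpha> = (\<Oplus>\<gamma>\<in>monoms t. c \<gamma> \<otimes> monom_jet \<gamma> i \<alpha>)"
    and d: "\<forall>\<gamma>. d \<gamma> \<in> carrier R"
      "\<forall>i \<alpha>. v i \<alpha> = (\<Oplus>\<gamma>\<in>monoms t. d \<gamma> \<otimes> monom_jet \<gamma> i \<alpha>)" by blast
  show ?case
  proof (intro exI[of _ "\<lambda>\<gamma>. c \<gamma> \<oplus> k \<otimes> d \<gamma>"] conjI allI)
    fix i \<alpha>
    have "(\<Oplus>\<gamma>\<in>monoms t. (c \<gamma> \<oplus> k \<otimes> d \<gamma>) \<otimes> monom_jet \<gamma> i \<alpha>) =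
      (\<Oplus>\<gamma>\<in>monoms t. c \<gamma> \<otimes> monom_jet \<gamma> i \<alpha> \<oplus> k \<otimes> (d \<gamma> \<otimes> monom_jet \<gamma> i \<alpha>))"
      by (rule finsum_cong') (use c d comb jetsD[OF monom_jet_jets] in \<open>auto simp: l_distr m_assoc\<close>)
    also have "\<dots> = (\<Oplus>\<gamma>\<in>monoms t. c \<gamma> \<otimes> monom_jet \<gamma> i \<alpha>) \<oplus>
        (\<Oplus>\<gamma>\<in>monoms t. k \<otimes> (d \<gamma> \<otimes> monom_jet \<gamma> i \<alpha>))"
      by (rule finsum_addf) (use c d comb jetsD[OF monom_jet_jets] in \<open>auto simp: Pi_def\<close>)
    also have "(\<Oplus>\<gamma>\<in>monoms t. k \<otimes> (d \<gamma> \<otimes> monom_jet \<gamma> i \<alpha>)) = k \<otimes> v i \<alpha>"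
      using d comb finite_monoms jetsD[OF monom_jet_jets] by (simp add: Pi_def finsum_rdistr)
    finally show "u i \<alpha> \<oplus> k \<otimes> v i \<alpha> = (\<Oplus>\<gamma>\<in>monoms t. (c \<gamma> \<oplus> k \<otimes> d \<gamma>) \<otimes> monom_jet \<gamma> i \<alpha>)"
      using c by simp
  qed (use c d comb in auto)
qed

text \<open>Dimension count: more polynomials than monomials are linearly dependent. The relation is
  found on the coefficients, so it holds at every point and in every order simultaneously.\<close>

lemma dependent_poly_jets:
  assumes "finite S" "card (monoms t) < card S" "\<And>a. a \<in> S \<Longrightarrow> v a \<in> poly_jets t"
  shows "\<exists>y. (\<forall>a\<in>S. y a \<in> carrier R) \<and> (\<exists>a\<in>S. y a \<noteq> \<zero>) \<and>
    (\<forall>i \<alpha>. (\<Oplus>a\<in>S. y a \<otimes> v a i \<alpha>) = \<zero>)"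
proof -
  have "\<forall>a\<in>S. \<exists>c. (\<forall>\<gamma>. c \<gamma> \<in> carrier R) \<and>
    (\<forall>i \<alpha>. v a i \<alpha> = (\<Oplus>\<gamma>\<in>monoms t. c \<gamma> \<otimes> monom_jet \<gamma> i \<alpha>))"
    by (intro ballI poly_jets_coeffs assms(3))
  from bchoice[OF this] obtain c where c': "\<forall>a\<in>S. (\<forall>\<gamma>. c a \<gamma> \<in> carrier R) \<and>
    (\<forall>i \<alpha>. v a i \<alpha> = (\<Oplus>\<gamma>\<in>monoms t. c a \<gamma> \<otimes> monom_jet \<gamma> i \<alpha>))" ..
  then have c: "\<And>a \<gamma>. a \<in> S \<Longrightarrow> c a \<gamma> \<in> carrier R"
      "\<And>a i \<alpha>. a \<in> S \<Longrightarrow> v a i \<alpha> = (\<Oplus>\<gamma>\<in>monoms t. c a \<gamma> \<otimes> monom_jet \<gamma> i \<alpha>)"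
    by simp_all
  obtain y where y: "\<forall>a\<in>S. y a \<in> carrier R" "\<exists>a\<in>S. y a \<noteq> \<zero>"
    "\<forall>\<gamma>\<in>monoms t. (\<Oplus>a\<in>S. y a \<otimes> c a \<gamma>) = \<zero>"
    using homogeneous_system[OF finite_monoms assms(1,2), of c] c by blast
  have "(\<Oplus>a\<in>S. y a \<otimes> v a i \<alpha>) = \<zero>" for i \<alpha>
  proof -
    have "(\<Oplus>a\<in>S. y a \<otimes> v a i \<alpha>) =
        (\<Oplus>a\<in>S. \<Oplus>\<gamma>\<in>monoms t. (y a \<otimes> c a \<gamma>) \<otimes> monom_jet \<gamma> i \<alpha>)"
    proof (rule finsum_cong')
      fix a assume a: "a \<in> S"
      have "y a \<otimes> v a i \<alpha> = (\<Oplus>\<gamma>\<in>monoms t. y a \<otimes> (c a \<gamma> \<otimes> monom_jet \<gamma> i \<alpha>))"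
        using c[OF a] y a jetsD[OF monom_jet_jets] by (simp add: finsum_rdistr finite_monoms Pi_def)
      also have "\<dots> = (\<Oplus>\<gamma>\<in>monoms t. (y a \<otimes> c a \<gamma>) \<otimes> monom_jet \<gamma> i \<alpha>)"
        by (rule finsum_cong') (use a c y jetsD[OF monom_jet_jets] in \<open>auto simp: m_assoc\<close>)
      finally show "y a \<otimes> v a i \<alpha> = (\<Oplus>\<gamma>\<in>monoms t. (y a \<otimes> c a \<gamma>) \<otimes> monom_jet \<gamma> i \<alpha>)" .
    qed (use c y jetsD[OF monom_jet_jets] in \<open>auto simp: Pi_def intro!: finsum_closed\<close>)
    also have "\<dots> = (\<Oplus>\<gamma>\<in>monoms t. \<Oplus>a\<in>S. (y a \<otimes> c a \<gamma>) \<otimes> monom_jet \<gamma> i \<alpha>)"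
      by (rule finsum_commute) (use assms finite_monoms c y jetsD[OF monom_jet_jets] in auto)
    also have "\<dots> = (\<Oplus>\<gamma>\<in>monoms t. (\<Oplus>a\<in>S. y a \<otimes> c a \<gamma>) \<otimes> monom_jet \<gamma> i \<alpha>)"
    proof (rule finsum_cong')
      fix \<gamma>
      show "(\<Oplus>a\<in>S. (y a \<otimes> c a \<gamma>) \<otimes> monom_jet \<gamma> i \<alpha>) = (\<Oplus>a\<in>S. y a \<otimes> c a \<gamma>) \<otimes> monom_jet \<gamma> i \<alpha>"
        by (rule finsum_ldistr[symmetric]) (use assms c y jetsD[OF monom_jet_jets] in auto)
    qed (use c y jetsD[OF monom_jet_jets] in \<open>auto simp: Pi_def intro!: finsum_closed\<close>)
    also have "\<dots> = \<zero>"
      by (rule finsum_eq_zero) (use y jetsD[OF monom_jet_jets] in auto)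
    finally show ?thesis .
  qed
  with y show ?thesis by blast
qed

text \<open>A product over \<open>k\<close> in \<open>I\<close> of linear factors (X_p - z k p) / (z
  j p - z k p), each for a coordinate \<open>p\<close> in which the two points differ. The degree is
  left unspecified because a fixed degree is absorbed in the later limit.\<close>

lemma separating_poly_jet:
  assumes "finite I" "j \<notin> I" "\<And>i. i \<in> I \<Longrightarrow> \<exists>p\<in>P. z i p \<noteq> z j p"
  shows "\<exists>t g. g \<in> poly_jets t \<and> g j {#} = \<one> \<and> (\<forall>i\<in>I. g i {#} = \<zero>)"
  using assms
proof (induction I rule: finite_induct)
  case empty
  show ?case
    by (intro exI[of _ 0] exI[of _ unit_jet] conjI unit_jet_poly) (auto simp: unit_jet_def)
next
  case (insert k I)
  then obtain t g where g: "g \<in> poly_jets t" "g j {#} = \<one>" "\<forall>i\<in>I. g i {#} = \<zero>" by auto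
  obtain p where p: "p \<in> P" "z k p \<noteq> z j p" using insert.prems by auto
  define s where "s = inv (z j p \<ominus> z k p)"
  have "z j p \<ominus> z k p \<in> Units R" using p by (auto simp: field_Units)
  then have s: "s \<in> carrier R" "s \<otimes> (z j p \<ominus> z k p) = \<one>"
    by (auto simp: s_def)
  have gc: "g i \<alpha> \<in> carrier R" for i \<alpha> using jetsD[OF poly_jets_jets[OF g(1)]] by simp
  define h where "h = (\<lambda>i \<alpha>. s \<otimes> (var p g i \<alpha> \<oplus> \<ominus> z k p \<otimes> g i \<alpha>))"
  have "h \<in> poly_jets (Suc t)"
    unfolding h_def
    by (intro scale_poly_jets poly_jets.comb var_poly_jets g p s poly_jets_mono[OF g(1)]) auto
  moreover have h0: "h i {#} = s \<otimes> (z i p \<ominus> z k p) \<otimes> g i {#}" for i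
    using gc s by (simp add: h_def var_def shift_def minus_eq l_distr m_assoc)
  have "h j {#} = \<one>" using g s by (simp add: h0)
  moreover have "h i {#} = \<zero>" if "i \<in> insert k I" for i
    using that g gc s by (auto simp: h0 r_neg minus_eq)
  ultimately show ?case by blast
qed

end

section \<open>Quadrics: values, differentials and Taylor expansion\<close>

context field begin

definition quadric :: "'a \<Rightarrow> ('p \<Rightarrow> 'a) \<Rightarrow> ('p \<Rightarrow> 'p \<Rightarrow> 'a) \<Rightarrow> bool" where
  "quadric c l q \<longleftrightarrow> c \<in> carrier R \<and> (\<forall>p. l p \<in> carrier R) \<and> (\<forall>p r. q p r \<in> carrier R)"

definition quad_val :: "'p set \<Rightarrow> 'a \<Rightarrow> ('p \<Rightarrow> 'a) \<Rightarrow> ('p \<Rightarrow> 'p \<Rightarrow> 'a) \<Rightarrow> ('p \<Rightarrow> 'a) \<Rightarrow> 'a" where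
  "quad_val P c l q x = c \<oplus> (\<Oplus>p\<in>P. l p \<otimes> x p) \<oplus> (\<Oplus>p\<in>P. \<Oplus>r\<in>P. q p r \<otimes> (x p \<otimes> x r))"

text \<open>The partial derivative in direction \<open>p\<close>. The matrix \<open>q\<close> is not
  assumed symmetric, so both \<open>q p r\<close> and \<open>q r p\<close> contribute; nothing is
  divided by 2 and the formula is correct in characteristic 2.\<close>

definition quad_diff :: "'p set \<Rightarrow> ('p \<Rightarrow> 'a) \<Rightarrow> ('p \<Rightarrow> 'p \<Rightarrow> 'a) \<Rightarrow> ('p \<Rightarrow> 'a) \<Rightarrow> 'p \<Rightarrow> 'a" where
  "quad_diff P l q x p = l p \<oplus> (\<Oplus>r\<in>P. (q p r \<oplus> q r p) \<otimes> x r)"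

lemma finsum_add2:
  assumes "\<And>p r. p \<in> S \<Longrightarrow> r \<in> T \<Longrightarrow> f p r \<in> carrier R" "\<And>p r. p \<in> S \<Longrightarrow> r \<in> T \<Longrightarrow> g p r \<in> carrier R"
  shows "(\<Oplus>p\<in>S. \<Oplus>r\<in>T. f p r \<oplus> g p r) = (\<Oplus>p\<in>S. \<Oplus>r\<in>T. f p r) \<oplus> (\<Oplus>p\<in>S. \<Oplus>r\<in>T. g p r)"
proof -
  have "(\<Oplus>p\<in>S. \<Oplus>r\<in>T. f p r \<oplus> g p r) = (\<Oplus>p\<in>S. (\<Oplus>r\<in>T. f p r) \<oplus> (\<Oplus>r\<in>T. g p r))"
  proof (rule finsum_cong')
    show "(\<Oplus>r\<in>T. f p r \<oplus> g p r) = (\<Oplus>r\<in>T. f p r) \<oplus> (\<Oplus>r\<in>T. g p r)" if "p \<in> S" for p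
      by (rule finsum_addf) (use that assms in auto)
  qed (use assms in \<open>auto intro!: finsum_closed\<close>)
  also have "\<dots> = (\<Oplus>p\<in>S. \<Oplus>r\<in>T. f p r) \<oplus> (\<Oplus>p\<in>S. \<Oplus>r\<in>T. g p r)"
    by (rule finsum_addf) (use assms in \<open>auto intro!: finsum_closed\<close>)
  finally show ?thesis .
qed

lemma finsum_smult2:
  assumes "finite S" "finite T" "k \<in> carrier R" "\<And>p r. p \<in> S \<Longrightarrow> r \<in> T \<Longrightarrow> f p r \<in> carrier R"
  shows "(\<Oplus>p\<in>S. \<Oplus>r\<in>T. k \<otimes> f p r) = k \<otimes> (\<Oplus>p\<in>S. \<Oplus>r\<in>T. f p r)"
proof -
  have "(\<Oplus>p\<in>S. \<Oplus>r\<in>T. k \<otimes> f p r) = (\<Oplus>p\<in>S. k \<otimes> (\<Oplus>r\<in>T. f p r))"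
  proof (rule finsum_cong')
    show "(\<Oplus>r\<in>T. k \<otimes> f p r) = k \<otimes> (\<Oplus>r\<in>T. f p r)" if "p \<in> S" for p
      by (rule finsum_rdistr[symmetric]) (use that assms in auto)
  qed (use assms in \<open>auto intro!: finsum_closed\<close>)
  also have "\<dots> = k \<otimes> (\<Oplus>p\<in>S. \<Oplus>r\<in>T. f p r)"
    by (rule finsum_rdistr[symmetric]) (use assms in \<open>auto intro!: finsum_closed\<close>)
  finally show ?thesis .
qed

lemma finsum_cong2:
  assumes "\<And>p r. p \<in> S \<Longrightarrow> r \<in> T \<Longrightarrow> f p r = g p r" "\<And>p r. p \<in> S \<Longrightarrow> r \<in> T \<Longrightarrow> g p r \<in> carrier R"
  shows "(\<Oplus>p\<in>S. \<Oplus>r\<in>T. f p r) = (\<Oplus>p\<in>S. \<Oplus>r\<in>T. g p r)"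
proof (rule finsum_cong')
  show "(\<Oplus>r\<in>T. f p r) = (\<Oplus>r\<in>T. g p r)" if "p \<in> S" for p
    by (rule finsum_cong') (use that assms in auto)
qed (use assms in \<open>auto intro!: finsum_closed\<close>)

text \<open>Taylor's formula for a quadric at \<open>x\<close>. Here \<open>u\<close>,
  \<open>s p\<close> and \<open>ss p r\<close> stand for a jet coefficient and its one-fold and
  two-fold shifts, so the three summands on the right are sorted by order.\<close>

lemma quad_expansion:
  assumes P: "finite P" and Q: "quadric c l q" and x: "\<And>p. x p \<in> carrier R"
    and u: "u \<in> carrier R" and s: "\<And>p. s p \<in> carrier R" and ss: "\<And>p r. ss p r \<in> carrier R"
  shows "c \<otimes> u \<oplus> (\<Oplus>p\<in>P. l p \<otimes> (x p \<otimes> u \<oplus> s p)) \<oplus>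
      (\<Oplus>p\<in>P. \<Oplus>r\<in>P. q p r \<otimes> ((x p \<otimes> x r) \<otimes> u \<oplus> (x p \<otimes> s r \<oplus> x r \<otimes> s p) \<oplus> ss p r)) =
    quad_val P c l q x \<otimes> u \<oplus> (\<Oplus>p\<in>P. quad_diff P l q x p \<otimes> s p) \<oplus>
      (\<Oplus>p\<in>P. \<Oplus>r\<in>P. q p r \<otimes> ss p r)"
proof -
  note car = x u s ss
  have c: "c \<in> carrier R" and l: "\<And>p. l p \<in> carrier R" and q: "\<And>p r. q p r \<in> carrier R"
    using Q by (auto simp: quadric_def)
  define lx where "lx = (\<Oplus>p\<in>P. l p \<otimes> x p)"
  define ls where "ls = (\<Oplus>p\<in>P. l p \<otimes> s p)"
  define qxx where "qxx = (\<Oplus>p\<in>P. \<Oplus>r\<in>P. q p r \<otimes> (x p \<otimes> x r))"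
  \<comment> \<open>The two halves of the mixed terms, both written against \<open>s p\<close>; for
    \<open>d1\<close> this takes an exchange of the two summations. Together they form the matrix
    part of the differential.\<close>
  define d1 where "d1 = (\<Oplus>p\<in>P. \<Oplus>r\<in>P. q r p \<otimes> x r \<otimes> s p)"
  define d2 where "d2 = (\<Oplus>p\<in>P. \<Oplus>r\<in>P. q p r \<otimes> x r \<otimes> s p)"
  define qss where "qss = (\<Oplus>p\<in>P. \<Oplus>r\<in>P. q p r \<otimes> ss p r)"
  have closed [simp]: "lx \<in> carrier R" "ls \<in> carrier R" "qxx \<in> carrier R" "d1 \<in> carrier R"
    "d2 \<in> carrier R" "qss \<in> carrier R"
    using l q car by (auto simp: lx_def ls_def qxx_def d1_def d2_def qss_def intro!: finsum_closed)
  have "(\<Oplus>p\<in>P. l p \<otimes> (x p \<otimes> u \<oplus> s p)) = (\<Oplus>p\<in>P. (l p \<otimes> x p) \<otimes> u \<oplus> l p \<otimes> s p)"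
    by (rule finsum_cong') (use l car in \<open>auto simp: r_distr m_assoc\<close>)
  also have "\<dots> = (\<Oplus>p\<in>P. (l p \<otimes> x p) \<otimes> u) \<oplus> ls"
    unfolding ls_def by (rule finsum_addf) (use l car in auto)
  also have "(\<Oplus>p\<in>P. (l p \<otimes> x p) \<otimes> u) = lx \<otimes> u"
    unfolding lx_def by (rule finsum_ldistr[symmetric]) (use P l car in auto)
  finally have A: "(\<Oplus>p\<in>P. l p \<otimes> (x p \<otimes> u \<oplus> s p)) = lx \<otimes> u \<oplus> ls" .
  have "(\<Oplus>p\<in>P. \<Oplus>r\<in>P. q p r \<otimes> ((x p \<otimes> x r) \<otimes> u \<oplus> (x p \<otimes> s r \<oplus> x r \<otimes> s p) \<oplus> ss p r)) =
      (\<Oplus>p\<in>P. \<Oplus>r\<in>P. u \<otimes> (q p r \<otimes> (x p \<otimes> x r)) \<oplus> (q p r \<otimes> x p \<otimes> s r \<oplus> q p r \<otimes> x r \<otimes> s p) \<oplus>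
        q p r \<otimes> ss p r)"
    by (rule finsum_cong2) (use q car in \<open>auto simp: r_distr m_assoc m_lcomm m_comm[of u]\<close>)
  also have "\<dots> = (\<Oplus>p\<in>P. \<Oplus>r\<in>P. u \<otimes> (q p r \<otimes> (x p \<otimes> x r))) \<oplus>
      ((\<Oplus>p\<in>P. \<Oplus>r\<in>P. q p r \<otimes> x p \<otimes> s r) \<oplus> d2) \<oplus> qss"
    unfolding d2_def qss_def using q car by (subst finsum_add2, simp, simp)+ simp
  also have "(\<Oplus>p\<in>P. \<Oplus>r\<in>P. u \<otimes> (q p r \<otimes> (x p \<otimes> x r))) = u \<otimes> qxx"
    unfolding qxx_def by (rule finsum_smult2) (use P q car in auto)
  also have "(\<Oplus>p\<in>P. \<Oplus>r\<in>P. q p r \<otimes> x p \<otimes> s r) = d1"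
    unfolding d1_def by (rule finsum_commute) (use P q car in auto)
  finally have B: "(\<Oplus>p\<in>P. \<Oplus>r\<in>P. q p r \<otimes> ((x p \<otimes> x r) \<otimes> u \<oplus> (x p \<otimes> s r \<oplus> x r \<otimes> s p) \<oplus> ss p r)) =
      u \<otimes> qxx \<oplus> (d1 \<oplus> d2) \<oplus> qss" .
  have "(\<Oplus>p\<in>P. quad_diff P l q x p \<otimes> s p) =
      (\<Oplus>p\<in>P. l p \<otimes> s p \<oplus> (\<Oplus>r\<in>P. q p r \<otimes> x r \<otimes> s p \<oplus> q r p \<otimes> x r \<otimes> s p))"
  proof (rule finsum_cong')
    fix p
    have "(\<Oplus>r\<in>P. (q p r \<oplus> q r p) \<otimes> x r) \<otimes> s p = (\<Oplus>r\<in>P. (q p r \<oplus> q r p) \<otimes> x r \<otimes> s p)"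
      by (rule finsum_ldistr) (use P q car in auto)
    also have "\<dots> = (\<Oplus>r\<in>P. q p r \<otimes> x r \<otimes> s p \<oplus> q r p \<otimes> x r \<otimes> s p)"
      by (rule finsum_cong') (use q car in \<open>auto simp: l_distr\<close>)
    finally show "quad_diff P l q x p \<otimes> s p =
        l p \<otimes> s p \<oplus> (\<Oplus>r\<in>P. q p r \<otimes> x r \<otimes> s p \<oplus> q r p \<otimes> x r \<otimes> s p)"
      unfolding quad_diff_def using l q car by (subst l_distr) (auto intro!: finsum_closed)
  qed (use l q car in \<open>auto intro!: finsum_closed\<close>)
  also have "\<dots> = ls \<oplus> (\<Oplus>p\<in>P. \<Oplus>r\<in>P. q p r \<otimes> x r \<otimes> s p \<oplus> q r p \<otimes> x r \<otimes> s p)"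
    unfolding ls_def by (rule finsum_addf) (use l q car in \<open>auto intro!: finsum_closed\<close>)
  also have "(\<Oplus>p\<in>P. \<Oplus>r\<in>P. q p r \<otimes> x r \<otimes> s p \<oplus> q r p \<otimes> x r \<otimes> s p) = d2 \<oplus> d1"
    unfolding d1_def d2_def by (rule finsum_add2) (use q car in auto)
  finally have D: "(\<Oplus>p\<in>P. quad_diff P l q x p \<otimes> s p) = ls \<oplus> (d2 \<oplus> d1)" .
  show ?thesis
    unfolding A B D quad_val_def lx_def[symmetric] qxx_def[symmetric] qss_def[symmetric]
    using c car by (simp add: l_distr m_comm[of u] a_ac)
qed

lemma quad_val_closed:
  "quadric c l q \<Longrightarrow> (\<And>p. p \<in> P \<Longrightarrow> x p \<in> carrier R) \<Longrightarrow> quad_val P c l q x \<in> carrier R"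
  unfolding quad_val_def quadric_def by (intro a_closed finsum_closed) auto

lemma quad_diff_closed:
  "quadric c l q \<Longrightarrow> (\<And>p. p \<in> P \<Longrightarrow> x p \<in> carrier R) \<Longrightarrow> quad_diff P l q x p \<in> carrier R"
  unfolding quad_diff_def quadric_def by (intro a_closed finsum_closed) auto

lemma quad_comb:
  assumes P: "finite P" and Q: "quadric c l q" "quadric c' l' q'" and k: "k \<in> carrier R"
    and x: "\<And>p. p \<in> P \<Longrightarrow> x p \<in> carrier R"
  shows "quadric (c \<oplus> k \<otimes> c') (\<lambda>p. l p \<oplus> k \<otimes> l' p) (\<lambda>p r. q p r \<oplus> k \<otimes> q' p r)"
    and "quad_val P (c \<oplus> k \<otimes> c') (\<lambda>p. l p \<oplus> k \<otimes> l' p) (\<lambda>p r. q p r \<oplus> k \<otimes> q' p r) x =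
      quad_val P c l q x \<oplus> k \<otimes> quad_val P c' l' q' x"
    and "quad_diff P (\<lambda>p. l p \<oplus> k \<otimes> l' p) (\<lambda>p r. q p r \<oplus> k \<otimes> q' p r) x p =
      quad_diff P l q x p \<oplus> k \<otimes> quad_diff P l' q' x p"
proof -
  have car: "c \<in> carrier R" "\<And>p. l p \<in> carrier R" "\<And>p r. q p r \<in> carrier R"
    "c' \<in> carrier R" "\<And>p. l' p \<in> carrier R" "\<And>p r. q' p r \<in> carrier R"
    using Q by (auto simp: quadric_def)
  show "quadric (c \<oplus> k \<otimes> c') (\<lambda>p. l p \<oplus> k \<otimes> l' p) (\<lambda>p r. q p r \<oplus> k \<otimes> q' p r)"
    using car k by (auto simp: quadric_def)
  have "(\<Oplus>p\<in>P. (l p \<oplus> k \<otimes> l' p) \<otimes> x p) = (\<Oplus>p\<in>P. l p \<otimes> x p \<oplus> k \<otimes> (l' p \<otimes> x p))"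
    by (rule finsum_cong') (use car k x in \<open>auto simp: l_distr m_assoc\<close>)
  also have "\<dots> = (\<Oplus>p\<in>P. l p \<otimes> x p) \<oplus> (\<Oplus>p\<in>P. k \<otimes> (l' p \<otimes> x p))"
    by (rule finsum_addf) (use car k x in auto)
  also have "(\<Oplus>p\<in>P. k \<otimes> (l' p \<otimes> x p)) = k \<otimes> (\<Oplus>p\<in>P. l' p \<otimes> x p)"
    by (rule finsum_rdistr[symmetric]) (use P car k x in auto)
  finally have L: "(\<Oplus>p\<in>P. (l p \<oplus> k \<otimes> l' p) \<otimes> x p) =
    (\<Oplus>p\<in>P. l p \<otimes> x p) \<oplus> k \<otimes> (\<Oplus>p\<in>P. l' p \<otimes> x p)" .
  have "(\<Oplus>p\<in>P. \<Oplus>r\<in>P. (q p r \<oplus> k \<otimes> q' p r) \<otimes> (x p \<otimes> x r)) =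
      (\<Oplus>p\<in>P. \<Oplus>r\<in>P. q p r \<otimes> (x p \<otimes> x r) \<oplus> k \<otimes> (q' p r \<otimes> (x p \<otimes> x r)))"
    by (rule finsum_cong2) (use car k x in \<open>auto simp: l_distr m_assoc\<close>)
  also have "\<dots> = (\<Oplus>p\<in>P. \<Oplus>r\<in>P. q p r \<otimes> (x p \<otimes> x r)) \<oplus>
      (\<Oplus>p\<in>P. \<Oplus>r\<in>P. k \<otimes> (q' p r \<otimes> (x p \<otimes> x r)))"
    by (rule finsum_add2) (use car k x in auto)
  also have "(\<Oplus>p\<in>P. \<Oplus>r\<in>P. k \<otimes> (q' p r \<otimes> (x p \<otimes> x r))) =
      k \<otimes> (\<Oplus>p\<in>P. \<Oplus>r\<in>P. q' p r \<otimes> (x p \<otimes> x r))"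
    by (rule finsum_smult2) (use P car k x in auto)
  finally have QQ: "(\<Oplus>p\<in>P. \<Oplus>r\<in>P. (q p r \<oplus> k \<otimes> q' p r) \<otimes> (x p \<otimes> x r)) =
    (\<Oplus>p\<in>P. \<Oplus>r\<in>P. q p r \<otimes> (x p \<otimes> x r)) \<oplus> k \<otimes> (\<Oplus>p\<in>P. \<Oplus>r\<in>P. q' p r \<otimes> (x p \<otimes> x r))" .
  have "(\<Oplus>p\<in>P. l p \<otimes> x p) \<in> carrier R" "(\<Oplus>p\<in>P. l' p \<otimes> x p) \<in> carrier R"
    "(\<Oplus>p\<in>P. \<Oplus>r\<in>P. q p r \<otimes> (x p \<otimes> x r)) \<in> carrier R"
    "(\<Oplus>p\<in>P. \<Oplus>r\<in>P. q' p r \<otimes> (x p \<otimes> x r)) \<in> carrier R"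
    using car x by (auto intro!: finsum_closed)
  then show "quad_val P (c \<oplus> k \<otimes> c') (\<lambda>p. l p \<oplus> k \<otimes> l' p) (\<lambda>p r. q p r \<oplus> k \<otimes> q' p r) x =
      quad_val P c l q x \<oplus> k \<otimes> quad_val P c' l' q' x"
    unfolding quad_val_def L QQ using car k by (simp add: r_distr a_ac)
  have "(\<Oplus>r\<in>P. (q p r \<oplus> k \<otimes> q' p r \<oplus> (q r p \<oplus> k \<otimes> q' r p)) \<otimes> x r) =
      (\<Oplus>r\<in>P. (q p r \<oplus> q r p) \<otimes> x r \<oplus> k \<otimes> ((q' p r \<oplus> q' r p) \<otimes> x r))"
    by (rule finsum_cong') (use car k x in \<open>auto simp: l_distr r_distr m_assoc a_ac\<close>)
  also have "\<dots> = (\<Oplus>r\<in>P. (q p r \<oplus> q r p) \<otimes> x r) \<oplus> (\<Oplus>r\<in>P. k \<otimes> ((q' p r \<oplus> q' r p) \<otimes> x r))"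
    by (rule finsum_addf) (use car k x in auto)
  also have "(\<Oplus>r\<in>P. k \<otimes> ((q' p r \<oplus> q' r p) \<otimes> x r)) = k \<otimes> (\<Oplus>r\<in>P. (q' p r \<oplus> q' r p) \<otimes> x r)"
    by (rule finsum_rdistr[symmetric]) (use P car k x in auto)
  finally have "(\<Oplus>r\<in>P. (q p r \<oplus> k \<otimes> q' p r \<oplus> (q r p \<oplus> k \<otimes> q' r p)) \<otimes> x r) =
    (\<Oplus>r\<in>P. (q p r \<oplus> q r p) \<otimes> x r) \<oplus> k \<otimes> (\<Oplus>r\<in>P. (q' p r \<oplus> q' r p) \<otimes> x r)" .
  moreover have "(\<Oplus>r\<in>P. (q p r \<oplus> q r p) \<otimes> x r) \<in> carrier R" "(\<Oplus>r\<in>P. (q' p r \<oplus> q' r p) \<otimes> x r) \<in> carrier R"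
    using car x by (auto intro!: finsum_closed)
  ultimately show "quad_diff P (\<lambda>p. l p \<oplus> k \<otimes> l' p) (\<lambda>p r. q p r \<oplus> k \<otimes> q' p r) x p =
      quad_diff P l q x p \<oplus> k \<otimes> quad_diff P l' q' x p"
    unfolding quad_diff_def using car k by (simp add: r_distr a_ac)
qed

end

section \<open>Leading terms of products of quadrics\<close>

context jet_space begin

definition quad_op ::
    "'a \<Rightarrow> ('p \<Rightarrow> 'a) \<Rightarrow> ('p \<Rightarrow> 'p \<Rightarrow> 'a) \<Rightarrow> ('i \<Rightarrow> 'p multiset \<Rightarrow> 'a) \<Rightarrow> 'i \<Rightarrow> 'p multiset \<Rightarrow> 'a" where
  "quad_op c l q u i \<alpha> = c \<otimes> u i \<alpha> \<oplus> (\<Oplus>p\<in>P. l p \<otimes> var p u i \<alpha>) \<oplus>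
    (\<Oplus>p\<in>P. \<Oplus>r\<in>P. q p r \<otimes> var p (var r u) i \<alpha>)"

text \<open>Multiplication by a quadric, sorted by order at the point \<open>z i\<close>. If the
  quadric vanishes there, the first summand disappears: the order goes up by at least one, and the
  differential governs the leading term.\<close>

lemma quad_op_expansion:
  assumes "quadric c l q" "u \<in> jets"
  shows "quad_op c l q u i \<alpha> = quad_val P c l q (z i) \<otimes> u i \<alpha> \<oplus>
    (\<Oplus>p\<in>P. quad_diff P l q (z i) p \<otimes> shift p u i \<alpha>) \<oplus>
    (\<Oplus>p\<in>P. \<Oplus>r\<in>P. q p r \<otimes> shift p (shift r u) i \<alpha>)"
proof -
  have "quad_op c l q u i \<alpha> = c \<otimes> u i \<alpha> \<oplus> (\<Oplus>p\<in>P. l p \<otimes> (z i p \<otimes> u i \<alpha> \<oplus> shift p u i \<alpha>)) \<oplus>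
      (\<Oplus>p\<in>P. \<Oplus>r\<in>P. q p r \<otimes> ((z i p \<otimes> z i r) \<otimes> u i \<alpha> \<oplus>
        (z i p \<otimes> shift r u i \<alpha> \<oplus> z i r \<otimes> shift p u i \<alpha>) \<oplus> shift p (shift r u) i \<alpha>))"
    unfolding quad_op_def var_var[OF assms(2)] by (simp only: var_def)
  also have "\<dots> = quad_val P c l q (z i) \<otimes> u i \<alpha> \<oplus>
    (\<Oplus>p\<in>P. quad_diff P l q (z i) p \<otimes> shift p u i \<alpha>) \<oplus>
    (\<Oplus>p\<in>P. \<Oplus>r\<in>P. q p r \<otimes> shift p (shift r u) i \<alpha>)"
    by (rule quad_expansion) (use assms finite_vars in \<open>auto intro: jetsD shift_jets\<close>)
  finally show ?thesis .
qed

lemma quad_op_poly_jets: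
  assumes "quadric c l q" "u \<in> poly_jets t"
  shows "quad_op c l q u \<in> poly_jets (t + 2)"
proof -
  have Q: "c \<in> carrier R" "\<And>p. l p \<in> carrier R" "\<And>p r. q p r \<in> carrier R"
    using assms(1) by (auto simp: quadric_def)
  have u: "u \<in> poly_jets (t + 2)" "\<And>p. p \<in> P \<Longrightarrow> var p u \<in> poly_jets (t + 2)"
    "\<And>p r. p \<in> P \<Longrightarrow> r \<in> P \<Longrightarrow> var p (var r u) \<in> poly_jets (t + 2)"
    using var_poly_jets[OF assms(2)] var_poly_jets[OF var_poly_jets[OF assms(2)]]
    by (auto intro: poly_jets_mono[OF assms(2)] poly_jets_mono[of _ "Suc t"])
  have "(\<lambda>i \<alpha>. (c \<otimes> u i \<alpha> \<oplus> (\<Oplus>p\<in>P. l p \<otimes> var p u i \<alpha>)) \<oplus>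
    (\<Oplus>p\<in>P. \<Oplus>r\<in>P. q p r \<otimes> var p (var r u) i \<alpha>)) \<in> poly_jets (t + 2)"
    by (intro add_poly_jets scale_poly_jets finsum_poly_jets finite_vars Q u)
  then show ?thesis by (simp add: quad_op_def[abs_def])
qed

text \<open>The quadrics vanishing on all points of \<open>I\<close> form a linear space, hence so
  do their differentials at \<open>z j\<close>. By \<open>sep\<close> no nonzero tangent vector is
  orthogonal to all of these, so \<open>separating_subspace\<close> yields every coordinate
  functional.\<close>

lemma unit_differential:
  assumes I: "finite I"
    and sep: "\<And>y. (\<And>p. p \<in> P \<Longrightarrow> y p \<in> carrier R) \<Longrightarrow> (\<exists>p\<in>P. y p \<noteq> \<zero>) \<Longrightarrow>
      \<exists>c l q. quadric c l q \<and> (\<forall>i\<in>I. quad_val P c l q (z i) = \<zero>) \<and>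
        (\<Oplus>p\<in>P. quad_diff P l q (z j) p \<otimes> y p) \<noteq> \<zero>"
    and p: "p \<in> P"
  shows "\<exists>c l q. quadric c l q \<and> (\<forall>i\<in>I. quad_val P c l q (z i) = \<zero>) \<and>
    (\<forall>r\<in>P. quad_diff P l q (z j) r = (if r = p then \<one> else \<zero>))"
proof -
  define D where "D = {quad_diff P l q (z j) | c l q. quadric c l q \<and> (\<forall>i\<in>I. quad_val P c l q (z i) = \<zero>)}"
  have "\<exists>d\<in>D. \<forall>r\<in>P. d r = (if r = p then \<one> else \<zero>)"
  proof (rule separating_subspace[OF finite_vars])
    have "quad_diff P (\<lambda>_. \<zero>) (\<lambda>_ _. \<zero>) (z j) \<in> D"
      unfolding D_def
      by (rule CollectI, rule exI[of _ \<zero>], rule exI[of _ "\<lambda>_. \<zero>"], rule exI[of _ "\<lambda>_ _. \<zero>"])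
        (simp add: quadric_def quad_val_def)
    then show "D \<noteq> {}" by blast
    show "d r \<in> carrier R" if "d \<in> D" for d r
      using that by (auto simp: D_def intro: quad_diff_closed)
    show "(\<lambda>p. d p \<oplus> k \<otimes> d' p) \<in> D" if dd: "d \<in> D" "d' \<in> D" and k: "k \<in> carrier R" for d d' k
    proof -
      obtain c l q c' l' q' where d: "d = quad_diff P l q (z j)" "d' = quad_diff P l' q' (z j)"
        and Q: "quadric c l q" "quadric c' l' q'"
        and v: "\<forall>i\<in>I. quad_val P c l q (z i) = \<zero>" "\<forall>i\<in>I. quad_val P c' l' q' (z i) = \<zero>"
        using dd unfolding D_def by blast
      show ?thesis
        unfolding D_def
        by (rule CollectI, rule exI[of _ "c \<oplus> k \<otimes> c'"], rule exI[of _ "\<lambda>p. l p \<oplus> k \<otimes> l' p"],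
            rule exI[of _ "\<lambda>p r. q p r \<oplus> k \<otimes> q' p r"])
          (use v k in \<open>simp add: quad_comb[OF finite_vars Q k] d fun_eq_iff\<close>)
    qed
    show "\<exists>d\<in>D. (\<Oplus>p\<in>P. d p \<otimes> y p) \<noteq> \<zero>"
      if y: "\<And>p. p \<in> P \<Longrightarrow> y p \<in> carrier R" "\<exists>p\<in>P. y p \<noteq> \<zero>" for y
    proof -
      obtain c l q where *: "quadric c l q" "\<forall>i\<in>I. quad_val P c l q (z i) = \<zero>"
          "(\<Oplus>p\<in>P. quad_diff P l q (z j) p \<otimes> y p) \<noteq> \<zero>"
        using sep[OF y] by auto
      then show ?thesis by (intro bexI[of _ "quad_diff P l q (z j)"]) (auto simp: D_def)
    qed
  qed auto
  then show ?thesis unfolding D_def by blast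
qed

text \<open>Each quadric contributes order one at every zero. At \<open>z j\<close> its leading term
  is the single variable \<open>p\<close>, so the product starts with the monomial of
  \<open>xs\<close>. At the other zeros \<open>g\<close> contributes one further order, so
  everything up to order \<open>length xs\<close> vanishes.\<close>

lemma leading_coefficients:
  assumes Q: "\<And>p. p \<in> P \<Longrightarrow> quadric (c p) (l p) (q p)"
    and van: "\<And>p i. p \<in> P \<Longrightarrow> i \<in> I \<Longrightarrow> quad_val P (c p) (l p) (q p) (z i) = \<zero>"
    and diff: "\<And>p r. p \<in> P \<Longrightarrow> r \<in> P \<Longrightarrow> quad_diff P (l p) (q p) (z j) r = (if r = p then \<one> else \<zero>)"
    and g: "g \<in> jets" "\<And>i. i \<in> I \<Longrightarrow> g i {#} = (if i = j then \<one> else \<zero>)"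
    and xs: "set xs \<subseteq> P"
  defines "v \<equiv> foldr (\<lambda>p. quad_op (c p) (l p) (q p)) xs g"
  shows "v \<in> jets \<and> (\<forall>i\<in>I. \<forall>\<beta>. size \<beta> \<le> length xs \<longrightarrow>
    v i \<beta> = (if i = j \<and> \<beta> = mset xs then \<one> else \<zero>))"
  using xs unfolding v_def
proof (induction xs)
  case Nil
  then show ?case using g by auto
next
  case (Cons p xs)
  define u where "u = foldr (\<lambda>p. quad_op (c p) (l p) (q p)) xs g"
  have p: "p \<in> P" and u: "u \<in> jets"
    and val: "\<And>i \<beta>. i \<in> I \<Longrightarrow> size \<beta> \<le> length xs \<Longrightarrow> u i \<beta> = (if i = j \<and> \<beta> = mset xs then \<one> else \<zero>)"
    using Cons by (auto simp: u_def)
  have car: "shift r u i \<beta> \<in> carrier R" "shift r (shift s u) i \<beta> \<in> carrier R" "u i \<beta> \<in> carrier R"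
    for r s i \<beta> using jetsD shift_jets u by metis+
  have "quad_op (c p) (l p) (q p) u \<in> jets"
    unfolding jets_def mem_Collect_eq quad_op_expansion[OF Q[OF p] u]
    using car quad_val_closed[OF Q[OF p], of P "z _"] quad_diff_closed[OF Q[OF p], of P "z _"] Q[OF p]
    by (auto simp: quadric_def intro!: finsum_closed)
  moreover have "quad_op (c p) (l p) (q p) u i \<beta> = (if i = j \<and> \<beta> = mset (p # xs) then \<one> else \<zero>)"
    if i: "i \<in> I" and \<beta>: "size \<beta> \<le> length (p # xs)" for i \<beta>
  proof -
    \<comment> \<open>A two-fold shift looks at a coefficient of order below
      \<open>length xs\<close>, where the induction hypothesis leaves nothing.\<close>
    have "shift r (shift s u) i \<beta> = \<zero>" for r s
    proof (cases "r \<in># \<beta> \<and> s \<in># \<beta> - {#r#}")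
      case True
      then obtain \<gamma> where "\<beta> = add_mset r (add_mset s \<gamma>)"
        by (metis insert_DiffM)
      with \<beta> have "size (\<beta> - {#r#} - {#s#}) < length xs" by simp
      then have "size (\<beta> - {#r#} - {#s#}) \<le> length xs" "\<beta> - {#r#} - {#s#} \<noteq> mset xs"
        by (auto dest: arg_cong[of _ _ size])
      with val[OF i] True show ?thesis by (simp add: shift_def)
    qed (auto simp: shift_def)
    then have "(\<Oplus>s\<in>P. \<Oplus>r\<in>P. q p s r \<otimes> shift s (shift r u) i \<beta>) = \<zero>"
      using Q[OF p] by (auto simp: quadric_def intro!: finsum_eq_zero)
    moreover have sh: "shift r u i \<beta> = (if i = j \<and> \<beta> = mset (r # xs) then \<one> else \<zero>)" for r
    proof (cases "r \<in># \<beta>")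
      case True
      then obtain \<gamma> where \<gamma>: "\<beta> = add_mset r \<gamma>" by (metis multi_member_split)
      with \<beta> have "size \<gamma> \<le> length xs" by simp
      with val[OF i this] \<gamma> show ?thesis by (auto simp: shift_def)
    qed (auto simp: shift_def)
    have "(\<Oplus>r\<in>P. quad_diff P (l p) (q p) (z i) r \<otimes> shift r u i \<beta>) =
        (if i = j \<and> \<beta> = mset (p # xs) then \<one> else \<zero>)"
    proof (cases "i = j")
      case True
      have "(\<Oplus>r\<in>P. quad_diff P (l p) (q p) (z i) r \<otimes> shift r u i \<beta>) =
          quad_diff P (l p) (q p) (z i) p \<otimes> shift p u i \<beta>"
        by (rule finsum_single) (use finite_vars p diff[OF p] True car in auto)
      then show ?thesis using True diff[OF p p] car sh[of p] by simp
    next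
      case False
      have "quad_diff P (l p) (q p) (z i) r \<in> carrier R" for r
        using quad_diff_closed[OF Q[OF p]] by simp
      with False show ?thesis by (auto simp: sh intro!: finsum_eq_zero)
    qed
    ultimately show ?thesis
      unfolding quad_op_expansion[OF Q[OF p] u] van[OF p i] using car by simp
  qed
  ultimately show ?case unfolding u_def by simp
qed

end

section \<open>Counting nondegenerate zeros of quadrics\<close>

text \<open>The quotient of the two binomials is the product of (t + k) / (s + k) over k = 1, ...,
  n, and each factor is at most (t + 1) / (s + 1). Denominators are cleared so that everything stays
  in \<open>nat\<close>.\<close>

lemma binomial_ratio_bound:
  fixes s t n :: nat
  assumes "s \<le> t"
  shows "((n + t) choose n) * (s + 1) ^ n \<le> ((n + s) choose n) * (t + 1) ^ n"
proof (induction n)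
  case (Suc n)
  have 1: "(Suc n + t) * (s + 1) \<le> (Suc n + s) * (t + 1)"
    using mult_left_mono[OF assms, of n] by (simp add: algebra_simps)
  have absorb: "Suc n * ((Suc n + t) choose Suc n) = (Suc n + t) * ((n + t) choose n)" for t
    using Suc_times_binomial[of n "n + t"] by (simp only: add_Suc)
  have "Suc n * (((Suc n + t) choose Suc n) * (s + 1) ^ Suc n) =
      ((Suc n + t) * (s + 1)) * (((n + t) choose n) * (s + 1) ^ n)"
    by (simp only: mult.assoc[symmetric] absorb power_Suc) (simp only: mult_ac)
  also have "\<dots> \<le> ((Suc n + s) * (t + 1)) * (((n + s) choose n) * (t + 1) ^ n)"
    by (rule mult_mono[OF 1 Suc]) auto
  also have "\<dots> = Suc n * (((Suc n + s) choose Suc n) * (t + 1) ^ Suc n)"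
    by (simp only: mult.assoc[symmetric] absorb power_Suc) (simp only: mult_ac)
  finally show ?case by (simp only: Suc_mult_le_cancel1)
qed simp

text \<open>Dividing by the binomial gives N \<le> ((D + 2 s + 1) / (s + 1))^n for every s, and the
  right-hand side tends to 2^n. The base 2 is the degree of a quadric; the constant \<open>D\<close>
  disappears in the limit.\<close>

lemma growth_bound:
  fixes N D n :: nat
  assumes "\<And>s. N * ((n + s) choose n) \<le> (n + (D + 2 * s)) choose n"
  shows "N \<le> 2 ^ n"
proof -
  have "real N \<le> (2 + (real D - 1) * inverse (real (Suc s))) ^ n" for s
  proof -
    have "N * ((n + s) choose n) * (s + 1) ^ n \<le> ((n + (D + 2 * s)) choose n) * (s + 1) ^ n"
      using assms by (rule mult_right_mono) simp
    also have "\<dots> \<le> ((n + s) choose n) * (D + 2 * s + 1) ^ n"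
      by (rule binomial_ratio_bound) simp
    finally have "((n + s) choose n) * (N * (s + 1) ^ n) \<le> ((n + s) choose n) * (D + 2 * s + 1) ^ n"
      by (simp add: mult_ac)
    then have "N * (s + 1) ^ n \<le> (D + 2 * s + 1) ^ n"
      by (subst (asm) mult_le_cancel1) simp
    then have "real (N * (s + 1) ^ n) \<le> real ((D + 2 * s + 1) ^ n)"
      by (rule of_nat_mono)
    then have "real N * real (Suc s) ^ n \<le> (real (D + 2 * s + 1)) ^ n"
      by simp
    then have "real N \<le> (real (D + 2 * s + 1) / real (Suc s)) ^ n"
      by (simp add: field_simps power_divide)
    also have "real (D + 2 * s + 1) / real (Suc s) = 2 + (real D - 1) * inverse (real (Suc s))"
      by (simp add: field_simps)
    finally show ?thesis .
  qed
  moreover have "(\<lambda>s. (2 + (real D - 1) * inverse (real (Suc s))) ^ n) \<longlonglongrightarrow> (2 + (real D - 1) * 0) ^ n"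
    by (intro tendsto_intros LIMSEQ_inverse_real_of_nat)
  ultimately have "real N \<le> (2 + (real D - 1) * 0) ^ n"
    by (intro LIMSEQ_le_const) auto
  then have "real N \<le> real (2 ^ n)" by simp
  then show ?thesis by (simp only: of_nat_le_iff)
qed

context jet_space begin

lemma card_monoms: "card (monoms t) = (card P + t) choose card P"
proof (cases "card P")
  case 0
  then have "P = {}" using finite_vars by simp
  then have "monoms t = {{#}}" by auto
  then show ?thesis using 0 by simp
next
  case (Suc n)
  have "monoms t = (\<Union>s\<le>t. multisets_of_size P s)"
    by (auto simp: multisets_of_size_def)
  moreover have "card (\<Union>s\<le>t. multisets_of_size P s) = (\<Sum>s\<le>t. card (multisets_of_size P s))"
    by (rule card_UN_disjoint)
      (use finite_vars in \<open>auto dest: multisets_of_size_size\<close>)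
  ultimately have "card (monoms t) = (\<Sum>s\<le>t. card (multisets_of_size P s))" by simp
  also have "\<dots> = (\<Sum>s\<le>t. (n + s) choose s)"
    using finite_vars Suc by (simp add: card_multisets_of_size)
  also have "\<dots> = Suc (n + t) choose t" by (rule sum_choose_lower)
  also have "\<dots> = (card P + t) choose card P"
    using Suc binomial_symmetric[of t "Suc (n + t)"] by simp
  finally show ?thesis .
qed

text \<open>For every zero \<open>z j\<close> and every \<alpha> of size at most s, multiply the
  quadrics adapted to \<open>z j\<close> as \<alpha> prescribes, and then by the polynomial
  separating \<open>z j\<close>. These products have degree at most D + 2 s and are linearly
  independent, so there are at most as many of them as monomials of that degree.\<close>

lemma card_nondegenerate_zeros:
  assumes I: "finite I"
    and distinct: "\<And>i j. i \<in> I \<Longrightarrow> j \<in> I \<Longrightarrow> i \<noteq> j \<Longrightarrow> \<exists>p\<in>P. z i p \<noteq> z j p"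
    and sep: "\<And>j y. j \<in> I \<Longrightarrow> (\<And>p. p \<in> P \<Longrightarrow> y p \<in> carrier R) \<Longrightarrow> (\<exists>p\<in>P. y p \<noteq> \<zero>) \<Longrightarrow>
      \<exists>c l q. quadric c l q \<and> (\<forall>i\<in>I. quad_val P c l q (z i) = \<zero>) \<and>
        (\<Oplus>p\<in>P. quad_diff P l q (z j) p \<otimes> y p) \<noteq> \<zero>"
  shows "card I \<le> 2 ^ card P"
proof -
  have "\<forall>j\<in>I. \<forall>p\<in>P. \<exists>Q. case Q of (c, l, q) \<Rightarrow> quadric c l q \<and>
      (\<forall>i\<in>I. quad_val P c l q (z i) = \<zero>) \<and>
      (\<forall>r\<in>P. quad_diff P l q (z j) r = (if r = p then \<one> else \<zero>))"
  proof (intro ballI)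
    fix j p assume "j \<in> I" "p \<in> P"
    then obtain c l q where "quadric c l q" "\<forall>i\<in>I. quad_val P c l q (z i) = \<zero>"
      "\<forall>r\<in>P. quad_diff P l q (z j) r = (if r = p then \<one> else \<zero>)"
      using unit_differential[OF I sep] by blast
    then show "\<exists>Q. case Q of (c, l, q) \<Rightarrow> quadric c l q \<and>
      (\<forall>i\<in>I. quad_val P c l q (z i) = \<zero>) \<and>
      (\<forall>r\<in>P. quad_diff P l q (z j) r = (if r = p then \<one> else \<zero>))"
      by (intro exI[of _ "(c, l, q)"]) simp
  qed
  then have "\<forall>j\<in>I. \<exists>f. \<forall>p\<in>P. case f p of (c, l, q) \<Rightarrow> quadric c l q \<and>
      (\<forall>i\<in>I. quad_val P c l q (z i) = \<zero>) \<and>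
      (\<forall>r\<in>P. quad_diff P l q (z j) r = (if r = p then \<one> else \<zero>))"
    by (intro ballI bchoice) blast
  from bchoice[OF this] obtain Q where Q: "\<forall>j\<in>I. \<forall>p\<in>P. (case Q j p of (c, l, q) \<Rightarrow> quadric c l q \<and>
      (\<forall>i\<in>I. quad_val P c l q (z i) = \<zero>) \<and>
      (\<forall>r\<in>P. quad_diff P l q (z j) r = (if r = p then \<one> else \<zero>)))" ..
  define C where "C j p = fst (Q j p)" for j p
  define L where "L j p = fst (snd (Q j p))" for j p
  define S where "S j p = snd (snd (Q j p))" for j p
  have Q: "quadric (C j p) (L j p) (S j p)" "\<And>i. i \<in> I \<Longrightarrow> quad_val P (C j p) (L j p) (S j p) (z i) = \<zero>"
    "\<And>r. r \<in> P \<Longrightarrow> quad_diff P (L j p) (S j p) (z j) r = (if r = p then \<one> else \<zero>)"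
    if "j \<in> I" "p \<in> P" for j p
    proof -
    have "case Q j p of (c, l, q) \<Rightarrow> quadric c l q \<and>
      (\<forall>i\<in>I. quad_val P c l q (z i) = \<zero>) \<and>
      (\<forall>r\<in>P. quad_diff P l q (z j) r = (if r = p then \<one> else \<zero>))"
      by (rule bspec[OF bspec[OF Q that(1)] that(2)])
    then show "quadric (C j p) (L j p) (S j p)" "\<And>i. i \<in> I \<Longrightarrow> quad_val P (C j p) (L j p) (S j p) (z i) = \<zero>"
      "\<And>r. r \<in> P \<Longrightarrow> quad_diff P (L j p) (S j p) (z j) r = (if r = p then \<one> else \<zero>)"
      unfolding C_def L_def S_def case_prod_beta by blast+
  qed
  have "\<forall>j\<in>I. \<exists>tg. snd tg \<in> poly_jets (fst tg) \<and> snd tg j {#} = \<one> \<and> (\<forall>i\<in>I - {j}. snd tg i {#} = \<zero>)"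
  proof
    fix j assume "j \<in> I"
    then show "\<exists>tg. snd tg \<in> poly_jets (fst tg) \<and> snd tg j {#} = \<one> \<and> (\<forall>i\<in>I - {j}. snd tg i {#} = \<zero>)"
      using separating_poly_jet[of "I - {j}" j] I distinct by simp
  qed
  from bchoice[OF this] obtain tg where tg: "\<forall>j\<in>I. snd (tg j) \<in> poly_jets (fst (tg j)) \<and>
    snd (tg j) j {#} = \<one> \<and> (\<forall>i\<in>I - {j}. snd (tg j) i {#} = \<zero>)" ..
  \<comment> \<open>A common degree bound for the separating polynomials; the inserted 0 makes the
    maximum meaningful when \<open>I\<close> is empty.\<close>
  define D where "D = Max (insert 0 ((\<lambda>j. fst (tg j)) ` I))"
  define g where "g j = snd (tg j)" for j
  have g: "g j \<in> poly_jets D" "\<And>i. i \<in> I \<Longrightarrow> g j i {#} = (if i = j then \<one> else \<zero>)" if "j \<in> I" for j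
  proof -
    have "fst (tg j) \<le> D" unfolding D_def using I that by (intro Max_ge) auto
    then show "g j \<in> poly_jets D" using tg that poly_jets_mono by (auto simp: g_def)
    show "g j i {#} = (if i = j then \<one> else \<zero>)" if "i \<in> I" for i
      using tg that \<open>j \<in> I\<close> by (auto simp: g_def)
  qed
  define mlist :: "'p multiset \<Rightarrow> 'p list" where "mlist \<alpha> = (SOME xs. mset xs = \<alpha>)" for \<alpha>
  have mlist: "mset (mlist \<alpha>) = \<alpha>" for \<alpha>
    unfolding mlist_def by (rule someI_ex) (rule ex_mset)
  define V where "V j xs = foldr (\<lambda>p. quad_op (C j p) (L j p) (S j p)) xs (g j)" for j xs
  have V_poly: "V j xs \<in> poly_jets (D + 2 * length xs)" if "j \<in> I" "set xs \<subseteq> P" for j xs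
    using that(2)
  proof (induction xs)
    case Nil
    then show ?case using g that by (simp add: V_def)
  next
    case (Cons p xs)
    then have "quad_op (C j p) (L j p) (S j p) (V j xs) \<in> poly_jets (D + 2 * length xs + 2)"
      using Q(1) that by (intro quad_op_poly_jets) auto
    then show ?case by (simp add: V_def)
  qed
  have V_lead: "V j xs i \<beta> = (if i = j \<and> \<beta> = mset xs then \<one> else \<zero>)"
    if "j \<in> I" "set xs \<subseteq> P" "i \<in> I" "size \<beta> \<le> length xs" for j xs i \<beta>
  proof -
    have "V j xs \<in> jets \<and> (\<forall>i\<in>I. \<forall>\<beta>. size \<beta> \<le> length xs \<longrightarrow>
        V j xs i \<beta> = (if i = j \<and> \<beta> = mset xs then \<one> else \<zero>))"
      unfolding V_def
      by (rule leading_coefficients)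
        (rule Q[OF that(1)] g(2)[OF that(1)] poly_jets_jets[OF g(1)[OF that(1)]] that(2); assumption?)+
    then show ?thesis using that by blast
  qed
  have "card I * ((card P + s) choose card P) \<le> (card P + (D + 2 * s)) choose card P" for s
  proof (rule ccontr)
    assume neg: "\<not> ?thesis"
    define A where "A = I \<times> monoms s"
    define v where "v a = V (fst a) (mlist (snd a))" for a
    have A: "finite A" "card A = card I * ((card P + s) choose card P)"
      using I finite_monoms by (auto simp: A_def card_cartesian_product card_monoms)
    have set: "set (mlist \<alpha>) \<subseteq> P" "length (mlist \<alpha>) = size \<alpha>" if "\<alpha> \<in> monoms s" for \<alpha>
      using that mlist[of \<alpha>] by (auto simp flip: set_mset_mset size_mset)
    have vD: "v a \<in> poly_jets (D + 2 * s)" if "a \<in> A" for a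
      using V_poly[of "fst a" "mlist (snd a)"] set[of "snd a"] that
      by (auto simp: A_def v_def intro: poly_jets_mono)
    obtain y where y: "\<forall>a\<in>A. y a \<in> carrier R" "\<exists>a\<in>A. y a \<noteq> \<zero>"
      "\<forall>i \<alpha>. (\<Oplus>a\<in>A. y a \<otimes> v a i \<alpha>) = \<zero>"
      using dependent_poly_jets[of A "D + 2 * s" v, OF A(1) _ vD] neg A(2) card_monoms[of "D + 2 * s"]
      by (auto simp: not_le)
    define B where "B = {a \<in> A. y a \<noteq> \<zero>}"
    have "B \<noteq> {}" using y(2) by (auto simp: B_def)
    \<comment> \<open>A term of least order among those with nonzero coefficient. At the point
      \<open>fst b\<close> and the exponent \<open>snd b\<close> every other such term vanishes by
      \<open>V_lead\<close>, whose size condition is exactly this minimality.\<close>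
    then obtain b where b: "b \<in> B" "\<And>a. a \<in> B \<Longrightarrow> size (snd b) \<le> size (snd a)"
      using ex_has_least_nat[of "\<lambda>a. a \<in> B" _ "\<lambda>a. size (snd a)"] by blast
    have bA: "b \<in> A" using b by (simp add: B_def)
    have val: "v a (fst b) (snd b) = (if a = b then \<one> else \<zero>)" if "a \<in> B" for a
      using V_lead[of "fst a" "mlist (snd a)" "fst b" "snd b"] b(2)[OF that] that bA set[of "snd a"] mlist[of "snd a"]
      by (auto simp: B_def A_def v_def prod_eq_iff)
    have vc: "v a (fst b) (snd b) \<in> carrier R" if "a \<in> A" for a
      using jetsD[OF poly_jets_jets[OF vD[OF that]]] .
    have "(\<Oplus>a\<in>A. y a \<otimes> v a (fst b) (snd b)) = y b \<otimes> v b (fst b) (snd b)"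
    proof (rule finsum_single[OF A(1) bA])
      show "y a \<otimes> v a (fst b) (snd b) = \<zero>" if "a \<in> A" "a \<noteq> b" for a
        using that val[of a] vc[of a] y(1) by (cases "y a = \<zero>") (auto simp: B_def)
    qed (use y bA vc in auto)
    with y val[OF b(1)] bA have "y b = \<zero>" by simp
    with b show False by (simp add: B_def)
  qed
  then show ?thesis by (rule growth_bound)
qed

end

text \<open>
  A Bezout bound that needs neither genericity nor an infinite field: at each zero the quadrics
  used may be different ones.
\<close>

theorem (in field) card_nondegenerate_zeros_of_quadrics:
  assumes P: "finite P" and Z: "finite Z" "Z \<subseteq> P \<rightarrow>\<^sub>E carrier R"
    and sep: "\<And>x y. x \<in> Z \<Longrightarrow> (\<And>p. p \<in> P \<Longrightarrow> y p \<in> carrier R) \<Longrightarrow> (\<exists>p\<in>P. y p \<noteq> \<zero>) \<Longrightarrow>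
      \<exists>c l q. quadric c l q \<and> (\<forall>x'\<in>Z. quad_val P c l q x' = \<zero>) \<and>
        (\<Oplus>p\<in>P. quad_diff P l q x p \<otimes> y p) \<noteq> \<zero>"
  shows "card Z \<le> 2 ^ card P"
proof -
  \<comment> \<open>The zeros index themselves. The default \<zero> is there because
    \<open>jet_space\<close> wants coordinates in the field for all indices and variables.\<close>
  define z where "z x p = (if x \<in> Z \<and> p \<in> P then x p else \<zero>)" for x :: "'c \<Rightarrow> 'a" and p
  have zc: "z x p \<in> carrier R" for x p using Z(2) by (auto simp: z_def)
  have zx: "z x p = x p" if "x \<in> Z" "p \<in> P" for x p using that by (simp add: z_def)
  interpret J: jet_space R P z by unfold_locales (use P zc in auto)
  have val: "quad_val P c l q (z x) = quad_val P c l q x" if Q: "quadric c l q" and x: "x \<in> Z" for c l q x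
  proof -
    have xc: "x p \<in> carrier R" if "p \<in> P" for p using Z(2) x that by auto
    have "(\<Oplus>p\<in>P. l p \<otimes> z x p) = (\<Oplus>p\<in>P. l p \<otimes> x p)"
      by (rule finsum_cong') (use Q zx[OF x] xc in \<open>auto simp: quadric_def\<close>)
    moreover have "(\<Oplus>p\<in>P. \<Oplus>r\<in>P. q p r \<otimes> (z x p \<otimes> z x r)) = (\<Oplus>p\<in>P. \<Oplus>r\<in>P. q p r \<otimes> (x p \<otimes> x r))"
      by (rule finsum_cong2) (use Q zx[OF x] xc in \<open>auto simp: quadric_def\<close>)
    ultimately show ?thesis by (simp add: quad_val_def)
  qed
  have diff: "quad_diff P l q (z x) p = quad_diff P l q x p" if Q: "quadric c l q" and x: "x \<in> Z" for c l q x p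
  proof -
    have xc: "x p \<in> carrier R" if "p \<in> P" for p using Z(2) x that by auto
    have "(\<Oplus>r\<in>P. (q p r \<oplus> q r p) \<otimes> z x r) = (\<Oplus>r\<in>P. (q p r \<oplus> q r p) \<otimes> x r)"
      by (rule finsum_cong') (use Q zx[OF x] xc in \<open>auto simp: quadric_def\<close>)
    then show ?thesis by (simp add: quad_diff_def)
  qed
  show ?thesis
  proof (rule J.card_nondegenerate_zeros[OF Z(1)])
    show "\<exists>p\<in>P. z x p \<noteq> z y p" if xy: "x \<in> Z" "y \<in> Z" "x \<noteq> y" for x y
    proof (rule ccontr)
      assume "\<not> ?thesis"
      then have "x p = y p" if "p \<in> P" for p using zx xy that by auto
      then have "x = y" using xy Z(2) by (intro PiE_ext[of x P "\<lambda>_. carrier R"]) auto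
      with xy show False by simp
    qed
    show "\<exists>c l q. quadric c l q \<and> (\<forall>i\<in>Z. quad_val P c l q (z i) = \<zero>) \<and>
        (\<Oplus>p\<in>P. quad_diff P l q (z x) p \<otimes> y p) \<noteq> \<zero>"
      if x: "x \<in> Z" and y: "\<And>p. p \<in> P \<Longrightarrow> y p \<in> carrier R" "\<exists>p\<in>P. y p \<noteq> \<zero>" for x y
    proof -
      obtain c l q where Q: "quadric c l q" "\<forall>x'\<in>Z. quad_val P c l q x' = \<zero>"
          "(\<Oplus>p\<in>P. quad_diff P l q x p \<otimes> y p) \<noteq> \<zero>"
        using sep[OF x y] by blast
      then show ?thesis
        by (intro exI[of _ c] exI[of _ l] exI[of _ q]) (simp add: val[OF Q(1)] diff[OF Q(1) x])
    qed
  qed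
qed

section \<open>Affine and quadratic functions without explicit coefficients\<close>

context field begin

text \<open>Values outside \<open>P\<close> are left free, so that coordinate families need not be
  made extensional; the set serves for points and for tangent vectors.\<close>

definition points :: "'p set \<Rightarrow> ('p \<Rightarrow> 'a) set" where
  "points P = {x. \<forall>p\<in>P. x p \<in> carrier R}"

lemma pointsD [simp]: "x \<in> points P \<Longrightarrow> p \<in> P \<Longrightarrow> x p \<in> carrier R"
  by (simp add: points_def)

text \<open>In both definitions the last argument is the differential of the preceding one.\<close>

definition affine_on :: "'p set \<Rightarrow> (('p \<Rightarrow> 'a) \<Rightarrow> 'a) \<Rightarrow> (('p \<Rightarrow> 'a) \<Rightarrow> 'a) \<Rightarrow> bool" where
  "affine_on P F dF \<longleftrightarrow> (\<exists>c l. c \<in> carrier R \<and> (\<forall>p. l p \<in> carrier R) \<and>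
    (\<forall>x\<in>points P. F x = c \<oplus> (\<Oplus>p\<in>P. l p \<otimes> x p)) \<and>
    (\<forall>y\<in>points P. dF y = (\<Oplus>p\<in>P. l p \<otimes> y p)))"

definition quadratic_on ::
    "'p set \<Rightarrow> (('p \<Rightarrow> 'a) \<Rightarrow> 'a) \<Rightarrow> (('p \<Rightarrow> 'a) \<Rightarrow> ('p \<Rightarrow> 'a) \<Rightarrow> 'a) \<Rightarrow> bool" where
  "quadratic_on P F dF \<longleftrightarrow> (\<exists>c l q. quadric c l q \<and>
    (\<forall>x\<in>points P. F x = quad_val P c l q x) \<and>
    (\<forall>x\<in>points P. \<forall>y\<in>points P. dF x y = (\<Oplus>p\<in>P. quad_diff P l q x p \<otimes> y p)))"

lemma finsum_smult:
  assumes "finite S" "k \<in> carrier R" "\<And>s. s \<in> S \<Longrightarrow> f s \<in> carrier R"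
  shows "(\<Oplus>s\<in>S. k \<otimes> f s) = k \<otimes> (\<Oplus>s\<in>S. f s)"
  by (rule finsum_rdistr[symmetric]) (use assms in auto)

lemma finsum_comb:
  assumes "finite S" "k \<in> carrier R" "\<And>s. s \<in> S \<Longrightarrow> f s \<in> carrier R" "\<And>s. s \<in> S \<Longrightarrow> g s \<in> carrier R"
  shows "(\<Oplus>s\<in>S. f s \<oplus> k \<otimes> g s) = (\<Oplus>s\<in>S. f s) \<oplus> k \<otimes> (\<Oplus>s\<in>S. g s)"
proof -
  have "(\<Oplus>s\<in>S. f s \<oplus> k \<otimes> g s) = (\<Oplus>s\<in>S. f s) \<oplus> (\<Oplus>s\<in>S. k \<otimes> g s)"
    by (rule finsum_addf) (use assms in auto)
  then show ?thesis using finsum_smult[OF assms(1,2), of g] assms(4) by simp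
qed

lemma affine_on_const: "c \<in> carrier R \<Longrightarrow> affine_on P (\<lambda>x. c) (\<lambda>y. \<zero>)"
  unfolding affine_on_def
  by (intro exI[of _ c] exI[of _ "\<lambda>_. \<zero>"]) (simp add: finsum_eq_zero)

lemma affine_on_coordinate:
  assumes "finite P" "p \<in> P"
  shows "affine_on P (\<lambda>x. x p) (\<lambda>y. y p)"
proof -
  have "(\<Oplus>r\<in>P. (if r = p then \<one> else \<zero>) \<otimes> x r) = x p" if "x \<in> points P" for x
  proof -
    have "(\<Oplus>r\<in>P. (if r = p then \<one> else \<zero>) \<otimes> x r) = (if p = p then \<one> else \<zero>) \<otimes> x p"
      by (rule finsum_single) (use assms that in auto)
    then show ?thesis using that assms by simp
  qed
  then show ?thesis
    unfolding affine_on_def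
    using assms by (intro exI[of _ \<zero>] exI[of _ "\<lambda>r. if r = p then \<one> else \<zero>"]) simp
qed

lemma affine_on_comb:
  assumes P: "finite P" and F: "affine_on P F dF" and G: "affine_on P G dG" and k: "k \<in> carrier R"
  shows "affine_on P (\<lambda>x. F x \<oplus> k \<otimes> G x) (\<lambda>y. dF y \<oplus> k \<otimes> dG y)"
proof -
  obtain c l where F: "c \<in> carrier R" "\<forall>p. l p \<in> carrier R"
    "\<forall>x\<in>points P. F x = c \<oplus> (\<Oplus>p\<in>P. l p \<otimes> x p)" "\<forall>y\<in>points P. dF y = (\<Oplus>p\<in>P. l p \<otimes> y p)"
    using F unfolding affine_on_def by blast
  obtain d g where G: "d \<in> carrier R" "\<forall>p. g p \<in> carrier R"
    "\<forall>x\<in>points P. G x = d \<oplus> (\<Oplus>p\<in>P. g p \<otimes> x p)" "\<forall>y\<in>points P. dG y = (\<Oplus>p\<in>P. g p \<otimes> y p)"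
    using G unfolding affine_on_def by blast
  have sum: "(\<Oplus>p\<in>P. (l p \<oplus> k \<otimes> g p) \<otimes> x p) = (\<Oplus>p\<in>P. l p \<otimes> x p) \<oplus> k \<otimes> (\<Oplus>p\<in>P. g p \<otimes> x p)"
    if x: "x \<in> points P" for x
  proof -
    have "(\<Oplus>p\<in>P. (l p \<oplus> k \<otimes> g p) \<otimes> x p) = (\<Oplus>p\<in>P. l p \<otimes> x p \<oplus> k \<otimes> (g p \<otimes> x p))"
      by (rule finsum_cong') (use F G k x in \<open>auto simp: l_distr m_assoc\<close>)
    also have "\<dots> = (\<Oplus>p\<in>P. l p \<otimes> x p) \<oplus> k \<otimes> (\<Oplus>p\<in>P. g p \<otimes> x p)"
      by (rule finsum_comb[OF P k]) (use F G x in auto)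
    finally show ?thesis .
  qed
  have closed: "(\<Oplus>p\<in>P. l p \<otimes> x p) \<in> carrier R" "(\<Oplus>p\<in>P. g p \<otimes> x p) \<in> carrier R" if "x \<in> points P" for x
    using F(2) G(2) that by (auto intro!: finsum_closed)
  show ?thesis
    unfolding affine_on_def
    using F G k closed
    by (intro exI[of _ "c \<oplus> k \<otimes> d"] exI[of _ "\<lambda>p. l p \<oplus> k \<otimes> g p"]) (simp add: sum r_distr a_ac)
qed

lemma affine_on_cong:
  "affine_on P F dF \<Longrightarrow> (\<And>x. x \<in> points P \<Longrightarrow> F' x = F x) \<Longrightarrow> (\<And>y. y \<in> points P \<Longrightarrow> dF' y = dF y) \<Longrightarrow>
    affine_on P F' dF'"
  unfolding affine_on_def by simp

lemma quadratic_on_cong: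
  "quadratic_on P F dF \<Longrightarrow> (\<And>x. x \<in> points P \<Longrightarrow> F' x = F x) \<Longrightarrow>
    (\<And>x y. x \<in> points P \<Longrightarrow> y \<in> points P \<Longrightarrow> dF' x y = dF x y) \<Longrightarrow> quadratic_on P F' dF'"
  unfolding quadratic_on_def by simp

lemma affine_on_closed:
  assumes "affine_on P F dF"
  shows "x \<in> points P \<Longrightarrow> F x \<in> carrier R" "y \<in> points P \<Longrightarrow> dF y \<in> carrier R"
proof -
  obtain c l where F: "c \<in> carrier R" "\<forall>p. l p \<in> carrier R"
    "\<forall>x\<in>points P. F x = c \<oplus> (\<Oplus>p\<in>P. l p \<otimes> x p)" "\<forall>y\<in>points P. dF y = (\<Oplus>p\<in>P. l p \<otimes> y p)"
    using assms unfolding affine_on_def by blast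
  show "F x \<in> carrier R" if "x \<in> points P"
    using F that by (auto intro!: finsum_closed)
  show "dF y \<in> carrier R" if "y \<in> points P"
    using F that by (auto intro!: finsum_closed)
qed

lemma quadratic_on_closed:
  assumes "quadratic_on P F dF"
  shows "x \<in> points P \<Longrightarrow> F x \<in> carrier R" "x \<in> points P \<Longrightarrow> y \<in> points P \<Longrightarrow> dF x y \<in> carrier R"
proof -
  obtain c l q where Q: "quadric c l q" "\<forall>x\<in>points P. F x = quad_val P c l q x"
    "\<forall>x\<in>points P. \<forall>y\<in>points P. dF x y = (\<Oplus>p\<in>P. quad_diff P l q x p \<otimes> y p)"
    using assms unfolding quadratic_on_def by blast
  show "F x \<in> carrier R" if "x \<in> points P"
    using Q(2) that quad_val_closed[OF Q(1), of P x] by simp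
  show "dF x y \<in> carrier R" if xy: "x \<in> points P" "y \<in> points P"
  proof -
    have "quad_diff P l q x p \<in> carrier R" for p
      by (rule quad_diff_closed[OF Q(1)]) (use xy in simp)
    then show ?thesis using Q(3) xy by (auto intro!: finsum_closed)
  qed
qed

lemma affine_on_finsum:
  assumes P: "finite P" and S: "finite S" and F: "\<And>s. s \<in> S \<Longrightarrow> affine_on P (F s) (dF s)"
  shows "affine_on P (\<lambda>x. \<Oplus>s\<in>S. F s x) (\<lambda>y. \<Oplus>s\<in>S. dF s y)"
  using S F
proof (induction S rule: finite_induct)
  case empty
  show ?case using affine_on_const[OF zero_closed] by simp
next
  case (insert s S)
  have "affine_on P (\<lambda>x. F s x \<oplus> \<one> \<otimes> (\<Oplus>s\<in>S. F s x)) (\<lambda>y. dF s y \<oplus> \<one> \<otimes> (\<Oplus>s\<in>S. dF s y))"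
    by (rule affine_on_comb[OF P]) (use insert in auto)
  moreover have closed: "F t x \<in> carrier R" "dF t x \<in> carrier R" if "t \<in> insert s S" "x \<in> points P" for t x
    using affine_on_closed[OF insert.prems[OF that(1)]] that(2) by auto
  have "(\<Oplus>s\<in>insert s S. F s x) = F s x \<oplus> (\<Oplus>s\<in>S. F s x)"
    "(\<Oplus>s\<in>insert s S. dF s x) = dF s x \<oplus> (\<Oplus>s\<in>S. dF s x)"
    "(\<Oplus>s\<in>S. F s x) \<in> carrier R" "(\<Oplus>s\<in>S. dF s x) \<in> carrier R" if "x \<in> points P" for x
    using closed that insert.hyps by (auto intro!: finsum_closed finsum_insert)
  ultimately show ?case by (elim affine_on_cong) simp_all
qed

lemma quadratic_on_comb:
  assumes P: "finite P" and F: "quadratic_on P F dF" and G: "quadratic_on P G dG" and k: "k \<in> carrier R"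
  shows "quadratic_on P (\<lambda>x. F x \<oplus> k \<otimes> G x) (\<lambda>x y. dF x y \<oplus> k \<otimes> dG x y)"
proof -
  obtain c l q where F: "quadric c l q" "\<forall>x\<in>points P. F x = quad_val P c l q x"
    "\<forall>x\<in>points P. \<forall>y\<in>points P. dF x y = (\<Oplus>p\<in>P. quad_diff P l q x p \<otimes> y p)"
    using F unfolding quadratic_on_def by blast
  obtain c' l' q' where G: "quadric c' l' q'" "\<forall>x\<in>points P. G x = quad_val P c' l' q' x"
    "\<forall>x\<in>points P. \<forall>y\<in>points P. dG x y = (\<Oplus>p\<in>P. quad_diff P l' q' x p \<otimes> y p)"
    using G unfolding quadratic_on_def by blast
  have sum: "(\<Oplus>p\<in>P. (quad_diff P l q x p \<oplus> k \<otimes> quad_diff P l' q' x p) \<otimes> y p) =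
      (\<Oplus>p\<in>P. quad_diff P l q x p \<otimes> y p) \<oplus> k \<otimes> (\<Oplus>p\<in>P. quad_diff P l' q' x p \<otimes> y p)"
    if xy: "x \<in> points P" "y \<in> points P" for x y
  proof -
    have d: "quad_diff P l q x p \<in> carrier R" "quad_diff P l' q' x p \<in> carrier R" for p
      by (rule quad_diff_closed[OF F(1)], use xy in simp, rule quad_diff_closed[OF G(1)], use xy in simp)
    have "(\<Oplus>p\<in>P. (quad_diff P l q x p \<oplus> k \<otimes> quad_diff P l' q' x p) \<otimes> y p) =
        (\<Oplus>p\<in>P. quad_diff P l q x p \<otimes> y p \<oplus> k \<otimes> (quad_diff P l' q' x p \<otimes> y p))"
      by (rule finsum_cong') (use d k xy in \<open>auto simp: l_distr m_assoc\<close>)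
    also have "\<dots> = (\<Oplus>p\<in>P. quad_diff P l q x p \<otimes> y p) \<oplus> k \<otimes> (\<Oplus>p\<in>P. quad_diff P l' q' x p \<otimes> y p)"
      by (rule finsum_comb[OF P k]) (use d xy in auto)
    finally show ?thesis .
  qed
  note comb = quad_comb[OF P F(1) G(1) k]
  show ?thesis
    unfolding quadratic_on_def
  proof (intro exI conjI ballI)
    show "quadric (c \<oplus> k \<otimes> c') (\<lambda>p. l p \<oplus> k \<otimes> l' p) (\<lambda>p r. q p r \<oplus> k \<otimes> q' p r)"
      by (rule comb(1)[of "\<lambda>_. \<zero>"]) simp
    fix x assume x: "x \<in> points P"
    show "F x \<oplus> k \<otimes> G x = quad_val P (c \<oplus> k \<otimes> c') (\<lambda>p. l p \<oplus> k \<otimes> l' p) (\<lambda>p r. q p r \<oplus> k \<otimes> q' p r) x"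
      using comb(2)[of x] F(2) G(2) x by simp
    fix y assume y: "y \<in> points P"
    show "dF x y \<oplus> k \<otimes> dG x y =
      (\<Oplus>p\<in>P. quad_diff P (\<lambda>p. l p \<oplus> k \<otimes> l' p) (\<lambda>p r. q p r \<oplus> k \<otimes> q' p r) x p \<otimes> y p)"
      using comb(3)[of x] F(3) G(3) x y sum[OF x y] by simp
  qed
qed

lemma quadratic_on_affine:
  assumes "finite P" "affine_on P F dF"
  shows "quadratic_on P F (\<lambda>x. dF)"
proof -
  obtain c l where F: "c \<in> carrier R" "\<forall>p. l p \<in> carrier R"
    "\<forall>x\<in>points P. F x = c \<oplus> (\<Oplus>p\<in>P. l p \<otimes> x p)" "\<forall>y\<in>points P. dF y = (\<Oplus>p\<in>P. l p \<otimes> y p)"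
    using assms(2) unfolding affine_on_def by blast
  have zero: "(\<Oplus>p\<in>P. \<Oplus>r\<in>P. \<zero> \<otimes> (x p \<otimes> x r)) = \<zero>" "(\<Oplus>r\<in>P. (\<zero> \<oplus> \<zero>) \<otimes> x r) = \<zero>"
    if "x \<in> points P" for x
    using that by (auto intro!: finsum_eq_zero)
  have closed: "(\<Oplus>p\<in>P. l p \<otimes> x p) \<in> carrier R" if "x \<in> points P" for x
    using F(2) that by (auto intro!: finsum_closed)
  have d: "quad_diff P l (\<lambda>_ _. \<zero>) x p = l p" if "x \<in> points P" for x p
    using zero(2)[OF that] F(2) by (simp add: quad_diff_def)
  show ?thesis
    unfolding quadratic_on_def
  proof (intro exI conjI ballI)
    show "quadric c l (\<lambda>_ _. \<zero>)" using F by (simp add: quadric_def)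
    fix x assume x: "x \<in> points P"
    show "F x = quad_val P c l (\<lambda>_ _. \<zero>) x"
      unfolding quad_val_def zero(1)[OF x] using F x closed[OF x] by simp
    show "dF y = (\<Oplus>p\<in>P. quad_diff P l (\<lambda>_ _. \<zero>) x p \<otimes> y p)" if "y \<in> points P" for y
      using F(4) that by (simp add: d[OF x])
  qed
qed

text \<open>The product rule. For factors c + L and d + H the product has constant part c d, linear
  part c H + d L and quadratic part L H; the latter is encoded by the unsymmetrised matrix
  \<open>l p \<otimes> g r\<close>.\<close>

lemma quadratic_on_mult:
  assumes P: "finite P" and F: "affine_on P F dF" and G: "affine_on P G dG"
  shows "quadratic_on P (\<lambda>x. F x \<otimes> G x) (\<lambda>x y. F x \<otimes> dG y \<oplus> dF y \<otimes> G x)"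
proof -
  obtain c l where F: "c \<in> carrier R" "\<And>p. l p \<in> carrier R"
    "\<And>x. x \<in> points P \<Longrightarrow> F x = c \<oplus> (\<Oplus>p\<in>P. l p \<otimes> x p)" "\<And>y. y \<in> points P \<Longrightarrow> dF y = (\<Oplus>p\<in>P. l p \<otimes> y p)"
    using F unfolding affine_on_def by blast
  obtain d g where G: "d \<in> carrier R" "\<And>p. g p \<in> carrier R"
    "\<And>x. x \<in> points P \<Longrightarrow> G x = d \<oplus> (\<Oplus>p\<in>P. g p \<otimes> x p)" "\<And>y. y \<in> points P \<Longrightarrow> dG y = (\<Oplus>p\<in>P. g p \<otimes> y p)"
    using G unfolding affine_on_def by blast
  define a where "a p = c \<otimes> g p \<oplus> d \<otimes> l p" for p
  define q where "q p r = l p \<otimes> g r" for p r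
  have closed: "(\<Oplus>p\<in>P. l p \<otimes> x p) \<in> carrier R" "(\<Oplus>p\<in>P. g p \<otimes> x p) \<in> carrier R" if "x \<in> points P" for x
    using F(2) G(2) that by (auto intro!: finsum_closed)
  show ?thesis
    unfolding quadratic_on_def
  proof (intro exI conjI ballI)
    show "quadric (c \<otimes> d) a q" using F G by (simp add: quadric_def a_def q_def)
    fix x assume x: "x \<in> points P"
    define L where "L = (\<Oplus>p\<in>P. l p \<otimes> x p)"
    define H where "H = (\<Oplus>p\<in>P. g p \<otimes> x p)"
    have LH: "L \<in> carrier R" "H \<in> carrier R" using closed[OF x] by (simp_all add: L_def H_def)
    have a: "(\<Oplus>p\<in>P. a p \<otimes> y p) = c \<otimes> (\<Oplus>p\<in>P. g p \<otimes> y p) \<oplus> d \<otimes> (\<Oplus>p\<in>P. l p \<otimes> y p)"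
      if y: "y \<in> points P" for y
    proof -
      have "(\<Oplus>p\<in>P. a p \<otimes> y p) = (\<Oplus>p\<in>P. c \<otimes> (g p \<otimes> y p) \<oplus> d \<otimes> (l p \<otimes> y p))"
        by (rule finsum_cong') (use F(1,2) G(1,2) y in \<open>auto simp: a_def l_distr m_assoc\<close>)
      also have "\<dots> = (\<Oplus>p\<in>P. c \<otimes> (g p \<otimes> y p)) \<oplus> d \<otimes> (\<Oplus>p\<in>P. l p \<otimes> y p)"
        by (rule finsum_comb[OF P G(1)]) (use F(1,2) G(1,2) y in auto)
      also have "(\<Oplus>p\<in>P. c \<otimes> (g p \<otimes> y p)) = c \<otimes> (\<Oplus>p\<in>P. g p \<otimes> y p)"
        by (rule finsum_smult[OF P F(1)]) (use G(2) y in auto)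
      finally show ?thesis .
    qed
    have "(\<Oplus>p\<in>P. \<Oplus>r\<in>P. q p r \<otimes> (x p \<otimes> x r)) = (\<Oplus>p\<in>P. (l p \<otimes> x p) \<otimes> H)"
    proof (rule finsum_cong')
      fix p assume p: "p \<in> P"
      have "(\<Oplus>r\<in>P. q p r \<otimes> (x p \<otimes> x r)) = (\<Oplus>r\<in>P. (l p \<otimes> x p) \<otimes> (g r \<otimes> x r))"
        by (rule finsum_cong') (use F(1,2) G(1,2) x p in \<open>auto simp: q_def m_ac\<close>)
      also have "\<dots> = (l p \<otimes> x p) \<otimes> H"
        unfolding H_def by (rule finsum_smult[OF P]) (use F(2) G(2) x p in auto)
      finally show "(\<Oplus>r\<in>P. q p r \<otimes> (x p \<otimes> x r)) = (l p \<otimes> x p) \<otimes> H" .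
    qed (use F(2) LH x in auto)
    also have "\<dots> = L \<otimes> H"
      unfolding L_def by (rule finsum_ldistr[symmetric]) (use P F(2) LH x in auto)
    finally have q: "(\<Oplus>p\<in>P. \<Oplus>r\<in>P. q p r \<otimes> (x p \<otimes> x r)) = L \<otimes> H" .
    show "F x \<otimes> G x = quad_val P (c \<otimes> d) a q x"
      unfolding quad_val_def q a[OF x] F(3)[OF x] G(3)[OF x] L_def[symmetric] H_def[symmetric]
      using LH F(1) G(1) by (simp add: l_distr r_distr m_comm[of L d] a_ac)
    fix y assume y: "y \<in> points P"
    define L' where "L' = (\<Oplus>p\<in>P. l p \<otimes> y p)"
    define H' where "H' = (\<Oplus>p\<in>P. g p \<otimes> y p)"
    have LH': "L' \<in> carrier R" "H' \<in> carrier R" using closed[OF y] by (simp_all add: L'_def H'_def)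
    have dq: "quad_diff P a q x p = a p \<oplus> (l p \<otimes> H \<oplus> g p \<otimes> L)" if p: "p \<in> P" for p
    proof -
      have "(\<Oplus>r\<in>P. (q p r \<oplus> q r p) \<otimes> x r) = (\<Oplus>r\<in>P. l p \<otimes> (g r \<otimes> x r) \<oplus> g p \<otimes> (l r \<otimes> x r))"
        by (rule finsum_cong') (use F(1,2) G(1,2) x p in \<open>auto simp: q_def l_distr r_distr m_ac\<close>)
      also have "\<dots> = (\<Oplus>r\<in>P. l p \<otimes> (g r \<otimes> x r)) \<oplus> g p \<otimes> L"
        unfolding L_def by (rule finsum_comb[OF P G(2)]) (use F(1,2) G(1,2) x in auto)
      also have "(\<Oplus>r\<in>P. l p \<otimes> (g r \<otimes> x r)) = l p \<otimes> H"
        unfolding H_def by (rule finsum_smult[OF P F(2)]) (use G(2) x in auto)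
      finally show ?thesis by (simp add: quad_diff_def)
    qed
    have "(\<Oplus>p\<in>P. quad_diff P a q x p \<otimes> y p) = (\<Oplus>p\<in>P. a p \<otimes> y p \<oplus> (H \<otimes> (l p \<otimes> y p) \<oplus> L \<otimes> (g p \<otimes> y p)))"
      by (rule finsum_cong')
        (use F(1,2) G(1,2) y LH in \<open>auto simp: dq a_def l_distr r_distr m_ac a_ac\<close>)
    also have "\<dots> = (\<Oplus>p\<in>P. a p \<otimes> y p) \<oplus> (\<Oplus>p\<in>P. H \<otimes> (l p \<otimes> y p) \<oplus> L \<otimes> (g p \<otimes> y p))"
      by (rule finsum_addf) (use F(1,2) G(1,2) y LH in \<open>auto simp: a_def\<close>)
    also have "(\<Oplus>p\<in>P. H \<otimes> (l p \<otimes> y p) \<oplus> L \<otimes> (g p \<otimes> y p)) = (\<Oplus>p\<in>P. H \<otimes> (l p \<otimes> y p)) \<oplus> L \<otimes> H'"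
      unfolding H'_def by (rule finsum_comb[OF P LH(1)]) (use F(2) G(2) y LH in auto)
    also have "(\<Oplus>p\<in>P. H \<otimes> (l p \<otimes> y p)) = H \<otimes> L'"
      unfolding L'_def by (rule finsum_smult[OF P LH(2)]) (use F(2) y in auto)
    finally have sum: "(\<Oplus>p\<in>P. quad_diff P a q x p \<otimes> y p) = (c \<otimes> H' \<oplus> d \<otimes> L') \<oplus> (H \<otimes> L' \<oplus> L \<otimes> H')"
      by (simp add: a[OF y] L'_def H'_def)
    show "F x \<otimes> dG y \<oplus> dF y \<otimes> G x = (\<Oplus>p\<in>P. quad_diff P a q x p \<otimes> y p)"
      unfolding sum F(3)[OF x] G(3)[OF x] F(4)[OF y] G(4)[OF y]
        L_def[symmetric] H_def[symmetric] L'_def[symmetric] H'_def[symmetric]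
      using LH LH' F(1) G(1) by (simp add: l_distr r_distr m_comm[of L'] a_ac)
  qed
qed

lemma quadratic_on_finsum:
  assumes P: "finite P" and S: "finite S" and F: "\<And>s. s \<in> S \<Longrightarrow> quadratic_on P (F s) (dF s)"
  shows "quadratic_on P (\<lambda>x. \<Oplus>s\<in>S. F s x) (\<lambda>x y. \<Oplus>s\<in>S. dF s x y)"
  using S F
proof (induction S rule: finite_induct)
  case empty
  show ?case using quadratic_on_affine[OF P affine_on_const[OF zero_closed]] by simp
next
  case (insert s S)
  have "quadratic_on P (\<lambda>x. F s x \<oplus> \<one> \<otimes> (\<Oplus>s\<in>S. F s x)) (\<lambda>x y. dF s x y \<oplus> \<one> \<otimes> (\<Oplus>s\<in>S. dF s x y))"
    by (rule quadratic_on_comb[OF P]) (use insert in auto)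
  moreover have closed: "F t x \<in> carrier R" "y \<in> points P \<Longrightarrow> dF t x y \<in> carrier R"
    if "t \<in> insert s S" "x \<in> points P" for t x y
    using quadratic_on_closed[OF insert.prems[OF that(1)]] that(2) by auto
  have "(\<Oplus>s\<in>insert s S. F s x) = F s x \<oplus> (\<Oplus>s\<in>S. F s x)" "(\<Oplus>s\<in>S. F s x) \<in> carrier R"
    if "x \<in> points P" for x
    using closed(1) that insert.hyps by (auto intro!: finsum_closed finsum_insert)
  moreover have "(\<Oplus>s\<in>insert s S. dF s x y) = dF s x y \<oplus> (\<Oplus>s\<in>S. dF s x y)" "(\<Oplus>s\<in>S. dF s x y) \<in> carrier R"
    if "x \<in> points P" "y \<in> points P" for x y
    using closed(2) that insert.hyps by (auto intro!: finsum_closed finsum_insert)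
  ultimately show ?case by (elim quadratic_on_cong) simp_all
qed

text \<open>The bound holds for every finite subset of \<open>Z\<close> with the same constant,
  which forces \<open>Z\<close> itself to be finite.\<close>

theorem card_nondegenerate_zeros_quadratic:
  assumes P: "finite P" and Z: "Z \<subseteq> P \<rightarrow>\<^sub>E carrier R"
    and sep: "\<And>x y. x \<in> Z \<Longrightarrow> y \<in> points P \<Longrightarrow> (\<exists>p\<in>P. y p \<noteq> \<zero>) \<Longrightarrow>
      \<exists>F dF. quadratic_on P F dF \<and> (\<forall>x'\<in>Z. F x' = \<zero>) \<and> dF x y \<noteq> \<zero>"
  shows "finite Z \<and> card Z \<le> 2 ^ card P"
proof -
  have points: "x \<in> points P" if "x \<in> Z" for x using Z that by (auto simp: points_def)
  have bound: "card Z' \<le> 2 ^ card P" if Z': "Z' \<subseteq> Z" "finite Z'" for Z'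
  proof (rule card_nondegenerate_zeros_of_quadrics[OF P Z'(2)])
    show "Z' \<subseteq> P \<rightarrow>\<^sub>E carrier R" using Z Z' by blast
    fix x y assume x: "x \<in> Z'" and y: "\<And>p. p \<in> P \<Longrightarrow> y p \<in> carrier R" "\<exists>p\<in>P. y p \<noteq> \<zero>"
    have yp: "y \<in> points P" using y(1) by (simp add: points_def)
    obtain F dF where F: "quadratic_on P F dF" "\<forall>x'\<in>Z. F x' = \<zero>" "dF x y \<noteq> \<zero>"
      using sep[OF _ yp y(2)] x Z'(1) by blast
    obtain c l q where Q: "quadric c l q" "\<forall>x\<in>points P. F x = quad_val P c l q x"
      "\<forall>x\<in>points P. \<forall>y\<in>points P. dF x y = (\<Oplus>p\<in>P. quad_diff P l q x p \<otimes> y p)"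
      using F(1) unfolding quadratic_on_def by blast
    have "\<forall>x'\<in>Z'. quad_val P c l q x' = \<zero>" 
    proof
      fix x' assume "x' \<in> Z'"
      then have "x' \<in> Z" using Z'(1) by blast
      then show "quad_val P c l q x' = \<zero>" using bspec[OF Q(2) points] bspec[OF F(2)] by metis
    qed
    moreover have "(\<Oplus>p\<in>P. quad_diff P l q x p \<otimes> y p) \<noteq> \<zero>"
      using F(3) bspec[OF bspec[OF Q(3) points[OF subsetD[OF Z'(1) x]]] yp] by metis
    ultimately show "\<exists>c l q. quadric c l q \<and> (\<forall>x'\<in>Z'. quad_val P c l q x' = \<zero>) \<and>
        (\<Oplus>p\<in>P. quad_diff P l q x p \<otimes> y p) \<noteq> \<zero>"
      using Q(1) by blast
  qed
  show ?thesis
    using finite_if_finite_subsets_card_bdd[of Z "2 ^ card P"] bound by blast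
qed

end

section \<open>Modules and brick chain filtrations\<close>

lemma (in abelian_group) minus_eq_add: "x \<ominus> y = x \<oplus> \<ominus> y"
  by (simp add: a_minus_def)

lemma (in abelian_group) neg_zero: "\<ominus> \<zero> = \<zero>"
  by (rule minus_equality) auto

context right_module begin

lemma act_zero [simp]: "a \<in> carrier A \<Longrightarrow> a \<odot>\<^bsub>M\<^esub> \<zero>\<^bsub>M\<^esub> = \<zero>\<^bsub>M\<^esub>"
  using act_distr_module[of a "\<zero>\<^bsub>M\<^esub>" "\<zero>\<^bsub>M\<^esub>"] act_closed[of a "\<zero>\<^bsub>M\<^esub>"]
    M.add.l_cancel_one[of "a \<odot>\<^bsub>M\<^esub> \<zero>\<^bsub>M\<^esub>" "a \<odot>\<^bsub>M\<^esub> \<zero>\<^bsub>M\<^esub>"] by simp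

lemma zero_act [simp]: "x \<in> carrier M \<Longrightarrow> \<zero>\<^bsub>A\<^esub> \<odot>\<^bsub>M\<^esub> x = \<zero>\<^bsub>M\<^esub>"
  using act_distr_ring[of "\<zero>\<^bsub>A\<^esub>" "\<zero>\<^bsub>A\<^esub>" x] act_closed[of "\<zero>\<^bsub>A\<^esub>" x]
    M.add.l_cancel_one[of "\<zero>\<^bsub>A\<^esub> \<odot>\<^bsub>M\<^esub> x" "\<zero>\<^bsub>A\<^esub> \<odot>\<^bsub>M\<^esub> x"] by simp

lemma act_neg:
  assumes "a \<in> carrier A" "x \<in> carrier M"
  shows "a \<odot>\<^bsub>M\<^esub> (\<ominus>\<^bsub>M\<^esub> x) = \<ominus>\<^bsub>M\<^esub> (a \<odot>\<^bsub>M\<^esub> x)"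
proof -
  have "a \<odot>\<^bsub>M\<^esub> (\<ominus>\<^bsub>M\<^esub> x) \<oplus>\<^bsub>M\<^esub> a \<odot>\<^bsub>M\<^esub> x = \<zero>\<^bsub>M\<^esub>"
    using assms act_distr_module[of a "\<ominus>\<^bsub>M\<^esub> x" x] by (simp add: M.l_neg)
  then show ?thesis using assms act_closed by (intro M.minus_equality[symmetric]) auto
qed

lemma neg_act:
  assumes "a \<in> carrier A" "x \<in> carrier M"
  shows "(\<ominus>\<^bsub>A\<^esub> a) \<odot>\<^bsub>M\<^esub> x = \<ominus>\<^bsub>M\<^esub> (a \<odot>\<^bsub>M\<^esub> x)"
proof -
  have "(\<ominus>\<^bsub>A\<^esub> a) \<odot>\<^bsub>M\<^esub> x \<oplus>\<^bsub>M\<^esub> a \<odot>\<^bsub>M\<^esub> x = \<zero>\<^bsub>M\<^esub>"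
    using assms act_distr_ring[of "\<ominus>\<^bsub>A\<^esub> a" a x] by (simp add: A.l_neg)
  then show ?thesis using assms act_closed by (intro M.minus_equality[symmetric]) auto
qed

lemma act_minus:
  assumes "a \<in> carrier A" "x \<in> carrier M" "y \<in> carrier M"
  shows "a \<odot>\<^bsub>M\<^esub> (x \<ominus>\<^bsub>M\<^esub> y) = a \<odot>\<^bsub>M\<^esub> x \<ominus>\<^bsub>M\<^esub> a \<odot>\<^bsub>M\<^esub> y"
  using assms by (simp add: M.minus_eq_add act_distr_module act_neg)

lemma rsubmoduleI:
  assumes "H \<subseteq> carrier M" "\<zero>\<^bsub>M\<^esub> \<in> H"
    and "\<And>x y. x \<in> H \<Longrightarrow> y \<in> H \<Longrightarrow> x \<oplus>\<^bsub>M\<^esub> y \<in> H"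
    and act: "\<And>a x. a \<in> carrier A \<Longrightarrow> x \<in> H \<Longrightarrow> a \<odot>\<^bsub>M\<^esub> x \<in> H"
  shows "rsubmodule A M H"
proof -
  have "\<ominus>\<^bsub>M\<^esub> x \<in> H" if "x \<in> H" for x
    using act[of "\<ominus>\<^bsub>A\<^esub> \<one>\<^bsub>A\<^esub>" x] that assms(1) neg_act[of "\<one>\<^bsub>A\<^esub>" x] act_one[of x] by auto
  then show ?thesis
    using assms
    by (auto simp: Module.submodule_def submodule_axioms_def subgroup_def simp flip: a_inv_def)
qed

lemma rsubmoduleD:
  assumes "rsubmodule A M H"
  shows "H \<subseteq> carrier M" "\<zero>\<^bsub>M\<^esub> \<in> H" "\<And>x y. x \<in> H \<Longrightarrow> y \<in> H \<Longrightarrow> x \<oplus>\<^bsub>M\<^esub> y \<in> H"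
    "\<And>a x. a \<in> carrier A \<Longrightarrow> x \<in> H \<Longrightarrow> a \<odot>\<^bsub>M\<^esub> x \<in> H" "\<And>x. x \<in> H \<Longrightarrow> \<ominus>\<^bsub>M\<^esub> x \<in> H"
    "\<And>x y. x \<in> H \<Longrightarrow> y \<in> H \<Longrightarrow> x \<ominus>\<^bsub>M\<^esub> y \<in> H"
  using assms
  by (auto simp: Module.submodule_def submodule_axioms_def subgroup_def a_minus_def a_inv_def)

lemma rsubmodule_carrier: "rsubmodule A M (carrier M)"
  by (rule rsubmoduleI) (auto simp: act_closed)

lemma rsubmodule_abelian_subgroup: "rsubmodule A M H \<Longrightarrow> abelian_subgroup H M"
  by (intro abelian_subgroupI3 additive_subgroup.intro M.abelian_group_axioms)
    (simp add: Module.submodule_def)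

lemma right_module_restrict:
  assumes "rsubmodule A M H"
  shows "right_module A (M\<lparr>carrier := H\<rparr>)"
proof -
  note H = rsubmoduleD[OF assms]
  have "abelian_group (M\<lparr>carrier := H\<rparr>)"
  proof (rule abelian_groupI)
    show "\<exists>y\<in>carrier (M\<lparr>carrier := H\<rparr>). y \<oplus>\<^bsub>M\<lparr>carrier := H\<rparr>\<^esub> x = \<zero>\<^bsub>M\<lparr>carrier := H\<rparr>\<^esub>"
      if "x \<in> carrier (M\<lparr>carrier := H\<rparr>)" for x
      using that H(1,5) by (auto intro!: bexI[of _ "\<ominus>\<^bsub>M\<^esub> x"] M.l_neg)
  qed (use H M.a_assoc M.a_comm in \<open>auto simp: subset_eq\<close>)
  then show ?thesis
    using H A.ring_axioms
    by (auto simp: right_module_def right_module_axioms_def subset_eq act_closed act_distr_ring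
        act_distr_module act_mult act_one)
qed

lemma rsubmodule_restrict:
  assumes "rsubmodule A M H" "rsubmodule A M N" "N \<subseteq> H"
  shows "rsubmodule A (M\<lparr>carrier := H\<rparr>) N"
proof -
  interpret H: right_module A "M\<lparr>carrier := H\<rparr>" by (rule right_module_restrict) fact
  show ?thesis by (rule H.rsubmoduleI) (use rsubmoduleD[OF assms(2)] assms(3) in auto)
qed

text \<open>The bridge between quotients and representatives: from here on, statements about M / P
  are handled as differences lying in P.\<close>

lemma coset_eq_iff:
  assumes "rsubmodule A M P" "x \<in> carrier M" "y \<in> carrier M"
  shows "P +>\<^bsub>M\<^esub> x = P +>\<^bsub>M\<^esub> y \<longleftrightarrow> x \<ominus>\<^bsub>M\<^esub> y \<in> P"
proof -
  interpret P: abelian_subgroup P M by (rule rsubmodule_abelian_subgroup) fact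
  show ?thesis
    using P.a_rcos_module[OF assms(3,2)] P.a_repr_independence'[of x y]
      P.a_repr_independenceD[of x y] P.a_rcos_self[OF assms(2)] assms(2,3)
    by (auto simp: M.minus_eq_add)
qed

lemma coset_eq_self_iff:
  assumes "rsubmodule A M P" "x \<in> carrier M"
  shows "P +>\<^bsub>M\<^esub> x = P \<longleftrightarrow> x \<in> P"
  using coset_eq_iff[OF assms M.zero_closed] rsubmoduleD(1)[OF assms(1)] assms(2)
    M.a_coset_add_zero[of P] M.neg_zero by (simp add: M.minus_eq_add)

lemma coset_add:
  assumes "rsubmodule A M P" "x \<in> carrier M" "y \<in> carrier M"
  shows "set_add M (P +>\<^bsub>M\<^esub> x) (P +>\<^bsub>M\<^esub> y) = P +>\<^bsub>M\<^esub> (x \<oplus>\<^bsub>M\<^esub> y)"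
  by (rule abelian_subgroup.a_rcos_sum[OF rsubmodule_abelian_subgroup]) fact+

lemma coset_mono:
  assumes "rsubmodule A M P" "rsubmodule A M R" "P \<subseteq> R" "x \<in> carrier M" "y \<in> carrier M"
    "P +>\<^bsub>M\<^esub> x = P +>\<^bsub>M\<^esub> y"
  shows "R +>\<^bsub>M\<^esub> x = R +>\<^bsub>M\<^esub> y"
  using assms coset_eq_iff by blast

lemma coset_act:
  assumes "rsubmodule A M P" "x \<in> carrier M" "y \<in> carrier M" "a \<in> carrier A"
    "P +>\<^bsub>M\<^esub> x = P +>\<^bsub>M\<^esub> y"
  shows "P +>\<^bsub>M\<^esub> (a \<odot>\<^bsub>M\<^esub> x) = P +>\<^bsub>M\<^esub> (a \<odot>\<^bsub>M\<^esub> y)"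
proof -
  have "x \<ominus>\<^bsub>M\<^esub> y \<in> P" using assms coset_eq_iff by blast
  then have "a \<odot>\<^bsub>M\<^esub> x \<ominus>\<^bsub>M\<^esub> a \<odot>\<^bsub>M\<^esub> y \<in> P"
    using rsubmoduleD(4)[OF assms(1,4)] act_minus[OF assms(4,2,3)] by metis
  then show ?thesis using assms coset_eq_iff[OF assms(1)] act_closed by simp
qed

lemma coset_absorb:
  assumes "rsubmodule A M P" "x \<in> carrier M" "p \<in> P"
  shows "P +>\<^bsub>M\<^esub> (x \<oplus>\<^bsub>M\<^esub> p) = P +>\<^bsub>M\<^esub> x"
proof -
  have p: "p \<in> carrier M" using assms rsubmoduleD(1) by blast
  have "(x \<oplus>\<^bsub>M\<^esub> p) \<ominus>\<^bsub>M\<^esub> x = p"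
    using assms(2) p by (simp add: M.minus_eq_add M.a_comm[of x p] M.a_assoc M.r_neg)
  then show ?thesis using assms p by (subst coset_eq_iff) auto
qed

text \<open>Evaluates \<open>quotient_module\<close> on cosets taken in \<open>M\<close> itself. The
  union defining its scalar action runs over cosets that all coincide, because acting on congruent
  elements gives congruent elements.\<close>

lemma subquotient_simps:
  assumes P: "rsubmodule A M P" and Q: "rsubmodule A M Q" and "P \<subseteq> Q"
  defines "F \<equiv> quotient_module (M\<lparr>carrier := Q\<rparr>) P"
  shows "carrier F = (\<lambda>x. P +>\<^bsub>M\<^esub> x) ` Q" "\<zero>\<^bsub>F\<^esub> = P"
    and "\<And>x y. x \<in> Q \<Longrightarrow> y \<in> Q \<Longrightarrow> (P +>\<^bsub>M\<^esub> x) \<oplus>\<^bsub>F\<^esub> (P +>\<^bsub>M\<^esub> y) = P +>\<^bsub>M\<^esub> (x \<oplus>\<^bsub>M\<^esub> y)"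
    and "\<And>a x. a \<in> carrier A \<Longrightarrow> x \<in> Q \<Longrightarrow> a \<odot>\<^bsub>F\<^esub> (P +>\<^bsub>M\<^esub> x) = P +>\<^bsub>M\<^esub> (a \<odot>\<^bsub>M\<^esub> x)"
proof -
  have coset: "a_r_coset (M\<lparr>carrier := Q\<rparr>) = a_r_coset M"
    by (auto simp: a_r_coset_def r_coset_def fun_eq_iff)
  have set_add: "set_add (M\<lparr>carrier := Q\<rparr>) = set_add M"
    by (auto simp: set_add_def set_mult_def fun_eq_iff)
  note D = rsubmoduleD[OF P] rsubmoduleD[OF Q]
  show "carrier F = (\<lambda>x. P +>\<^bsub>M\<^esub> x) ` Q"
    by (auto simp: F_def quotient_module_def A_RCOSETS_def RCOSETS_def a_r_coset_def r_coset_def)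
  show "\<zero>\<^bsub>F\<^esub> = P" by (simp add: F_def quotient_module_def)
  show "(P +>\<^bsub>M\<^esub> x) \<oplus>\<^bsub>F\<^esub> (P +>\<^bsub>M\<^esub> y) = P +>\<^bsub>M\<^esub> (x \<oplus>\<^bsub>M\<^esub> y)" if "x \<in> Q" "y \<in> Q" for x y
    using that D by (simp add: F_def quotient_module_def set_add coset_add[OF P] subset_eq)
  show "a \<odot>\<^bsub>F\<^esub> (P +>\<^bsub>M\<^esub> x) = P +>\<^bsub>M\<^esub> (a \<odot>\<^bsub>M\<^esub> x)" if a: "a \<in> carrier A" and x: "x \<in> Q" for a x
  proof -
    interpret P: abelian_subgroup P M by (rule rsubmodule_abelian_subgroup) fact
    have xM: "x \<in> carrier M" using x D by auto
    have const: "P +>\<^bsub>M\<^esub> (a \<odot>\<^bsub>M\<^esub> y) = P +>\<^bsub>M\<^esub> (a \<odot>\<^bsub>M\<^esub> x)" if y: "y \<in> P +>\<^bsub>M\<^esub> x" for y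
      using P.a_elemrcos_carrier[OF xM y] P.a_repr_independence'[OF y xM] coset_act[OF P _ xM a]
      by metis
    have "x \<in> P +>\<^bsub>M\<^esub> x" by (rule P.a_rcos_self[OF xM])
    then have "P +>\<^bsub>M\<^esub> x \<noteq> {}" by blast
    have "a \<odot>\<^bsub>F\<^esub> (P +>\<^bsub>M\<^esub> x) = (\<Union>y\<in>P +>\<^bsub>M\<^esub> x. P +>\<^bsub>M\<^esub> (a \<odot>\<^bsub>M\<^esub> y))"
      by (simp add: F_def quotient_module_def coset)
    also have "\<dots> = P +>\<^bsub>M\<^esub> (a \<odot>\<^bsub>M\<^esub> x)"
      by (rule SUP_eq_const) fact+
    finally show ?thesis .
  qed
qed

lemma subquotient_right_module:
  assumes P: "rsubmodule A M P" and Q: "rsubmodule A M Q" and PQ: "P \<subseteq> Q"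
  shows "right_module A (quotient_module (M\<lparr>carrier := Q\<rparr>) P)"
proof -
  let ?F = "quotient_module (M\<lparr>carrier := Q\<rparr>) P"
  note S = subquotient_simps[OF assms]
  note D = rsubmoduleD[OF Q]
  have QM: "x \<in> carrier M" if "x \<in> Q" for x using that D(1) by blast
  have zero: "\<zero>\<^bsub>?F\<^esub> = P +>\<^bsub>M\<^esub> \<zero>\<^bsub>M\<^esub>"
    using S(2) coset_eq_self_iff[OF P M.zero_closed] rsubmoduleD(2)[OF P] by simp
  have "abelian_group ?F"
  proof (rule abelian_groupI)
    show "\<exists>y\<in>carrier ?F. y \<oplus>\<^bsub>?F\<^esub> x = \<zero>\<^bsub>?F\<^esub>" if "x \<in> carrier ?F" for x
    proof -
      obtain u where u: "u \<in> Q" "x = P +>\<^bsub>M\<^esub> u" using \<open>x \<in> carrier ?F\<close> S by auto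
      then show ?thesis
        using D(5)[OF u(1)] S(3)[OF D(5)[OF u(1)] u(1)] QM[OF u(1)]
        by (intro bexI[of _ "P +>\<^bsub>M\<^esub> \<ominus>\<^bsub>M\<^esub> u"]) (simp_all add: S(1) zero M.l_neg)
    qed
  qed (use D in \<open>auto simp: S(1,3) zero M.a_ac QM\<close>)
  then show ?thesis
    unfolding right_module_def right_module_axioms_def
    using A.ring_axioms D
    by (auto simp: S(1,3,4) act_distr_ring act_distr_module act_mult act_one QM)
qed

end

section \<open>Homomorphisms between filtered modules\<close>

lemma module_homD:
  assumes "f \<in> module_hom A X Y"
  shows "\<And>x. x \<in> carrier X \<Longrightarrow> f x \<in> carrier Y"
    "\<And>x y. x \<in> carrier X \<Longrightarrow> y \<in> carrier X \<Longrightarrow> f (x \<oplus>\<^bsub>X\<^esub> y) = f x \<oplus>\<^bsub>Y\<^esub> f y"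
    "\<And>a x. a \<in> carrier A \<Longrightarrow> x \<in> carrier X \<Longrightarrow> f (a \<odot>\<^bsub>X\<^esub> x) = a \<odot>\<^bsub>Y\<^esub> f x"
  using assms by (auto simp: module_hom_def)

lemma module_homI:
  assumes "\<And>x. x \<in> carrier X \<Longrightarrow> f x \<in> carrier Y"
    "\<And>x y. x \<in> carrier X \<Longrightarrow> y \<in> carrier X \<Longrightarrow> f (x \<oplus>\<^bsub>X\<^esub> y) = f x \<oplus>\<^bsub>Y\<^esub> f y"
    "\<And>a x. a \<in> carrier A \<Longrightarrow> x \<in> carrier X \<Longrightarrow> f (a \<odot>\<^bsub>X\<^esub> x) = a \<odot>\<^bsub>Y\<^esub> f x"
  shows "f \<in> module_hom A X Y"
  using assms by (auto simp: module_hom_def)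

lemma module_hom_zero:
  assumes "right_module A X" "right_module A Y" "f \<in> module_hom A X Y"
  shows "f \<zero>\<^bsub>X\<^esub> = \<zero>\<^bsub>Y\<^esub>"
proof -
  interpret X: right_module A X by fact
  interpret Y: right_module A Y by fact
  note f = module_homD[OF assms(3)]
  have "f \<zero>\<^bsub>X\<^esub> \<oplus>\<^bsub>Y\<^esub> f \<zero>\<^bsub>X\<^esub> = f \<zero>\<^bsub>X\<^esub>"
    using f(2)[OF X.M.zero_closed X.M.zero_closed] by simp
  then show ?thesis using f(1)[OF X.M.zero_closed] by (simp add: Y.M.add.l_cancel_one)
qed

text \<open>Homomorphisms into a quotient \<open>Y / R\<close> are represented by functions into \<open>Y\<close>.\<close>

definition hom_mod ::
    "('k, 'a) module \<Rightarrow> ('a, 'm) module \<Rightarrow> 'm set \<Rightarrow> ('a, 'n) module \<Rightarrow> 'n set \<Rightarrow> ('m \<Rightarrow> 'n) \<Rightarrow> bool" where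
  "hom_mod A X Q Y R f \<longleftrightarrow> (\<forall>x\<in>Q. f x \<in> carrier Y) \<and>
    (\<forall>x\<in>Q. \<forall>y\<in>Q. R +>\<^bsub>Y\<^esub> f (x \<oplus>\<^bsub>X\<^esub> y) = R +>\<^bsub>Y\<^esub> (f x \<oplus>\<^bsub>Y\<^esub> f y)) \<and>
    (\<forall>a\<in>carrier A. \<forall>x\<in>Q. R +>\<^bsub>Y\<^esub> f (a \<odot>\<^bsub>X\<^esub> x) = R +>\<^bsub>Y\<^esub> (a \<odot>\<^bsub>Y\<^esub> f x))"

lemma hom_modD:
  assumes "hom_mod A X Q Y R f"
  shows "\<And>x. x \<in> Q \<Longrightarrow> f x \<in> carrier Y"
    "\<And>x y. x \<in> Q \<Longrightarrow> y \<in> Q \<Longrightarrow> R +>\<^bsub>Y\<^esub> f (x \<oplus>\<^bsub>X\<^esub> y) = R +>\<^bsub>Y\<^esub> (f x \<oplus>\<^bsub>Y\<^esub> f y)"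
    "\<And>a x. a \<in> carrier A \<Longrightarrow> x \<in> Q \<Longrightarrow> R +>\<^bsub>Y\<^esub> f (a \<odot>\<^bsub>X\<^esub> x) = R +>\<^bsub>Y\<^esub> (a \<odot>\<^bsub>Y\<^esub> f x)"
  using assms by (auto simp: hom_mod_def)

lemma hom_mod_mono:
  assumes X: "right_module A X" and Y: "right_module A Y"
    and "rsubmodule A Y R" "rsubmodule A Y S" "R \<subseteq> S" "rsubmodule A X Q" "Q' \<subseteq> Q"
    and f: "hom_mod A X Q Y R f"
  shows "hom_mod A X Q' Y S f"
proof -
  interpret X: right_module A X by fact
  interpret Y: right_module A Y by fact
  note Q = X.rsubmoduleD[OF assms(6)] and f = hom_modD[OF f]
  have Q': "x \<in> Q" if "x \<in> Q'" for x using assms(7) that by blast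
  show ?thesis
    unfolding hom_mod_def
  proof (intro conjI ballI)
    fix x y assume "x \<in> Q'" "y \<in> Q'"
    then show "S +>\<^bsub>Y\<^esub> f (x \<oplus>\<^bsub>X\<^esub> y) = S +>\<^bsub>Y\<^esub> (f x \<oplus>\<^bsub>Y\<^esub> f y)"
      using f Q(3) by (intro Y.coset_mono[OF assms(3,4,5)] Y.M.a_closed) (simp_all add: Q')
  next
    fix a x assume "a \<in> carrier A" "x \<in> Q'"
    then show "S +>\<^bsub>Y\<^esub> f (a \<odot>\<^bsub>X\<^esub> x) = S +>\<^bsub>Y\<^esub> (a \<odot>\<^bsub>Y\<^esub> f x)"
      using f Q(4) by (intro Y.coset_mono[OF assms(3,4,5)] Y.act_closed) (simp_all add: Q')
  qed (use f Q' in auto)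
qed

text \<open>Since \<open>f\<close> is additive and equivariant modulo R and maps P into R, it
  induces a homomorphism Q / P \<rightarrow> S / R, which is zero by assumption.\<close>

lemma hom_zero_subquotients:
  assumes X: "right_module A X" and Y: "right_module A Y"
    and P: "rsubmodule A X P" and Q: "rsubmodule A X Q" "P \<subseteq> Q"
    and R: "rsubmodule A Y R" and S: "rsubmodule A Y S" "R \<subseteq> S"
    and zero: "hom_zero A (quotient_module (X\<lparr>carrier := Q\<rparr>) P) (quotient_module (Y\<lparr>carrier := S\<rparr>) R)"
    and f: "hom_mod A X Q Y R f" "\<And>x. x \<in> Q \<Longrightarrow> f x \<in> S" "\<And>x. x \<in> P \<Longrightarrow> f x \<in> R"
    and x: "x \<in> Q"
  shows "f x \<in> R"
proof -
  interpret X: right_module A X by fact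
  interpret Y: right_module A Y by fact
  let ?F = "quotient_module (X\<lparr>carrier := Q\<rparr>) P" and ?G = "quotient_module (Y\<lparr>carrier := S\<rparr>) R"
  note F = X.subquotient_simps[OF P Q] and G = Y.subquotient_simps[OF R S]
  note DP = X.rsubmoduleD[OF P] and DQ = X.rsubmoduleD[OF Q(1)] and DR = Y.rsubmoduleD[OF R]
    and DS = Y.rsubmoduleD[OF S(1)]
  have fY: "f x \<in> carrier Y" if "x \<in> Q" for x using f(2) DS that by auto
  have QX: "x \<in> carrier X" if "x \<in> Q" for x using DQ that by auto
  have congr: "R +>\<^bsub>Y\<^esub> f x = R +>\<^bsub>Y\<^esub> f y" if xy: "x \<in> Q" "y \<in> Q" "P +>\<^bsub>X\<^esub> x = P +>\<^bsub>X\<^esub> y" for x y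
  proof -
    define p where "p = x \<ominus>\<^bsub>X\<^esub> y"
    have p: "p \<in> P" using X.coset_eq_iff[OF P] xy QX by (simp add: p_def)
    then have pQ: "p \<in> Q" using Q by auto
    have "x = y \<oplus>\<^bsub>X\<^esub> p"
      using xy QX by (simp add: p_def X.M.minus_eq_add X.M.a_lcomm X.M.r_neg)
    then have "R +>\<^bsub>Y\<^esub> f x = R +>\<^bsub>Y\<^esub> (f y \<oplus>\<^bsub>Y\<^esub> f p)"
      using hom_modD(2)[OF f(1) xy(2) pQ] by simp
    also have "\<dots> = R +>\<^bsub>Y\<^esub> f y" by (rule Y.coset_absorb[OF R fY[OF xy(2)] f(3)[OF p]])
    finally show ?thesis .
  qed
  \<comment> \<open>The induced map, through a chosen representative of each coset;
    \<open>congr\<close> shows that the choice is immaterial.\<close>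
  define g where "g C = R +>\<^bsub>Y\<^esub> f (SOME x. x \<in> Q \<and> C = P +>\<^bsub>X\<^esub> x)" for C
  have g: "g (P +>\<^bsub>X\<^esub> x) = R +>\<^bsub>Y\<^esub> f x" if "x \<in> Q" for x
  proof -
    let ?x = "SOME x'. x' \<in> Q \<and> P +>\<^bsub>X\<^esub> x = P +>\<^bsub>X\<^esub> x'"
    have "?x \<in> Q \<and> P +>\<^bsub>X\<^esub> x = P +>\<^bsub>X\<^esub> ?x" by (rule someI[of _ x]) (use that in auto)
    then show ?thesis unfolding g_def using congr[OF that] by metis
  qed
  have "g \<in> module_hom A ?F ?G"
  proof (rule module_homI)
    fix C assume "C \<in> carrier ?F"
    then obtain x where x: "x \<in> Q" "C = P +>\<^bsub>X\<^esub> x" using F(1) by auto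
    then show "g C \<in> carrier ?G" using g f(2) G(1) by simp
    fix a assume a: "a \<in> carrier A"
    show "g (a \<odot>\<^bsub>?F\<^esub> C) = a \<odot>\<^bsub>?G\<^esub> g C"
      using x a F(4) G(4)[OF a f(2)] g DQ(4) hom_modD(3)[OF f(1)] by simp
  next
    fix C D assume "C \<in> carrier ?F" "D \<in> carrier ?F"
    then obtain x y where x: "x \<in> Q" "C = P +>\<^bsub>X\<^esub> x" and y: "y \<in> Q" "D = P +>\<^bsub>X\<^esub> y" using F(1) by auto
    then show "g (C \<oplus>\<^bsub>?F\<^esub> D) = g C \<oplus>\<^bsub>?G\<^esub> g D"
      using F(3) G(3)[OF f(2) f(2)] g DQ(3) hom_modD(2)[OF f(1)] by simp
  qed
  then have "g (P +>\<^bsub>X\<^esub> x) = R"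
    using zero x F(1) G(2) by (auto simp: hom_zero_def)
  then show ?thesis using g[OF x] Y.coset_eq_self_iff[OF R fY[OF x]] by simp
qed

text \<open>A double induction: upwards along \<open>Xs\<close>, and for each of its steps downwards
  along \<open>Ys\<close>, one pair of factors at a time. The chain \<open>Ys\<close> need not begin
  at zero; its bottom is the submodule modulo which \<open>f\<close> is a homomorphism, so the lemma
  covers maps into a quotient of Y.\<close>

lemma hom_zero_filtrations:
  assumes X: "right_module A X" and Y: "right_module A Y"
    and Xs: "filtration A X Xs"
    and Ys: "Ys \<noteq> []" "last Ys = carrier Y" "\<And>N. N \<in> set Ys \<Longrightarrow> rsubmodule A Y N" "sorted_wrt (\<subseteq>) Ys"
    and zero: "\<And>k l. k < length Xs - 1 \<Longrightarrow> l < length Ys - 1 \<Longrightarrow> hom_zero A (factor X Xs k) (factor Y Ys l)"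
    and f: "hom_mod A X (carrier X) Y (Ys ! 0) f"
    and x: "x \<in> carrier X"
  shows "f x \<in> Ys ! 0"
proof -
  interpret X: right_module A X by fact
  interpret Y: right_module A Y by fact
  have sub: "rsubmodule A X (Xs ! k)" if "k < length Xs" for k
    using Xs that by (auto simp: filtration_def)
  have subY: "rsubmodule A Y (Ys ! l)" if "l < length Ys" for l using Ys that by auto
  have Y0: "0 < length Ys" and X0: "0 < length Xs" using Ys Xs by (auto simp: filtration_def)
  have mono: "Ys ! 0 \<subseteq> Ys ! l" if "l < length Ys" for l
    using sorted_wrt_nth_less[OF Ys(4), of 0 l] that by (cases l) auto
  have "\<forall>x\<in>Xs ! k. f x \<in> Ys ! 0" if "k < length Xs" for k
    using that
  proof (induction k)
    case 0
    have "Xs ! 0 = {\<zero>\<^bsub>X\<^esub>}" using Xs by (auto simp: filtration_def hd_conv_nth)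
    moreover have "f \<zero>\<^bsub>X\<^esub> \<in> Ys ! 0"
    proof -
      have c: "f \<zero>\<^bsub>X\<^esub> \<in> carrier Y" using hom_modD(1)[OF f] by simp
      have "Ys ! 0 +>\<^bsub>Y\<^esub> f \<zero>\<^bsub>X\<^esub> = Ys ! 0 +>\<^bsub>Y\<^esub> (f \<zero>\<^bsub>X\<^esub> \<oplus>\<^bsub>Y\<^esub> f \<zero>\<^bsub>X\<^esub>)"
        using hom_modD(2)[OF f X.M.zero_closed X.M.zero_closed] by simp
      then have "f \<zero>\<^bsub>X\<^esub> \<ominus>\<^bsub>Y\<^esub> (f \<zero>\<^bsub>X\<^esub> \<oplus>\<^bsub>Y\<^esub> f \<zero>\<^bsub>X\<^esub>) \<in> Ys ! 0"
        using Y.coset_eq_iff[OF subY[OF Y0]] c by simp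
      then have "\<ominus>\<^bsub>Y\<^esub> f \<zero>\<^bsub>X\<^esub> \<in> Ys ! 0"
        using c by (simp add: Y.M.minus_eq_add Y.M.minus_add Y.M.a_assoc[symmetric] Y.M.r_neg)
      then show ?thesis using Y.rsubmoduleD(5)[OF subY[OF Y0], of "\<ominus>\<^bsub>Y\<^esub> f \<zero>\<^bsub>X\<^esub>"] c by simp
    qed
    ultimately show ?case by simp
  next
    case (Suc k)
    have k: "k < length Xs - 1" using Suc.prems by simp
    have IH: "\<forall>x\<in>Xs ! k. f x \<in> Ys ! 0" using Suc by simp
    note prems = Suc.prems
    have incl: "Xs ! k \<subseteq> Xs ! Suc k"
      using Xs Suc.prems sorted_wrt_nth_less[of "(\<subseteq>)" Xs k "Suc k"] by (auto simp: filtration_def)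
    \<comment> \<open>The inner induction starts at the top, where \<open>Ys\<close> is all of Y,
      and descends. Truncated subtraction keeps the index at 0 once the bottom is reached.\<close>
    have "\<forall>x\<in>Xs ! Suc k. f x \<in> Ys ! (length Ys - 1 - j)" for j
    proof (induction j)
      case 0
      have "Ys ! (length Ys - 1) = carrier Y" using Ys last_conv_nth by metis
      then show ?case
        using hom_modD(1)[OF f] X.rsubmoduleD(1)[OF sub[OF Suc.prems]] by auto
    next
      case (Suc j)
      show ?case
      proof (cases "Suc j \<le> length Ys - 1")
        case False
        then have "length Ys - 1 - Suc j = length Ys - 1 - j" by simp
        then show ?thesis using Suc.IH by simp
      next
        case True
        define l where "l = length Ys - 1 - Suc j"
        have l: "length Ys - 1 - j = Suc l" "l < length Ys - 1" using True by (auto simp: l_def)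
        have inclY: "Ys ! l \<subseteq> Ys ! Suc l"
          using sorted_wrt_nth_less[OF Ys(4), of l "Suc l"] l by simp
        have h: "hom_mod A X (Xs ! Suc k) Y (Ys ! l) f"
          by (rule hom_mod_mono[OF X Y subY subY mono X.rsubmodule_carrier _ f])
            (use l X.rsubmoduleD(1)[OF sub[OF prems]] in auto)
        show ?thesis
        proof
          fix x assume "x \<in> Xs ! Suc k"
          moreover have "k < length Xs" "Suc k < length Xs" "l < length Ys" "Suc l < length Ys"
            using k l by auto
          moreover have "f x \<in> Ys ! Suc l" if "x \<in> Xs ! Suc k" for x using Suc.IH l(1) that by simp
          moreover have "f x \<in> Ys ! l" if "x \<in> Xs ! k" for x using IH mono[of l] l(2) that less_imp_diff_less by fastforce
          ultimately show "f x \<in> Ys ! (length Ys - 1 - Suc j)"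
            unfolding l_def[symmetric]
            using hom_zero_subquotients[OF X Y sub[of k] sub[of "Suc k"] incl subY[of l] subY[of "Suc l"]
                inclY zero[OF k l(2), unfolded factor_def] h] by blast
        qed
      qed
    qed
    from this[of "length Ys - 1"] show ?case by simp
  qed
  from this[of "length Xs - 1"] X0 show ?thesis
    using x Xs by (auto simp: filtration_def last_conv_nth)
qed


lemma filtration_hom_mod_zero:
  assumes X: "right_module A X" and Y: "right_module A Y"
    and Xs: "filtration A X Xs" and Ys: "filtration A Y Ys"
    and zero: "\<And>k l. k < length Xs - 1 \<Longrightarrow> l < length Ys - 1 \<Longrightarrow> hom_zero A (factor X Xs k) (factor Y Ys l)"
  shows "hom_zero A X Y"
  unfolding hom_zero_def
proof (intro ballI)
  fix f x assume f: "f \<in> module_hom A X Y" and x: "x \<in> carrier X"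
  have "f x \<in> Ys ! 0"
  proof (rule hom_zero_filtrations[OF X Y Xs _ _ _ _ zero _ x])
    show "hom_mod A X (carrier X) Y (Ys ! 0) f"
      using module_homD[OF f] by (auto simp: hom_mod_def)
  qed (use Ys in \<open>auto simp: filtration_def\<close>)
  then show "f x = \<zero>\<^bsub>Y\<^esub>" using Ys by (auto simp: filtration_def hd_conv_nth)
qed

lemma hom_zero_iso:
  assumes X: "right_module A X" and Y: "right_module A Y" and B: "right_module A B" and C: "right_module A C"
    and iso: "modules_isomorphic A X B" "modules_isomorphic A Y C" and zero: "hom_zero A B C"
  shows "hom_zero A X Y"
  unfolding hom_zero_def
proof (intro ballI)
  interpret X: right_module A X by fact
  interpret Y: right_module A Y by fact
  obtain g h where g: "g \<in> module_hom A X B" "bij_betw g (carrier X) (carrier B)"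
    and h: "h \<in> module_hom A Y C" "bij_betw h (carrier Y) (carrier C)"
    using iso by (auto simp: modules_isomorphic_def)
  note gD = module_homD[OF g(1)] and hD = module_homD[OF h(1)]
  define g' where "g' = inv_into (carrier X) g"
  have g'X: "g' b \<in> carrier X" and gg': "g (g' b) = b" if "b \<in> carrier B" for b
    using that g(2) by (auto simp: g'_def bij_betw_def intro: inv_into_into f_inv_into_f)
  have g'g: "g' (g x) = x" if "x \<in> carrier X" for x
    using that g(2) by (simp add: g'_def bij_betw_inv_into_left)
  have g'_eq: "g' b = x" if "x \<in> carrier X" "g x = b" for b x using g'g that by blast
  fix f x assume f: "f \<in> module_hom A X Y" and x: "x \<in> carrier X"
  note fD = module_homD[OF f]
  have "(\<lambda>b. h (f (g' b))) \<in> module_hom A B C"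
  proof (rule module_homI)
    fix b c assume bc: "b \<in> carrier B" "c \<in> carrier B"
    then have "g' (b \<oplus>\<^bsub>B\<^esub> c) = g' b \<oplus>\<^bsub>X\<^esub> g' c"
      by (intro g'_eq) (simp_all add: g'X gD gg')
    then show "h (f (g' (b \<oplus>\<^bsub>B\<^esub> c))) = h (f (g' b)) \<oplus>\<^bsub>C\<^esub> h (f (g' c))"
      using bc by (simp add: g'X fD hD)
  next
    fix a b assume ab: "a \<in> carrier A" "b \<in> carrier B"
    then have "g' (a \<odot>\<^bsub>B\<^esub> b) = a \<odot>\<^bsub>X\<^esub> g' b"
      by (intro g'_eq) (simp_all add: g'X gD gg' X.act_closed)
    then show "h (f (g' (a \<odot>\<^bsub>B\<^esub> b))) = a \<odot>\<^bsub>C\<^esub> h (f (g' b))"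
      using ab by (simp add: g'X fD hD)
  qed (simp add: g'X fD hD)
  with zero have "\<forall>b\<in>carrier B. h (f (g' b)) = \<zero>\<^bsub>C\<^esub>" unfolding hom_zero_def by (rule bspec)
  then have "h (f (g' (g x))) = \<zero>\<^bsub>C\<^esub>" by (rule bspec) (rule gD(1)[OF x])
  then have "h (f x) = h \<zero>\<^bsub>Y\<^esub>" using g'g[OF x] module_hom_zero[OF Y C h(1)] by simp
  then show "f x = \<zero>\<^bsub>Y\<^esub>"
    using h(2) fD(1)[OF x] by (auto simp: bij_betw_def inj_on_def)
qed

lemma factor_right_module:
  assumes "right_module A X" "filtration A X Xs" "k < length Xs - 1"
  shows "right_module A (factor X Xs k)"
  unfolding factor_def
  using assms sorted_wrt_nth_less[of "(\<subseteq>)" Xs k "Suc k"]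
  by (intro right_module.subquotient_right_module) (auto simp: filtration_def)

text \<open>Every pair of factors is isomorphic to the pair (B, C), so the double induction over the
  two filtrations applies.\<close>

lemma hom_zero_Filt:
  assumes "right_module A B" "right_module A C" "X \<in> Filt K A B" "Y \<in> Filt K A C" "hom_zero A B C"
  shows "hom_zero A X Y"
proof -
  have X: "right_module A X" and Y: "right_module A Y"
    using assms(3,4) by (auto simp: Filt_def fd_right_module_def)
  obtain Xs Ys where Xs: "filtration A X Xs" "\<forall>i < length Xs - 1. modules_isomorphic A (factor X Xs i) B"
    and Ys: "filtration A Y Ys" "\<forall>i < length Ys - 1. modules_isomorphic A (factor Y Ys i) C"
    using assms(3,4) by (auto simp: Filt_def)
  show ?thesis
  proof (rule filtration_hom_mod_zero[OF X Y Xs(1) Ys(1)])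
    fix k l assume kl: "k < length Xs - 1" "l < length Ys - 1"
    show "hom_zero A (factor X Xs k) (factor Y Ys l)"
      by (rule hom_zero_iso[OF factor_right_module[OF X Xs(1) kl(1)] factor_right_module[OF Y Ys(1) kl(2)] assms(1,2) _ _ assms(5)])
        (use Xs Ys kl in auto)
  qed
qed

text \<open>\<open>Hom(U, M / U) = 0\<close>\<close>

definition hom_orthogonal :: "('k, 'a) module \<Rightarrow> ('a, 'm) module \<Rightarrow> 'm set \<Rightarrow> bool" where
  "hom_orthogonal A M U \<longleftrightarrow> rsubmodule A M U \<and> (\<forall>f. hom_mod A M U M U f \<longrightarrow> (\<forall>x\<in>U. f x \<in> U))"

text \<open>The chain up to U filters U and the chain from U on filters M / U. Every factor of the
  first part has a smaller index than every factor of the second, so the bricks, and with them the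
  factors, admit only zero maps.\<close>

lemma brick_chain_hom_orthogonal:
  fixes K :: "'k ring" and A :: "('k, 'a) module" and M :: "('a, 'm) module"
  assumes M: "right_module A M" and Ms: "brick_chain_filtration K A M Ms" and U: "U \<in> set Ms"
  shows "hom_orthogonal A M U"
proof -
  interpret M: right_module A M by fact
  obtain B :: "nat \<Rightarrow> ('k, 'a) coord_module" where fil: "filtration A M Ms"
    and B: "\<And>i. i < length Ms - 1 \<Longrightarrow> brick K A (B i) \<and> factor M Ms i \<in> Filt K A (B i)"
    and zero: "\<And>i j. j < length Ms - 1 \<Longrightarrow> i < j \<Longrightarrow> hom_zero A (B i) (B j)"
    using Ms unfolding brick_chain_filtration_def by blast
  obtain i where i: "i < length Ms" "U = Ms ! i" using U by (auto simp: in_set_conv_nth)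
  have subU: "rsubmodule A M U" using fil U by (auto simp: filtration_def)
  have zero': "hom_zero A (factor M Ms k) (factor M Ms l)" if "k < l" "l < length Ms - 1" for k l
  proof (rule hom_zero_Filt)
    have k: "k < length Ms - 1" using that by simp
    show "right_module A (B k)" "factor M Ms k \<in> Filt K A (B k)"
      using B[OF k] by (auto simp only: brick_def fd_right_module_def)
    show "right_module A (B l)" "factor M Ms l \<in> Filt K A (B l)"
      using B[OF that(2)] by (auto simp only: brick_def fd_right_module_def)
    show "hom_zero A (B k) (B l)" by (rule zero[OF that(2,1)])
  qed
  let ?X = "M\<lparr>carrier := U\<rparr>"
  have sorted: "sorted_wrt (\<subseteq>) Ms" and sub: "\<And>N. N \<in> set Ms \<Longrightarrow> rsubmodule A M N"
    and Ms0: "Ms \<noteq> []" "Ms ! 0 = {\<zero>\<^bsub>M\<^esub>}" "last Ms = carrier M"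
    using fil unfolding filtration_def by (blast, blast, blast, metis hd_conv_nth, blast)
  \<comment> \<open>The two halves overlap in U: \<open>take (Suc i)\<close> ends with it, and
    \<open>drop i\<close> begins with it instead of with zero, as
    \<open>hom_zero_filtrations\<close> permits.\<close>
  have "filtration A ?X (take (Suc i) Ms)"
    unfolding filtration_def
  proof (intro conjI ballI)
    show "last (take (Suc i) Ms) = carrier ?X"
      using i by (simp add: take_Suc_conv_app_nth)
    show "hd (take (Suc i) Ms) = {\<zero>\<^bsub>?X\<^esub>}" using Ms0 by (simp add: hd_conv_nth)
    show "sorted_wrt (\<subseteq>) (take (Suc i) Ms)" using sorted by (rule sorted_wrt_take)
    fix N assume N: "N \<in> set (take (Suc i) Ms)"
    then have "rsubmodule A M N" using sub in_set_takeD by fast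
    moreover obtain j where "j \<le> i" "N = Ms ! j"
      using N less_Suc_eq_le by (auto simp: in_set_conv_nth)
    then have "N \<subseteq> U" using sorted_wrt_nth_less[OF sorted, of j i] i by (cases "j = i") auto
    ultimately show "rsubmodule A ?X N" using M.rsubmodule_restrict[OF subU] by blast
  qed (use Ms0 in auto)
  moreover have "drop i Ms \<noteq> []" "last (drop i Ms) = carrier M" "drop i Ms ! 0 = U"
    using i Ms0 by simp_all
  moreover have "rsubmodule A M N" if "N \<in> set (drop i Ms)" for N
    by (rule sub[OF in_set_dropD[OF that]])
  moreover have "sorted_wrt (\<subseteq>) (drop i Ms)" by (rule sorted_wrt_drop[OF sorted])
  moreover have "hom_zero A (factor ?X (take (Suc i) Ms) k) (factor M (drop i Ms) l)"
    if "k < length (take (Suc i) Ms) - 1" "l < length (drop i Ms) - 1" for k l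
  proof -
    have "factor ?X (take (Suc i) Ms) k = factor M Ms k" "factor M (drop i Ms) l = factor M Ms (i + l)"
      using that i by (simp_all add: factor_def)
    then show ?thesis using zero'[of k "i + l"] that i by simp
  qed
  ultimately have main: "f x \<in> drop i Ms ! 0"
    if "hom_mod A ?X (carrier ?X) M (drop i Ms ! 0) f" "x \<in> carrier ?X" for f x
    using that by (intro hom_zero_filtrations[OF M.right_module_restrict[OF subU] M])
  have U: "drop i Ms ! 0 = U" using i by simp
  show ?thesis
    unfolding hom_orthogonal_def
    using main subU unfolding U by (auto simp: hom_mod_def)
qed

section \<open>Finite-dimensional modules\<close>

locale fd_module = FA: fd_algebra K A + RM: right_module A M
  for K :: "'k ring" and A :: "('k, 'a) module" and M :: "('a, 'm) module" +
  assumes fin_dim_module: "vectorspace.fin_dim K (scalar_restriction A M)"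
begin

definition sc :: "'k \<Rightarrow> 'm \<Rightarrow> 'm" where
  "sc c x = (c \<odot>\<^bsub>A\<^esub> \<one>\<^bsub>A\<^esub>) \<odot>\<^bsub>M\<^esub> x"

lemma scalar_vectorspace: "vectorspace K (scalar_restriction A M)"
  by (rule scalar_restriction_vectorspace) unfold_locales

lemma scalar_in_algebra: "c \<in> carrier K \<Longrightarrow> c \<odot>\<^bsub>A\<^esub> \<one>\<^bsub>A\<^esub> \<in> carrier A"
  by simp

lemma sc_closed [simp]: "c \<in> carrier K \<Longrightarrow> x \<in> carrier M \<Longrightarrow> sc c x \<in> carrier M"
  unfolding sc_def by (intro RM.act_closed scalar_in_algebra)

lemma sc_l_distr:
  "c \<in> carrier K \<Longrightarrow> d \<in> carrier K \<Longrightarrow> x \<in> carrier M \<Longrightarrow> sc (c \<oplus>\<^bsub>K\<^esub> d) x = sc c x \<oplus>\<^bsub>M\<^esub> sc d x"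
  using module.smult_l_distr[OF vectorspace.axioms(1)[OF scalar_vectorspace]]
  by (simp add: scalar_restriction_def sc_def)

lemma sc_r_distr:
  "c \<in> carrier K \<Longrightarrow> x \<in> carrier M \<Longrightarrow> y \<in> carrier M \<Longrightarrow> sc c (x \<oplus>\<^bsub>M\<^esub> y) = sc c x \<oplus>\<^bsub>M\<^esub> sc c y"
  unfolding sc_def by (intro RM.act_distr_module scalar_in_algebra)

lemma sc_assoc:
  "c \<in> carrier K \<Longrightarrow> d \<in> carrier K \<Longrightarrow> x \<in> carrier M \<Longrightarrow> sc (c \<otimes>\<^bsub>K\<^esub> d) x = sc c (sc d x)"
  using module.smult_assoc1[OF vectorspace.axioms(1)[OF scalar_vectorspace]]
  by (simp add: scalar_restriction_def sc_def)

lemma sc_one [simp]: "x \<in> carrier M \<Longrightarrow> sc \<one>\<^bsub>K\<^esub> x = x"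
  using module.smult_one[OF vectorspace.axioms(1)[OF scalar_vectorspace]]
  by (simp add: scalar_restriction_def sc_def)

lemma sc_zero [simp]: "x \<in> carrier M \<Longrightarrow> sc \<zero>\<^bsub>K\<^esub> x = \<zero>\<^bsub>M\<^esub>"
  using module.smult_l_null[OF vectorspace.axioms(1)[OF scalar_vectorspace]]
  by (simp add: scalar_restriction_def sc_def)

lemma sc_zero_right [simp]: "c \<in> carrier K \<Longrightarrow> sc c \<zero>\<^bsub>M\<^esub> = \<zero>\<^bsub>M\<^esub>"
  unfolding sc_def by (intro RM.act_zero scalar_in_algebra)

lemma sc_act:
  assumes "c \<in> carrier K" "a \<in> carrier A" "x \<in> carrier M"
  shows "sc c (a \<odot>\<^bsub>M\<^esub> x) = a \<odot>\<^bsub>M\<^esub> sc c x"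
proof -
  have "a \<otimes>\<^bsub>A\<^esub> (c \<odot>\<^bsub>A\<^esub> \<one>\<^bsub>A\<^esub>) = (c \<odot>\<^bsub>A\<^esub> \<one>\<^bsub>A\<^esub>) \<otimes>\<^bsub>A\<^esub> a"
    using assms FA.smult_mult_left[of c "\<one>\<^bsub>A\<^esub>" a] FA.smult_mult_right[of c a "\<one>\<^bsub>A\<^esub>"] by simp
  then show ?thesis
    unfolding sc_def using assms scalar_in_algebra RM.act_mult by metis
qed

lemma sc_rsubmodule: "rsubmodule A M N \<Longrightarrow> c \<in> carrier K \<Longrightarrow> x \<in> N \<Longrightarrow> sc c x \<in> N"
  unfolding sc_def by (rule RM.rsubmoduleD(4)) (auto intro: scalar_in_algebra)

lemma sc_inverse:
  assumes "c \<in> carrier K" "c \<noteq> \<zero>\<^bsub>K\<^esub>" "x \<in> carrier M"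
  shows "inv\<^bsub>K\<^esub> c \<in> carrier K" "sc (inv\<^bsub>K\<^esub> c) (sc c x) = x"
proof -
  have "c \<in> Units K" using assms FA.field_Units by auto
  then show "inv\<^bsub>K\<^esub> c \<in> carrier K" by (rule FA.module.R.Units_inv_closed)
  then show "sc (inv\<^bsub>K\<^esub> c) (sc c x) = x"
    using assms \<open>c \<in> Units K\<close> sc_assoc[of "inv\<^bsub>K\<^esub> c" c x] FA.module.R.Units_l_inv by simp
qed

definition lin_subspace :: "'m set \<Rightarrow> bool" where
  "lin_subspace D \<longleftrightarrow> D \<subseteq> carrier M \<and> \<zero>\<^bsub>M\<^esub> \<in> D \<and> (\<forall>x\<in>D. \<forall>y\<in>D. x \<oplus>\<^bsub>M\<^esub> y \<in> D) \<and>
    (\<forall>c\<in>carrier K. \<forall>x\<in>D. sc c x \<in> D)"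

text \<open>Spanning is phrased through subspaces: to show that an algebra element kills M, it then
  suffices that its kernel, a subspace, contains \<open>G\<close>.\<close>

lemma finite_generators:
  obtains G where "finite G" "G \<subseteq> carrier M" "\<And>D. lin_subspace D \<Longrightarrow> G \<subseteq> D \<Longrightarrow> D = carrier M"
proof -
  interpret V: vectorspace K "scalar_restriction A M" by (rule scalar_vectorspace)
  have carrier: "carrier (scalar_restriction A M) = carrier M" by (simp add: scalar_restriction_def)
  obtain G where G: "finite G" "G \<subseteq> carrier M" "V.span G = carrier M"
    using fin_dim_module unfolding V.fin_dim_def carrier by blast
  have "D = carrier M" if D: "lin_subspace D" "G \<subseteq> D" for D
  proof -
    have "LinearCombinations.submodule K D (scalar_restriction A M)"
      using D V.module_axioms
      by (auto simp: LinearCombinations.submodule_def lin_subspace_def sc_def scalar_restriction_def)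
    then have "V.span G \<subseteq> D" by (rule V.span_is_subset[OF D(2)])
    then show ?thesis using G(3) D(1) by (auto simp: lin_subspace_def)
  qed
  with G that show ?thesis by blast
qed

text \<open>One vector \<open>x\<close> is removed from a spanning set of least size. The rest
  \<open>G\<close> no longer spans, which gives \<open>D0\<close>, but \<open>x\<close> together
  with any subspace containing \<open>G\<close> does. An algebra element that kills \<open>G\<close>
  and fixes \<open>x\<close> will therefore have rank one.\<close>

lemma complemented_line:
  assumes "carrier M \<noteq> {\<zero>\<^bsub>M\<^esub>}"
  obtains x G D0 where "x \<in> carrier M" "finite G" "G \<subseteq> carrier M"
    "lin_subspace D0" "G \<subseteq> D0" "x \<notin> D0"
    "\<And>D y. lin_subspace D \<Longrightarrow> G \<subseteq> D \<Longrightarrow> y \<in> carrier M \<Longrightarrow> \<exists>c\<in>carrier K. \<exists>d\<in>D. y = sc c x \<oplus>\<^bsub>M\<^esub> d"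
proof -
  define gen where "gen G \<longleftrightarrow> finite G \<and> G \<subseteq> carrier M \<and> (\<forall>D. lin_subspace D \<longrightarrow> G \<subseteq> D \<longrightarrow> D = carrier M)" for G
  have "\<exists>G. gen G" by (rule finite_generators) (auto simp: gen_def)
  then obtain G where G: "gen G" "\<And>H. gen H \<Longrightarrow> card G \<le> card H"
    using ex_has_least_nat[of gen _ card] by blast
  have fin: "finite G" "G \<subseteq> carrier M" using G(1) by (auto simp: gen_def)
  have "lin_subspace {\<zero>\<^bsub>M\<^esub>}" by (auto simp: lin_subspace_def)
  with G(1) assms have "G \<noteq> {}" unfolding gen_def by blast
  then obtain x where x: "x \<in> G" by blast
  then have "card (G - {x}) < card G" using fin by (metis card_Diff1_less)
  then have "\<not> gen (G - {x})" using G(2) not_le by blast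
  then obtain D0 where D0: "lin_subspace D0" "G - {x} \<subseteq> D0" "D0 \<noteq> carrier M"
    using fin unfolding gen_def by blast
  have "x \<notin> D0" using D0 G(1) unfolding gen_def by blast
  have xM: "x \<in> carrier M" using x fin by blast
  have "\<exists>c\<in>carrier K. \<exists>d\<in>D. y = sc c x \<oplus>\<^bsub>M\<^esub> d"
    if D: "lin_subspace D" "G - {x} \<subseteq> D" and y: "y \<in> carrier M" for D y
  proof -
    define E where "E = {sc c x \<oplus>\<^bsub>M\<^esub> d | c d. c \<in> carrier K \<and> d \<in> D}"
    have DM: "d \<in> carrier M" if "d \<in> D" for d using D that by (auto simp: lin_subspace_def)
    have E: "sc c x \<oplus>\<^bsub>M\<^esub> d \<in> E" if "c \<in> carrier K" "d \<in> D" for c d using that by (auto simp: E_def)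
    have D1: "\<zero>\<^bsub>M\<^esub> \<in> D" "\<And>d e. d \<in> D \<Longrightarrow> e \<in> D \<Longrightarrow> d \<oplus>\<^bsub>M\<^esub> e \<in> D"
      "\<And>c d. c \<in> carrier K \<Longrightarrow> d \<in> D \<Longrightarrow> sc c d \<in> D" using D by (auto simp: lin_subspace_def)
    have DE: "d \<in> E" if "d \<in> D" for d
      using E[of "\<zero>\<^bsub>K\<^esub>" d] that xM DM by simp
    have "lin_subspace E"
      unfolding lin_subspace_def
    proof (intro conjI ballI)
      show "E \<subseteq> carrier M" using xM DM by (auto simp: E_def)
      show "\<zero>\<^bsub>M\<^esub> \<in> E" using D1(1) by (rule DE)
    next
      fix u v assume "u \<in> E" "v \<in> E"
      then obtain c d c' d' where u: "u = sc c x \<oplus>\<^bsub>M\<^esub> d" "c \<in> carrier K" "d \<in> D"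
        and v: "v = sc c' x \<oplus>\<^bsub>M\<^esub> d'" "c' \<in> carrier K" "d' \<in> D" unfolding E_def by blast
      have "u \<oplus>\<^bsub>M\<^esub> v = sc (c \<oplus>\<^bsub>K\<^esub> c') x \<oplus>\<^bsub>M\<^esub> (d \<oplus>\<^bsub>M\<^esub> d')"
        using u v xM DM by (simp add: sc_l_distr RM.M.a_ac)
      then show "u \<oplus>\<^bsub>M\<^esub> v \<in> E" using u v D1 by (simp add: E)
    next
      fix k u assume k: "k \<in> carrier K" and "u \<in> E"
      then obtain c d where u: "u = sc c x \<oplus>\<^bsub>M\<^esub> d" "c \<in> carrier K" "d \<in> D" unfolding E_def by blast
      have "sc k u = sc (k \<otimes>\<^bsub>K\<^esub> c) x \<oplus>\<^bsub>M\<^esub> sc k d"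
        using u k xM DM by (simp add: sc_assoc sc_r_distr)
      then show "sc k u \<in> E" using u k D1 by (simp add: E)
    qed
    moreover have "x \<in> E" using E[OF _ D1(1), of "\<one>\<^bsub>K\<^esub>"] xM by simp
    then have "G \<subseteq> E" using D(2) DE by blast
    ultimately have "E = carrier M" using G(1) by (simp add: gen_def)
    with y have "y \<in> E" by simp
    then show ?thesis unfolding E_def by blast
  qed
  then show ?thesis using that[of x "G - {x}" D0] xM fin D0 \<open>x \<notin> D0\<close> by auto
qed

text \<open>Coefficients with respect to an enumerated finite spanning set, chosen once for each
  element. They need not be unique or linear: an injection into coordinate sequences is enough to
  transport a module structure.\<close>

lemma coordinate_injection:
  obtains \<phi> :: "'m \<Rightarrow> nat \<Rightarrow> 'k" where "inj_on \<phi> (carrier M)"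
proof -
  interpret V: vectorspace K "scalar_restriction A M" by (rule scalar_vectorspace)
  have carrier: "carrier (scalar_restriction A M) = carrier M" by (simp add: scalar_restriction_def)
  obtain G where G: "finite G" "G \<subseteq> carrier M" "V.span G = carrier M"
    using fin_dim_module unfolding V.fin_dim_def carrier by blast
  obtain g :: "nat \<Rightarrow> 'm" and n where g: "G = g ` {i. i < n}"
    using finite_imp_nat_seg_image_inj_on[OF G(1)] by blast
  have "\<forall>x\<in>carrier M. \<exists>a. a \<in> G \<rightarrow> carrier K \<and> V.lincomb a G = x"
    using V.finite_in_span[OF G(1)] G(2,3) carrier by auto
  from bchoice[OF this] obtain a where
    a: "\<forall>x\<in>carrier M. a x \<in> G \<rightarrow> carrier K \<and> V.lincomb (a x) G = x" ..
  have "inj_on (\<lambda>x i. a x (g i)) (carrier M)"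
  proof (rule inj_onI)
    fix x y assume x: "x \<in> carrier M" and y: "y \<in> carrier M" and eq: "(\<lambda>i. a x (g i)) = (\<lambda>i. a y (g i))"
    have "V.lincomb (a x) G = V.lincomb (a y) G"
    proof (rule V.lincomb_cong)
      show "a x v = a y v" if "v \<in> G" for v using that fun_cong[OF eq] by (auto simp: g)
    qed (use a y G carrier in auto)
    then show "x = y" using a x y by metis
  qed
  then show ?thesis by (rule that)
qed

end

text \<open>Splitness speaks of simple modules on coordinate sequences only. The factors of a
  composition series live on cosets and are moved there along an injection. The fields
  \<open>mult\<close> and \<open>one\<close> are dummies.\<close>

definition transport_module :: "('m \<Rightarrow> 'n) \<Rightarrow> ('a, 'm) module \<Rightarrow> ('a, 'n) module" where
  "transport_module \<phi> M = (let \<psi> = inv_into (carrier M) \<phi> in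
    \<lparr>carrier = \<phi> ` carrier M, mult = (\<lambda>_ _. \<phi> \<zero>\<^bsub>M\<^esub>), one = \<phi> \<zero>\<^bsub>M\<^esub>, zero = \<phi> \<zero>\<^bsub>M\<^esub>,
     add = (\<lambda>u v. \<phi> (\<psi> u \<oplus>\<^bsub>M\<^esub> \<psi> v)), smult = (\<lambda>a u. \<phi> (a \<odot>\<^bsub>M\<^esub> \<psi> u))\<rparr>)"

lemma transport_simple_module:
  assumes A: "fd_algebra K A" and S: "simple_module K A S" and inj: "inj_on \<phi> (carrier S)"
  defines "T \<equiv> transport_module \<phi> S"
  shows "simple_module K A T" "\<phi> \<in> module_hom A S T" "bij_betw \<phi> (carrier S) (carrier T)"
proof -
  interpret FA: fd_algebra K A by fact
  interpret S: right_module A S using S by (simp add: simple_module_def fd_right_module_def)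
  define \<psi> where "\<psi> = inv_into (carrier S) \<phi>"
  have \<psi> [simp]: "\<psi> (\<phi> x) = x" if "x \<in> carrier S" for x
    using that inj by (simp add: \<psi>_def)
  have T: "carrier T = \<phi> ` carrier S" "\<zero>\<^bsub>T\<^esub> = \<phi> \<zero>\<^bsub>S\<^esub>"
    "\<And>x y. x \<in> carrier S \<Longrightarrow> y \<in> carrier S \<Longrightarrow> \<phi> x \<oplus>\<^bsub>T\<^esub> \<phi> y = \<phi> (x \<oplus>\<^bsub>S\<^esub> y)"
    "\<And>a x. x \<in> carrier S \<Longrightarrow> a \<odot>\<^bsub>T\<^esub> \<phi> x = \<phi> (a \<odot>\<^bsub>S\<^esub> x)"
    by (simp_all add: T_def transport_module_def Let_def \<psi>_def[symmetric])
  show hom: "\<phi> \<in> module_hom A S T" by (rule module_homI) (simp_all add: T)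
  show bij: "bij_betw \<phi> (carrier S) (carrier T)" using inj T(1) by (simp add: bij_betw_def)
  have "abelian_group T"
  proof (rule abelian_groupI)
    show "\<exists>y\<in>carrier T. y \<oplus>\<^bsub>T\<^esub> x = \<zero>\<^bsub>T\<^esub>" if xT: "x \<in> carrier T" for x
    proof -
      obtain u where u: "u \<in> carrier S" "x = \<phi> u" using xT T(1) by auto
      then show ?thesis
        by (intro bexI[of _ "\<phi> (\<ominus>\<^bsub>S\<^esub> u)"]) (simp_all add: T S.M.l_neg)
    qed
  qed (auto simp: T S.M.a_ac)
  then have T_mod: "right_module A T"
    unfolding right_module_def right_module_axioms_def
    using right_module.axioms(1)[OF S.right_module_axioms]
    by (auto simp: T S.act_closed S.act_distr_ring S.act_distr_module S.act_mult S.act_one)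
  interpret T: right_module A T by fact
  \<comment> \<open>The transport map is linear, so finite dimension passes to its image.\<close>
  have "linear_map K (scalar_restriction A S) (scalar_restriction A T) \<phi>"
    unfolding linear_map_def mod_hom_def mod_hom_axioms_def
    using scalar_restriction_vectorspace[OF A S.right_module_axioms]
      scalar_restriction_vectorspace[OF A T_mod] module_homD[OF hom]
    by (auto simp: vectorspace_def module_hom_def scalar_restriction_def)
  then have "vectorspace.fin_dim K (scalar_restriction A T)"
    by (rule linear_map.rank_nullity_main(2))
      (use S T(1) in \<open>auto simp: simple_module_def fd_right_module_def scalar_restriction_def\<close>)
  then have fd: "fd_right_module K A T" using T_mod by (simp add: fd_right_module_def)
  have "N = {\<zero>\<^bsub>T\<^esub>} \<or> N = carrier T" if N: "rsubmodule A T N" for N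
  proof -
    note D = T.rsubmoduleD[OF N]
    define H where "H = {x \<in> carrier S. \<phi> x \<in> N}"
    have "rsubmodule A S H"
    proof (rule S.rsubmoduleI)
      show "\<zero>\<^bsub>S\<^esub> \<in> H" using D(2) T(2) by (simp add: H_def)
      show "x \<oplus>\<^bsub>S\<^esub> y \<in> H" if "x \<in> H" "y \<in> H" for x y
        using that D(3)[of "\<phi> x" "\<phi> y"] T(3)[of x y] by (simp add: H_def)
      show "a \<odot>\<^bsub>S\<^esub> x \<in> H" if "a \<in> carrier A" "x \<in> H" for a x
        using that D(4)[of a "\<phi> x"] T(4)[of x a] S.act_closed[of a x] by (simp add: H_def)
    qed (auto simp: H_def)
    then have "H = {\<zero>\<^bsub>S\<^esub>} \<or> H = carrier S" using S by (simp add: simple_module_def)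
    moreover have "N = \<phi> ` H" using D(1) T(1) by (auto simp: H_def)
    ultimately show ?thesis using T(1,2) by auto
  qed
  moreover have "carrier T \<noteq> {\<zero>\<^bsub>T\<^esub>}"
  proof
    assume eq: "carrier T = {\<zero>\<^bsub>T\<^esub>}"
    have "x = \<zero>\<^bsub>S\<^esub>" if x: "x \<in> carrier S" for x
    proof -
      have "\<phi> x = \<phi> \<zero>\<^bsub>S\<^esub>" using eq x T(1,2) by auto
      then show ?thesis using inj x by (auto simp: inj_on_def)
    qed
    then have "carrier S = {\<zero>\<^bsub>S\<^esub>}" by auto
    with S show False by (simp add: simple_module_def)
  qed
  ultimately show "simple_module K A T" using fd by (simp add: simple_module_def)
qed

lemma fd_moduleI:
  "fd_algebra K A \<Longrightarrow> fd_right_module K A M \<Longrightarrow> fd_module K A M"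
  by (simp add: fd_module_def fd_module_axioms_def fd_right_module_def)

text \<open>An isomorphism \<open>h\<close> of algebras from the endomorphisms to K sends the scalar
  endomorphism c to c. An endomorphism with image c under \<open>h\<close> is therefore that scalar,
  by injectivity.\<close>

lemma split_coord_endo_scalar:
  fixes K :: "'k ring" and A :: "('k, 'a) module" and S :: "('k, 'a) coord_module"
  assumes A: "fd_algebra K A" and split: "split_algebra K A" and S: "simple_module K A S"
    and f: "f \<in> module_hom A S S"
  shows "\<exists>c\<in>carrier K. \<forall>x\<in>carrier S. f x = fd_module.sc A S c x"
proof -
  interpret S: fd_module K A S using A S by (intro fd_moduleI) (auto simp: simple_module_def)
  let ?E = "endo_algebra A S"
  have "algebras_isomorphic K ?E (self_algebra K)"
    using split S by (simp add: split_algebra_def)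
  then obtain h where h: "h \<in> ring_iso ?E (self_algebra K)"
    and lin: "\<forall>c\<in>carrier K. \<forall>x\<in>carrier ?E. h (c \<odot>\<^bsub>?E\<^esub> x) = c \<odot>\<^bsub>self_algebra K\<^esub> h x"
    unfolding algebras_isomorphic_def by (rule bexE)
  have hom: "h \<in> ring_hom ?E (self_algebra K)" and bij: "bij_betw h (carrier ?E) (carrier (self_algebra K))"
    using h by (auto simp: ring_iso_def)
  have one: "\<one>\<^bsub>?E\<^esub> \<in> carrier ?E"
    by (auto simp: endo_algebra_def module_hom_def S.RM.act_closed)
  define g where "g = restrict f (carrier S)"
  have g: "g \<in> carrier ?E"
    using f S.RM.act_closed by (auto simp: g_def endo_algebra_def module_hom_def)
  define c where "c = h g"
  have c: "c \<in> carrier K"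
    using ring_hom_memE(1)[OF hom g] by (simp add: c_def self_algebra_def)
  have cE: "c \<odot>\<^bsub>?E\<^esub> \<one>\<^bsub>?E\<^esub> \<in> carrier ?E"
    using c S.sc_closed[OF c] S.sc_act[OF c] S.sc_r_distr[OF c]
    by (auto simp: endo_algebra_def module_hom_def S.RM.act_closed S.sc_def)
  have "h (c \<odot>\<^bsub>?E\<^esub> \<one>\<^bsub>?E\<^esub>) = h g"
    using bspec[OF bspec[OF lin c] one] ring_hom_memE(4)[OF hom] c by (simp add: self_algebra_def c_def)
  then have eq: "c \<odot>\<^bsub>?E\<^esub> \<one>\<^bsub>?E\<^esub> = g" using bij cE g by (auto simp: bij_betw_def inj_on_def)
  have "f x = S.sc c x" if x: "x \<in> carrier S" for x
  proof -
    have "(c \<odot>\<^bsub>?E\<^esub> \<one>\<^bsub>?E\<^esub>) x = S.sc c x" using x by (simp add: endo_algebra_def S.sc_def)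
    then show ?thesis using x by (simp add: eq g_def)
  qed
  with c show ?thesis by blast
qed

text \<open>The endomorphism is conjugated to the transported copy of S, recognised there as a
  scalar, and pulled back.\<close>

lemma split_endo_scalar:
  fixes K :: "'k ring" and A :: "('k, 'a) module" and S :: "('a, 'm) module"
  assumes A: "fd_algebra K A" and split: "split_algebra K A" and S: "simple_module K A S"
    and f: "f \<in> module_hom A S S"
  shows "\<exists>c\<in>carrier K. \<forall>x\<in>carrier S. f x = fd_module.sc A S c x"
proof -
  interpret S: fd_module K A S using A S by (intro fd_moduleI) (auto simp: simple_module_def)
  obtain \<phi> :: "'m \<Rightarrow> nat \<Rightarrow> 'k" where inj: "inj_on \<phi> (carrier S)" by (rule S.coordinate_injection)
  define T where "T = transport_module \<phi> S"
  have T: "simple_module K A T" "\<phi> \<in> module_hom A S T" "bij_betw \<phi> (carrier S) (carrier T)"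
    unfolding T_def by (rule transport_simple_module[OF A S inj])+
  interpret T: fd_module K A T using A T(1) by (intro fd_moduleI) (auto simp: simple_module_def)
  note \<phi>D = module_homD[OF T(2)] and fD = module_homD[OF f]
  define \<psi> where "\<psi> = inv_into (carrier S) \<phi>"
  have \<psi>\<phi>: "\<psi> (\<phi> x) = x" if "x \<in> carrier S" for x using that inj by (simp add: \<psi>_def)
  have T_elim: "\<exists>x. x \<in> carrier S \<and> u = \<phi> x" if "u \<in> carrier T" for u
    using that T(3) by (auto simp: bij_betw_def)
  have "(\<lambda>u. \<phi> (f (\<psi> u))) \<in> module_hom A T T"
  proof (rule module_homI)
    fix u v assume "u \<in> carrier T" "v \<in> carrier T"
    then obtain x y where x: "x \<in> carrier S" "u = \<phi> x" and y: "y \<in> carrier S" "v = \<phi> y"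
      using T_elim by metis
    have "u \<oplus>\<^bsub>T\<^esub> v = \<phi> (x \<oplus>\<^bsub>S\<^esub> y)" using x y \<phi>D(2) by simp
    then have "\<psi> (u \<oplus>\<^bsub>T\<^esub> v) = x \<oplus>\<^bsub>S\<^esub> y" using \<psi>\<phi> x y by simp
    then show "\<phi> (f (\<psi> (u \<oplus>\<^bsub>T\<^esub> v))) = \<phi> (f (\<psi> u)) \<oplus>\<^bsub>T\<^esub> \<phi> (f (\<psi> v))"
      using x y by (simp add: \<psi>\<phi> \<phi>D(2) fD(1,2))
  next
    fix a u assume a: "a \<in> carrier A" and "u \<in> carrier T"
    then obtain x where x: "x \<in> carrier S" "u = \<phi> x" using T_elim by metis
    have "a \<odot>\<^bsub>T\<^esub> u = \<phi> (a \<odot>\<^bsub>S\<^esub> x)" using x a \<phi>D(3) by simp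
    then have "\<psi> (a \<odot>\<^bsub>T\<^esub> u) = a \<odot>\<^bsub>S\<^esub> x" using \<psi>\<phi> x a S.RM.act_closed by simp
    then show "\<phi> (f (\<psi> (a \<odot>\<^bsub>T\<^esub> u))) = a \<odot>\<^bsub>T\<^esub> \<phi> (f (\<psi> u))"
      using x a by (simp add: \<psi>\<phi> \<phi>D(3) fD(1,3))
  next
    fix u assume "u \<in> carrier T"
    then obtain x where x: "x \<in> carrier S" "u = \<phi> x" using T_elim by metis
    then show "\<phi> (f (\<psi> u)) \<in> carrier T" by (simp add: \<psi>\<phi> \<phi>D(1) fD(1))
  qed
  then obtain c where c: "c \<in> carrier K" "\<forall>u\<in>carrier T. \<phi> (f (\<psi> u)) = T.sc c u"
    using split_coord_endo_scalar[OF A split T(1)] by blast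
  have "f x = S.sc c x" if x: "x \<in> carrier S" for x
  proof -
    have "\<phi> (f x) = T.sc c (\<phi> x)" using bspec[OF c(2) \<phi>D(1)[OF x]] \<psi>\<phi>[OF x] by simp
    also have "\<dots> = \<phi> (S.sc c x)"
      unfolding S.sc_def T.sc_def using \<phi>D(3) x S.scalar_in_algebra[OF c(1)] by simp
    finally show ?thesis using inj fD(1)[OF x] S.sc_closed[OF c(1) x] by (auto simp: inj_on_def)
  qed
  with c show ?thesis by blast
qed

section \<open>Simple modules of a split algebra\<close>

lemma (in right_module) rsubmodule_generated:
  assumes "y \<in> carrier M"
  shows "rsubmodule A M ((\<lambda>a. a \<odot>\<^bsub>M\<^esub> y) ` carrier A)"
proof (rule rsubmoduleI)
  show "\<zero>\<^bsub>M\<^esub> \<in> (\<lambda>a. a \<odot>\<^bsub>M\<^esub> y) ` carrier A"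
    using assms by (intro image_eqI[of _ _ "\<zero>\<^bsub>A\<^esub>"]) auto
  show "u \<oplus>\<^bsub>M\<^esub> v \<in> (\<lambda>a. a \<odot>\<^bsub>M\<^esub> y) ` carrier A"
    if uv: "u \<in> (\<lambda>a. a \<odot>\<^bsub>M\<^esub> y) ` carrier A" "v \<in> (\<lambda>a. a \<odot>\<^bsub>M\<^esub> y) ` carrier A" for u v
  proof -
    obtain a b where "a \<in> carrier A" "u = a \<odot>\<^bsub>M\<^esub> y" "b \<in> carrier A" "v = b \<odot>\<^bsub>M\<^esub> y"
      using uv by blast
    then show ?thesis using assms by (intro image_eqI[of _ _ "a \<oplus>\<^bsub>A\<^esub> b"]) (auto simp: act_distr_ring)
  qed
  show "b \<odot>\<^bsub>M\<^esub> u \<in> (\<lambda>a. a \<odot>\<^bsub>M\<^esub> y) ` carrier A"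
    if bu: "b \<in> carrier A" "u \<in> (\<lambda>a. a \<odot>\<^bsub>M\<^esub> y) ` carrier A" for b u
  proof -
    obtain a where "a \<in> carrier A" "u = a \<odot>\<^bsub>M\<^esub> y" using bu by blast
    then show ?thesis using assms bu by (intro image_eqI[of _ _ "a \<otimes>\<^bsub>A\<^esub> b"]) (auto simp: act_mult)
  qed
qed (use assms act_closed in auto)

lemma simple_module_transitive:
  assumes S: "simple_module K A S" and y: "y \<in> carrier S" "y \<noteq> \<zero>\<^bsub>S\<^esub>" and z: "z \<in> carrier S"
  shows "\<exists>a\<in>carrier A. a \<odot>\<^bsub>S\<^esub> y = z"
proof -
  interpret S: right_module A S using S by (simp add: simple_module_def fd_right_module_def)
  let ?N = "(\<lambda>a. a \<odot>\<^bsub>S\<^esub> y) ` carrier A"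
  have "y \<in> ?N" using y S.act_one by (intro image_eqI[of _ _ "\<one>\<^bsub>A\<^esub>"]) auto
  then have "?N = carrier S"
    using S S.rsubmodule_generated[OF y(1)] y(2) by (auto simp: simple_module_def)
  with z have "z \<in> ?N" by simp
  then show ?thesis by blast
qed

text \<open>Pairs of a module and an element of it, so that elements of different modules can be
  killed by one algebra element. For right modules this common annihilator is a right ideal.\<close>

definition annihilator :: "('k, 'a) module \<Rightarrow> (('a, 'n) module \<times> 'n) set \<Rightarrow> 'a set" where
  "annihilator A P = {a \<in> carrier A. \<forall>p\<in>P. a \<odot>\<^bsub>fst p\<^esub> snd p = \<zero>\<^bsub>fst p\<^esub>}"

lemma annihilator_right_ideal:
  assumes A: "ring A" and P: "\<forall>p\<in>P. right_module A (fst p) \<and> snd p \<in> carrier (fst p)"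
  shows "\<zero>\<^bsub>A\<^esub> \<in> annihilator A P"
    and "\<And>a b. a \<in> annihilator A P \<Longrightarrow> b \<in> annihilator A P \<Longrightarrow> a \<oplus>\<^bsub>A\<^esub> b \<in> annihilator A P"
    and "\<And>a b. a \<in> annihilator A P \<Longrightarrow> b \<in> annihilator A P \<Longrightarrow> a \<ominus>\<^bsub>A\<^esub> b \<in> annihilator A P"
    and "\<And>a b. a \<in> annihilator A P \<Longrightarrow> b \<in> carrier A \<Longrightarrow> a \<otimes>\<^bsub>A\<^esub> b \<in> annihilator A P"
proof -
  interpret A: ring A by fact
  have "\<zero>\<^bsub>A\<^esub> \<odot>\<^bsub>fst p\<^esub> snd p = \<zero>\<^bsub>fst p\<^esub>" if p: "p \<in> P" for p
    by (rule right_module.zero_act) (use bspec[OF P p] in simp_all)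
  then show "\<zero>\<^bsub>A\<^esub> \<in> annihilator A P" by (simp add: annihilator_def)
  fix a b
  show "a \<oplus>\<^bsub>A\<^esub> b \<in> annihilator A P" if ab: "a \<in> annihilator A P" "b \<in> annihilator A P"
    unfolding annihilator_def
  proof (intro CollectI conjI ballI)
    fix p assume p: "p \<in> P"
    interpret T: right_module A "fst p" using bspec[OF P p] by simp
    show "(a \<oplus>\<^bsub>A\<^esub> b) \<odot>\<^bsub>fst p\<^esub> snd p = \<zero>\<^bsub>fst p\<^esub>"
      using ab bspec[OF P p] p by (simp add: annihilator_def T.act_distr_ring)
  qed (use ab in \<open>simp add: annihilator_def\<close>)
  show "a \<ominus>\<^bsub>A\<^esub> b \<in> annihilator A P" if ab: "a \<in> annihilator A P" "b \<in> annihilator A P"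
    unfolding annihilator_def
  proof (intro CollectI conjI ballI)
    fix p assume p: "p \<in> P"
    interpret T: right_module A "fst p" using bspec[OF P p] by simp
    show "(a \<ominus>\<^bsub>A\<^esub> b) \<odot>\<^bsub>fst p\<^esub> snd p = \<zero>\<^bsub>fst p\<^esub>"
      using ab bspec[OF P p] p by (simp add: annihilator_def A.minus_eq T.act_distr_ring T.neg_act T.M.neg_zero)
  qed (use ab in \<open>simp add: annihilator_def\<close>)
  show "a \<otimes>\<^bsub>A\<^esub> b \<in> annihilator A P" if ab: "a \<in> annihilator A P" "b \<in> carrier A"
    unfolding annihilator_def
  proof (intro CollectI conjI ballI)
    fix p assume p: "p \<in> P"
    interpret T: right_module A "fst p" using bspec[OF P p] by simp
    show "(a \<otimes>\<^bsub>A\<^esub> b) \<odot>\<^bsub>fst p\<^esub> snd p = \<zero>\<^bsub>fst p\<^esub>"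
      using ab bspec[OF P p] p by (simp add: annihilator_def T.act_mult)
  qed (use ab in \<open>simp add: annihilator_def\<close>)
qed

text \<open>Jacobson density in dual form. Let I annihilate the pairs treated so far. If I kills the
  new element t, nothing changes. Otherwise I t is a nonzero submodule of the simple module T, hence
  all of it, and sending a t to a x for a in I defines a homomorphism \<phi>. Then x - \<phi> t is
  killed by I and lies in D by induction, while \<phi> t lies in D by assumption.\<close>

lemma annihilator_density:
  fixes P :: "(('a, 'n) module \<times> 'n) set" and A :: "('k, 'a) module" and S :: "('a, 'm) module"
  assumes S: "right_module A S"
    and D: "\<zero>\<^bsub>S\<^esub> \<in> D" "\<And>d e. d \<in> D \<Longrightarrow> e \<in> D \<Longrightarrow> d \<oplus>\<^bsub>S\<^esub> e \<in> D"
    and "finite P"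
    and P: "\<And>p. p \<in> P \<Longrightarrow> simple_module K A (fst p) \<and> snd p \<in> carrier (fst p)"
    and hom: "\<And>p \<phi>. p \<in> P \<Longrightarrow> \<phi> \<in> module_hom A (fst p) S \<Longrightarrow> \<phi> (snd p) \<in> D"
    and x: "x \<in> carrier S"
    and ann: "\<And>a. a \<in> annihilator A P \<Longrightarrow> a \<odot>\<^bsub>S\<^esub> x = \<zero>\<^bsub>S\<^esub>"
  shows "x \<in> D"
  using \<open>finite P\<close> P hom x ann
proof (induction P arbitrary: x rule: finite_induct)
  case empty
  interpret S: right_module A S by fact
  have "\<one>\<^bsub>A\<^esub> \<odot>\<^bsub>S\<^esub> x = \<zero>\<^bsub>S\<^esub>" by (rule empty(4)) (simp add: annihilator_def)
  then show ?case using D(1) S.act_one[OF empty(3)] by simp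
next
  case (insert p P)
  define T t where "T = fst p" and "t = snd p"
  interpret S: right_module A S by fact
  have T: "simple_module K A T" and t: "t \<in> carrier T" using insert.prems(1)[of p] by (auto simp: T_def t_def)
  interpret T: right_module A T using T by (simp add: simple_module_def fd_right_module_def)
  note x = insert.prems(3)
  define I where "I = annihilator A P"
  have IA: "a \<in> carrier A" if "a \<in> I" for a using that by (simp add: I_def annihilator_def)
  have "\<forall>p\<in>P. right_module A (fst p) \<and> snd p \<in> carrier (fst p)"
    using insert.prems(1) by (simp add: simple_module_def fd_right_module_def)
  note I = annihilator_right_ideal[of A P, OF S.A.ring_axioms this, folded I_def]
  note I_zero = I(1) and I_add = I(2) and I_diff = I(3) and I_mult = I(4)
  have kill: "a \<odot>\<^bsub>S\<^esub> x = \<zero>\<^bsub>S\<^esub>" if "a \<in> I" "a \<odot>\<^bsub>T\<^esub> t = \<zero>\<^bsub>T\<^esub>" for a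
    using that by (intro insert.prems(4)) (simp add: I_def annihilator_def T_def t_def)
  have IH: "x' \<in> D" if "x' \<in> carrier S" "\<And>a. a \<in> I \<Longrightarrow> a \<odot>\<^bsub>S\<^esub> x' = \<zero>\<^bsub>S\<^esub>" for x'
  proof (rule insert.IH)
    show "simple_module K A (fst p) \<and> snd p \<in> carrier (fst p)" if "p \<in> P" for p
      using insert.prems(1) that by simp
    show "\<phi> (snd p) \<in> D" if "p \<in> P" "\<phi> \<in> module_hom A (fst p) S" for p \<phi>
      using insert.prems(2) that by simp
  qed (use that in \<open>simp_all add: I_def\<close>)
  show ?case
  proof (cases "\<forall>a\<in>I. a \<odot>\<^bsub>T\<^esub> t = \<zero>\<^bsub>T\<^esub>")
    case True
    show ?thesis by (rule IH[OF x]) (use kill True in blast)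
  next
    case False
    define N where "N = (\<lambda>a. a \<odot>\<^bsub>T\<^esub> t) ` I"
    have "rsubmodule A T N"
    proof (rule T.rsubmoduleI)
      show "N \<subseteq> carrier T" using IA t T.act_closed by (auto simp: N_def)
      show "\<zero>\<^bsub>T\<^esub> \<in> N" unfolding N_def using I_zero t by (intro image_eqI[of _ _ "\<zero>\<^bsub>A\<^esub>"]) auto
      show "u \<oplus>\<^bsub>T\<^esub> v \<in> N" if uv: "u \<in> N" "v \<in> N" for u v
      proof -
        obtain a b where "a \<in> I" "u = a \<odot>\<^bsub>T\<^esub> t" "b \<in> I" "v = b \<odot>\<^bsub>T\<^esub> t"
          using uv unfolding N_def by blast
        then show ?thesis
          unfolding N_def using t I_add IA by (intro image_eqI[of _ _ "a \<oplus>\<^bsub>A\<^esub> b"]) (auto simp: T.act_distr_ring)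
      qed
      show "b \<odot>\<^bsub>T\<^esub> u \<in> N" if bu: "b \<in> carrier A" "u \<in> N" for b u
      proof -
        obtain a where "a \<in> I" "u = a \<odot>\<^bsub>T\<^esub> t" using bu unfolding N_def by blast
        then show ?thesis
          unfolding N_def using t bu I_mult IA by (intro image_eqI[of _ _ "a \<otimes>\<^bsub>A\<^esub> b"]) (auto simp: T.act_mult)
      qed
    qed
    moreover have "N \<noteq> {\<zero>\<^bsub>T\<^esub>}" using False by (auto simp: N_def)
    ultimately have N: "N = carrier T" using T by (auto simp: simple_module_def)
    define pick where "pick u = (SOME a. a \<in> I \<and> a \<odot>\<^bsub>T\<^esub> t = u)" for u
    have pick: "pick u \<in> I" "pick u \<odot>\<^bsub>T\<^esub> t = u" if "u \<in> carrier T" for u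
    proof -
      have "\<exists>a. a \<in> I \<and> a \<odot>\<^bsub>T\<^esub> t = u" using that unfolding N[symmetric] N_def by blast
      from someI_ex[OF this] show "pick u \<in> I" "pick u \<odot>\<^bsub>T\<^esub> t = u" by (auto simp: pick_def)
    qed
    \<comment> \<open>Well defined although \<open>pick\<close> is a choice: the difference of two
      choices kills \<open>t\<close>, so it annihilates the enlarged set of pairs and kills
      \<open>x\<close>.\<close>
    define \<phi> where "\<phi> u = pick u \<odot>\<^bsub>S\<^esub> x" for u
    have \<phi>: "\<phi> (a \<odot>\<^bsub>T\<^esub> t) = a \<odot>\<^bsub>S\<^esub> x" if a: "a \<in> I" for a
    proof -
      have u: "a \<odot>\<^bsub>T\<^esub> t \<in> carrier T" using a IA t T.act_closed by simp
      let ?b = "pick (a \<odot>\<^bsub>T\<^esub> t)"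
      have b: "?b \<in> I" "?b \<odot>\<^bsub>T\<^esub> t = a \<odot>\<^bsub>T\<^esub> t" using pick[OF u] by auto
      have "(?b \<ominus>\<^bsub>A\<^esub> a) \<odot>\<^bsub>T\<^esub> t = \<zero>\<^bsub>T\<^esub>"
        using a b IA t u by (simp add: S.A.minus_eq T.act_distr_ring T.neg_act T.M.r_neg)
      then have "(?b \<ominus>\<^bsub>A\<^esub> a) \<odot>\<^bsub>S\<^esub> x = \<zero>\<^bsub>S\<^esub>" by (rule kill[OF I_diff[OF b(1) a]])
      then have "?b \<odot>\<^bsub>S\<^esub> x \<oplus>\<^bsub>S\<^esub> \<ominus>\<^bsub>S\<^esub> (a \<odot>\<^bsub>S\<^esub> x) = \<zero>\<^bsub>S\<^esub>"
        using a b IA x by (simp add: S.A.minus_eq S.act_distr_ring S.neg_act)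
      then show ?thesis
        unfolding \<phi>_def using a b IA x S.act_closed S.M.minus_equality[of "?b \<odot>\<^bsub>S\<^esub> x" "\<ominus>\<^bsub>S\<^esub> (a \<odot>\<^bsub>S\<^esub> x)"]
        by simp
    qed
    have hom\<phi>: "\<phi> \<in> module_hom A T S"
    proof (rule module_homI)
      show "\<phi> u \<in> carrier S" if "u \<in> carrier T" for u
        using pick(1)[OF that] IA x S.act_closed by (simp add: \<phi>_def)
      show "\<phi> (u \<oplus>\<^bsub>T\<^esub> v) = \<phi> u \<oplus>\<^bsub>S\<^esub> \<phi> v" if uv: "u \<in> carrier T" "v \<in> carrier T" for u v
      proof -
        have "u \<oplus>\<^bsub>T\<^esub> v = (pick u \<oplus>\<^bsub>A\<^esub> pick v) \<odot>\<^bsub>T\<^esub> t"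
          using pick[OF uv(1)] pick[OF uv(2)] IA t by (simp add: T.act_distr_ring)
        then show ?thesis
          using \<phi>[OF I_add[OF pick(1)[OF uv(1)] pick(1)[OF uv(2)]]] pick(1)[OF uv(1)] pick(1)[OF uv(2)]
            IA x by (simp add: \<phi>_def[of u] \<phi>_def[of v] S.act_distr_ring)
      qed
      show "\<phi> (a \<odot>\<^bsub>T\<^esub> u) = a \<odot>\<^bsub>S\<^esub> \<phi> u" if au: "a \<in> carrier A" "u \<in> carrier T" for a u
      proof -
        have "a \<odot>\<^bsub>T\<^esub> u = (pick u \<otimes>\<^bsub>A\<^esub> a) \<odot>\<^bsub>T\<^esub> t"
          using pick[OF au(2)] IA t au by (simp add: T.act_mult)
        then show ?thesis
          using \<phi>[OF I_mult[OF pick(1)[OF au(2)] au(1)]] pick(1)[OF au(2)] au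
            IA x by (simp add: \<phi>_def[of u] S.act_mult)
      qed
    qed
    have \<phi>t: "\<phi> t \<in> D" "\<phi> t \<in> carrier S"
      using insert.prems(2)[of p \<phi>] hom\<phi> module_homD(1)[OF hom\<phi> t] by (simp_all add: T_def t_def)
    have "x \<ominus>\<^bsub>S\<^esub> \<phi> t \<in> D"
    proof (rule IH)
      show "x \<ominus>\<^bsub>S\<^esub> \<phi> t \<in> carrier S" using x \<phi>t by simp
      fix a assume a: "a \<in> I"
      have "a \<odot>\<^bsub>S\<^esub> \<phi> t = a \<odot>\<^bsub>S\<^esub> x" using module_homD(3)[OF hom\<phi> IA[OF a] t] \<phi>[OF a] by simp
      then show "a \<odot>\<^bsub>S\<^esub> (x \<ominus>\<^bsub>S\<^esub> \<phi> t) = \<zero>\<^bsub>S\<^esub>"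
        using S.act_minus[OF IA[OF a] x \<phi>t(2)] S.act_closed[OF IA[OF a] x]
        by (simp add: S.M.minus_eq_add S.M.r_neg)
    qed
    then have "(x \<ominus>\<^bsub>S\<^esub> \<phi> t) \<oplus>\<^bsub>S\<^esub> \<phi> t \<in> D" by (rule D(2)[OF _ \<phi>t(1)])
    then show ?thesis
      using x \<phi>t(2) by (simp add: S.M.minus_eq_add S.M.a_assoc S.M.l_neg)
  qed
qed

lemma module_hom_minus:
  assumes X: "right_module A X" and Y: "right_module A Y" and f: "f \<in> module_hom A X Y"
    and x: "x \<in> carrier X" "y \<in> carrier X"
  shows "f (x \<ominus>\<^bsub>X\<^esub> y) = f x \<ominus>\<^bsub>Y\<^esub> f y"
proof -
  interpret X: right_module A X by fact
  interpret Y: right_module A Y by fact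
  note fD = module_homD[OF f]
  have "f (\<ominus>\<^bsub>X\<^esub> y) \<oplus>\<^bsub>Y\<^esub> f y = \<zero>\<^bsub>Y\<^esub>"
    using fD(2)[of "\<ominus>\<^bsub>X\<^esub> y" y] x module_hom_zero[OF X Y f] by (simp add: X.M.l_neg)
  then have "\<ominus>\<^bsub>Y\<^esub> f y = f (\<ominus>\<^bsub>X\<^esub> y)" using x fD(1) by (intro Y.M.minus_equality) auto
  then show ?thesis using x fD(2) by (simp add: X.M.minus_eq_add Y.M.minus_eq_add)
qed

lemma schur:
  assumes T: "simple_module K A T" and S: "simple_module K A S" and f: "f \<in> module_hom A T S"
    and x: "x \<in> carrier T" "f x \<noteq> \<zero>\<^bsub>S\<^esub>"
  shows "modules_isomorphic A T S"
proof -
  have TR: "right_module A T" and SR: "right_module A S"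
    using T S by (auto simp: simple_module_def fd_right_module_def)
  interpret T: right_module A T by fact
  interpret S: right_module A S by fact
  note fD = module_homD[OF f] and f0 = module_hom_zero[OF TR SR f]
  define N where "N = {y \<in> carrier T. f y = \<zero>\<^bsub>S\<^esub>}"
  have "rsubmodule A T N"
    by (rule T.rsubmoduleI) (auto simp: N_def fD f0 T.act_closed)
  moreover have "N \<noteq> carrier T" using x by (auto simp: N_def)
  ultimately have N: "N = {\<zero>\<^bsub>T\<^esub>}" using T by (auto simp: simple_module_def)
  have "inj_on f (carrier T)"
  proof (rule inj_onI)
    fix u v assume uv: "u \<in> carrier T" "v \<in> carrier T" "f u = f v"
    have "f (u \<ominus>\<^bsub>T\<^esub> v) = \<zero>\<^bsub>S\<^esub>"
      using module_hom_minus[OF TR SR f uv(1,2)] uv fD(1)[OF uv(2)] by (simp add: S.M.minus_eq_add S.M.r_neg)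
    then have "u \<ominus>\<^bsub>T\<^esub> v \<in> N" using uv by (simp add: N_def)
    then have "u \<oplus>\<^bsub>T\<^esub> \<ominus>\<^bsub>T\<^esub> v = \<zero>\<^bsub>T\<^esub>" using N by (simp add: T.M.minus_eq_add)
    then show "u = v" using uv T.M.minus_equality[of u "\<ominus>\<^bsub>T\<^esub> v"] by simp
  qed
  moreover have "rsubmodule A S (f ` carrier T)"
  proof (rule S.rsubmoduleI)
    show "\<zero>\<^bsub>S\<^esub> \<in> f ` carrier T" using f0 by (intro image_eqI[of _ _ "\<zero>\<^bsub>T\<^esub>"]) auto
    show "u \<oplus>\<^bsub>S\<^esub> v \<in> f ` carrier T" if "u \<in> f ` carrier T" "v \<in> f ` carrier T" for u v
      using that fD(2)[symmetric] by auto
    show "a \<odot>\<^bsub>S\<^esub> u \<in> f ` carrier T" if "a \<in> carrier A" "u \<in> f ` carrier T" for a u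
      using that fD(3)[symmetric] T.act_closed by auto
  qed (use fD(1) in auto)
  then have "f ` carrier T = carrier S"
    using S x by (auto simp: simple_module_def)
  ultimately show ?thesis using f by (auto simp: modules_isomorphic_def bij_betw_def)
qed

lemma modules_isomorphic_sym:
  assumes X: "right_module A X" and iso: "modules_isomorphic A X Y"
  shows "modules_isomorphic A Y X"
proof -
  interpret X: right_module A X by fact
  obtain g where g: "g \<in> module_hom A X Y" "bij_betw g (carrier X) (carrier Y)"
    using iso by (auto simp: modules_isomorphic_def)
  note gD = module_homD[OF g(1)]
  define h where "h = inv_into (carrier X) g"
  have hX: "h b \<in> carrier X" and gh: "g (h b) = b" if "b \<in> carrier Y" for b
    using that g(2) by (auto simp: h_def bij_betw_def intro: inv_into_into f_inv_into_f)
  have h_eq: "h b = x" if "x \<in> carrier X" "g x = b" for b x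
    using that g(2) bij_betw_inv_into_left[of g "carrier X" "carrier Y" x] by (simp add: h_def)
  have "h \<in> module_hom A Y X"
    by (rule module_homI) (auto intro!: h_eq simp: hX gh gD X.act_closed)
  moreover have "bij_betw h (carrier Y) (carrier X)"
    unfolding h_def by (rule bij_betw_inv_into[OF g(2)])
  ultimately show ?thesis by (auto simp: modules_isomorphic_def)
qed

lemma modules_isomorphic_trans:
  assumes "modules_isomorphic A X Y" "modules_isomorphic A Y Z"
  shows "modules_isomorphic A X Z"
proof -
  obtain f g where f: "f \<in> module_hom A X Y" "bij_betw f (carrier X) (carrier Y)"
    and g: "g \<in> module_hom A Y Z" "bij_betw g (carrier Y) (carrier Z)"
    using assms by (auto simp: modules_isomorphic_def)
  have "(g \<circ> f) \<in> module_hom A X Z"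
    using module_homD[OF f(1)] module_homD[OF g(1)] by (intro module_homI) auto
  then show ?thesis
    using bij_betw_trans[OF f(2) g(2)] by (auto simp: modules_isomorphic_def)
qed

lemma modules_isomorphic_refl: "modules_isomorphic A X X"
  unfolding modules_isomorphic_def
  by (rule bexI[of _ id]) (auto simp: module_hom_def)

text \<open>Projection onto the line through a fixed vector x. That a acts idempotently follows,
  because its image is this line and a fixes it.\<close>

definition rank_one_idempotent :: "'k ring \<Rightarrow> ('k, 'a) module \<Rightarrow> ('a, 'n) module \<Rightarrow> 'a \<Rightarrow> bool" where
  "rank_one_idempotent K A F a \<longleftrightarrow> (\<exists>x\<in>carrier F. x \<noteq> \<zero>\<^bsub>F\<^esub> \<and> a \<odot>\<^bsub>F\<^esub> x = x \<and>
    (\<forall>y\<in>carrier F. \<exists>c\<in>carrier K. a \<odot>\<^bsub>F\<^esub> y = (c \<odot>\<^bsub>A\<^esub> \<one>\<^bsub>A\<^esub>) \<odot>\<^bsub>F\<^esub> x))"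

lemma rank_one_idempotent_iso:
  assumes A: "fd_algebra K A" and S: "right_module A S" and T: "right_module A T"
    and iso: "modules_isomorphic A S T" and a: "a \<in> carrier A" and rank: "rank_one_idempotent K A S a"
  shows "rank_one_idempotent K A T a"
proof -
  interpret FA: fd_algebra K A by fact
  obtain h where h: "h \<in> module_hom A S T" "bij_betw h (carrier S) (carrier T)"
    using iso by (auto simp: modules_isomorphic_def)
  note hD = module_homD[OF h(1)]
  obtain x where x: "x \<in> carrier S" "x \<noteq> \<zero>\<^bsub>S\<^esub>" "a \<odot>\<^bsub>S\<^esub> x = x"
    "\<forall>y\<in>carrier S. \<exists>c\<in>carrier K. a \<odot>\<^bsub>S\<^esub> y = (c \<odot>\<^bsub>A\<^esub> \<one>\<^bsub>A\<^esub>) \<odot>\<^bsub>S\<^esub> x"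
    using rank by (auto simp: rank_one_idempotent_def)
  have zero: "\<zero>\<^bsub>S\<^esub> \<in> carrier S"
    using S by (simp add: right_module_def abelian_group_def abelian_monoid.zero_closed)
  have "h x \<noteq> h \<zero>\<^bsub>S\<^esub>" using x h(2) zero by (auto simp: bij_betw_def inj_on_def)
  then have "h x \<noteq> \<zero>\<^bsub>T\<^esub>" using module_hom_zero[OF S T h(1)] by simp
  moreover have "a \<odot>\<^bsub>T\<^esub> h x = h x" using hD(3)[OF a x(1)] x(3) by simp
  moreover have "\<exists>c\<in>carrier K. a \<odot>\<^bsub>T\<^esub> z = (c \<odot>\<^bsub>A\<^esub> \<one>\<^bsub>A\<^esub>) \<odot>\<^bsub>T\<^esub> h x" if z: "z \<in> carrier T" for z
  proof -
    have "z \<in> h ` carrier S" using z h(2) by (simp add: bij_betw_def)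
    then obtain y where y: "y \<in> carrier S" "z = h y" by blast
    obtain c where c: "c \<in> carrier K" "a \<odot>\<^bsub>S\<^esub> y = (c \<odot>\<^bsub>A\<^esub> \<one>\<^bsub>A\<^esub>) \<odot>\<^bsub>S\<^esub> x" using x(4) y by blast
    have cA: "c \<odot>\<^bsub>A\<^esub> \<one>\<^bsub>A\<^esub> \<in> carrier A" using c by simp
    have "a \<odot>\<^bsub>T\<^esub> z = (c \<odot>\<^bsub>A\<^esub> \<one>\<^bsub>A\<^esub>) \<odot>\<^bsub>T\<^esub> h x"
      using hD(3)[OF a y(1)] hD(3)[OF cA x(1)] c(2) y(2) by simp
    with c show ?thesis by blast
  qed
  ultimately show ?thesis using hD(1)[OF x(1)] unfolding rank_one_idempotent_def by blast
qed

lemma (in fd_module) kernel_lin_subspace: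
  assumes "a \<in> carrier A"
  shows "lin_subspace {y \<in> carrier M. a \<odot>\<^bsub>M\<^esub> y = \<zero>\<^bsub>M\<^esub>}"
  unfolding lin_subspace_def
  using assms by (auto simp: RM.act_distr_module simp flip: sc_act)

text \<open>The element sought kills a complement of a line in \<open>F i\<close> and generators of
  every \<open>F j\<close> not isomorphic to \<open>F i\<close>, but not the line itself. Density
  says when such an element exists, and the homomorphisms to be controlled are scalars or
  zero.\<close>

lemma separating_idempotent:
  fixes K :: "'k ring" and A :: "('k, 'a) module" and F :: "nat \<Rightarrow> ('a, 'n) module"
  assumes A: "fd_algebra K A" and split: "split_algebra K A"
    and F: "\<And>j. j < m \<Longrightarrow> simple_module K A (F j)" and i: "i < m"
  shows "\<exists>a\<in>carrier A. rank_one_idempotent K A (F i) a \<and>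
    (\<forall>j<m. \<not> modules_isomorphic A (F i) (F j) \<longrightarrow> (\<forall>y\<in>carrier (F j). a \<odot>\<^bsub>F j\<^esub> y = \<zero>\<^bsub>F j\<^esub>))"
proof -
  have fdm: "fd_module K A (F j)" if "j < m" for j
    using F[OF that] A by (intro fd_moduleI) (auto simp: simple_module_def)
  have rm: "right_module A (F j)" if "j < m" for j
    using F[OF that] by (simp add: simple_module_def fd_right_module_def)
  define S where "S = F i"
  have S: "simple_module K A S" using F[OF i] by (simp add: S_def)
  interpret S: fd_module K A S unfolding S_def by (rule fdm[OF i])
  have "carrier S \<noteq> {\<zero>\<^bsub>S\<^esub>}" using S by (simp add: simple_module_def)
  then obtain x G D0 where x: "x \<in> carrier S" and G: "finite G" "G \<subseteq> carrier S"
    and D0: "S.lin_subspace D0" "G \<subseteq> D0" "x \<notin> D0"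
    and line: "\<And>D y. S.lin_subspace D \<Longrightarrow> G \<subseteq> D \<Longrightarrow> y \<in> carrier S \<Longrightarrow>
      \<exists>c\<in>carrier K. \<exists>d\<in>D. y = S.sc c x \<oplus>\<^bsub>S\<^esub> d"
    by (rule S.complemented_line) blast
  have "\<forall>j\<in>{..<m}. \<exists>H. finite H \<and> H \<subseteq> carrier (F j) \<and>
    (\<forall>D. fd_module.lin_subspace K A (F j) D \<longrightarrow> H \<subseteq> D \<longrightarrow> D = carrier (F j))"
  proof
    fix j assume "j \<in> {..<m}"
    then interpret Fj: fd_module K A "F j" using fdm by simp
    show "\<exists>H. finite H \<and> H \<subseteq> carrier (F j) \<and> (\<forall>D. Fj.lin_subspace D \<longrightarrow> H \<subseteq> D \<longrightarrow> D = carrier (F j))"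
      by (rule Fj.finite_generators) blast
  qed
  from bchoice[OF this] obtain H where H: "\<forall>j\<in>{..<m}. finite (H j) \<and> H j \<subseteq> carrier (F j) \<and>
    (\<forall>D. fd_module.lin_subspace K A (F j) D \<longrightarrow> H j \<subseteq> D \<longrightarrow> D = carrier (F j))" ..
  define J where "J = {j. j < m \<and> \<not> modules_isomorphic A (F i) (F j)}"
  define P where "P = Pair S ` G \<union> (\<Union>j\<in>J. Pair (F j) ` H j)"
  have J: "j < m" if "j \<in> J" for j using that by (simp add: J_def)
  have HF: "h \<in> carrier (F j)" if "j \<in> J" "h \<in> H j" for j h
  proof -
    have "H j \<subseteq> carrier (F j)" using H J[OF that(1)] by simp
    then show ?thesis using that(2) by (rule subsetD)
  qed
  have "finite J" by (simp add: J_def)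
  then have finP: "finite P" using G H J by (auto simp: P_def)
  have Pcases: "(fst p = S \<and> snd p \<in> G) \<or> (\<exists>j\<in>J. fst p = F j \<and> snd p \<in> H j)" if "p \<in> P" for p
    using that by (auto simp: P_def)
  have D0c: "\<zero>\<^bsub>S\<^esub> \<in> D0" "\<And>d e. d \<in> D0 \<Longrightarrow> e \<in> D0 \<Longrightarrow> d \<oplus>\<^bsub>S\<^esub> e \<in> D0"
    "\<And>c d. c \<in> carrier K \<Longrightarrow> d \<in> D0 \<Longrightarrow> S.sc c d \<in> D0"
    using D0(1) by (auto simp: S.lin_subspace_def)
  have "\<exists>a. a \<in> annihilator A P \<and> a \<odot>\<^bsub>S\<^esub> x \<noteq> \<zero>\<^bsub>S\<^esub>"
  proof (rule ccontr)
    assume neg: "\<not> ?thesis"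
    \<comment> \<open>If every element killing \<open>P\<close> killed x, density would put x into
      \<open>D0\<close>: endomorphisms of S are scalars because A is split, so they map
      \<open>G\<close> into \<open>D0\<close>, and by Schur's lemma all maps from the other
      \<open>F j\<close> are zero.\<close>
    have "x \<in> D0"
    proof (rule annihilator_density[OF S.RM.right_module_axioms D0c(1) _ finP, where K = K])
      show "d \<oplus>\<^bsub>S\<^esub> e \<in> D0" if "d \<in> D0" "e \<in> D0" for d e by (rule D0c(2)[OF that])
      show "simple_module K A (fst p) \<and> snd p \<in> carrier (fst p)" if "p \<in> P" for p
        using Pcases[OF that]
      proof
        assume "\<exists>j\<in>J. fst p = F j \<and> snd p \<in> H j"
        then obtain j where "j \<in> J" "fst p = F j" "snd p \<in> H j" by blast
        then show ?thesis using F[OF J] HF by simp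
      qed (use S G in auto)
      show "\<phi> (snd p) \<in> D0" if p: "p \<in> P" and \<phi>: "\<phi> \<in> module_hom A (fst p) S" for p \<phi>
        using Pcases[OF p]
      proof
        assume pS: "fst p = S \<and> snd p \<in> G"
        then obtain c where "c \<in> carrier K" "\<forall>x\<in>carrier S. \<phi> x = S.sc c x"
          using split_endo_scalar[OF A split S] \<phi> by auto
        moreover have "snd p \<in> carrier S" "snd p \<in> D0" using pS G(2) D0(2) by blast+
        ultimately show ?thesis using D0c(3) by simp
      next
        assume "\<exists>j\<in>J. fst p = F j \<and> snd p \<in> H j"
        then obtain j where j: "j \<in> J" "fst p = F j" "snd p \<in> H j" by blast
        have t: "snd p \<in> carrier (F j)" by (rule HF[OF j(1,3)])
        have \<phi>': "\<phi> \<in> module_hom A (F j) S" using \<phi> j(2) by simp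
        have "\<phi> (snd p) = \<zero>\<^bsub>S\<^esub>"
        proof (rule ccontr)
          assume "\<phi> (snd p) \<noteq> \<zero>\<^bsub>S\<^esub>"
          with schur[OF F[OF J[OF j(1)]] S \<phi>' t] have "modules_isomorphic A (F j) S" by blast
          then have "modules_isomorphic A S (F j)" by (rule modules_isomorphic_sym[OF rm[OF J[OF j(1)]]])
          with j(1) show False by (simp add: J_def S_def)
        qed
        then show ?thesis using D0c(1) by simp
      qed
      show "a \<odot>\<^bsub>S\<^esub> x = \<zero>\<^bsub>S\<^esub>" if "a \<in> annihilator A P" for a using neg that by blast
    qed (rule x)
    with D0(3) show False by blast
  qed
  then obtain a where a: "a \<in> annihilator A P" "a \<odot>\<^bsub>S\<^esub> x \<noteq> \<zero>\<^bsub>S\<^esub>" by blast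
  have aA: "a \<in> carrier A" using a by (simp add: annihilator_def)
  obtain b where b: "b \<in> carrier A" "b \<odot>\<^bsub>S\<^esub> (a \<odot>\<^bsub>S\<^esub> x) = x"
    using simple_module_transitive[OF S S.RM.act_closed[OF aA x] a(2) x] by blast
  \<comment> \<open>\<open>b\<close> carries the image of x under \<open>a\<close> back to x, so the
    product fixes x and still kills everything that \<open>a\<close> kills.\<close>
  define e where "e = a \<otimes>\<^bsub>A\<^esub> b"
  have eA: "e \<in> carrier A" using aA b by (simp add: e_def)
  have ex: "e \<odot>\<^bsub>S\<^esub> x = x" using aA b x by (simp add: e_def S.RM.act_mult)
  have kill: "e \<odot>\<^bsub>F j\<^esub> t = \<zero>\<^bsub>F j\<^esub>" if "j < m" "t \<in> carrier (F j)" "a \<odot>\<^bsub>F j\<^esub> t = \<zero>\<^bsub>F j\<^esub>" for j t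
    using right_module.act_mult[OF rm[OF that(1)] aA b(1) that(2)] that(3)
      right_module.act_zero[OF rm[OF that(1)] b(1)] by (simp add: e_def)
  have "rank_one_idempotent K A S e"
    unfolding rank_one_idempotent_def
  proof (intro bexI[of _ x] conjI ballI)
    show "x \<noteq> \<zero>\<^bsub>S\<^esub>" using D0c(1) D0(3) by blast
    fix y assume y: "y \<in> carrier S"
    define D where "D = {y \<in> carrier S. e \<odot>\<^bsub>S\<^esub> y = \<zero>\<^bsub>S\<^esub>}"
    have "a \<odot>\<^bsub>S\<^esub> g = \<zero>\<^bsub>S\<^esub>" if "g \<in> G" for g
    proof -
      have "(S, g) \<in> P" unfolding P_def using that by blast
      then have "a \<odot>\<^bsub>fst (S, g)\<^esub> snd (S, g) = \<zero>\<^bsub>fst (S, g)\<^esub>"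
        using a(1) unfolding annihilator_def by blast
      then show ?thesis by simp
    qed
    then have "G \<subseteq> D" using G kill[OF i] by (auto simp: D_def S_def)
    moreover have "S.lin_subspace D" unfolding D_def by (rule S.kernel_lin_subspace[OF eA])
    ultimately obtain c d where c: "c \<in> carrier K" and d: "d \<in> D" and yy: "y = S.sc c x \<oplus>\<^bsub>S\<^esub> d"
      using line[OF _ _ y] by blast
    have dS: "d \<in> carrier S" "e \<odot>\<^bsub>S\<^esub> d = \<zero>\<^bsub>S\<^esub>" using d by (auto simp: D_def)
    have "e \<odot>\<^bsub>S\<^esub> y = S.sc c x"
      using S.sc_act[OF c eA x] ex c x dS eA by (simp add: yy S.RM.act_distr_module)
    then show "\<exists>c\<in>carrier K. e \<odot>\<^bsub>S\<^esub> y = (c \<odot>\<^bsub>A\<^esub> \<one>\<^bsub>A\<^esub>) \<odot>\<^bsub>S\<^esub> x"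
      using c by (auto simp: S.sc_def)
  qed (use x ex in auto)
  moreover have "e \<odot>\<^bsub>F j\<^esub> y = \<zero>\<^bsub>F j\<^esub>"
    if j: "j < m" "\<not> modules_isomorphic A (F i) (F j)" and y: "y \<in> carrier (F j)" for j y
  proof -
    interpret Fj: fd_module K A "F j" by (rule fdm[OF j(1)])
    define D where "D = {y \<in> carrier (F j). e \<odot>\<^bsub>F j\<^esub> y = \<zero>\<^bsub>F j\<^esub>}"
    have jJ: "j \<in> J" using j by (simp add: J_def)
    have "a \<odot>\<^bsub>F j\<^esub> g = \<zero>\<^bsub>F j\<^esub>" if g: "g \<in> H j" for g
    proof -
      have "(F j, g) \<in> P" unfolding P_def using g jJ by blast
      then have "a \<odot>\<^bsub>fst (F j, g)\<^esub> snd (F j, g) = \<zero>\<^bsub>fst (F j, g)\<^esub>"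
        using a(1) unfolding annihilator_def by blast
      then show ?thesis by simp
    qed
    then have "H j \<subseteq> D" using HF[OF jJ] kill[OF j(1)] by (auto simp: D_def)
    moreover have "Fj.lin_subspace D" unfolding D_def by (rule Fj.kernel_lin_subspace[OF eA])
    ultimately have "D = carrier (F j)" using H j(1) by blast
    with y show ?thesis by (auto simp: D_def)
  qed
  ultimately show ?thesis using eA by (auto simp: S_def)
qed

text \<open>The sum of one separating idempotent for each isomorphism class among the factors: on a
  given factor exactly one summand acts nontrivially, with rank one. Repeating a class would spoil
  this, hence the representatives.\<close>

lemma common_rank_one_element:
  fixes K :: "'k ring" and A :: "('k, 'a) module" and F :: "nat \<Rightarrow> ('a, 'n) module"
  assumes A: "fd_algebra K A" and split: "split_algebra K A"
    and F: "\<And>j. j < m \<Longrightarrow> simple_module K A (F j)"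
  shows "\<exists>a\<in>carrier A. \<forall>j<m. rank_one_idempotent K A (F j) a"
proof -
  interpret FA: fd_algebra K A by fact
  have rm: "right_module A (F j)" if "j < m" for j
    using F[OF that] by (simp add: simple_module_def fd_right_module_def)
  \<comment> \<open>The least index of an isomorphic module. As \<open>j\<close> itself competes,
    the representative is at most \<open>j\<close> and stays below \<open>m\<close>.\<close>
  define rep where "rep j = (LEAST i. modules_isomorphic A (F i) (F j))" for j
  have rep_iso: "modules_isomorphic A (F (rep j)) (F j)" for j
    unfolding rep_def by (rule LeastI[of _ j]) (rule modules_isomorphic_refl)
  have rep_le: "rep j \<le> j" for j
    unfolding rep_def by (rule Least_le) (rule modules_isomorphic_refl)
  have rep_eq: "rep i = rep j" if ij: "i < m" "modules_isomorphic A (F i) (F j)" for i j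
  proof -
    have "modules_isomorphic A (F l) (F i) \<longleftrightarrow> modules_isomorphic A (F l) (F j)" for l
      using modules_isomorphic_trans[OF _ ij(2), of "F l"]
        modules_isomorphic_trans[OF _ modules_isomorphic_sym[OF rm[OF ij(1)] ij(2)], of "F l"] by blast
    then show ?thesis by (simp add: rep_def)
  qed
  have rep_rep: "rep (rep j) = rep j" if "j < m" for j
    using rep_eq[OF _ rep_iso[of j]] rep_le[of j] that by simp
  \<comment> \<open>\<open>R\<close> collects the classes already treated; vanishing on all other
    classes is carried along so that adding the next summand does no harm.\<close>
  have "\<exists>a\<in>carrier A. \<forall>j<m. if rep j \<in> R then rank_one_idempotent K A (F j) a
      else (\<forall>y\<in>carrier (F j). a \<odot>\<^bsub>F j\<^esub> y = \<zero>\<^bsub>F j\<^esub>)" if "finite R" "R \<subseteq> rep ` {..<m}" for R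
    using that
  proof (induction R rule: finite_induct)
    case empty
    show ?case
      by (rule bexI[of _ "\<zero>\<^bsub>A\<^esub>"]) (auto intro: right_module.zero_act[OF rm])
  next
    case (insert i R)
    then obtain a where a: "a \<in> carrier A" "\<And>j. j < m \<Longrightarrow> if rep j \<in> R then rank_one_idempotent K A (F j) a
      else (\<forall>y\<in>carrier (F j). a \<odot>\<^bsub>F j\<^esub> y = \<zero>\<^bsub>F j\<^esub>)" by auto
    obtain k where k: "k < m" "i = rep k" using insert.prems by auto
    have i: "i < m" "rep i = i" using k rep_le[of k] rep_rep[of k] by auto
    obtain b where b: "b \<in> carrier A" "rank_one_idempotent K A (F i) b"
      "\<And>j. j < m \<Longrightarrow> \<not> modules_isomorphic A (F i) (F j) \<Longrightarrow> (\<forall>y\<in>carrier (F j). b \<odot>\<^bsub>F j\<^esub> y = \<zero>\<^bsub>F j\<^esub>)"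
      using separating_idempotent[of K A m F i, OF A split F i(1)] by auto
    have "if rep j \<in> insert i R then rank_one_idempotent K A (F j) (a \<oplus>\<^bsub>A\<^esub> b)
      else (\<forall>y\<in>carrier (F j). (a \<oplus>\<^bsub>A\<^esub> b) \<odot>\<^bsub>F j\<^esub> y = \<zero>\<^bsub>F j\<^esub>)" if j: "j < m" for j
    proof -
      interpret Fj: right_module A "F j" by (rule rm[OF j])
      have sum: "(a \<oplus>\<^bsub>A\<^esub> b) \<odot>\<^bsub>F j\<^esub> y = a \<odot>\<^bsub>F j\<^esub> y \<oplus>\<^bsub>F j\<^esub> b \<odot>\<^bsub>F j\<^esub> y" if "y \<in> carrier (F j)" for y
        using Fj.act_distr_ring[OF a(1) b(1) that] .
      show ?thesis
      proof (cases "rep j = i")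
        case True
        then have "\<forall>y\<in>carrier (F j). a \<odot>\<^bsub>F j\<^esub> y = \<zero>\<^bsub>F j\<^esub>" using a(2)[OF j] insert.hyps(2) by auto
        then have eq: "\<forall>y\<in>carrier (F j). (a \<oplus>\<^bsub>A\<^esub> b) \<odot>\<^bsub>F j\<^esub> y = b \<odot>\<^bsub>F j\<^esub> y"
          using sum Fj.act_closed[OF b(1)] by simp
        have "rank_one_idempotent K A (F j) b"
          using rank_one_idempotent_iso[OF A rm[OF i(1)] rm[OF j] _ b(1,2)] rep_iso[of j] True by simp
        then have "rank_one_idempotent K A (F j) (a \<oplus>\<^bsub>A\<^esub> b)"
          unfolding rank_one_idempotent_def using eq by auto
        with True show ?thesis by simp
      next
        case False
        then have "\<not> modules_isomorphic A (F i) (F j)" using rep_eq[OF i(1)] i(2) by auto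
        then have "\<forall>y\<in>carrier (F j). b \<odot>\<^bsub>F j\<^esub> y = \<zero>\<^bsub>F j\<^esub>" by (rule b(3)[OF j])
        then have eq: "\<forall>y\<in>carrier (F j). (a \<oplus>\<^bsub>A\<^esub> b) \<odot>\<^bsub>F j\<^esub> y = a \<odot>\<^bsub>F j\<^esub> y"
          using sum Fj.act_closed[OF a(1)] by simp
        show ?thesis
        proof (cases "rep j \<in> R")
          case True
          then have "rank_one_idempotent K A (F j) a" using a(2)[OF j] by simp
          then have "rank_one_idempotent K A (F j) (a \<oplus>\<^bsub>A\<^esub> b)"
            unfolding rank_one_idempotent_def using eq by auto
          with True show ?thesis by simp
        next
          case nR: False
          then have "\<forall>y\<in>carrier (F j). a \<odot>\<^bsub>F j\<^esub> y = \<zero>\<^bsub>F j\<^esub>" using a(2)[OF j] by simp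
          then show ?thesis using eq False nR by simp
        qed
      qed
    qed
    then show ?case using a(1) b(1) by (intro bexI[of _ "a \<oplus>\<^bsub>A\<^esub> b"]) auto
  qed
  from this[of "rep ` {..<m}"] show ?thesis by auto
qed

section \<open>Lifting idempotents\<close>

text \<open>The closing cancellation of \<open>idempotent_lifting\<close>: for u, y, v the images of
  x, of the defect of x and of e applied to that defect, the left side is e' applied twice to x and
  the right side is e' applied once.\<close>

lemma (in abelian_group) lift_identity:
  assumes "u \<in> carrier G" "y \<in> carrier G" "v \<in> carrier G"
  shows "((u \<oplus> y) \<oplus> (v \<ominus> (v \<oplus> v))) \<oplus> (v \<ominus> (v \<oplus> v)) = u \<oplus> (y \<ominus> (v \<oplus> v))"
proof -
  have "v \<ominus> (v \<oplus> v) = \<ominus> v"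
    using assms by (simp add: minus_eq_add minus_add a_assoc[symmetric] r_neg)
  then show ?thesis using assms by (simp add: minus_eq_add minus_add a_assoc)
qed

lemma (in abelian_group) add_diff_cancel:
  "x \<in> carrier G \<Longrightarrow> y \<in> carrier G \<Longrightarrow> x \<oplus> (y \<ominus> x) = y"
  by (simp add: minus_eq_add a_lcomm[of x y] r_neg)

context right_module begin

lemma diff_sym:
  assumes "rsubmodule A M N" "x \<in> carrier M" "y \<in> carrier M" "x \<ominus>\<^bsub>M\<^esub> y \<in> N"
  shows "y \<ominus>\<^bsub>M\<^esub> x \<in> N"
  using assms coset_eq_iff by metis

lemma diff_trans:
  assumes "rsubmodule A M N" "x \<in> carrier M" "y \<in> carrier M" "z \<in> carrier M"
    "x \<ominus>\<^bsub>M\<^esub> y \<in> N" "y \<ominus>\<^bsub>M\<^esub> z \<in> N"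
  shows "x \<ominus>\<^bsub>M\<^esub> z \<in> N"
  using assms coset_eq_iff by metis

lemma diff_mem:
  assumes "rsubmodule A M N" "x \<in> carrier M" "y \<in> carrier M" "x \<ominus>\<^bsub>M\<^esub> y \<in> N"
  shows "x \<in> N \<longleftrightarrow> y \<in> N"
  using assms coset_eq_iff coset_eq_self_iff by metis

end

context fd_module begin

text \<open>The property \<open>rank_one_idempotent\<close> for the subquotient N' / N, with
  representatives in place of cosets.\<close>

definition rank_one_on :: "'m set \<Rightarrow> 'm set \<Rightarrow> 'a \<Rightarrow> bool" where
  "rank_one_on N N' e \<longleftrightarrow> (\<exists>x\<in>N'. x \<notin> N \<and> e \<odot>\<^bsub>M\<^esub> x \<ominus>\<^bsub>M\<^esub> x \<in> N \<and>
    (\<forall>y\<in>N'. \<exists>c\<in>carrier K. e \<odot>\<^bsub>M\<^esub> y \<ominus>\<^bsub>M\<^esub> sc c x \<in> N))"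

lemma rank_one_on_subquotient:
  assumes N: "rsubmodule A M N" and N': "rsubmodule A M N'" "N \<subseteq> N'" and e: "e \<in> carrier A"
    and rank: "rank_one_idempotent K A (quotient_module (M\<lparr>carrier := N'\<rparr>) N) e"
  shows "rank_one_on N N' e"
proof -
  let ?F = "quotient_module (M\<lparr>carrier := N'\<rparr>) N"
  note F = RM.subquotient_simps[OF N N']
  have NM: "x \<in> carrier M" if "x \<in> N'" for x using that RM.rsubmoduleD(1)[OF N'(1)] by blast
  obtain C where C: "C \<in> carrier ?F" "C \<noteq> \<zero>\<^bsub>?F\<^esub>" "e \<odot>\<^bsub>?F\<^esub> C = C"
    "\<forall>D\<in>carrier ?F. \<exists>c\<in>carrier K. e \<odot>\<^bsub>?F\<^esub> D = (c \<odot>\<^bsub>A\<^esub> \<one>\<^bsub>A\<^esub>) \<odot>\<^bsub>?F\<^esub> C"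
    using rank unfolding rank_one_idempotent_def by blast
  obtain x where x: "x \<in> N'" "C = N +>\<^bsub>M\<^esub> x" using C(1) F(1) by auto
  have "x \<notin> N" using C(2) x F(2) RM.coset_eq_self_iff[OF N NM[OF x(1)]] by auto
  moreover have "e \<odot>\<^bsub>M\<^esub> x \<ominus>\<^bsub>M\<^esub> x \<in> N"
    using C(3) F(4)[OF e x(1)] x RM.coset_eq_iff[OF N RM.act_closed[OF e NM[OF x(1)]] NM[OF x(1)]] by simp
  moreover have "\<exists>c\<in>carrier K. e \<odot>\<^bsub>M\<^esub> y \<ominus>\<^bsub>M\<^esub> sc c x \<in> N" if y: "y \<in> N'" for y
  proof -
    have "N +>\<^bsub>M\<^esub> y \<in> carrier ?F" using y F(1) by blast
    then obtain c where c: "c \<in> carrier K"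
      "e \<odot>\<^bsub>?F\<^esub> (N +>\<^bsub>M\<^esub> y) = (c \<odot>\<^bsub>A\<^esub> \<one>\<^bsub>A\<^esub>) \<odot>\<^bsub>?F\<^esub> C" using C(4) by blast
    then have "N +>\<^bsub>M\<^esub> (e \<odot>\<^bsub>M\<^esub> y) = N +>\<^bsub>M\<^esub> sc c x"
      using F(4)[OF e y] F(4)[OF scalar_in_algebra[OF c(1)] x(1)] x(2) by (simp add: sc_def)
    then have "e \<odot>\<^bsub>M\<^esub> y \<ominus>\<^bsub>M\<^esub> sc c x \<in> N"
      using RM.coset_eq_iff[OF N RM.act_closed[OF e NM[OF y]] sc_closed[OF c(1) NM[OF x(1)]]] by simp
    with c(1) show ?thesis by blast
  qed
  ultimately show ?thesis using x(1) unfolding rank_one_on_def by blast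
qed

text \<open>Modulo N the element e maps y to a multiple of x and fixes x.\<close>

lemma rank_one_on_idempotent:
  assumes N: "rsubmodule A M N" and N': "rsubmodule A M N'" and e: "e \<in> carrier A"
    and rank: "rank_one_on N N' e" and y: "y \<in> N'"
  shows "e \<odot>\<^bsub>M\<^esub> (e \<odot>\<^bsub>M\<^esub> y) \<ominus>\<^bsub>M\<^esub> e \<odot>\<^bsub>M\<^esub> y \<in> N"
proof -
  have NM: "x \<in> carrier M" if "x \<in> N'" for x using that RM.rsubmoduleD(1)[OF N'] by blast
  obtain x where x: "x \<in> N'" "e \<odot>\<^bsub>M\<^esub> x \<ominus>\<^bsub>M\<^esub> x \<in> N" "\<forall>y\<in>N'. \<exists>c\<in>carrier K. e \<odot>\<^bsub>M\<^esub> y \<ominus>\<^bsub>M\<^esub> sc c x \<in> N"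
    using rank unfolding rank_one_on_def by blast
  obtain c where c: "c \<in> carrier K" "e \<odot>\<^bsub>M\<^esub> y \<ominus>\<^bsub>M\<^esub> sc c x \<in> N" using x(3) y by blast
  have car: "e \<odot>\<^bsub>M\<^esub> y \<in> carrier M" "sc c x \<in> carrier M" "e \<odot>\<^bsub>M\<^esub> x \<in> carrier M" "x \<in> carrier M"
    using NM x(1) y c(1) e RM.act_closed by simp_all
  have "e \<odot>\<^bsub>M\<^esub> (e \<odot>\<^bsub>M\<^esub> y \<ominus>\<^bsub>M\<^esub> sc c x) \<in> N" using c(2) by (rule RM.rsubmoduleD(4)[OF N e])
  then have 1: "e \<odot>\<^bsub>M\<^esub> (e \<odot>\<^bsub>M\<^esub> y) \<ominus>\<^bsub>M\<^esub> sc c (e \<odot>\<^bsub>M\<^esub> x) \<in> N"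
    using RM.act_minus[OF e car(1,2)] sc_act[OF c(1) e car(4)] by simp
  have "sc c (e \<odot>\<^bsub>M\<^esub> x \<ominus>\<^bsub>M\<^esub> x) \<in> N" by (rule sc_rsubmodule[OF N c(1) x(2)])
  then have 2: "sc c (e \<odot>\<^bsub>M\<^esub> x) \<ominus>\<^bsub>M\<^esub> sc c x \<in> N"
    using RM.act_minus[OF scalar_in_algebra[OF c(1)] car(3,4)] by (simp add: sc_def)
  have ee: "e \<odot>\<^bsub>M\<^esub> (e \<odot>\<^bsub>M\<^esub> y) \<in> carrier M" "sc c (e \<odot>\<^bsub>M\<^esub> x) \<in> carrier M"
    using car e c(1) RM.act_closed by simp_all
  have "e \<odot>\<^bsub>M\<^esub> (e \<odot>\<^bsub>M\<^esub> y) \<ominus>\<^bsub>M\<^esub> sc c x \<in> N"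
    by (rule RM.diff_trans[OF N ee car(2) 1 2])
  then show ?thesis
    by (rule RM.diff_trans[OF N ee(1) car(2,1) _ RM.diff_sym[OF N car(1,2) c(2)]])
qed

lemma rank_one_on_cong:
  assumes N: "rsubmodule A M N" and N': "rsubmodule A M N'" and e: "e \<in> carrier A" "e' \<in> carrier A"
    and rank: "rank_one_on N N' e" and cong: "\<And>y. y \<in> N' \<Longrightarrow> e' \<odot>\<^bsub>M\<^esub> y \<ominus>\<^bsub>M\<^esub> e \<odot>\<^bsub>M\<^esub> y \<in> N"
  shows "rank_one_on N N' e'"
proof -
  have NM: "x \<in> carrier M" if "x \<in> N'" for x using that RM.rsubmoduleD(1)[OF N'] by blast
  obtain x where x: "x \<in> N'" "x \<notin> N" "e \<odot>\<^bsub>M\<^esub> x \<ominus>\<^bsub>M\<^esub> x \<in> N" "\<forall>y\<in>N'. \<exists>c\<in>carrier K. e \<odot>\<^bsub>M\<^esub> y \<ominus>\<^bsub>M\<^esub> sc c x \<in> N"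
    using rank unfolding rank_one_on_def by blast
  have trans: "e' \<odot>\<^bsub>M\<^esub> y \<ominus>\<^bsub>M\<^esub> z \<in> N" if "y \<in> N'" "z \<in> carrier M" "e \<odot>\<^bsub>M\<^esub> y \<ominus>\<^bsub>M\<^esub> z \<in> N" for y z
    by (rule RM.diff_trans[OF N _ _ that(2) cong[OF that(1)] that(3)])
      (use NM[OF that(1)] e RM.act_closed in simp_all)
  have "\<exists>c\<in>carrier K. e' \<odot>\<^bsub>M\<^esub> y \<ominus>\<^bsub>M\<^esub> sc c x \<in> N" if y: "y \<in> N'" for y
  proof -
    obtain c where "c \<in> carrier K" "e \<odot>\<^bsub>M\<^esub> y \<ominus>\<^bsub>M\<^esub> sc c x \<in> N" using x(4) y by blast
    then show ?thesis using trans[OF y] NM[OF x(1)] by (intro bexI[of _ c]) auto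
  qed
  then show ?thesis
    unfolding rank_one_on_def using x trans[OF x(1) NM[OF x(1)] x(3)] by blast
qed

text \<open>The defect e^2 - e maps each layer one step down. The correction below does not change e
  on the factors, and it makes e idempotent on one more step of the series: on that step the defect
  lands in \<open>N k\<close>, where e is already idempotent.\<close>

lemma idempotent_lifting:
  fixes N :: "nat \<Rightarrow> 'm set"
  assumes N: "\<And>i. i \<le> m \<Longrightarrow> rsubmodule A M (N i)" and N0: "N 0 = {\<zero>\<^bsub>M\<^esub>}"
    and a: "a \<in> carrier A" "\<And>i. i < m \<Longrightarrow> rank_one_on (N i) (N (Suc i)) a"
    and k: "k \<le> m"
  shows "\<exists>e\<in>carrier A. (\<forall>i<m. rank_one_on (N i) (N (Suc i)) e) \<and> (\<forall>x\<in>N k. e \<odot>\<^bsub>M\<^esub> (e \<odot>\<^bsub>M\<^esub> x) = e \<odot>\<^bsub>M\<^esub> x)"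
  using k
proof (induction k)
  case 0
  show ?case using a by (intro bexI[of _ a]) (auto simp: N0)
next
  case (Suc k)
  then obtain e where e: "e \<in> carrier A" "\<forall>i<m. rank_one_on (N i) (N (Suc i)) e"
    and idem: "\<forall>x\<in>N k. e \<odot>\<^bsub>M\<^esub> (e \<odot>\<^bsub>M\<^esub> x) = e \<odot>\<^bsub>M\<^esub> x" by auto
  define n where "n x = e \<odot>\<^bsub>M\<^esub> (e \<odot>\<^bsub>M\<^esub> x) \<ominus>\<^bsub>M\<^esub> e \<odot>\<^bsub>M\<^esub> x" for x
  define \<nu> where "\<nu> = e \<otimes>\<^bsub>A\<^esub> e \<ominus>\<^bsub>A\<^esub> e"
  \<comment> \<open>The classical correction 3 e^2 - 2 e^3, written as e + \<nu> - 2 \<nu> e with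
    the defect \<nu> = e^2 - e.\<close>
  define e' where "e' = e \<oplus>\<^bsub>A\<^esub> (\<nu> \<ominus>\<^bsub>A\<^esub> (\<nu> \<otimes>\<^bsub>A\<^esub> e \<oplus>\<^bsub>A\<^esub> \<nu> \<otimes>\<^bsub>A\<^esub> e))"
  have \<nu>: "\<nu> \<in> carrier A" using e by (simp add: \<nu>_def)
  then have e'A: "e' \<in> carrier A" using e by (simp add: e'_def)
  have nM: "n x \<in> carrier M" if "x \<in> carrier M" for x
    using that e(1) RM.act_closed by (simp add: n_def)
  have \<nu>n: "\<nu> \<odot>\<^bsub>M\<^esub> x = n x" if x: "x \<in> carrier M" for x
    using x e(1) by (simp add: \<nu>_def n_def RM.M.minus_eq_add FA.minus_eq RM.act_distr_ring RM.neg_act RM.act_mult)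
  have e'x: "e' \<odot>\<^bsub>M\<^esub> x = e \<odot>\<^bsub>M\<^esub> x \<oplus>\<^bsub>M\<^esub> (n x \<ominus>\<^bsub>M\<^esub> (e \<odot>\<^bsub>M\<^esub> n x \<oplus>\<^bsub>M\<^esub> e \<odot>\<^bsub>M\<^esub> n x))"
    if x: "x \<in> carrier M" for x
    using x e(1) \<nu> nM[OF x]
    by (simp add: e'_def RM.M.minus_eq_add FA.minus_eq RM.act_distr_ring RM.neg_act RM.act_mult \<nu>n)
  have n_N: "n y \<in> N i" if "i < m" "y \<in> N (Suc i)" for i y
    unfolding n_def
    by (rule rank_one_on_idempotent[OF N N e(1)]) (use e(2) that in auto)
  have "rank_one_on (N i) (N (Suc i)) e'" if i: "i < m" for i
  proof (rule rank_one_on_cong[OF N N e(1) e'A])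
    fix y assume y: "y \<in> N (Suc i)"
    have Ni: "rsubmodule A M (N i)" using N i by simp
    have yM: "y \<in> carrier M" using RM.rsubmoduleD(1)[OF N[of "Suc i"]] i y by auto
    define w where "w = n y \<ominus>\<^bsub>M\<^esub> (e \<odot>\<^bsub>M\<^esub> n y \<oplus>\<^bsub>M\<^esub> e \<odot>\<^bsub>M\<^esub> n y)"
    have "w \<in> N i"
      using n_N[OF i y] RM.rsubmoduleD(3,4,6)[OF Ni] e(1) by (simp add: w_def)
    moreover have "w \<in> carrier M" using \<open>w \<in> N i\<close> RM.rsubmoduleD(1)[OF Ni] by blast
    moreover have "e \<odot>\<^bsub>M\<^esub> y \<in> carrier M" using e(1) yM RM.act_closed by simp
    ultimately show "e' \<odot>\<^bsub>M\<^esub> y \<ominus>\<^bsub>M\<^esub> e \<odot>\<^bsub>M\<^esub> y \<in> N i"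
      unfolding e'x[OF yM] w_def[symmetric]
      by (simp add: RM.M.minus_eq_add RM.M.a_comm[of "e \<odot>\<^bsub>M\<^esub> y" w] RM.M.a_assoc RM.M.r_neg)
  qed (use i e(2) in auto)
  moreover have "e' \<odot>\<^bsub>M\<^esub> (e' \<odot>\<^bsub>M\<^esub> x) = e' \<odot>\<^bsub>M\<^esub> x" if x: "x \<in> N (Suc k)" for x
  proof -
    have xM: "x \<in> carrier M" using RM.rsubmoduleD(1)[OF N[of "Suc k"]] Suc.prems x by auto
    define u where "u = e \<odot>\<^bsub>M\<^esub> x"
    define y where "y = n x"
    define v where "v = e \<odot>\<^bsub>M\<^esub> y"
    have Nk: "rsubmodule A M (N k)" using N Suc.prems by simp
    have yN: "y \<in> N k" using n_N[of k x] x Suc.prems by (simp add: y_def)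
    have vN: "v \<in> N k" using RM.rsubmoduleD(4)[OF Nk e(1) yN] by (simp add: v_def)
    have car: "u \<in> carrier M" "y \<in> carrier M" "v \<in> carrier M"
      using RM.rsubmoduleD(1)[OF Nk] yN vN e(1) xM RM.act_closed by (auto simp: u_def)
    have ev: "e \<odot>\<^bsub>M\<^esub> v = v" using idem yN by (simp add: v_def)
    have n0: "n z = \<zero>\<^bsub>M\<^esub>" if z: "z \<in> N k" for z
    proof -
      have "z \<in> carrier M" using RM.rsubmoduleD(1)[OF Nk] z by blast
      then show ?thesis
        using idem z RM.act_closed[OF e(1)] by (simp add: n_def RM.M.minus_eq_add RM.M.r_neg)
    qed
    have eu: "e \<odot>\<^bsub>M\<^esub> u = u \<oplus>\<^bsub>M\<^esub> y"
      using RM.M.add_diff_cancel[OF car(1) RM.act_closed[OF e(1) car(1)]] by (simp add: y_def n_def u_def)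
    have nu: "n u = v"
      using RM.act_minus[OF e(1), of "e \<odot>\<^bsub>M\<^esub> u" u] RM.act_closed[OF e(1)] car
      by (simp add: v_def y_def n_def u_def)
    have e'z: "e' \<odot>\<^bsub>M\<^esub> z = e \<odot>\<^bsub>M\<^esub> z" if z: "z \<in> N k" for z
    proof -
      have "z \<in> carrier M" using RM.rsubmoduleD(1)[OF Nk] z by blast
      then show ?thesis
        using n0[OF z] e(1) RM.act_closed[OF e(1)] by (simp add: e'x RM.M.minus_eq_add RM.M.neg_zero)
    qed
    have e'u: "e' \<odot>\<^bsub>M\<^esub> u = (u \<oplus>\<^bsub>M\<^esub> y) \<oplus>\<^bsub>M\<^esub> (v \<ominus>\<^bsub>M\<^esub> (v \<oplus>\<^bsub>M\<^esub> v))"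
      using e'x[OF car(1)] by (simp add: nu eu ev)
    have "e' \<odot>\<^bsub>M\<^esub> x = u \<oplus>\<^bsub>M\<^esub> (y \<ominus>\<^bsub>M\<^esub> (v \<oplus>\<^bsub>M\<^esub> v))"
      using e'x[OF xM] by (simp add: u_def y_def v_def)
    moreover have "e' \<odot>\<^bsub>M\<^esub> (u \<oplus>\<^bsub>M\<^esub> (y \<ominus>\<^bsub>M\<^esub> (v \<oplus>\<^bsub>M\<^esub> v))) =
        ((u \<oplus>\<^bsub>M\<^esub> y) \<oplus>\<^bsub>M\<^esub> (v \<ominus>\<^bsub>M\<^esub> (v \<oplus>\<^bsub>M\<^esub> v))) \<oplus>\<^bsub>M\<^esub> (v \<ominus>\<^bsub>M\<^esub> (v \<oplus>\<^bsub>M\<^esub> v))"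
      using car e'z[OF yN] e'z[OF vN] v_def ev
      by (simp add: RM.act_distr_module[OF e'A] RM.act_minus[OF e'A] e'u)
    ultimately show ?thesis using RM.M.lift_identity[OF car] by simp
  qed
  ultimately show ?case using e'A by blast
qed

end

section \<open>Reduction to a basic algebra\<close>

lemma (in abelian_group) add_diff_add:
  assumes "x \<in> carrier G" "y \<in> carrier G" "u \<in> carrier G" "v \<in> carrier G"
  shows "(x \<oplus> y) \<ominus> (u \<oplus> v) = (x \<ominus> u) \<oplus> (y \<ominus> v)"
  using assms by (simp add: minus_eq_add minus_add a_ac)

text \<open>
  A composition series \<open>N 0 \<subset> \<dots> \<subset> N m\<close> together with an element \<open>e\<close> acting as an idempotent on \<open>M\<close> and
  with rank one on every factor: \<open>M e\<close> is the image of \<open>M\<close> under the Morita reduction to a basic algebra.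
\<close>

locale basic_series = fd_module K A M
  for K :: "'k ring" and A :: "('k, 'a) module" and M :: "('a, 'm) module" +
  fixes N :: "nat \<Rightarrow> 'm set" and m :: nat and e :: 'a
  assumes N_sub: "i \<le> m \<Longrightarrow> rsubmodule A M (N i)"
    and N_0: "N 0 = {\<zero>\<^bsub>M\<^esub>}" and N_m: "N m = carrier M"
    and N_mono: "i < m \<Longrightarrow> N i \<subseteq> N (Suc i)"
    and N_trans: "i < m \<Longrightarrow> y \<in> N (Suc i) \<Longrightarrow> y \<notin> N i \<Longrightarrow> z \<in> N (Suc i) \<Longrightarrow>
      \<exists>a\<in>carrier A. a \<odot>\<^bsub>M\<^esub> y \<ominus>\<^bsub>M\<^esub> z \<in> N i"
    and e_closed: "e \<in> carrier A"
    and e_idem: "x \<in> carrier M \<Longrightarrow> e \<odot>\<^bsub>M\<^esub> (e \<odot>\<^bsub>M\<^esub> x) = e \<odot>\<^bsub>M\<^esub> x"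
    and e_rank: "i < m \<Longrightarrow> rank_one_on (N i) (N (Suc i)) e"
begin

definition V :: "'m set" where
  "V = {x \<in> carrier M. e \<odot>\<^bsub>M\<^esub> x = x}"

lemma V_M: "x \<in> V \<Longrightarrow> x \<in> carrier M"
  by (simp add: V_def)

lemma e_V: "x \<in> V \<Longrightarrow> e \<odot>\<^bsub>M\<^esub> x = x"
  by (simp add: V_def)

lemma V_closed:
  "\<zero>\<^bsub>M\<^esub> \<in> V" "x \<in> V \<Longrightarrow> y \<in> V \<Longrightarrow> x \<oplus>\<^bsub>M\<^esub> y \<in> V" "c \<in> carrier K \<Longrightarrow> x \<in> V \<Longrightarrow> sc c x \<in> V"
  "x \<in> V \<Longrightarrow> y \<in> V \<Longrightarrow> x \<ominus>\<^bsub>M\<^esub> y \<in> V" "x \<in> carrier M \<Longrightarrow> e \<odot>\<^bsub>M\<^esub> x \<in> V"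
  using e_closed e_idem
  by (auto simp: V_def RM.act_distr_module RM.act_minus RM.act_closed simp flip: sc_act)

lemma N_M: "i \<le> m \<Longrightarrow> x \<in> N i \<Longrightarrow> x \<in> carrier M"
  using RM.rsubmoduleD(1)[OF N_sub] by blast

lemma N_le: "i \<le> j \<Longrightarrow> j \<le> m \<Longrightarrow> N i \<subseteq> N j"
proof (induction rule: dec_induct)
  case (step j)
  then show ?case using N_mono[of j] by auto
qed simp

lemma V_generator:
  assumes "i < m"
  obtains b where "b \<in> V" "b \<in> N (Suc i)" "b \<notin> N i"
proof -
  obtain x where x: "x \<in> N (Suc i)" "x \<notin> N i" "e \<odot>\<^bsub>M\<^esub> x \<ominus>\<^bsub>M\<^esub> x \<in> N i"
    using e_rank[OF assms] unfolding rank_one_on_def by blast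
  have xM: "x \<in> carrier M" using N_M[of "Suc i"] x(1) assms by simp
  have "e \<odot>\<^bsub>M\<^esub> x \<notin> N i"
    using RM.diff_mem[OF N_sub _ xM x(3)] RM.act_closed[OF e_closed xM] x(2) assms by simp
  moreover have "e \<odot>\<^bsub>M\<^esub> x \<in> N (Suc i)"
    using RM.rsubmoduleD(4)[OF N_sub e_closed x(1)] assms by simp
  ultimately show ?thesis using that V_closed(5)[OF xM] by blast
qed

text \<open>Modulo \<open>N i\<close> both \<open>b\<close> and \<open>x\<close> are fixed by e,
  hence multiples of the same vector \<open>g\<close>, and the multiple for \<open>b\<close> is
  invertible. Together with \<open>V_generator\<close>, every layer contributes exactly one
  dimension to V.\<close>

lemma V_line:
  assumes i: "i < m" and b: "b \<in> V" "b \<in> N (Suc i)" "b \<notin> N i" and x: "x \<in> V" "x \<in> N (Suc i)"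
  shows "\<exists>c\<in>carrier K. x \<ominus>\<^bsub>M\<^esub> sc c b \<in> N i"
proof -
  have Ni: "rsubmodule A M (N i)" using N_sub i by simp
  obtain g where g: "g \<in> N (Suc i)" "\<forall>y\<in>N (Suc i). \<exists>c\<in>carrier K. e \<odot>\<^bsub>M\<^esub> y \<ominus>\<^bsub>M\<^esub> sc c g \<in> N i"
    using e_rank[OF i] unfolding rank_one_on_def by blast
  have gM: "g \<in> carrier M" using N_M[of "Suc i"] g(1) i by simp
  note bM = V_M[OF b(1)] and xM = V_M[OF x(1)]
  obtain c where c: "c \<in> carrier K" "b \<ominus>\<^bsub>M\<^esub> sc c g \<in> N i" using g(2) b(2) e_V[OF b(1)] by force
  obtain d where d: "d \<in> carrier K" "x \<ominus>\<^bsub>M\<^esub> sc d g \<in> N i" using g(2) x(2) e_V[OF x(1)] by force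
  have c0: "c \<noteq> \<zero>\<^bsub>K\<^esub>"
  proof
    assume "c = \<zero>\<^bsub>K\<^esub>"
    then have "b \<in> N i" using c(2) bM gM by (simp add: RM.M.minus_eq_add RM.M.neg_zero)
    with b(3) show False ..
  qed
  note ci = sc_inverse[OF c(1) c0]
  have cb: "sc (inv\<^bsub>K\<^esub> c) b \<ominus>\<^bsub>M\<^esub> g \<in> N i"
  proof -
    have "sc (inv\<^bsub>K\<^esub> c) (b \<ominus>\<^bsub>M\<^esub> sc c g) \<in> N i" by (rule sc_rsubmodule[OF Ni ci(1)[OF gM] c(2)])
    moreover have "sc (inv\<^bsub>K\<^esub> c) (b \<ominus>\<^bsub>M\<^esub> sc c g) = sc (inv\<^bsub>K\<^esub> c) b \<ominus>\<^bsub>M\<^esub> sc (inv\<^bsub>K\<^esub> c) (sc c g)"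
      unfolding sc_def[of "inv\<^bsub>K\<^esub> c"]
      by (rule RM.act_minus) (use scalar_in_algebra[OF ci(1)[OF gM]] bM gM c(1) in auto)
    ultimately show ?thesis using ci(2)[OF gM] by simp
  qed
  define k where "k = d \<otimes>\<^bsub>K\<^esub> inv\<^bsub>K\<^esub> c"
  have k: "k \<in> carrier K" using d(1) ci(1)[OF gM] by (simp add: k_def)
  have "sc d (sc (inv\<^bsub>K\<^esub> c) b \<ominus>\<^bsub>M\<^esub> g) \<in> N i" by (rule sc_rsubmodule[OF Ni d(1) cb])
  moreover have "sc d (sc (inv\<^bsub>K\<^esub> c) b \<ominus>\<^bsub>M\<^esub> g) = sc d (sc (inv\<^bsub>K\<^esub> c) b) \<ominus>\<^bsub>M\<^esub> sc d g"
    unfolding sc_def[of d]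
    by (rule RM.act_minus) (use scalar_in_algebra[OF d(1)] bM gM ci(1)[OF gM] in auto)
  ultimately have "sc k b \<ominus>\<^bsub>M\<^esub> sc d g \<in> N i"
    using sc_assoc[OF d(1) ci(1)[OF gM] bM] by (simp add: k_def)
  then have "sc d g \<ominus>\<^bsub>M\<^esub> sc k b \<in> N i"
    using RM.diff_sym[OF Ni sc_closed[OF k bM] sc_closed[OF d(1) gM]] by simp
  then have "x \<ominus>\<^bsub>M\<^esub> sc k b \<in> N i"
    by (rule RM.diff_trans[OF Ni xM sc_closed[OF d(1) gM] sc_closed[OF k bM] d(2)])
  with k show ?thesis by blast
qed

text \<open>Layer by layer: an element y of Y that is new in layer i is moved to a generator in V
  modulo \<open>N i\<close>, and e turns the result into an element of Y \<inter> V, hence of X,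
  still outside \<open>N i\<close>. Moving back recovers y up to an element of Y \<inter> N i, which
  is in X by induction.\<close>

lemma rsubmodule_determined:
  assumes X: "rsubmodule A M X" and Y: "rsubmodule A M Y" and XY: "X \<subseteq> Y" and V: "Y \<inter> V \<subseteq> X"
  shows "Y = X"
proof -
  note DX = RM.rsubmoduleD[OF X] and DY = RM.rsubmoduleD[OF Y]
  have "Y \<inter> N i \<subseteq> X" if "i \<le> m" for i
    using that
  proof (induction i)
    case 0
    then show ?case using DX(2) by (auto simp: N_0)
  next
    case (Suc i)
    have i: "i < m" and IH: "Y \<inter> N i \<subseteq> X" using Suc by auto
    have Ni: "rsubmodule A M (N i)" and NSi: "rsubmodule A M (N (Suc i))" using N_sub i by simp_all
    note D = RM.rsubmoduleD[OF Ni] and DS = RM.rsubmoduleD[OF NSi]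
    show ?case
    proof
      fix y assume y: "y \<in> Y \<inter> N (Suc i)"
      then have yM: "y \<in> carrier M" using DY(1) by blast
      show "y \<in> X"
      proof (cases "y \<in> N i")
        case True
        with y IH show ?thesis by blast
      next
        case False
        obtain b where b: "b \<in> V" "b \<in> N (Suc i)" "b \<notin> N i" using V_generator[OF i] .
        note bM = V_M[OF b(1)]
        obtain a where a: "a \<in> carrier A" "a \<odot>\<^bsub>M\<^esub> y \<ominus>\<^bsub>M\<^esub> b \<in> N i"
          using N_trans[OF i _ False b(2)] y by blast
        define x where "x = e \<odot>\<^bsub>M\<^esub> (a \<odot>\<^bsub>M\<^esub> y)"
        have ayM: "a \<odot>\<^bsub>M\<^esub> y \<in> carrier M" using a(1) yM RM.act_closed by simp
        have xV: "x \<in> V" unfolding x_def by (rule V_closed(5)[OF ayM])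
        have "e \<odot>\<^bsub>M\<^esub> (a \<odot>\<^bsub>M\<^esub> y \<ominus>\<^bsub>M\<^esub> b) \<in> N i" by (rule D(4)[OF e_closed a(2)])
        then have "x \<ominus>\<^bsub>M\<^esub> b \<in> N i"
          using RM.act_minus[OF e_closed ayM bM] e_V[OF b(1)] by (simp add: x_def)
        then have xN: "x \<notin> N i" using RM.diff_mem[OF Ni V_M[OF xV] bM] b(3) by blast
        have "x \<in> Y" using y DY(4) a(1) e_closed by (simp add: x_def)
        then have xX: "x \<in> X" using V xV by blast
        have xS: "x \<in> N (Suc i)" using y DS(4) a(1) e_closed by (simp add: x_def)
        obtain a' where a': "a' \<in> carrier A" "a' \<odot>\<^bsub>M\<^esub> x \<ominus>\<^bsub>M\<^esub> y \<in> N i"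
          using N_trans[OF i xS xN] y by blast
        have a'x: "a' \<odot>\<^bsub>M\<^esub> x \<in> X" by (rule DX(4)[OF a'(1) xX])
        then have "a' \<odot>\<^bsub>M\<^esub> x \<ominus>\<^bsub>M\<^esub> y \<in> X" using IH a'(2) XY DY(6) y by blast
        then show "y \<in> X" using RM.diff_mem[OF X _ yM] a'x DX(1) by blast
      qed
    qed
  qed
  from this[of m] show ?thesis using N_m DY(1) XY by auto
qed

lemma rsubmodule_eqI:
  assumes X: "rsubmodule A M X" and Y: "rsubmodule A M Y" and V: "X \<inter> V = Y \<inter> V"
  shows "X = Y"
proof -
  have "rsubmodule A M (X \<inter> Y)"
    by (rule RM.rsubmoduleI) (use RM.rsubmoduleD[OF X] RM.rsubmoduleD[OF Y] in auto)
  note det = rsubmodule_determined[OF this]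
  have "X = X \<inter> Y" by (rule det[OF X]) (use V in auto)
  moreover have "Y = X \<inter> Y" by (rule det[OF Y]) (use V in auto)
  ultimately show ?thesis by simp
qed

text \<open>In right-module notation y a e; on V = M e this is the action of e a e.\<close>

definition T :: "'a \<Rightarrow> 'm \<Rightarrow> 'm" where
  "T a y = e \<odot>\<^bsub>M\<^esub> (a \<odot>\<^bsub>M\<^esub> y)"

lemma T_V: "a \<in> carrier A \<Longrightarrow> y \<in> carrier M \<Longrightarrow> T a y \<in> V"
  unfolding T_def by (intro V_closed(5) RM.act_closed)

lemma T_add: "a \<in> carrier A \<Longrightarrow> x \<in> carrier M \<Longrightarrow> y \<in> carrier M \<Longrightarrow> T a (x \<oplus>\<^bsub>M\<^esub> y) = T a x \<oplus>\<^bsub>M\<^esub> T a y"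
  unfolding T_def by (simp add: RM.act_distr_module RM.act_closed e_closed)

lemma T_sc: "a \<in> carrier A \<Longrightarrow> c \<in> carrier K \<Longrightarrow> x \<in> carrier M \<Longrightarrow> T a (sc c x) = sc c (T a x)"
  unfolding T_def by (simp add: sc_act RM.act_closed e_closed)

lemma T_rsubmodule: "rsubmodule A M U \<Longrightarrow> a \<in> carrier A \<Longrightarrow> x \<in> U \<Longrightarrow> T a x \<in> U"
  unfolding T_def by (intro RM.rsubmoduleD(4) e_closed)

text \<open>The elements z with z A e inside U form a submodule that contains U and has no further
  elements of V, so it equals U.\<close>

lemma all_T_mem:
  assumes U: "rsubmodule A M U" and z: "z \<in> carrier M" and T: "\<And>a. a \<in> carrier A \<Longrightarrow> T a z \<in> U"
  shows "z \<in> U"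
proof -
  define Y where "Y = {z \<in> carrier M. \<forall>a\<in>carrier A. T a z \<in> U}"
  note D = RM.rsubmoduleD[OF U]
  have "rsubmodule A M Y"
  proof (rule RM.rsubmoduleI)
    show "\<zero>\<^bsub>M\<^esub> \<in> Y" using D(2) e_closed by (simp add: Y_def T_def)
    show "x \<oplus>\<^bsub>M\<^esub> y \<in> Y" if "x \<in> Y" "y \<in> Y" for x y
      using that D(3) by (simp add: Y_def T_add)
    show "b \<odot>\<^bsub>M\<^esub> x \<in> Y" if "b \<in> carrier A" "x \<in> Y" for b x
    proof -
      have "T a (b \<odot>\<^bsub>M\<^esub> x) = T (b \<otimes>\<^bsub>A\<^esub> a) x" if "a \<in> carrier A" for a
        using \<open>b \<in> carrier A\<close> \<open>x \<in> Y\<close> that by (simp add: T_def Y_def RM.act_mult)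
      then show ?thesis using that by (simp add: Y_def RM.act_closed)
    qed
  qed (auto simp: Y_def)
  moreover have "U \<subseteq> Y" using D(1) T_rsubmodule[OF U] by (auto simp: Y_def)
  moreover have "Y \<inter> V \<subseteq> U"
  proof
    fix y assume y: "y \<in> Y \<inter> V"
    then have "T \<one>\<^bsub>A\<^esub> y \<in> U" by (simp add: Y_def)
    then show "y \<in> U" using y e_V[of y] V_M[of y] by (simp add: T_def RM.act_one)
  qed
  ultimately have "Y = U" by (intro rsubmodule_determined[OF U])
  then show ?thesis using z T by (auto simp: Y_def)
qed

text \<open>The submodule of U x M generated by the pairs (w, \<Psi> w) with w in U e and by 0 x U.
  It is the graph of the extension of \<Psi> to a map into M / U, available before that map is known
  to be well defined on sums of elements w a.\<close>

inductive hom_graph :: "'m set \<Rightarrow> ('m \<Rightarrow> 'm) \<Rightarrow> 'm \<Rightarrow> 'm \<Rightarrow> bool" for U \<Psi> where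
  base: "w \<in> U \<Longrightarrow> w \<in> V \<Longrightarrow> hom_graph U \<Psi> w (\<Psi> w)"
| zero: "u \<in> U \<Longrightarrow> hom_graph U \<Psi> \<zero>\<^bsub>M\<^esub> u"
| add: "hom_graph U \<Psi> x y \<Longrightarrow> hom_graph U \<Psi> x' y' \<Longrightarrow> hom_graph U \<Psi> (x \<oplus>\<^bsub>M\<^esub> x') (y \<oplus>\<^bsub>M\<^esub> y')"
| act: "hom_graph U \<Psi> x y \<Longrightarrow> a \<in> carrier A \<Longrightarrow> hom_graph U \<Psi> (a \<odot>\<^bsub>M\<^esub> x) (a \<odot>\<^bsub>M\<^esub> y)"

text \<open>\<open>\<Psi>\<close> is a homomorphism \<open>U e \<rightarrow> M e / U e\<close> of \<open>e A e\<close>-modules; since \<open>U = U e A\<close>, it extends to \<open>U \<rightarrow> M / U\<close>.\<close>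

lemma hom_orthogonal_V:
  assumes orth: "hom_orthogonal A M U"
    and \<Psi>: "\<And>y. y \<in> U \<Longrightarrow> y \<in> V \<Longrightarrow> \<Psi> y \<in> V"
      "\<And>x y. x \<in> U \<Longrightarrow> x \<in> V \<Longrightarrow> y \<in> U \<Longrightarrow> y \<in> V \<Longrightarrow> \<Psi> (x \<oplus>\<^bsub>M\<^esub> y) = \<Psi> x \<oplus>\<^bsub>M\<^esub> \<Psi> y"
    and equivariant: "\<And>a y. a \<in> carrier A \<Longrightarrow> y \<in> U \<Longrightarrow> y \<in> V \<Longrightarrow> T a (\<Psi> y) \<ominus>\<^bsub>M\<^esub> \<Psi> (T a y) \<in> U"
    and w: "w \<in> U" "w \<in> V"
  shows "\<Psi> w \<in> U"
proof -
  let ?G = "hom_graph U \<Psi>"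
  have U: "rsubmodule A M U" using orth by (simp add: hom_orthogonal_def)
  note D = RM.rsubmoduleD[OF U]
  have \<Psi>0: "\<Psi> \<zero>\<^bsub>M\<^esub> = \<zero>\<^bsub>M\<^esub>"
    using \<Psi>(2)[OF D(2) V_closed(1) D(2) V_closed(1)] V_M[OF \<Psi>(1)[OF D(2) V_closed(1)]]
      RM.M.add.l_cancel_one[of "\<Psi> \<zero>\<^bsub>M\<^esub>" "\<Psi> \<zero>\<^bsub>M\<^esub>"] by simp
  have G_mem: "x \<in> U \<and> y \<in> carrier M" if "?G x y" for x y
    using that
    by induction (use D V_M[OF \<Psi>(1)] RM.act_closed in auto)
  \<comment> \<open>The invariant that makes the graph single-valued modulo U: after compression by
    e, second components agree with \<Psi> of first components. For first component zero it puts all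
    compressions of z into U, and \<open>all_T_mem\<close> applies.\<close>
  have G_T: "\<forall>a\<in>carrier A. T a y \<ominus>\<^bsub>M\<^esub> \<Psi> (T a x) \<in> U" if "?G x y" for x y
    using that
  proof induction
    case (base w)
    then show ?case using equivariant by blast
  next
    case (zero u)
    have "T a \<zero>\<^bsub>M\<^esub> = \<zero>\<^bsub>M\<^esub>" if "a \<in> carrier A" for a using that e_closed by (simp add: T_def)
    moreover have "T a u \<ominus>\<^bsub>M\<^esub> \<zero>\<^bsub>M\<^esub> \<in> U" if "a \<in> carrier A" for a
      using T_rsubmodule[OF U that zero] by (rule D(6)[OF _ D(2)])
    ultimately show ?case by (simp add: \<Psi>0)
  next
    case (add x y x' y')
    show ?case
    proof
      fix a assume a: "a \<in> carrier A"
      have x: "x \<in> U" "x' \<in> U" "y \<in> carrier M" "y' \<in> carrier M" "x \<in> carrier M" "x' \<in> carrier M"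
        using G_mem add.hyps D(1) by blast+
      have TU: "T a x \<in> U" "T a x' \<in> U" using T_rsubmodule[OF U a] x by auto
      have TV: "T a x \<in> V" "T a x' \<in> V" "T a y \<in> V" "T a y' \<in> V" using T_V[OF a] x by auto
      have *: "T a (y \<oplus>\<^bsub>M\<^esub> y') \<ominus>\<^bsub>M\<^esub> \<Psi> (T a (x \<oplus>\<^bsub>M\<^esub> x')) =
          (T a y \<ominus>\<^bsub>M\<^esub> \<Psi> (T a x)) \<oplus>\<^bsub>M\<^esub> (T a y' \<ominus>\<^bsub>M\<^esub> \<Psi> (T a x'))"
        unfolding T_add[OF a x(3,4)] T_add[OF a x(5,6)] \<Psi>(2)[OF TU(1) TV(1) TU(2) TV(2)]
        by (rule RM.M.add_diff_add) (intro V_M TV \<Psi>(1) TU)+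
      show "T a (y \<oplus>\<^bsub>M\<^esub> y') \<ominus>\<^bsub>M\<^esub> \<Psi> (T a (x \<oplus>\<^bsub>M\<^esub> x')) \<in> U"
        unfolding * using D(3) add.IH a by blast
    qed
  next
    case (act x y b)
    show ?case
    proof
      fix a assume a: "a \<in> carrier A"
      have xy: "x \<in> carrier M" "y \<in> carrier M" using G_mem[OF act.hyps(1)] D(1) by auto
      have "T a (b \<odot>\<^bsub>M\<^esub> z) = T (b \<otimes>\<^bsub>A\<^esub> a) z" if "z \<in> carrier M" for z
        using that a act.hyps(2) by (simp add: T_def RM.act_mult)
      then show "T a (b \<odot>\<^bsub>M\<^esub> y) \<ominus>\<^bsub>M\<^esub> \<Psi> (T a (b \<odot>\<^bsub>M\<^esub> x)) \<in> U"
        using act.IH a act.hyps(2) xy by simp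
    qed
  qed
  have G_zero: "z \<in> U" if z: "?G \<zero>\<^bsub>M\<^esub> z" for z
  proof (rule all_T_mem[OF U])
    show zM: "z \<in> carrier M" using G_mem[OF z] by simp
    fix a assume a: "a \<in> carrier A"
    have "T a \<zero>\<^bsub>M\<^esub> = \<zero>\<^bsub>M\<^esub>" using a e_closed by (simp add: T_def)
    then show "T a z \<in> U"
      using bspec[OF G_T[OF z] a] V_M[OF T_V[OF a zM]] by (simp add: \<Psi>0 RM.M.minus_eq_add RM.M.neg_zero)
  qed
  have G_diff: "?G (x \<ominus>\<^bsub>M\<^esub> x') (y \<ominus>\<^bsub>M\<^esub> y')" if xy: "?G x y" "?G x' y'" for x y x' y'
  proof -
    have one: "\<ominus>\<^bsub>A\<^esub> \<one>\<^bsub>A\<^esub> \<in> carrier A" by simp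
    have "(\<ominus>\<^bsub>A\<^esub> \<one>\<^bsub>A\<^esub>) \<odot>\<^bsub>M\<^esub> z = \<ominus>\<^bsub>M\<^esub> z" if "z \<in> carrier M" for z
      using that by (simp add: RM.neg_act RM.act_one)
    then show ?thesis
      using hom_graph.add[OF xy(1) hom_graph.act[OF xy(2) one]] G_mem[OF xy(2)] D(1)
      by (auto simp: RM.M.minus_eq_add)
  qed
  have G_unique: "y \<ominus>\<^bsub>M\<^esub> y' \<in> U" if xy: "?G x y" "?G x y'" for x y y'
    using G_zero G_diff[OF xy] G_mem[OF xy(1)] D(1) by (auto simp: RM.M.minus_eq_add RM.M.r_neg)
  \<comment> \<open>The domain of the graph is a submodule of U containing U \<inter> V, so it is
    all of U.\<close>
  have "U = {x \<in> U. \<exists>y. ?G x y}"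
  proof (rule rsubmodule_determined[OF _ U])
    show "rsubmodule A M {x \<in> U. \<exists>y. ?G x y}"
      by (rule RM.rsubmoduleI) (use D in \<open>auto intro: hom_graph.intros\<close>)
  qed (auto intro: hom_graph.base)
  then have G_total: "\<exists>y. ?G x y" if "x \<in> U" for x using that by blast
  define f where "f x = (SOME y. ?G x y)" for x
  have f: "?G x (f x)" if "x \<in> U" for x
    unfolding f_def by (rule someI_ex[OF G_total[OF that]])
  have fM: "f x \<in> carrier M" if "x \<in> U" for x using G_mem[OF f[OF that]] by simp
  have "hom_mod A M U M U f"
    unfolding hom_mod_def
  proof (intro conjI ballI)
    show "f x \<in> carrier M" if "x \<in> U" for x by (rule fM[OF that])
    show "U +>\<^bsub>M\<^esub> f (x \<oplus>\<^bsub>M\<^esub> y) = U +>\<^bsub>M\<^esub> (f x \<oplus>\<^bsub>M\<^esub> f y)" if xy: "x \<in> U" "y \<in> U" for x y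
      using G_unique[OF f[OF D(3)[OF xy]] hom_graph.add[OF f[OF xy(1)] f[OF xy(2)]]]
        RM.coset_eq_iff[OF U fM[OF D(3)[OF xy]]] fM xy by simp
    show "U +>\<^bsub>M\<^esub> f (a \<odot>\<^bsub>M\<^esub> x) = U +>\<^bsub>M\<^esub> (a \<odot>\<^bsub>M\<^esub> f x)" if ax: "a \<in> carrier A" "x \<in> U" for a x
      using G_unique[OF f[OF D(4)[OF ax]] hom_graph.act[OF f[OF ax(2)] ax(1)]]
        RM.coset_eq_iff[OF U fM[OF D(4)[OF ax]]] fM RM.act_closed ax by simp
  qed
  then have "f w \<in> U" using orth w(1) by (simp add: hom_orthogonal_def)
  then show ?thesis
    using RM.diff_mem[OF U fM[OF w(1)] V_M[OF \<Psi>(1)[OF w]]] G_unique[OF f[OF w(1)] hom_graph.base[OF w]] by blast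
qed

end

section \<open>Coordinates and charts\<close>

text \<open>Stated for a closed subset D of the carrier because maps such as \<open>coord\<close>
  are known to be additive on V only.\<close>

lemma finsum_additive:
  fixes G :: "('g, 'x) ring_scheme" and H :: "('h, 'y) ring_scheme"
  assumes "abelian_monoid G" "abelian_monoid H"
    and D: "D \<subseteq> carrier G" "\<zero>\<^bsub>G\<^esub> \<in> D" "\<And>x y. x \<in> D \<Longrightarrow> y \<in> D \<Longrightarrow> x \<oplus>\<^bsub>G\<^esub> y \<in> D"
    and \<phi>: "\<And>x. x \<in> D \<Longrightarrow> \<phi> x \<in> carrier H" "\<phi> \<zero>\<^bsub>G\<^esub> = \<zero>\<^bsub>H\<^esub>"
      "\<And>x y. x \<in> D \<Longrightarrow> y \<in> D \<Longrightarrow> \<phi> (x \<oplus>\<^bsub>G\<^esub> y) = \<phi> x \<oplus>\<^bsub>H\<^esub> \<phi> y"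
    and S: "finite S" "\<And>s. s \<in> S \<Longrightarrow> f s \<in> D"
  shows "(\<Oplus>\<^bsub>G\<^esub>s\<in>S. f s) \<in> D" "\<phi> (\<Oplus>\<^bsub>G\<^esub>s\<in>S. f s) = (\<Oplus>\<^bsub>H\<^esub>s\<in>S. \<phi> (f s))"
proof -
  interpret G: abelian_monoid G by fact
  interpret H: abelian_monoid H by fact
  have "(\<Oplus>\<^bsub>G\<^esub>s\<in>S. f s) \<in> D \<and> \<phi> (\<Oplus>\<^bsub>G\<^esub>s\<in>S. f s) = (\<Oplus>\<^bsub>H\<^esub>s\<in>S. \<phi> (f s))"
    using S
  proof (induction S rule: finite_induct)
    case empty
    then show ?case using D(2) \<phi>(2) by simp
  next
    case (insert s S)
    have fs: "f s \<in> D" and IH: "(\<Oplus>\<^bsub>G\<^esub>s\<in>S. f s) \<in> D" "\<phi> (\<Oplus>\<^bsub>G\<^esub>s\<in>S. f s) = (\<Oplus>\<^bsub>H\<^esub>s\<in>S. \<phi> (f s))"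
      using insert by auto
    have f: "f \<in> S \<rightarrow> carrier G" "f s \<in> carrier G" using insert.prems D(1) by auto
    have \<phi>f: "(\<lambda>s. \<phi> (f s)) \<in> S \<rightarrow> carrier H" "\<phi> (f s) \<in> carrier H" using insert.prems \<phi>(1) by auto
    show ?case
      unfolding G.finsum_insert[OF insert.hyps f] H.finsum_insert[OF insert.hyps \<phi>f]
      using D(3)[OF fs IH(1)] \<phi>(3)[OF fs IH(1)] IH(2) by simp
  qed
  then show "(\<Oplus>\<^bsub>G\<^esub>s\<in>S. f s) \<in> D" "\<phi> (\<Oplus>\<^bsub>G\<^esub>s\<in>S. f s) = (\<Oplus>\<^bsub>H\<^esub>s\<in>S. \<phi> (f s))" by auto
qed

context fd_module begin

lemma finsum_in_rsubmodule:
  assumes "rsubmodule A M U" "finite S" "\<And>s. s \<in> S \<Longrightarrow> f s \<in> U"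
  shows "(\<Oplus>\<^bsub>M\<^esub>s\<in>S. f s) \<in> U"
  by (rule finsum_additive(1)[where \<phi> = "\<lambda>x. x" and H = M, OF RM.M.abelian_monoid_axioms RM.M.abelian_monoid_axioms])
    (use RM.rsubmoduleD(1-3)[OF assms(1)] assms(2,3) in auto)

lemma act_finsum:
  assumes "a \<in> carrier A" "finite S" "\<And>s. s \<in> S \<Longrightarrow> f s \<in> carrier M"
  shows "a \<odot>\<^bsub>M\<^esub> (\<Oplus>\<^bsub>M\<^esub>s\<in>S. f s) = (\<Oplus>\<^bsub>M\<^esub>s\<in>S. a \<odot>\<^bsub>M\<^esub> f s)"
  by (rule finsum_additive(2)[where D = "carrier M", OF RM.M.abelian_monoid_axioms RM.M.abelian_monoid_axioms])
    (use assms in \<open>auto simp: RM.act_closed RM.act_distr_module\<close>)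

lemma sc_minus:
  "c \<in> carrier K \<Longrightarrow> x \<in> carrier M \<Longrightarrow> y \<in> carrier M \<Longrightarrow> sc c (x \<ominus>\<^bsub>M\<^esub> y) = sc c x \<ominus>\<^bsub>M\<^esub> sc c y"
  unfolding sc_def by (intro RM.act_minus scalar_in_algebra)

lemma sc_finsum:
  assumes "c \<in> carrier K" "finite S" "\<And>s. s \<in> S \<Longrightarrow> f s \<in> carrier M"
  shows "sc c (\<Oplus>\<^bsub>M\<^esub>s\<in>S. f s) = (\<Oplus>\<^bsub>M\<^esub>s\<in>S. sc c (f s))"
  unfolding sc_def by (rule act_finsum[OF scalar_in_algebra]) (use assms in auto)

end

text \<open>One vector of V from each layer. Since V has one dimension per layer, these are a basis
  of V; \<open>lc_eq_zero\<close> and \<open>expansion\<close> are independence and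
  spanning.\<close>

locale adapted_basis = basic_series K A M N m e
  for K :: "'k ring" and A :: "('k, 'a) module" and M :: "('a, 'm) module" and N m e +
  fixes b :: "nat \<Rightarrow> 'm"
  assumes b_V: "i < m \<Longrightarrow> b i \<in> V" and b_N: "i < m \<Longrightarrow> b i \<in> N (Suc i)" and b_not_N: "i < m \<Longrightarrow> b i \<notin> N i"
begin

definition lc :: "nat set \<Rightarrow> (nat \<Rightarrow> 'k) \<Rightarrow> 'm" where
  "lc S c = (\<Oplus>\<^bsub>M\<^esub>i\<in>S. sc (c i) (b i))"

lemma V_finsum:
  assumes "finite S" "\<And>s. s \<in> S \<Longrightarrow> f s \<in> V"
  shows "(\<Oplus>\<^bsub>M\<^esub>s\<in>S. f s) \<in> V"
  by (rule finsum_additive(1)[where \<phi> = "\<lambda>x. x" and H = M, OF RM.M.abelian_monoid_axioms RM.M.abelian_monoid_axioms])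
    (use V_closed(1,2) V_M assms in auto)

lemma lc_V: "S \<subseteq> {..<m} \<Longrightarrow> (\<And>i. i \<in> S \<Longrightarrow> c i \<in> carrier K) \<Longrightarrow> lc S c \<in> V"
  unfolding lc_def by (rule V_finsum) (auto intro!: V_closed(3) b_V intro: finite_subset)

lemma lc_cong:
  assumes "S \<subseteq> {..<m}" "\<And>i. i \<in> S \<Longrightarrow> d i \<in> carrier K" "\<And>i. i \<in> S \<Longrightarrow> c i = d i"
  shows "lc S c = lc S d"
  unfolding lc_def by (rule RM.M.finsum_cong') (use assms V_M[OF b_V] in auto)

text \<open>Take the largest index with nonzero coefficient: all other terms lie in
  \<open>N i\<close>, and the leading term does not because its coefficient is invertible.\<close>

lemma lc_top:
  assumes S: "S \<subseteq> {..<m}" and c: "\<And>i. i \<in> S \<Longrightarrow> c i \<in> carrier K" and nonzero: "i \<in> S" "c i \<noteq> \<zero>\<^bsub>K\<^esub>"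
  shows "\<exists>i\<in>S. c i \<noteq> \<zero>\<^bsub>K\<^esub> \<and> lc S c \<in> N (Suc i) \<and> lc S c \<notin> N i"
proof -
  have fin: "finite S" using S finite_subset by blast
  define i where "i = Max {i \<in> S. c i \<noteq> \<zero>\<^bsub>K\<^esub>}"
  have "{i \<in> S. c i \<noteq> \<zero>\<^bsub>K\<^esub>} \<noteq> {}" "finite {i \<in> S. c i \<noteq> \<zero>\<^bsub>K\<^esub>}" using nonzero fin by auto
  from Max_in[OF this(2,1)] Max_ge[OF this(2)]
  have i: "i \<in> S" "c i \<noteq> \<zero>\<^bsub>K\<^esub>" and max: "\<And>j. j \<in> S \<Longrightarrow> c j \<noteq> \<zero>\<^bsub>K\<^esub> \<Longrightarrow> j \<le> i"
    unfolding i_def by auto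
  have im: "i < m" using i S by auto
  have Ni: "rsubmodule A M (N i)" and NS: "rsubmodule A M (N (Suc i))" using N_sub im by auto
  have bM: "b j \<in> carrier M" if "j \<in> S" for j using V_M b_V that S by blast
  have rest: "(\<Oplus>\<^bsub>M\<^esub>j\<in>S - {i}. sc (c j) (b j)) \<in> N i"
  proof (rule finsum_in_rsubmodule[OF Ni])
    fix j assume j: "j \<in> S - {i}"
    show "sc (c j) (b j) \<in> N i"
    proof (cases "c j = \<zero>\<^bsub>K\<^esub>")
      case True
      then show ?thesis using bM j RM.rsubmoduleD(2)[OF Ni] by simp
    next
      case False
      then have ji: "j < i" using max[of j] j by auto
      then have "b j \<in> N i" using b_N[of j] N_le[of "Suc j" i] im by auto
      then show ?thesis using sc_rsubmodule[OF Ni c] j by blast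
    qed
  qed (use fin in simp)
  have "lc S c = sc (c i) (b i) \<oplus>\<^bsub>M\<^esub> (\<Oplus>\<^bsub>M\<^esub>j\<in>S - {i}. sc (c j) (b j))"
  proof -
    have "S = insert i (S - {i})" using i by auto
    then have "lc S c = (\<Oplus>\<^bsub>M\<^esub>j\<in>insert i (S - {i}). sc (c j) (b j))" by (simp add: lc_def)
    also have "\<dots> = sc (c i) (b i) \<oplus>\<^bsub>M\<^esub> (\<Oplus>\<^bsub>M\<^esub>j\<in>S - {i}. sc (c j) (b j))"
      by (rule RM.M.finsum_insert) (use fin i c bM in auto)
    finally show ?thesis .
  qed
  moreover have top: "sc (c i) (b i) \<in> N (Suc i)" using sc_rsubmodule[OF NS c[OF i(1)] b_N[OF im]] .
  moreover have "sc (c i) (b i) \<notin> N i"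
  proof
    assume "sc (c i) (b i) \<in> N i"
    then have "sc (inv\<^bsub>K\<^esub> c i) (sc (c i) (b i)) \<in> N i"
      using sc_rsubmodule[OF Ni] sc_inverse(1)[OF c[OF i(1)] i(2) bM[OF i(1)]] by blast
    then show False using sc_inverse(2)[OF c[OF i(1)] i(2) bM[OF i(1)]] b_not_N[OF im] by simp
  qed
  ultimately have eq: "lc S c = sc (c i) (b i) \<oplus>\<^bsub>M\<^esub> (\<Oplus>\<^bsub>M\<^esub>j\<in>S - {i}. sc (c j) (b j))"
    "sc (c i) (b i) \<in> N (Suc i)" "sc (c i) (b i) \<notin> N i" by auto
  have "lc S c \<in> N (Suc i)"
    unfolding eq(1) using RM.rsubmoduleD(3)[OF NS eq(2)] rest N_mono[OF im] by blast
  moreover have "lc S c \<notin> N i"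
  proof
    assume "lc S c \<in> N i"
    then have "lc S c \<ominus>\<^bsub>M\<^esub> (\<Oplus>\<^bsub>M\<^esub>j\<in>S - {i}. sc (c j) (b j)) \<in> N i" by (rule RM.rsubmoduleD(6)[OF Ni _ rest])
    moreover have "lc S c \<ominus>\<^bsub>M\<^esub> (\<Oplus>\<^bsub>M\<^esub>j\<in>S - {i}. sc (c j) (b j)) = sc (c i) (b i)"
      using N_M[OF _ rest] N_M[OF _ eq(2)] im
      by (simp add: eq(1) RM.M.minus_eq_add RM.M.a_assoc RM.M.r_neg)
    ultimately show False using eq(3) by simp
  qed
  ultimately show ?thesis using i(1,2) by blast
qed

lemma lc_eq_zero:
  assumes "S \<subseteq> {..<m}" "\<And>i. i \<in> S \<Longrightarrow> c i \<in> carrier K" "lc S c = \<zero>\<^bsub>M\<^esub>" "i \<in> S"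
  shows "c i = \<zero>\<^bsub>K\<^esub>"
proof (rule ccontr)
  assume "c i \<noteq> \<zero>\<^bsub>K\<^esub>"
  from lc_top[of S c i, OF assms(1,2,4) this] obtain j where "j \<in> S" "lc S c \<notin> N j" by blast
  moreover have "j \<le> m" using assms(1) \<open>j \<in> S\<close> by auto
  ultimately show False using assms(3) RM.rsubmoduleD(2)[OF N_sub[of j]] by simp
qed

lemma lc_add:
  assumes "S \<subseteq> {..<m}" "\<And>i. i \<in> S \<Longrightarrow> c i \<in> carrier K" "\<And>i. i \<in> S \<Longrightarrow> d i \<in> carrier K"
  shows "lc S (\<lambda>i. c i \<oplus>\<^bsub>K\<^esub> d i) = lc S c \<oplus>\<^bsub>M\<^esub> lc S d"
proof -
  have bM: "b i \<in> carrier M" if "i \<in> S" for i using V_M b_V that assms(1) by blast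
  have "lc S (\<lambda>i. c i \<oplus>\<^bsub>K\<^esub> d i) = (\<Oplus>\<^bsub>M\<^esub>i\<in>S. sc (c i) (b i) \<oplus>\<^bsub>M\<^esub> sc (d i) (b i))"
    unfolding lc_def by (rule RM.M.finsum_cong') (use assms bM in \<open>auto simp: sc_l_distr\<close>)
  also have "\<dots> = lc S c \<oplus>\<^bsub>M\<^esub> lc S d"
    unfolding lc_def by (rule RM.M.finsum_addf) (use assms bM in auto)
  finally show ?thesis .
qed

lemma lc_sc:
  assumes "S \<subseteq> {..<m}" "\<And>i. i \<in> S \<Longrightarrow> c i \<in> carrier K" "k \<in> carrier K"
  shows "lc S (\<lambda>i. k \<otimes>\<^bsub>K\<^esub> c i) = sc k (lc S c)"
proof -
  have bM: "b i \<in> carrier M" if "i \<in> S" for i using V_M b_V that assms(1) by blast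
  have "sc k (lc S c) = (\<Oplus>\<^bsub>M\<^esub>i\<in>S. sc k (sc (c i) (b i)))"
    unfolding lc_def by (rule sc_finsum) (use assms bM finite_subset[OF assms(1)] in auto)
  also have "\<dots> = lc S (\<lambda>i. k \<otimes>\<^bsub>K\<^esub> c i)"
    unfolding lc_def by (rule RM.M.finsum_cong') (use assms bM in \<open>auto simp: sc_assoc\<close>)
  finally show ?thesis by simp
qed

text \<open>The component in the top layer is split off by \<open>V_line\<close>, and the remainder
  lies one layer lower.\<close>

lemma expansion:
  assumes "k \<le> m" "x \<in> V" "x \<in> N k"
  shows "\<exists>c. (\<forall>i. c i \<in> carrier K) \<and> x = lc {..<k} c"
  using assms
proof (induction k arbitrary: x)
  case 0
  then show ?case by (intro exI[of _ "\<lambda>_. \<zero>\<^bsub>K\<^esub>"]) (simp add: N_0 lc_def)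
next
  case (Suc k)
  have k: "k < m" using Suc.prems by simp
  obtain d where d: "d \<in> carrier K" "x \<ominus>\<^bsub>M\<^esub> sc d (b k) \<in> N k"
    using V_line[OF k b_V[OF k] b_N[OF k] b_not_N[OF k] Suc.prems(2,3)] by blast
  have dV: "sc d (b k) \<in> V" using V_closed(3)[OF d(1) b_V[OF k]] .
  obtain c where c: "\<forall>i. c i \<in> carrier K" "x \<ominus>\<^bsub>M\<^esub> sc d (b k) = lc {..<k} c"
    using Suc.IH[OF _ V_closed(4)[OF Suc.prems(2) dV] d(2)] k by auto
  let ?c = "c(k := d)"
  have "lc {..<Suc k} ?c = sc d (b k) \<oplus>\<^bsub>M\<^esub> (\<Oplus>\<^bsub>M\<^esub>i\<in>{..<k}. sc (?c i) (b i))"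
    unfolding lc_def lessThan_Suc
    by (subst RM.M.finsum_insert) (use c(1) d(1) V_M[OF b_V] k in auto)
  also have "(\<Oplus>\<^bsub>M\<^esub>i\<in>{..<k}. sc (?c i) (b i)) = lc {..<k} c"
    unfolding lc_def by (rule RM.M.finsum_cong') (use c(1) V_M[OF b_V] k in auto)
  also have "sc d (b k) \<oplus>\<^bsub>M\<^esub> lc {..<k} c = x"
    unfolding c(2)[symmetric] RM.M.minus_eq_add
    using V_M[OF dV] V_M[OF Suc.prems(2)] by (simp add: RM.M.a_ac RM.M.r_neg1 RM.M.r_neg2 RM.M.r_neg)
  finally show ?case using c(1) d(1) by (intro exI[of _ ?c]) auto
qed

text \<open>Determined for elements of V and indices below \<open>m\<close>, by
  \<open>coord_unique\<close>; nothing is claimed elsewhere.\<close>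

definition coord :: "'m \<Rightarrow> nat \<Rightarrow> 'k" where
  "coord x = (SOME c. (\<forall>i. c i \<in> carrier K) \<and> x = lc {..<m} c)"

lemma coord:
  assumes "x \<in> V"
  shows coord_closed: "coord x i \<in> carrier K" and coord_lc: "lc {..<m} (coord x) = x"
proof -
  have "\<exists>c. (\<forall>i. c i \<in> carrier K) \<and> x = lc {..<m} c"
    using expansion[of m x] assms V_M[OF assms] N_m by simp
  from someI_ex[OF this] show "coord x i \<in> carrier K" "lc {..<m} (coord x) = x"
    unfolding coord_def by auto
qed

lemma coord_unique:
  assumes c: "\<And>i. i < m \<Longrightarrow> c i \<in> carrier K" and i: "i < m"
  shows "coord (lc {..<m} c) i = c i"
proof -
  let ?x = "lc {..<m} c" and ?n = "\<ominus>\<^bsub>K\<^esub> \<one>\<^bsub>K\<^esub>"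
  have x: "?x \<in> V" by (rule lc_V) (use c in auto)
  note cl = coord_closed[OF x] and xM = V_M[OF x]
  have n: "?n \<in> carrier K" by simp
  have "lc {..<m} (\<lambda>i. coord ?x i \<oplus>\<^bsub>K\<^esub> ?n \<otimes>\<^bsub>K\<^esub> c i) = lc {..<m} (coord ?x) \<oplus>\<^bsub>M\<^esub> lc {..<m} (\<lambda>i. ?n \<otimes>\<^bsub>K\<^esub> c i)"
    by (rule lc_add) (use cl c in auto)
  also have "\<dots> = ?x \<oplus>\<^bsub>M\<^esub> sc ?n ?x"
    using lc_sc[of "{..<m}" c ?n] c n coord_lc[OF x] by simp
  also have "\<dots> = sc \<one>\<^bsub>K\<^esub> ?x \<oplus>\<^bsub>M\<^esub> sc ?n ?x" using xM by simp
  also have "\<dots> = sc (\<one>\<^bsub>K\<^esub> \<oplus>\<^bsub>K\<^esub> ?n) ?x" using sc_l_distr[of "\<one>\<^bsub>K\<^esub>" ?n ?x] xM by simp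
  also have "\<dots> = \<zero>\<^bsub>M\<^esub>" using xM by (simp add: FA.module.R.r_neg)
  finally have zero: "lc {..<m} (\<lambda>i. coord ?x i \<oplus>\<^bsub>K\<^esub> ?n \<otimes>\<^bsub>K\<^esub> c i) = \<zero>\<^bsub>M\<^esub>" .
  have "coord ?x i \<oplus>\<^bsub>K\<^esub> ?n \<otimes>\<^bsub>K\<^esub> c i = \<zero>\<^bsub>K\<^esub>"
    using lc_eq_zero[OF order_refl _ zero, of i] cl c i by simp
  then have "coord ?x i \<oplus>\<^bsub>K\<^esub> \<ominus>\<^bsub>K\<^esub> c i = \<zero>\<^bsub>K\<^esub>"
    using c[OF i] by (simp add: FA.module.R.l_minus)
  then have "\<ominus>\<^bsub>K\<^esub> (\<ominus>\<^bsub>K\<^esub> c i) = coord ?x i" using cl c[OF i] by (intro FA.module.R.minus_equality) simp_all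
  then show ?thesis using c[OF i] by simp
qed

lemma coord_add:
  assumes "x \<in> V" "y \<in> V" "i < m"
  shows "coord (x \<oplus>\<^bsub>M\<^esub> y) i = coord x i \<oplus>\<^bsub>K\<^esub> coord y i"
proof -
  have "x \<oplus>\<^bsub>M\<^esub> y = lc {..<m} (\<lambda>i. coord x i \<oplus>\<^bsub>K\<^esub> coord y i)"
    using lc_add[of "{..<m}" "coord x" "coord y"] coord[OF assms(1)] coord[OF assms(2)] by simp
  then show ?thesis
    using coord_unique[of "\<lambda>i. coord x i \<oplus>\<^bsub>K\<^esub> coord y i" i] coord_closed[OF assms(1)] coord_closed[OF assms(2)] assms(3)
    by simp
qed

lemma coord_sc:
  assumes "k \<in> carrier K" "x \<in> V" "i < m"
  shows "coord (sc k x) i = k \<otimes>\<^bsub>K\<^esub> coord x i"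
proof -
  have "sc k x = lc {..<m} (\<lambda>i. k \<otimes>\<^bsub>K\<^esub> coord x i)"
    using lc_sc[of "{..<m}" "coord x" k] coord[OF assms(2)] assms(1) by simp
  then show ?thesis
    using coord_unique[of "\<lambda>i. k \<otimes>\<^bsub>K\<^esub> coord x i" i] coord_closed[OF assms(2)] assms(1,3) by simp
qed

lemma coord_zero: "i < m \<Longrightarrow> coord \<zero>\<^bsub>M\<^esub> i = \<zero>\<^bsub>K\<^esub>"
  using coord_sc[of "\<zero>\<^bsub>K\<^esub>" "\<zero>\<^bsub>M\<^esub>" i] V_closed(1) coord_closed[OF V_closed(1)] by simp

lemma sc_neg_one: "x \<in> carrier M \<Longrightarrow> sc (\<ominus>\<^bsub>K\<^esub> \<one>\<^bsub>K\<^esub>) x = \<ominus>\<^bsub>M\<^esub> x"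
  using sc_l_distr[of "\<ominus>\<^bsub>K\<^esub> \<one>\<^bsub>K\<^esub>" "\<one>\<^bsub>K\<^esub>" x]
  by (intro RM.M.minus_equality[symmetric]) (simp_all add: FA.module.R.l_neg)

lemma coord_minus:
  assumes "x \<in> V" "y \<in> V" "i < m"
  shows "coord (x \<ominus>\<^bsub>M\<^esub> y) i = coord x i \<ominus>\<^bsub>K\<^esub> coord y i"
proof -
  have n: "\<ominus>\<^bsub>K\<^esub> \<one>\<^bsub>K\<^esub> \<in> carrier K" by simp
  have "x \<ominus>\<^bsub>M\<^esub> y = x \<oplus>\<^bsub>M\<^esub> sc (\<ominus>\<^bsub>K\<^esub> \<one>\<^bsub>K\<^esub>) y"
    using V_M[OF assms(2)] by (simp add: RM.M.minus_eq_add sc_neg_one)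
  then show ?thesis
    using coord_add[OF assms(1) V_closed(3)[OF n assms(2)] assms(3)] coord_sc[OF n assms(2,3)]
      coord_closed[OF assms(2)] by (simp add: FA.module.R.l_minus FA.module.R.minus_eq)
qed

lemma coord_finsum:
  assumes "finite S" "\<And>s. s \<in> S \<Longrightarrow> f s \<in> V" "i < m"
  shows "coord (\<Oplus>\<^bsub>M\<^esub>s\<in>S. f s) i = (\<Oplus>\<^bsub>K\<^esub>s\<in>S. coord (f s) i)"
  by (rule finsum_additive(2)[where D = V and \<phi> = "\<lambda>x. coord x i",
        OF RM.M.abelian_monoid_axioms FA.module.R.abelian_monoid_axioms])
    (use V_closed(1,2) V_M coord_closed coord_add coord_zero assms in auto)

lemma coord_basis:
  assumes "j < m" "i < m"
  shows "coord (b j) i = (if i = j then \<one>\<^bsub>K\<^esub> else \<zero>\<^bsub>K\<^esub>)"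
proof -
  let ?c = "\<lambda>i. if i = j then \<one>\<^bsub>K\<^esub> else \<zero>\<^bsub>K\<^esub>"
  have bM: "b i \<in> carrier M" if "i < m" for i using V_M b_V that by blast
  have "lc {..<m} ?c = (\<Oplus>\<^bsub>M\<^esub>i\<in>{..<m}. if j = i then b i else \<zero>\<^bsub>M\<^esub>)"
    unfolding lc_def by (rule RM.M.finsum_cong') (use bM in auto)
  also have "\<dots> = b j"
    by (rule RM.M.finsum_singleton) (use assms bM in auto)
  finally show ?thesis using coord_unique[of ?c i] assms by simp
qed

end

section \<open>Pivot sets of submodules\<close>

context basic_series begin

text \<open>The layers in which U \<inter> V grows, that is, the leading positions of an echelon
  basis of U \<inter> V. Submodules with a fixed pivot set form the analogue of a Schubert
  cell.\<close>

definition pivots :: "'m set \<Rightarrow> nat set" where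
  "pivots U = {i. i < m \<and> (\<exists>x\<in>U. x \<in> V \<and> x \<in> N (Suc i) \<and> x \<notin> N i)}"

lemma pivots_less: "pivots U \<subseteq> {..<m}"
  by (auto simp: pivots_def)

lemma pivots_mono: "U \<subseteq> U' \<Longrightarrow> pivots U \<subseteq> pivots U'"
  by (auto simp: pivots_def)

lemma pivots_zero: "pivots {\<zero>\<^bsub>M\<^esub>} = {}"
proof -
  have "\<zero>\<^bsub>M\<^esub> \<in> N i" if "i < m" for i using RM.rsubmoduleD(2)[OF N_sub[of i]] that by simp
  then show ?thesis by (auto simp: pivots_def)
qed

text \<open>If the pivots agree, any y in Y \<inter> V can be lowered by one layer by subtracting a
  multiple of an element of X with the same leading layer. So Y \<inter> V is contained in X, and
  the submodules coincide.\<close>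

lemma pivots_strict_mono:
  assumes X: "rsubmodule A M X" and Y: "rsubmodule A M Y" and XY: "X \<subset> Y"
  shows "pivots X \<subset> pivots Y"
proof -
  have "Y = X" if eq: "pivots X = pivots Y"
  proof -
    note DX = RM.rsubmoduleD[OF X] and DY = RM.rsubmoduleD[OF Y]
    have step: "Y \<inter> V \<inter> N i \<subseteq> X" if "i \<le> m" for i
      using that
    proof (induction i)
      case 0
      then show ?case using DX(2) by (auto simp: N_0)
    next
      case (Suc i)
      then have i: "i < m" and IH: "Y \<inter> V \<inter> N i \<subseteq> X" by auto
      show ?case
      proof
        fix y assume y: "y \<in> Y \<inter> V \<inter> N (Suc i)"
        show "y \<in> X"
        proof (cases "y \<in> N i")
          case True
          then show ?thesis using y IH by blast
        next
          case False
          then have "i \<in> pivots X" unfolding eq using y i by (auto simp: pivots_def)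
          then obtain x where x: "x \<in> X" "x \<in> V" "x \<in> N (Suc i)" "x \<notin> N i" by (auto simp: pivots_def)
          obtain c where c: "c \<in> carrier K" "y \<ominus>\<^bsub>M\<^esub> sc c x \<in> N i"
            using V_line[OF i x(2,3,4), of y] y by blast
          have cx: "sc c x \<in> X" "sc c x \<in> V"
            using sc_rsubmodule[OF X c(1) x(1)] V_closed(3)[OF c(1) x(2)] by auto
          have "y \<ominus>\<^bsub>M\<^esub> sc c x \<in> Y" using DY(6)[of y "sc c x"] y cx(1) XY by blast
          moreover have "y \<ominus>\<^bsub>M\<^esub> sc c x \<in> V" using V_closed(4)[of y "sc c x"] y cx(2) by blast
          ultimately have "y \<ominus>\<^bsub>M\<^esub> sc c x \<in> X" using IH c(2) by blast
          then show ?thesis using RM.diff_mem[OF X, of y "sc c x"] y cx V_M by blast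
        qed
      qed
    qed
    show ?thesis
      by (rule rsubmodule_determined[OF X Y]) (use XY step[of m] DY(1) N_m in auto)
  qed
  then show ?thesis using pivots_mono[of X Y] XY by blast
qed

end

section \<open>Coordinates and reduced echelon form\<close>

context adapted_basis begin

lemma coord_lc_subset:
  assumes "S \<subseteq> {..<m}" "\<And>i. i \<in> S \<Longrightarrow> c i \<in> carrier K" "i < m"
  shows "coord (lc S c) i = (if i \<in> S then c i else \<zero>\<^bsub>K\<^esub>)"
proof -
  have bM: "b i \<in> carrier M" if "i < m" for i using V_M b_V that by blast
  have "lc {..<m} (\<lambda>i. if i \<in> S then c i else \<zero>\<^bsub>K\<^esub>) =
      lc S (\<lambda>i. if i \<in> S then c i else \<zero>\<^bsub>K\<^esub>)"
    unfolding lc_def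
    by (rule RM.M.add.finprod_mono_neutral_cong_right[simplified]) (use assms bM in auto)
  also have "\<dots> = lc S c"
    unfolding lc_def by (rule RM.M.finsum_cong') (use assms bM in auto)
  finally have "lc {..<m} (\<lambda>i. if i \<in> S then c i else \<zero>\<^bsub>K\<^esub>) = lc S c" .
  then show ?thesis
    using coord_unique[of "\<lambda>i. if i \<in> S then c i else \<zero>\<^bsub>K\<^esub>" i] assms by auto
qed

text \<open>If z were nonzero, its leading index would be a pivot of U and carry a nonzero
  coordinate.\<close>

lemma coord_pivots:
  assumes U: "rsubmodule A M U" and z: "z \<in> U" "z \<in> V"
    and zero: "\<And>i. i \<in> pivots U \<Longrightarrow> coord z i = \<zero>\<^bsub>K\<^esub>" and i: "i < m"
  shows "coord z i = \<zero>\<^bsub>K\<^esub>"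
proof (rule ccontr)
  assume "coord z i \<noteq> \<zero>\<^bsub>K\<^esub>"
  from lc_top[of "{..<m}" "coord z" i, OF _ _ _ this]
  obtain j where j: "j < m" "coord z j \<noteq> \<zero>\<^bsub>K\<^esub>" "z \<in> N (Suc j)" "z \<notin> N j"
    using coord[OF z(2)] i by auto
  then have "j \<in> pivots U" using z by (auto simp: pivots_def)
  with zero j(2) show False by blast
qed

lemma mem_if_coord:
  assumes Z: "rsubmodule A M Z" and b: "\<And>r. r \<in> pivots Z \<Longrightarrow> b r \<in> Z" and z: "z \<in> V"
    and zero: "\<And>i. i < m \<Longrightarrow> i \<notin> pivots Z \<Longrightarrow> coord z i = \<zero>\<^bsub>K\<^esub>"
  shows "z \<in> Z"
proof -
  have "lc {..<m} (coord z) \<in> Z"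
    unfolding lc_def
  proof (rule finsum_in_rsubmodule[OF Z])
    fix i assume i: "i \<in> {..<m}"
    show "sc (coord z i) (b i) \<in> Z"
    proof (cases "i \<in> pivots Z")
      case True
      then show ?thesis using sc_rsubmodule[OF Z coord_closed[OF z]] b by blast
    next
      case False
      then show ?thesis using zero[of i] i V_M[OF b_V[of i]] RM.rsubmoduleD(2)[OF Z] by simp
    qed
  qed simp
  then show ?thesis using coord_lc[OF z] by simp
qed

text \<open>Subtracting the part of z along the basis vectors that lie in Z leaves an element of U
  with no coordinate at any pivot of U, hence zero; outside the pivots of Z nothing was
  subtracted.\<close>

lemma coord_eq_zero:
  assumes Z: "rsubmodule A M Z" and b: "\<And>r. r \<in> pivots Z \<Longrightarrow> b r \<in> Z" and U: "rsubmodule A M U" and ZU: "Z \<subseteq> U"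
    and z: "z \<in> U" "z \<in> V" and zero: "\<And>q. q \<in> pivots U - pivots Z \<Longrightarrow> coord z q = \<zero>\<^bsub>K\<^esub>"
    and i: "i < m" "i \<notin> pivots Z"
  shows "coord z i = \<zero>\<^bsub>K\<^esub>"
proof -
  let ?y = "lc (pivots Z) (coord z)"
  have cl: "coord z i \<in> carrier K" for i by (rule coord_closed[OF z(2)])
  have yV: "?y \<in> V" by (rule lc_V) (use pivots_less cl in auto)
  have cy: "coord ?y i = (if i \<in> pivots Z then coord z i else \<zero>\<^bsub>K\<^esub>)" if "i < m" for i
    by (rule coord_lc_subset) (use pivots_less cl that in auto)
  have "?y \<in> Z" by (rule mem_if_coord[OF Z b yV]) (use cy in auto)
  then have yU: "?y \<in> U" using ZU by blast
  have zy: "z \<ominus>\<^bsub>M\<^esub> ?y \<in> U" "z \<ominus>\<^bsub>M\<^esub> ?y \<in> V"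
    using RM.rsubmoduleD(6)[OF U z(1) yU] V_closed(4)[OF z(2) yV] by auto
  have "coord (z \<ominus>\<^bsub>M\<^esub> ?y) i = \<zero>\<^bsub>K\<^esub>"
  proof (rule coord_pivots[OF U zy _ i(1)])
    fix j assume j: "j \<in> pivots U"
    then have "j < m" using pivots_less by auto
    then show "coord (z \<ominus>\<^bsub>M\<^esub> ?y) j = \<zero>\<^bsub>K\<^esub>"
      using coord_minus[OF z(2) yV, of j] cy[of j] cl[of j] zero[of j] j
      by (cases "j \<in> pivots Z") (simp_all add: FA.module.R.minus_eq FA.module.R.r_neg)
  qed
  then show ?thesis
    using coord_minus[OF z(2) yV i(1)] cy[OF i(1)] cl[of i] i(2) by (simp add: FA.module.R.minus_eq)
qed

text \<open>One row of a reduced echelon basis: modulo U the vector \<open>b q\<close> is a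
  combination of the basis vectors at nonpivots.\<close>

lemma reduced_generator:
  assumes U: "rsubmodule A M U" and q: "q < m"
  shows "\<exists>c. (\<forall>p. c p \<in> carrier K) \<and> b q \<oplus>\<^bsub>M\<^esub> lc ({..<m} - pivots U) c \<in> U"
proof -
  let ?J = "pivots U" and ?P = "{..<m} - pivots U"
  have "\<forall>i\<in>?J. \<exists>x. x \<in> U \<and> x \<in> V \<and> x \<in> N (Suc i) \<and> x \<notin> N i" by (auto simp: pivots_def)
  then obtain g where g: "\<And>i. i \<in> ?J \<Longrightarrow> g i \<in> U" "\<And>i. i \<in> ?J \<Longrightarrow> g i \<in> V"
    "\<And>i. i \<in> ?J \<Longrightarrow> g i \<in> N (Suc i)" "\<And>i. i \<in> ?J \<Longrightarrow> g i \<notin> N i" by metis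
  \<comment> \<open>At the pivots of U the basis vectors are exchanged for elements of U in the same
    layers. The result is again adapted, and expanding \<open>b q\<close> in it isolates the part
    lying in U.\<close>
  define b' where "b' i = (if i \<in> ?J then g i else b i)" for i
  interpret B: adapted_basis K A M N m e b'
    by unfold_locales (auto simp: b'_def g b_V b_N b_not_N)
  have bV: "b q \<in> V" by (rule b_V[OF q])
  obtain d where d: "\<forall>i. d i \<in> carrier K" "b q = B.lc {..<m} d"
    using B.expansion[of m "b q"] bV V_M[OF bV] N_m by auto
  have b'M: "b' i \<in> carrier M" if "i < m" for i using V_M[OF B.b_V[OF that]] .
  have fin: "finite ?J" "finite ?P" using finite_subset[OF pivots_less[of U]] by simp_all
  have "{..<m} = ?J \<union> ?P" using pivots_less[of U] by blast
  then have "B.lc {..<m} d = B.lc (?J \<union> ?P) d" by simp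
  also have "\<dots> = B.lc ?J d \<oplus>\<^bsub>M\<^esub> B.lc ?P d"
    unfolding B.lc_def
    by (rule RM.M.finsum_Un_disjoint) (use fin b'M d(1) pivots_less[of U] in auto)
  also have "B.lc ?P d = lc ?P d"
    unfolding B.lc_def lc_def by (rule RM.M.finsum_cong') (use d(1) V_M[OF b_V] in \<open>auto simp: b'_def\<close>)
  finally have eq: "b q = B.lc ?J d \<oplus>\<^bsub>M\<^esub> lc ?P d" using d(2) by simp
  have JU: "B.lc ?J d \<in> U"
    unfolding B.lc_def
    by (rule finsum_in_rsubmodule[OF U fin(1)], rule sc_rsubmodule[OF U]) (use d(1) g(1) in \<open>auto simp: b'_def\<close>)
  have M: "B.lc ?J d \<in> carrier M" "lc ?P d \<in> carrier M"
    using JU RM.rsubmoduleD(1)[OF U] V_M[OF lc_V[of ?P d]] d(1) by auto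
  have n: "\<ominus>\<^bsub>K\<^esub> \<one>\<^bsub>K\<^esub> \<in> carrier K" by simp
  have "lc ?P (\<lambda>i. \<ominus>\<^bsub>K\<^esub> \<one>\<^bsub>K\<^esub> \<otimes>\<^bsub>K\<^esub> d i) = \<ominus>\<^bsub>M\<^esub> lc ?P d"
    using lc_sc[of ?P d, OF _ _ n] d(1) sc_neg_one[OF M(2)] by auto
  then have "b q \<oplus>\<^bsub>M\<^esub> lc ?P (\<lambda>i. \<ominus>\<^bsub>K\<^esub> \<one>\<^bsub>K\<^esub> \<otimes>\<^bsub>K\<^esub> d i) = B.lc ?J d"
    using M unfolding eq by (simp add: RM.M.a_assoc RM.M.r_neg)
  then show ?thesis
    using JU d(1) n by (intro exI[of _ "\<lambda>i. \<ominus>\<^bsub>K\<^esub> \<one>\<^bsub>K\<^esub> \<otimes>\<^bsub>K\<^esub> d i"]) auto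
qed

end

text \<open>The basis is chosen so that it contains elements of Z at the pivots of Z. Only the rows
  indexed by J - pivots Z then remain free, which keeps the number of coordinates down to |P|
  |Q|.\<close>

locale pivot_chart = adapted_basis K A M N m e b
  for K :: "'k ring" and A :: "('k, 'a) module" and M :: "('a, 'm) module" and N m e b +
  fixes Z :: "'m set" and J :: "nat set"
  assumes Z: "rsubmodule A M Z" and J_less: "J \<subseteq> {..<m}" and Z_J: "pivots Z \<subseteq> J"
    and b_Z: "r \<in> pivots Z \<Longrightarrow> b r \<in> Z"
begin

abbreviation "P \<equiv> {..<m} - J"
abbreviation "Q \<equiv> J - pivots Z"

text \<open>Besides being the variable part of the row \<open>w\<close>, this is its derivative:
  \<open>w\<close> is affine in its coefficients, so \<open>u Y q\<close> is the first-order change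
  of row q in direction Y.\<close>

definition u :: "(nat \<times> nat \<Rightarrow> 'k) \<Rightarrow> nat \<Rightarrow> 'm" where
  "u Y q = lc P (\<lambda>p. Y (p, q))"

text \<open>A submodule containing \<open>Z\<close> with pivot set \<open>J\<close> has, modulo \<open>Z\<close>, a unique basis in reduced echelon form; it consists of
  the \<open>w X q\<close>, and the free coefficients \<open>X\<close> are the coordinates of the submodule.\<close>

definition w :: "(nat \<times> nat \<Rightarrow> 'k) \<Rightarrow> nat \<Rightarrow> 'm" where
  "w X q = b q \<oplus>\<^bsub>M\<^esub> u X q"

definition cell :: "'m set set" where
  "cell = {U. rsubmodule A M U \<and> Z \<subseteq> U \<and> pivots U = J}"

text \<open>Any reduced coefficients may be chosen here; injectivity rests on
  \<open>param_w\<close>. The restriction makes the families extensional, as the count of zeros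
  demands.\<close>

definition param :: "'m set \<Rightarrow> nat \<times> nat \<Rightarrow> 'k" where
  "param U = (\<lambda>(p, q)\<in>P \<times> Q. (SOME c. (\<forall>p. c p \<in> carrier K) \<and> b q \<oplus>\<^bsub>M\<^esub> lc P c \<in> U) p)"

lemma finite_PQ: "finite P" "finite Q" "finite (P \<times> Q)"
  using finite_subset[OF J_less] by simp_all

lemma Q_less: "q \<in> Q \<Longrightarrow> q < m"
  using J_less by auto

lemma u_V: "Y \<in> FA.points (P \<times> Q) \<Longrightarrow> q \<in> Q \<Longrightarrow> u Y q \<in> V"
  unfolding u_def by (rule lc_V) auto

lemma w_V: "X \<in> FA.points (P \<times> Q) \<Longrightarrow> q \<in> Q \<Longrightarrow> w X q \<in> V"
  unfolding w_def by (intro V_closed(2) u_V b_V Q_less)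

lemma coord_u:
  "Y \<in> FA.points (P \<times> Q) \<Longrightarrow> q \<in> Q \<Longrightarrow> i < m \<Longrightarrow> coord (u Y q) i = (if i \<in> P then Y (i, q) else \<zero>\<^bsub>K\<^esub>)"
  unfolding u_def by (rule coord_lc_subset) auto

lemma coord_w:
  assumes X: "X \<in> FA.points (P \<times> Q)" and q: "q \<in> Q" and i: "i < m"
  shows "coord (w X q) i = (if i \<in> P then X (i, q) else if i = q then \<one>\<^bsub>K\<^esub> else \<zero>\<^bsub>K\<^esub>)"
proof -
  have "coord (w X q) i = coord (b q) i \<oplus>\<^bsub>K\<^esub> coord (u X q) i"
    unfolding w_def by (rule coord_add[OF b_V[OF Q_less[OF q]] u_V[OF X q] i])
  then show ?thesis
    using coord_u[OF X q i] coord_basis[OF Q_less[OF q] i] X q i by (cases "i \<in> P") auto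
qed

lemma cellD:
  assumes "U \<in> cell"
  shows "rsubmodule A M U" "Z \<subseteq> U" "pivots U = J"
  using assms by (simp_all add: cell_def)

lemma param:
  assumes U: "U \<in> cell"
  shows param_closed: "param U \<in> P \<times> Q \<rightarrow>\<^sub>E carrier K" and param_w: "q \<in> Q \<Longrightarrow> w (param U) q \<in> U"
proof -
  let ?c = "\<lambda>q. SOME c. (\<forall>p. c p \<in> carrier K) \<and> b q \<oplus>\<^bsub>M\<^esub> lc P c \<in> U"
  have c: "(\<forall>p. ?c q p \<in> carrier K) \<and> b q \<oplus>\<^bsub>M\<^esub> lc P (?c q) \<in> U" if "q \<in> Q" for q
    using someI_ex[OF reduced_generator[OF cellD(1)[OF U] Q_less[OF that]]] unfolding cellD(3)[OF U] .
  show "param U \<in> P \<times> Q \<rightarrow>\<^sub>E carrier K"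
    unfolding param_def by (rule restrict_PiE_iff[THEN iffD2]) (use c in auto)
  show "w (param U) q \<in> U" if q: "q \<in> Q"
  proof -
    have "u (param U) q = lc P (?c q)"
      unfolding u_def by (rule lc_cong) (use c[OF q] q in \<open>auto simp: param_def\<close>)
    then show ?thesis using c[OF q] by (simp add: w_def)
  qed
qed

lemma param_points: "U \<in> cell \<Longrightarrow> param U \<in> FA.points (P \<times> Q)"
  using param_closed unfolding FA.points_def by blast

text \<open>With g = \<open>w X\<close> this is the part of y along the echelon rows; with g =
  \<open>u Y\<close> it is the linear map that sends each row \<open>w X q\<close> to its
  first-order change \<open>u Y q\<close>.\<close>

definition comb :: "'m \<Rightarrow> (nat \<Rightarrow> 'm) \<Rightarrow> 'm" where
  "comb y g = (\<Oplus>\<^bsub>M\<^esub>q\<in>Q. sc (coord y q) (g q))"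

lemma comb_V: "y \<in> V \<Longrightarrow> (\<And>q. q \<in> Q \<Longrightarrow> g q \<in> V) \<Longrightarrow> comb y g \<in> V"
  unfolding comb_def by (rule V_finsum[OF finite_PQ(2)]) (auto intro: V_closed(3) coord_closed)

lemma coord_comb:
  assumes "y \<in> V" "\<And>q. q \<in> Q \<Longrightarrow> g q \<in> V" "i < m"
  shows "coord (comb y g) i = (\<Oplus>\<^bsub>K\<^esub>q\<in>Q. coord y q \<otimes>\<^bsub>K\<^esub> coord (g q) i)"
proof -
  have "coord (comb y g) i = (\<Oplus>\<^bsub>K\<^esub>q\<in>Q. coord (sc (coord y q) (g q)) i)"
    unfolding comb_def
    by (rule coord_finsum[OF finite_PQ(2)]) (use assms in \<open>auto intro: V_closed(3) coord_closed\<close>)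
  also have "\<dots> = (\<Oplus>\<^bsub>K\<^esub>q\<in>Q. coord y q \<otimes>\<^bsub>K\<^esub> coord (g q) i)"
    by (rule FA.module.R.finsum_cong')
      (use assms in \<open>auto simp: coord_sc coord_closed\<close>)
  finally show ?thesis .
qed

lemma comb_rsubmodule:
  "rsubmodule A M U \<Longrightarrow> y \<in> V \<Longrightarrow> (\<And>q. q \<in> Q \<Longrightarrow> g q \<in> U) \<Longrightarrow> comb y g \<in> U"
  unfolding comb_def by (rule finsum_in_rsubmodule[OF _ finite_PQ(2)]) (auto intro: sc_rsubmodule coord_closed)

lemma comb_add:
  assumes "x \<in> V" "y \<in> V" "\<And>q. q \<in> Q \<Longrightarrow> g q \<in> V"
  shows "comb (x \<oplus>\<^bsub>M\<^esub> y) g = comb x g \<oplus>\<^bsub>M\<^esub> comb y g"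
proof -
  have g: "g q \<in> carrier M" if "q \<in> Q" for q using V_M assms(3) that by blast
  have "comb (x \<oplus>\<^bsub>M\<^esub> y) g = (\<Oplus>\<^bsub>M\<^esub>q\<in>Q. sc (coord x q) (g q) \<oplus>\<^bsub>M\<^esub> sc (coord y q) (g q))"
    unfolding comb_def
    by (rule RM.M.finsum_cong')
      (use g assms(1,2) Q_less in \<open>auto simp: coord_add coord_closed sc_l_distr\<close>)
  also have "\<dots> = comb x g \<oplus>\<^bsub>M\<^esub> comb y g"
    unfolding comb_def by (rule RM.M.finsum_addf) (use g assms(1,2) in \<open>auto simp: coord_closed\<close>)
  finally show ?thesis .
qed

lemma comb_sc:
  assumes "c \<in> carrier K" "y \<in> V" "\<And>q. q \<in> Q \<Longrightarrow> g q \<in> V"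
  shows "comb (sc c y) g = sc c (comb y g)"
proof -
  have g: "g q \<in> carrier M" if "q \<in> Q" for q using V_M assms(3) that by blast
  have "sc c (comb y g) = (\<Oplus>\<^bsub>M\<^esub>q\<in>Q. sc c (sc (coord y q) (g q)))"
    unfolding comb_def by (rule sc_finsum[OF assms(1) finite_PQ(2)]) (use g assms in \<open>auto simp: coord_closed\<close>)
  also have "\<dots> = comb (sc c y) g"
    unfolding comb_def
    by (rule RM.M.finsum_cong')
      (use g assms Q_less in \<open>auto simp: coord_sc coord_closed sc_assoc\<close>)
  finally show ?thesis by simp
qed

lemma comb_eq_zero:
  assumes "\<And>q. q \<in> Q \<Longrightarrow> coord y q = \<zero>\<^bsub>K\<^esub>" "\<And>q. q \<in> Q \<Longrightarrow> g q \<in> V"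
  shows "comb y g = \<zero>\<^bsub>M\<^esub>"
proof -
  have "comb y g = (\<Oplus>\<^bsub>M\<^esub>q\<in>Q. \<zero>\<^bsub>M\<^esub>)"
    unfolding comb_def by (rule RM.M.finsum_cong') (use assms V_M in auto)
  then show ?thesis by simp
qed

lemma coord_comb_w:
  assumes X: "X \<in> FA.points (P \<times> Q)" and y: "y \<in> V" and r: "r \<in> Q"
  shows "coord (comb y (w X)) r = coord y r"
proof -
  have rm: "r < m" "r \<notin> P" using Q_less r by auto
  have cl: "coord y i \<in> carrier K" for i by (rule coord_closed[OF y])
  have "coord (comb y (w X)) r = (\<Oplus>\<^bsub>K\<^esub>q\<in>Q. coord y q \<otimes>\<^bsub>K\<^esub> coord (w X q) r)"
    by (rule coord_comb[OF y w_V[OF X] rm(1)])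
  also have "\<dots> = (\<Oplus>\<^bsub>K\<^esub>q\<in>Q. if r = q then coord y q else \<zero>\<^bsub>K\<^esub>)"
    by (rule FA.module.R.finsum_cong') (use coord_w[OF X _ rm(1)] cl rm(2) in auto)
  also have "\<dots> = coord y r"
    by (rule FA.module.R.finsum_singleton[OF r finite_PQ(2)]) (use cl in auto)
  finally show ?thesis .
qed

lemma coord_comb_u:
  assumes X: "Y \<in> FA.points (P \<times> Q)" and y: "y \<in> V" and r: "r \<in> Q"
  shows "coord (comb y (u Y)) r = \<zero>\<^bsub>K\<^esub>"
proof -
  have rm: "r < m" "r \<notin> P" using Q_less r by auto
  have cl: "coord y i \<in> carrier K" for i by (rule coord_closed[OF y])
  have "coord (comb y (u Y)) r = (\<Oplus>\<^bsub>K\<^esub>q\<in>Q. coord y q \<otimes>\<^bsub>K\<^esub> coord (u Y q) r)"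
    by (rule coord_comb[OF y u_V[OF X] rm(1)])
  also have "\<dots> = (\<Oplus>\<^bsub>K\<^esub>q\<in>Q. \<zero>\<^bsub>K\<^esub>)"
    by (rule FA.module.R.finsum_cong') (use coord_u[OF X _ rm(1)] cl rm(2) in auto)
  finally show ?thesis by simp
qed

lemma mem_Z:
  assumes "z \<in> V" "\<And>q. q \<in> Q \<Longrightarrow> coord z q = \<zero>\<^bsub>K\<^esub>" "\<And>p. p \<in> P \<Longrightarrow> coord z p = \<zero>\<^bsub>K\<^esub>"
  shows "z \<in> Z"
  by (rule mem_if_coord[OF Z b_Z assms(1)]) (use assms(2,3) in auto)

lemma coord_Z: "z \<in> Z \<Longrightarrow> z \<in> V \<Longrightarrow> i < m \<Longrightarrow> i \<notin> pivots Z \<Longrightarrow> coord z i = \<zero>\<^bsub>K\<^esub>"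
  by (rule coord_eq_zero[OF Z b_Z Z]) auto

lemma coord_cell:
  assumes U: "U \<in> cell" and z: "z \<in> U" "z \<in> V" "\<And>q. q \<in> Q \<Longrightarrow> coord z q = \<zero>\<^bsub>K\<^esub>" and p: "p \<in> P"
  shows "coord z p = \<zero>\<^bsub>K\<^esub>"
  by (rule coord_eq_zero[OF Z b_Z cellD(1,2)[OF U] z(1,2)]) (use z(3) p cellD(3)[OF U] Z_J in auto)

text \<open>The rows have the identity matrix in the coordinates \<open>Q\<close>, so subtracting
  the combination clears these coordinates. As the difference lies in U, its coordinates in
  \<open>P\<close> vanish as well.\<close>

lemma diff_comb_mem_Z:
  assumes U: "U \<in> cell" and X: "X \<in> FA.points (P \<times> Q)" "\<And>q. q \<in> Q \<Longrightarrow> w X q \<in> U" and y: "y \<in> U" "y \<in> V"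
  shows "y \<ominus>\<^bsub>M\<^esub> comb y (w X) \<in> Z"
proof -
  let ?z = "y \<ominus>\<^bsub>M\<^esub> comb y (w X)"
  have cV: "comb y (w X) \<in> V" by (rule comb_V[OF y(2) w_V[OF X(1)]])
  have zV: "?z \<in> V" by (rule V_closed(4)[OF y(2) cV])
  have zU: "?z \<in> U" by (rule RM.rsubmoduleD(6)[OF cellD(1)[OF U] y(1) comb_rsubmodule[OF cellD(1)[OF U] y(2) X(2)]])
  have zQ: "coord ?z q = \<zero>\<^bsub>K\<^esub>" if "q \<in> Q" for q
    using coord_minus[OF y(2) cV Q_less[OF that]] coord_comb_w[OF X(1) y(2) that] coord_closed[OF y(2), of q]
    by (simp add: FA.module.R.minus_eq FA.module.R.r_neg)
  show ?thesis by (rule mem_Z[OF zV zQ coord_cell[OF U zU zV zQ]])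
qed

text \<open>By \<open>diff_comb_mem_Z\<close>, Z and the rows determine U \<inter> V, and U \<inter>
  V determines U.\<close>

lemma inj_on_param: "inj_on param cell"
proof (rule inj_onI)
  fix U U' assume U: "U \<in> cell" and U': "U' \<in> cell" and eq: "param U = param U'"
  have sub: "U \<inter> V \<subseteq> U'" if UU: "U \<in> cell" "U' \<in> cell" "param U = param U'" for U U'
  proof
    fix y assume "y \<in> U \<inter> V"
    then have y: "y \<in> U" "y \<in> V" by auto
    let ?g = "comb y (w (param U))"
    have "y \<ominus>\<^bsub>M\<^esub> ?g \<in> U'"
      using diff_comb_mem_Z[OF UU(1) param_points[OF UU(1)] param_w[OF UU(1)] y] cellD(2)[OF UU(2)] by blast
    moreover have "?g \<in> U'"
      by (rule comb_rsubmodule[OF cellD(1)[OF UU(2)] y(2)]) (use param_w[OF UU(2)] UU(3) in simp)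
    moreover have "?g \<in> V" by (rule comb_V[OF y(2) w_V[OF param_points[OF UU(1)]]])
    ultimately show "y \<in> U'"
      using RM.diff_mem[OF cellD(1)[OF UU(2)] V_M[OF y(2)], of ?g] V_M by blast
  qed
  show "U = U'"
    by (rule rsubmodule_eqI[OF cellD(1)[OF U] cellD(1)[OF U']])
      (use sub[OF U U' eq] sub[OF U' U eq[symmetric]] in blast)
qed

end

section \<open>Equations of a cell and their tangent vectors\<close>

context pivot_chart begin

lemma affine_on_coord:
  assumes a: "a \<in> carrier A" and q: "q \<in> Q" and i: "i < m"
  shows "FA.affine_on (P \<times> Q) (\<lambda>X. coord (T a (w X q)) i) (\<lambda>Y. coord (T a (u Y q)) i)"
proof -
  let ?k = "\<lambda>p. coord (T a (b p)) i"
  have bM: "b p \<in> carrier M" if "p < m" for p using V_M b_V that by blast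
  have TV: "T a (b p) \<in> V" if "p < m" for p using T_V[OF a bM[OF that]] .
  have k: "?k p \<in> carrier K" if "p < m" for p using coord_closed[OF TV[OF that]] .
  \<comment> \<open>The leading zero in each summand reproduces the form in which
    \<open>affine_on_comb\<close> delivers a multiple of a coordinate function.\<close>
  have coord_Tu: "coord (T a (u Y q)) i = (\<Oplus>\<^bsub>K\<^esub>p\<in>P. \<zero>\<^bsub>K\<^esub> \<oplus>\<^bsub>K\<^esub> ?k p \<otimes>\<^bsub>K\<^esub> Y (p, q))"
    if Y: "Y \<in> FA.points (P \<times> Q)" for Y
  proof -
    have Yp: "Y (p, q) \<in> carrier K" if "p \<in> P" for p using Y q that by simp
    have "T a (u Y q) = (\<Oplus>\<^bsub>M\<^esub>p\<in>P. T a (sc (Y (p, q)) (b p)))"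
      unfolding u_def lc_def
      by (rule finsum_additive(2)[where D = "carrier M", OF RM.M.abelian_monoid_axioms RM.M.abelian_monoid_axioms])
        (use T_V[OF a] V_M T_add[OF a] finite_PQ Yp bM a e_closed in \<open>auto simp: T_def\<close>)
    also have "\<dots> = (\<Oplus>\<^bsub>M\<^esub>p\<in>P. sc (Y (p, q)) (T a (b p)))"
      by (rule RM.M.finsum_cong') (use T_sc[OF a] Yp bM V_M[OF TV] in auto)
    finally have "coord (T a (u Y q)) i = (\<Oplus>\<^bsub>K\<^esub>p\<in>P. coord (sc (Y (p, q)) (T a (b p))) i)"
      using coord_finsum[OF finite_PQ(1), of "\<lambda>p. sc (Y (p, q)) (T a (b p))" i] V_closed(3) Yp TV i by simp
    also have "\<dots> = (\<Oplus>\<^bsub>K\<^esub>p\<in>P. \<zero>\<^bsub>K\<^esub> \<oplus>\<^bsub>K\<^esub> ?k p \<otimes>\<^bsub>K\<^esub> Y (p, q))"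
      by (rule FA.module.R.finsum_cong')
        (use coord_sc[OF Yp TV i] Yp k in \<open>auto simp: FA.module.R.m_comm\<close>)
    finally show ?thesis .
  qed
  have kq: "?k q \<in> carrier K" by (rule k[OF Q_less[OF q]])
  have lin: "FA.affine_on (P \<times> Q) (\<lambda>X. \<zero>\<^bsub>K\<^esub> \<oplus>\<^bsub>K\<^esub> ?k p \<otimes>\<^bsub>K\<^esub> X (p, q)) (\<lambda>Y. \<zero>\<^bsub>K\<^esub> \<oplus>\<^bsub>K\<^esub> ?k p \<otimes>\<^bsub>K\<^esub> Y (p, q))"
    if p: "p \<in> P" for p
    by (rule FA.affine_on_comb[OF finite_PQ(3) FA.affine_on_const FA.affine_on_coordinate[OF finite_PQ(3)] k])
      (use p q in auto)
  have sum: "FA.affine_on (P \<times> Q) (\<lambda>X. \<Oplus>\<^bsub>K\<^esub>p\<in>P. \<zero>\<^bsub>K\<^esub> \<oplus>\<^bsub>K\<^esub> ?k p \<otimes>\<^bsub>K\<^esub> X (p, q)) (\<lambda>Y. \<Oplus>\<^bsub>K\<^esub>p\<in>P. \<zero>\<^bsub>K\<^esub> \<oplus>\<^bsub>K\<^esub> ?k p \<otimes>\<^bsub>K\<^esub> Y (p, q))"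
    by (rule FA.affine_on_finsum[OF finite_PQ(3,1) lin])
  have one: "\<one>\<^bsub>K\<^esub> \<in> carrier K" by simp
  show ?thesis
  proof (rule FA.affine_on_cong[OF FA.affine_on_comb[OF finite_PQ(3) FA.affine_on_const[OF kq] sum one]])
    have closed: "coord (T a (u Y q)) i \<in> carrier K" if "Y \<in> FA.points (P \<times> Q)" for Y
      by (rule coord_closed[OF T_V[OF a V_M[OF u_V[OF that q]]]])
    fix X assume X: "X \<in> FA.points (P \<times> Q)"
    note uM = V_M[OF u_V[OF X q]]
    have "coord (T a (w X q)) i = ?k q \<oplus>\<^bsub>K\<^esub> coord (T a (u X q)) i"
      unfolding w_def T_add[OF a bM[OF Q_less[OF q]] uM]
      by (rule coord_add[OF TV[OF Q_less[OF q]] T_V[OF a uM] i])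
    then show "coord (T a (w X q)) i = ?k q \<oplus>\<^bsub>K\<^esub> \<one>\<^bsub>K\<^esub> \<otimes>\<^bsub>K\<^esub> (\<Oplus>\<^bsub>K\<^esub>p\<in>P. \<zero>\<^bsub>K\<^esub> \<oplus>\<^bsub>K\<^esub> ?k p \<otimes>\<^bsub>K\<^esub> X (p, q))"
      unfolding coord_Tu[OF X, symmetric] using closed[OF X] by simp
    show "coord (T a (u X q)) i = \<zero>\<^bsub>K\<^esub> \<oplus>\<^bsub>K\<^esub> \<one>\<^bsub>K\<^esub> \<otimes>\<^bsub>K\<^esub> (\<Oplus>\<^bsub>K\<^esub>p\<in>P. \<zero>\<^bsub>K\<^esub> \<oplus>\<^bsub>K\<^esub> ?k p \<otimes>\<^bsub>K\<^esub> X (p, q))"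
      unfolding coord_Tu[OF X, symmetric] using closed[OF X] by simp
  qed
qed

text \<open>The \<open>p\<close>-th coordinate of \<open>T a (w X q)\<close> after reduction modulo the \<open>w X r\<close>: these quadratic polynomials in \<open>X\<close>
  vanish if the span of the \<open>w X r\<close> is, modulo \<open>Z\<close>, closed under \<open>e A e\<close>. A tangent vector at which all
  differentials vanish is a homomorphism \<open>U \<rightarrow> M / U\<close>.\<close>

definition obstruction :: "'a \<Rightarrow> nat \<Rightarrow> nat \<Rightarrow> (nat \<times> nat \<Rightarrow> 'k) \<Rightarrow> 'k" where
  "obstruction a q p X = coord (T a (w X q)) p \<oplus>\<^bsub>K\<^esub>
    (\<ominus>\<^bsub>K\<^esub> \<one>\<^bsub>K\<^esub>) \<otimes>\<^bsub>K\<^esub> (\<Oplus>\<^bsub>K\<^esub>r\<in>Q. coord (T a (w X q)) r \<otimes>\<^bsub>K\<^esub> X (p, r))"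

text \<open>The differential at X in direction Y: \<open>u Y\<close> is the derivative of
  \<open>w X\<close>, and the products follow the product rule.\<close>

definition obstruction_diff ::
    "'a \<Rightarrow> nat \<Rightarrow> nat \<Rightarrow> (nat \<times> nat \<Rightarrow> 'k) \<Rightarrow> (nat \<times> nat \<Rightarrow> 'k) \<Rightarrow> 'k" where
  "obstruction_diff a q p X Y = coord (T a (u Y q)) p \<oplus>\<^bsub>K\<^esub>
    (\<ominus>\<^bsub>K\<^esub> \<one>\<^bsub>K\<^esub>) \<otimes>\<^bsub>K\<^esub> (\<Oplus>\<^bsub>K\<^esub>r\<in>Q. coord (T a (w X q)) r \<otimes>\<^bsub>K\<^esub> Y (p, r) \<oplus>\<^bsub>K\<^esub> coord (T a (u Y q)) r \<otimes>\<^bsub>K\<^esub> X (p, r))"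

lemma quadratic_on_obstruction:
  assumes a: "a \<in> carrier A" and q: "q \<in> Q" and p: "p \<in> P"
  shows "FA.quadratic_on (P \<times> Q) (obstruction a q p) (obstruction_diff a q p)"
proof -
  have aff: "FA.quadratic_on (P \<times> Q) (\<lambda>X. coord (T a (w X q)) p) (\<lambda>X Y. coord (T a (u Y q)) p)"
    by (rule FA.quadratic_on_affine[OF finite_PQ(3) affine_on_coord[OF a q]]) (use p in simp)
  have prod: "FA.quadratic_on (P \<times> Q) (\<lambda>X. coord (T a (w X q)) r \<otimes>\<^bsub>K\<^esub> X (p, r))
      (\<lambda>X Y. coord (T a (w X q)) r \<otimes>\<^bsub>K\<^esub> Y (p, r) \<oplus>\<^bsub>K\<^esub> coord (T a (u Y q)) r \<otimes>\<^bsub>K\<^esub> X (p, r))"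
    if r: "r \<in> Q" for r
    by (rule FA.quadratic_on_mult[OF finite_PQ(3) affine_on_coord[OF a q Q_less[OF r]]
          FA.affine_on_coordinate[OF finite_PQ(3)]]) (use p r in simp)
  have n: "\<ominus>\<^bsub>K\<^esub> \<one>\<^bsub>K\<^esub> \<in> carrier K" by simp
  show ?thesis
    unfolding obstruction_def obstruction_diff_def
    by (rule FA.quadratic_on_comb[OF finite_PQ(3) aff FA.quadratic_on_finsum[OF finite_PQ(3,2) prod] n])
qed

lemma coord_comb_P:
  assumes "y \<in> V" "X \<in> FA.points (P \<times> Q)" "p \<in> P"
  shows "coord (comb y (w X)) p = (\<Oplus>\<^bsub>K\<^esub>r\<in>Q. coord y r \<otimes>\<^bsub>K\<^esub> X (p, r))"
    and "coord (comb y (u X)) p = (\<Oplus>\<^bsub>K\<^esub>r\<in>Q. coord y r \<otimes>\<^bsub>K\<^esub> X (p, r))"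
proof -
  have pm: "p < m" using assms(3) by simp
  have w_eq: "coord (comb y (w X)) p = (\<Oplus>\<^bsub>K\<^esub>r\<in>Q. coord y r \<otimes>\<^bsub>K\<^esub> coord (w X r) p)"
    by (rule coord_comb[OF assms(1) w_V[OF assms(2)] pm])
  have u_eq: "coord (comb y (u X)) p = (\<Oplus>\<^bsub>K\<^esub>r\<in>Q. coord y r \<otimes>\<^bsub>K\<^esub> coord (u X r) p)"
    by (rule coord_comb[OF assms(1) u_V[OF assms(2)] pm])
  have cl: "coord y r \<otimes>\<^bsub>K\<^esub> X (p, r) \<in> carrier K" if "r \<in> Q" for r
    using coord_closed[OF assms(1)] assms(2,3) that by simp
  show "coord (comb y (w X)) p = (\<Oplus>\<^bsub>K\<^esub>r\<in>Q. coord y r \<otimes>\<^bsub>K\<^esub> X (p, r))"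
    unfolding w_eq
    by (rule FA.module.R.finsum_cong') (use coord_w[OF assms(2) _ pm] assms(3) cl in auto)
  show "coord (comb y (u X)) p = (\<Oplus>\<^bsub>K\<^esub>r\<in>Q. coord y r \<otimes>\<^bsub>K\<^esub> X (p, r))"
    unfolding u_eq
    by (rule FA.module.R.finsum_cong') (use coord_u[OF assms(2) _ pm] assms(3) cl in auto)
qed

text \<open>U is stable under \<open>T a\<close>, so the image of a row differs from a combination
  of rows by an element of Z, and elements of Z have no coordinates in \<open>P\<close>.\<close>

lemma obstruction_cell:
  assumes U: "U \<in> cell" and a: "a \<in> carrier A" and q: "q \<in> Q" and p: "p \<in> P"
  shows "obstruction a q p (param U) = \<zero>\<^bsub>K\<^esub>"
proof -
  let ?X = "param U" and ?y = "T a (w (param U) q)"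
  note X = param_points[OF U]
  have pm: "p < m" "p \<notin> pivots Z" using p Z_J by auto
  have y: "?y \<in> U" "?y \<in> V"
    using T_rsubmodule[OF cellD(1)[OF U] a param_w[OF U q]] T_V[OF a V_M[OF w_V[OF X q]]] by auto
  have cV: "comb ?y (w ?X) \<in> V" by (rule comb_V[OF y(2) w_V[OF X]])
  have "?y \<ominus>\<^bsub>M\<^esub> comb ?y (w ?X) \<in> Z" by (rule diff_comb_mem_Z[OF U X param_w[OF U] y])
  then have "coord (?y \<ominus>\<^bsub>M\<^esub> comb ?y (w ?X)) p = \<zero>\<^bsub>K\<^esub>"
    by (rule coord_Z[OF _ V_closed(4)[OF y(2) cV] pm])
  then show ?thesis
    using coord_minus[OF y(2) cV pm(1)] coord_comb_P(1)[OF y(2) X p] coord_closed[OF cV, of p]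
    by (simp add: obstruction_def FA.module.R.l_minus FA.module.R.minus_eq)
qed

text \<open>The tangent vector Y defines a linear map \<Psi> that kills Z \<inter> V and sends the
  row \<open>w ?X q\<close> to \<open>u Y q\<close>. Vanishing differentials make it commute with
  every \<open>T a\<close> modulo U, so orthogonality puts \<open>u Y q\<close> into U. This vector
  has no coordinates in \<open>Q\<close>, hence none in \<open>P\<close>, and those are the entries
  of Y.\<close>

lemma obstruction_nondegenerate:
  assumes U: "U \<in> cell" and orth: "hom_orthogonal A M U" and Y: "Y \<in> FA.points (P \<times> Q)"
    and zero: "\<And>a q p. a \<in> carrier A \<Longrightarrow> q \<in> Q \<Longrightarrow> p \<in> P \<Longrightarrow> obstruction_diff a q p (param U) Y = \<zero>\<^bsub>K\<^esub>"
    and pq: "p \<in> P" "q \<in> Q"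
  shows "Y (p, q) = \<zero>\<^bsub>K\<^esub>"
proof -
  let ?X = "param U"
  define \<Psi> where "\<Psi> y = comb y (u Y)" for y
  note X = param_points[OF U] and US = cellD(1)[OF U]
  note D = RM.rsubmoduleD[OF US]
  have \<Psi>_V: "\<Psi> y \<in> V" if "y \<in> V" for y unfolding \<Psi>_def by (rule comb_V[OF that u_V[OF Y]])
  have \<Psi>_add: "\<Psi> (x \<oplus>\<^bsub>M\<^esub> y) = \<Psi> x \<oplus>\<^bsub>M\<^esub> \<Psi> y" if "x \<in> V" "y \<in> V" for x y
    unfolding \<Psi>_def by (rule comb_add[OF that u_V[OF Y]])
  have \<Psi>_sc: "\<Psi> (sc c y) = sc c (\<Psi> y)" if "c \<in> carrier K" "y \<in> V" for c y
    unfolding \<Psi>_def by (rule comb_sc[OF that u_V[OF Y]])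
  have \<Psi>_w: "\<Psi> (w ?X q) = u Y q" if q: "q \<in> Q" for q
  proof -
    have "\<Psi> (w ?X q) = (\<Oplus>\<^bsub>M\<^esub>r\<in>Q. if q = r then u Y r else \<zero>\<^bsub>M\<^esub>)"
      unfolding \<Psi>_def comb_def
      by (rule RM.M.finsum_cong') (use coord_w[OF X q Q_less] V_M[OF u_V[OF Y]] in auto)
    also have "\<dots> = u Y q"
      by (rule RM.M.finsum_singleton[OF q finite_PQ(2)]) (use V_M[OF u_V[OF Y]] in auto)
    finally show ?thesis .
  qed
  have \<Psi>_Z: "\<Psi> z = \<zero>\<^bsub>M\<^esub>" if "z \<in> Z" "z \<in> V" for z
    unfolding \<Psi>_def by (rule comb_eq_zero[OF _ u_V[OF Y]]) (use coord_Z[OF that] Q_less in auto)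
  have equivariant: "T a (\<Psi> y) \<ominus>\<^bsub>M\<^esub> \<Psi> (T a y) \<in> U" if a: "a \<in> carrier A" and y: "y \<in> U" "y \<in> V" for a y
  proof -
    \<comment> \<open>The failure of \<Psi> to commute with \<open>T a\<close>. It is additive and
      homogeneous on V and vanishes on Z \<inter> V, so only its values at the rows have to be
      examined.\<close>
    define E where "E y = T a (\<Psi> y) \<ominus>\<^bsub>M\<^esub> \<Psi> (T a y)" for y
    have cl: "\<Psi> y \<in> V" "T a y \<in> V" "T a (\<Psi> y) \<in> V" "\<Psi> (T a y) \<in> V" if "y \<in> V" for y
      using that T_V[OF a V_M] \<Psi>_V by blast+
    have E_V: "E y \<in> V" if "y \<in> V" for y
      unfolding E_def by (rule V_closed(4)[OF cl(3,4)[OF that]])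
    have E_add: "E (x \<oplus>\<^bsub>M\<^esub> y) = E x \<oplus>\<^bsub>M\<^esub> E y" if xy: "x \<in> V" "y \<in> V" for x y
      unfolding E_def T_add[OF a V_M[OF xy(1)] V_M[OF xy(2)]] \<Psi>_add[OF xy]
        T_add[OF a V_M[OF cl(1)[OF xy(1)]] V_M[OF cl(1)[OF xy(2)]]] \<Psi>_add[OF cl(2)[OF xy(1)] cl(2)[OF xy(2)]]
      by (rule RM.M.add_diff_add) (intro V_M cl xy)+
    have E_sc: "E (sc c x) = sc c (E x)" if cx: "c \<in> carrier K" "x \<in> V" for c x
      unfolding E_def T_sc[OF a cx(1) V_M[OF cx(2)]] \<Psi>_sc[OF cx]
        T_sc[OF a cx(1) V_M[OF cl(1)[OF cx(2)]]] \<Psi>_sc[OF cx(1) cl(2)[OF cx(2)]]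
      by (rule sc_minus[OF cx(1) V_M[OF cl(3)[OF cx(2)]] V_M[OF cl(4)[OF cx(2)]], symmetric])
    have E_w: "E (w ?X q) \<in> U" if q: "q \<in> Q" for q
    proof -
      \<comment> \<open>Subtracting \<open>?h\<close>, which belongs to U, clears the coordinates of
        \<open>?t - ?g\<close> in \<open>Q\<close>. Those left in \<open>P\<close> are values of
        \<open>obstruction_diff\<close>, which vanish, so the difference lies in Z.\<close>
      let ?t = "T a (u Y q)" and ?g = "comb (T a (w ?X q)) (u Y)" and ?h = "comb (T a (u Y q)) (w ?X)"
      have V: "?t \<in> V" "T a (w ?X q) \<in> V" using T_V[OF a V_M[OF u_V[OF Y q]]] T_V[OF a V_M[OF w_V[OF X q]]] by simp_all
      have gV: "?g \<in> V" by (rule comb_V[OF V(2) u_V[OF Y]])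
      have hV: "?h \<in> V" by (rule comb_V[OF V(1) w_V[OF X]])
      have tgV: "?t \<ominus>\<^bsub>M\<^esub> ?g \<in> V" by (rule V_closed(4)[OF V(1) gV])
      have coord: "coord ((?t \<ominus>\<^bsub>M\<^esub> ?g) \<ominus>\<^bsub>M\<^esub> ?h) i = (coord ?t i \<ominus>\<^bsub>K\<^esub> coord ?g i) \<ominus>\<^bsub>K\<^esub> coord ?h i"
        if "i < m" for i
        using coord_minus[OF tgV hV that] coord_minus[OF V(1) gV that] by simp
      have "(?t \<ominus>\<^bsub>M\<^esub> ?g) \<ominus>\<^bsub>M\<^esub> ?h \<in> Z"
      proof (rule mem_Z[OF V_closed(4)[OF tgV hV]])
        show "coord ((?t \<ominus>\<^bsub>M\<^esub> ?g) \<ominus>\<^bsub>M\<^esub> ?h) r = \<zero>\<^bsub>K\<^esub>" if r: "r \<in> Q" for r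
          unfolding coord[OF Q_less[OF r]] coord_comb_u[OF Y V(2) r] coord_comb_w[OF X V(1) r]
          using coord_closed[OF V(1), of r] by (simp add: FA.module.R.minus_eq FA.module.R.r_neg)
        fix p assume p: "p \<in> P"
        then have pm: "p < m" by simp
        have "(\<Oplus>\<^bsub>K\<^esub>r\<in>Q. coord (T a (w ?X q)) r \<otimes>\<^bsub>K\<^esub> Y (p, r) \<oplus>\<^bsub>K\<^esub> coord ?t r \<otimes>\<^bsub>K\<^esub> ?X (p, r)) =
            coord ?g p \<oplus>\<^bsub>K\<^esub> coord ?h p"
          unfolding coord_comb_P(2)[OF V(2) Y p] coord_comb_P(1)[OF V(1) X p]
          by (rule FA.module.R.finsum_addf)
            (use coord_closed[OF V(1)] coord_closed[OF V(2)] X Y p in \<open>auto intro!: FA.module.R.m_closed\<close>)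
        then have "coord ?t p \<oplus>\<^bsub>K\<^esub> (\<ominus>\<^bsub>K\<^esub> \<one>\<^bsub>K\<^esub>) \<otimes>\<^bsub>K\<^esub> (coord ?g p \<oplus>\<^bsub>K\<^esub> coord ?h p) = \<zero>\<^bsub>K\<^esub>"
          using zero[OF a q p] by (simp add: obstruction_diff_def)
        then show "coord ((?t \<ominus>\<^bsub>M\<^esub> ?g) \<ominus>\<^bsub>M\<^esub> ?h) p = \<zero>\<^bsub>K\<^esub>"
          unfolding coord[OF pm]
          using coord_closed[OF V(1), of p] coord_closed[OF gV, of p] coord_closed[OF hV, of p]
          by (simp add: FA.module.R.l_minus FA.module.R.minus_eq FA.module.R.minus_add FA.module.R.a_assoc)
      qed
      then have "(?t \<ominus>\<^bsub>M\<^esub> ?g) \<ominus>\<^bsub>M\<^esub> ?h \<in> U" using cellD(2)[OF U] by blast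
      moreover have "?h \<in> U" by (rule comb_rsubmodule[OF US V(1) param_w[OF U]])
      ultimately have "?t \<ominus>\<^bsub>M\<^esub> ?g \<in> U"
        using RM.diff_mem[OF US V_M[OF tgV] V_M[OF hV]] by blast
      then show ?thesis unfolding E_def \<Psi>_w[OF q] by (simp add: \<Psi>_def)
    qed
    have E_Z: "E z = \<zero>\<^bsub>M\<^esub>" if z: "z \<in> Z" "z \<in> V" for z
      unfolding E_def \<Psi>_Z[OF z] \<Psi>_Z[OF T_rsubmodule[OF Z a z(1)] cl(2)[OF z(2)]]
      using a e_closed by (simp add: T_def RM.M.minus_eq_add RM.M.neg_zero)
    have zeroV: "E \<zero>\<^bsub>M\<^esub> = \<zero>\<^bsub>M\<^esub>" by (rule E_Z[OF RM.rsubmoduleD(2)[OF Z] V_closed(1)])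
    let ?g = "comb y (w ?X)"
    have gV: "?g \<in> V" by (rule comb_V[OF y(2) w_V[OF X]])
    have dV: "y \<ominus>\<^bsub>M\<^esub> ?g \<in> V" by (rule V_closed(4)[OF y(2) gV])
    have dZ: "y \<ominus>\<^bsub>M\<^esub> ?g \<in> Z" by (rule diff_comb_mem_Z[OF U X param_w[OF U] y])
    have cw: "sc (coord y r) (w ?X r) \<in> V" if "r \<in> Q" for r
      by (rule V_closed(3)[OF coord_closed[OF y(2)] w_V[OF X that]])
    have V_sub: "V \<subseteq> carrier M" by (rule subsetI) (rule V_M)
    have "E ?g = (\<Oplus>\<^bsub>M\<^esub>r\<in>Q. E (sc (coord y r) (w ?X r)))"
      unfolding comb_def
      by (rule finsum_additive(2)[where D = V and \<phi> = E, OF RM.M.abelian_monoid_axioms RM.M.abelian_monoid_axioms])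
        (fact V_sub V_closed(1,2) V_M[OF E_V] zeroV E_add finite_PQ(2) cw)+
    also have "\<dots> \<in> U"
      by (rule finsum_in_rsubmodule[OF US finite_PQ(2)])
        (simp only: E_sc[OF coord_closed[OF y(2)] w_V[OF X]] sc_rsubmodule[OF US coord_closed[OF y(2)] E_w])
    finally have "E ?g \<in> U" .
    moreover have "E (?g \<oplus>\<^bsub>M\<^esub> (y \<ominus>\<^bsub>M\<^esub> ?g)) = E ?g"
      using E_add[OF gV dV] E_Z[OF dZ dV] V_M[OF E_V[OF gV]] by simp
    ultimately show ?thesis
      using RM.M.add_diff_cancel[OF V_M[OF gV] V_M[OF y(2)]] by (simp add: E_def)
  qed
  have "\<Psi> (w ?X q) \<in> U"
    by (rule hom_orthogonal_V[OF orth _ _ equivariant param_w[OF U pq(2)] w_V[OF X pq(2)]])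
      (use \<Psi>_V \<Psi>_add in blast)+
  then have uU: "u Y q \<in> U" by (simp add: \<Psi>_w[OF pq(2)])
  have "coord (u Y q) p = \<zero>\<^bsub>K\<^esub>"
    by (rule coord_cell[OF U uU u_V[OF Y pq(2)] _ pq(1)]) (use coord_u[OF Y pq(2) Q_less] in auto)
  then show ?thesis using coord_u[OF Y pq(2), of p] pq(1) by simp
qed

text \<open>The coordinates of the orthogonal submodules are zeros of all obstructions, and each
  nonzero tangent vector is detected by the differential of some obstruction; there are |P| |Q|
  variables.\<close>

theorem card_hom_orthogonal_cell:
  "finite {U \<in> cell. hom_orthogonal A M U} \<and> card {U \<in> cell. hom_orthogonal A M U} \<le> 2 ^ (card P * card Q)"
proof -
  let ?C = "{U \<in> cell. hom_orthogonal A M U}"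
  have inj: "inj_on param ?C" using inj_on_param by (rule inj_on_subset) auto
  have bound: "finite (param ` ?C) \<and> card (param ` ?C) \<le> 2 ^ card (P \<times> Q)"
  proof (rule FA.card_nondegenerate_zeros_quadratic[OF finite_PQ(3)])
    show "param ` ?C \<subseteq> P \<times> Q \<rightarrow>\<^sub>E carrier K" using param_closed by blast
    fix X Y assume X: "X \<in> param ` ?C" and Y: "Y \<in> FA.points (P \<times> Q)" and nz: "\<exists>s\<in>P \<times> Q. Y s \<noteq> \<zero>\<^bsub>K\<^esub>"
    obtain U where U: "U \<in> cell" "hom_orthogonal A M U" "X = param U" using X by blast
    obtain p q where pq: "p \<in> P" "q \<in> Q" "Y (p, q) \<noteq> \<zero>\<^bsub>K\<^esub>" using nz by blast
    obtain a r s where ars: "a \<in> carrier A" "r \<in> Q" "s \<in> P" "obstruction_diff a r s X Y \<noteq> \<zero>\<^bsub>K\<^esub>"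
      using obstruction_nondegenerate[OF U(1,2) Y _ pq(1,2)] pq(3) U(3) by blast
    have vanish: "\<forall>X'\<in>param ` ?C. obstruction a r s X' = \<zero>\<^bsub>K\<^esub>"
      using obstruction_cell[OF _ ars(1,2,3)] by blast
    show "\<exists>F dF. FA.quadratic_on (P \<times> Q) F dF \<and> (\<forall>X'\<in>param ` ?C. F X' = \<zero>\<^bsub>K\<^esub>) \<and> dF X Y \<noteq> \<zero>\<^bsub>K\<^esub>"
      by (rule exI, rule exI) (rule conjI[OF quadratic_on_obstruction[OF ars(1,2,3)] conjI[OF vanish ars(4)]])
  qed
  show ?thesis
  proof
    show "finite ?C" using bound finite_imageD[OF _ inj] by simp
    show "card ?C \<le> 2 ^ (card P * card Q)"
      using bound unfolding card_image[OF inj] card_cartesian_product by (rule conjunct2)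
  qed
qed

end

section \<open>Counting chains\<close>

text \<open>With |J - J0| = |J| - |J0| the two exponents add up to (m - |J|) n, at most (n - 1) n
  because J is strictly larger than J0. There are at most 2^n sets J, and n + n (n - 1) =
  n^2.\<close>

lemma sum_proper_subsets:
  fixes m :: nat
  assumes J0: "J0 \<subseteq> {..<m}"
  defines "n \<equiv> m - card J0"
  shows "(\<Sum>J | J0 \<subset> J \<and> J \<subseteq> {..<m}. 2 ^ ((m - card J) * card (J - J0)) * 2 ^ ((m - card J)\<^sup>2)) \<le> (2::nat) ^ n\<^sup>2"
proof -
  let ?S = "{J. J0 \<subset> J \<and> J \<subseteq> {..<m}}"
  have fin: "finite J0" using J0 finite_subset by blast
  have bound: "2 ^ ((m - card J) * card (J - J0)) * 2 ^ ((m - card J)\<^sup>2) \<le> (2::nat) ^ (n * (n - 1))"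
    if J: "J \<in> ?S" for J
  proof -
    have finJ: "finite J" and le: "card J \<le> m" and less: "card J0 < card J"
      using J finite_subset[of J "{..<m}"] card_mono[of "{..<m}" J] psubset_card_mono[of J J0] by auto
    have cJ: "card (J - J0) = card J - card J0" using J card_Diff_subset[OF fin] by auto
    have "(m - card J) * card (J - J0) + (m - card J)\<^sup>2 = (m - card J) * n"
      using le less by (simp add: cJ n_def power2_eq_square flip: distrib_left)
    also have "\<dots> \<le> (n - 1) * n" using less le by (intro mult_right_mono) (auto simp: n_def)
    finally show ?thesis by (simp add: mult.commute flip: power_add)
  qed
  have "?S \<subseteq> (\<lambda>X. J0 \<union> X) ` (Pow ({..<m} - J0))"
  proof
    fix J assume "J \<in> ?S"
    then have "J = J0 \<union> (J - J0)" "J - J0 \<in> Pow ({..<m} - J0)" by auto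
    then show "J \<in> (\<lambda>X. J0 \<union> X) ` (Pow ({..<m} - J0))" by blast
  qed
  then have "card ?S \<le> card (Pow ({..<m} - J0))" by (rule surj_card_le[rotated]) simp
  also have "\<dots> = 2 ^ n" using card_Diff_subset[OF fin J0] by (simp add: card_Pow n_def)
  finally have card: "card ?S \<le> 2 ^ n" .
  show ?thesis
  proof (cases "n = 0")
    case True
    have empty: "?S = {}"
    proof (rule ccontr)
      assume "?S \<noteq> {}"
      then obtain J where J: "J0 \<subset> J" "J \<subseteq> {..<m}" by blast
      then have "card J0 < card J" "card J \<le> m"
        using psubset_card_mono[of J J0] finite_subset[of J "{..<m}"] card_mono[of "{..<m}" J] by auto
      then show False using True by (simp add: n_def)
    qed
    show ?thesis unfolding empty by simp
  next
    case False
    have "(\<Sum>J\<in>?S. 2 ^ ((m - card J) * card (J - J0)) * 2 ^ ((m - card J)\<^sup>2)) \<le> (\<Sum>J\<in>?S. (2::nat) ^ (n * (n - 1)))"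
      by (rule sum_mono) (rule bound)
    also have "\<dots> \<le> 2 ^ n * 2 ^ (n * (n - 1))" using card by simp
    also have "\<dots> = 2 ^ n\<^sup>2"
      using False by (cases n) (simp_all add: power2_eq_square flip: power_add)
    finally show ?thesis .
  qed
qed

context basic_series begin

lemma card_hom_orthogonal_pivots:
  assumes Z: "rsubmodule A M Z" and J: "pivots Z \<subset> J" "J \<subseteq> {..<m}"
  defines "C \<equiv> {U. hom_orthogonal A M U \<and> Z \<subseteq> U \<and> pivots U = J}"
  shows "finite C \<and> card C \<le> 2 ^ ((m - card J) * card (J - pivots Z))"
proof -
  \<comment> \<open>The basis is taken inside Z at the pivots of Z and arbitrarily in the other
    layers.\<close>
  have "\<exists>x. x \<in> V \<and> x \<in> N (Suc i) \<and> x \<notin> N i \<and> (i \<in> pivots Z \<longrightarrow> x \<in> Z)" if i: "i < m" for i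
  proof (cases "i \<in> pivots Z")
    case True
    then show ?thesis by (auto simp: pivots_def)
  next
    case False
    then show ?thesis using V_generator[OF i] by metis
  qed
  then obtain b where b: "\<And>i. i < m \<Longrightarrow> b i \<in> V" "\<And>i. i < m \<Longrightarrow> b i \<in> N (Suc i)"
    "\<And>i. i < m \<Longrightarrow> b i \<notin> N i" "\<And>i. i < m \<Longrightarrow> i \<in> pivots Z \<Longrightarrow> b i \<in> Z" by metis
  have bZ: "b r \<in> Z" if r: "r \<in> pivots Z" for r
    using b(4)[of r] r pivots_less[of Z] by blast
  have ZJ: "pivots Z \<subseteq> J" using J(1) by blast
  have "adapted_basis K A M N m e b"
    by (rule adapted_basis.intro[OF basic_series_axioms adapted_basis_axioms.intro]) (fact b)+
  moreover have "pivot_chart_axioms A M N m e b Z J"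
    by (rule pivot_chart_axioms.intro) (fact Z J(2) ZJ bZ)+
  ultimately have chart: "pivot_chart K A M N m e b Z J"
    by (rule pivot_chart.intro)
  have sub: "rsubmodule A M U" if "hom_orthogonal A M U" for U
    using that unfolding hom_orthogonal_def by (rule conjunct1)
  have eq: "C = {U \<in> pivot_chart.cell A M N m e Z J. hom_orthogonal A M U}"
    unfolding C_def pivot_chart.cell_def[OF chart] mem_Collect_eq
  proof (rule Collect_cong)
    show "(hom_orthogonal A M U \<and> Z \<subseteq> U \<and> pivots U = J) =
        ((rsubmodule A M U \<and> Z \<subseteq> U \<and> pivots U = J) \<and> hom_orthogonal A M U)" for U
      using sub[of U] by argo
  qed
  have "card ({..<m} - J) = m - card J"
    using card_Diff_subset[OF finite_subset[OF J(2) finite_lessThan] J(2)] by (simp only: card_lessThan)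
  then show ?thesis using pivot_chart.card_hom_orthogonal_cell[OF chart] unfolding eq by (simp only:)
qed

text \<open>Of a brick chain filtration only the strict inclusions and the orthogonality of its
  members are kept, which makes the tail of such a chain an object of the same kind.\<close>

definition orth_chains :: "'m set \<Rightarrow> 'm set list set" where
  "orth_chains Z = {Ms. Ms \<noteq> [] \<and> hd Ms = Z \<and> last Ms = carrier M \<and> sorted_wrt (\<subset>) Ms \<and>
    (\<forall>U\<in>set Ms. hom_orthogonal A M U)}"

lemma orth_chains_cases:
  assumes "Ms \<in> orth_chains Z"
  shows "(Z = carrier M \<and> Ms = [Z]) \<or>
    (\<exists>U Ns. Ms = Z # Ns \<and> Ns \<in> orth_chains U \<and> hom_orthogonal A M U \<and> Z \<subset> U)"
proof -
  obtain Ns where Ms: "Ms = Z # Ns" using assms by (cases Ms) (auto simp: orth_chains_def)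
  show ?thesis
  proof (cases Ns)
    case Nil
    then show ?thesis using assms Ms by (simp add: orth_chains_def)
  next
    case (Cons U Ls)
    then show ?thesis using assms Ms by (auto simp: orth_chains_def)
  qed
qed

text \<open>A chain that has not reached M continues with some U whose pivot set J strictly contains
  that of Z. The choices of U for a given J are bounded by the cell count, and the rest of the chain
  by induction, as m - |J| is smaller.\<close>

lemma card_orth_chains:
  assumes "rsubmodule A M Z"
  shows "finite (orth_chains Z) \<and> card (orth_chains Z) \<le> 2 ^ (m - card (pivots Z))\<^sup>2"
  using assms
proof (induction "m - card (pivots Z)" arbitrary: Z rule: less_induct)
  case less
  note Z = less.prems
  let ?J0 = "pivots Z" and ?S = "{J. pivots Z \<subset> J \<and> J \<subseteq> {..<m}}"
  define C where "C J = {U. hom_orthogonal A M U \<and> Z \<subseteq> U \<and> pivots U = J}" for J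
  show ?case
  proof (cases "Z = carrier M")
    case True
    have "orth_chains Z \<subseteq> {[Z]}"
    proof
      fix Ms assume "Ms \<in> orth_chains Z"
      from orth_chains_cases[OF this] show "Ms \<in> {[Z]}"
        using True RM.rsubmoduleD(1) by (auto simp: hom_orthogonal_def)
    qed
    then have fin: "finite (orth_chains Z)" and "card (orth_chains Z) \<le> 1"
      using finite_subset[of "orth_chains Z" "{[Z]}"] card_mono[of "{[Z]}" "orth_chains Z"] by auto
    moreover have "(1::nat) \<le> 2 ^ (m - card ?J0)\<^sup>2" by simp
    ultimately show ?thesis using order_trans by blast
  next
    case False
    have finS: "finite ?S" by (rule finite_subset[of _ "Pow {..<m}"]) auto
    have C: "finite (C J) \<and> card (C J) \<le> 2 ^ ((m - card J) * card (J - ?J0))" if "J \<in> ?S" for J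
      unfolding C_def by (rule card_hom_orthogonal_pivots[OF Z]) (use that in auto)
    have IH: "finite (orth_chains U) \<and> card (orth_chains U) \<le> 2 ^ (m - card J)\<^sup>2" if J: "J \<in> ?S" and U: "U \<in> C J" for J U
    proof -
      have U': "rsubmodule A M U" "pivots U = J" using U by (simp_all add: C_def hom_orthogonal_def)
      have "card ?J0 < card J" "card J \<le> m"
        using J psubset_card_mono[of J ?J0] finite_subset[of J "{..<m}"] card_mono[of "{..<m}" J] by auto
      then show ?thesis using less.hyps[of U] U' by simp
    qed
    let ?D = "\<Union>J\<in>?S. \<Union>U\<in>C J. (#) Z ` orth_chains U"
    have sub: "orth_chains Z \<subseteq> ?D"
    proof
      fix Ms assume "Ms \<in> orth_chains Z"
      from orth_chains_cases[OF this] False obtain U Ns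
        where U: "Ms = Z # Ns" "Ns \<in> orth_chains U" "hom_orthogonal A M U" "Z \<subset> U" by blast
      have "pivots Z \<subset> pivots U" using pivots_strict_mono[OF Z] U(3,4) by (simp add: hom_orthogonal_def)
      then have "pivots U \<in> ?S" "U \<in> C (pivots U)" using U(3,4) pivots_less[of U] by (auto simp: C_def)
      then show "Ms \<in> ?D" using U(1,2) by blast
    qed
    have finD: "finite ?D"
    proof (rule finite_UN_I[OF finS])
      fix J assume J: "J \<in> ?S"
      show "finite (\<Union>U\<in>C J. (#) Z ` orth_chains U)"
        by (rule finite_UN_I) (use C[OF J] IH[OF J] in auto)
    qed
    have "card ?D \<le> (\<Sum>J\<in>?S. card (\<Union>U\<in>C J. (#) Z ` orth_chains U))" by (rule card_UN_le[OF finS])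
    also have "\<dots> \<le> (\<Sum>J\<in>?S. 2 ^ ((m - card J) * card (J - ?J0)) * 2 ^ (m - card J)\<^sup>2)"
    proof (rule sum_mono)
      fix J assume J: "J \<in> ?S"
      have fC: "finite (C J)" and cC: "card (C J) \<le> 2 ^ ((m - card J) * card (J - ?J0))" using C[OF J] by auto
      have "card (\<Union>U\<in>C J. (#) Z ` orth_chains U) \<le> (\<Sum>U\<in>C J. card ((#) Z ` orth_chains U))" by (rule card_UN_le[OF fC])
      also have "\<dots> \<le> (\<Sum>U\<in>C J. 2 ^ (m - card J)\<^sup>2)"
      proof (rule sum_mono)
        fix U assume U: "U \<in> C J"
        show "card ((#) Z ` orth_chains U) \<le> 2 ^ (m - card J)\<^sup>2"
          using IH[OF J U] card_image_le[of "orth_chains U" "(#) Z"] by (auto intro: order_trans)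
      qed
      also have "\<dots> = card (C J) * 2 ^ (m - card J)\<^sup>2" by simp
      also have "\<dots> \<le> 2 ^ ((m - card J) * card (J - ?J0)) * 2 ^ (m - card J)\<^sup>2" using cC by (rule mult_right_mono) simp
      finally show "card (\<Union>U\<in>C J. (#) Z ` orth_chains U) \<le> 2 ^ ((m - card J) * card (J - ?J0)) * 2 ^ (m - card J)\<^sup>2" .
    qed
    also have "\<dots> \<le> 2 ^ (m - card ?J0)\<^sup>2" by (rule sum_proper_subsets[OF pivots_less])
    finally have "card ?D \<le> 2 ^ (m - card ?J0)\<^sup>2" .
    then show ?thesis using finite_subset[OF sub finD] card_mono[OF finD sub] by (auto intro: order_trans)
  qed
qed

end

text \<open>The rank-one element for the factors of a composition series is idempotent only modulo
  lower layers; lifting it along the whole series makes it idempotent on M.\<close>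

lemma basic_series_exists:
  fixes K :: "'k ring" and A :: "('k, 'a) module" and M :: "('a, 'm) module"
  assumes alg: "fd_algebra K A" and split: "split_algebra K A" and M: "fd_right_module K A M"
    and m: "has_composition_length K A M m"
  shows "\<exists>N e. basic_series K A M N m e"
proof -
  interpret fd_module K A M by (rule fd_moduleI[OF alg M])
  obtain Ms where Ms: "filtration A M Ms" "length Ms = Suc m" and simple: "\<And>i. i < m \<Longrightarrow> simple_module K A (factor M Ms i)"
    using m unfolding has_composition_length_def by blast
  define N where "N i = Ms ! i" for i
  have sub: "rsubmodule A M (N i)" if "i \<le> m" for i
    using Ms that nth_mem[of i Ms] by (auto simp: filtration_def N_def)
  have mono: "N i \<subseteq> N (Suc i)" if "i < m" for i
    using Ms that sorted_wrt_nth_less[of "(\<subseteq>)" Ms i "Suc i"] by (auto simp: filtration_def N_def)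
  have N0: "N 0 = {\<zero>\<^bsub>M\<^esub>}" and Nm: "N m = carrier M"
    using Ms by (auto simp: filtration_def N_def hd_conv_nth last_conv_nth)
  have factor: "factor M Ms i = quotient_module (M\<lparr>carrier := N (Suc i)\<rparr>) (N i)" for i
    by (simp add: factor_def N_def)
  obtain a where a: "a \<in> carrier A" "\<forall>j<m. rank_one_idempotent K A (factor M Ms j) a"
    using common_rank_one_element[OF alg split, of m "factor M Ms"] simple by blast
  have rank: "rank_one_on (N i) (N (Suc i)) a" if i: "i < m" for i
    by (rule rank_one_on_subquotient[OF _ _ mono[OF i] a(1)]) (use sub i a(2) factor in auto)
  obtain e where e: "e \<in> carrier A" "\<forall>i<m. rank_one_on (N i) (N (Suc i)) e"
    "\<forall>x\<in>N m. e \<odot>\<^bsub>M\<^esub> (e \<odot>\<^bsub>M\<^esub> x) = e \<odot>\<^bsub>M\<^esub> x"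
    using idempotent_lifting[of m N a m] sub N0 a(1) rank by blast
  have trans: "\<exists>c\<in>carrier A. c \<odot>\<^bsub>M\<^esub> y \<ominus>\<^bsub>M\<^esub> z \<in> N i"
    if i: "i < m" and y: "y \<in> N (Suc i)" "y \<notin> N i" and z: "z \<in> N (Suc i)" for i y z
  proof -
    have s: "rsubmodule A M (N i)" "rsubmodule A M (N (Suc i))" using sub i by auto
    have M: "y \<in> carrier M" "z \<in> carrier M" using RM.rsubmoduleD(1)[OF s(2)] y(1) z by auto
    note Q = RM.subquotient_simps[OF s mono[OF i], folded factor]
    have "N i +>\<^bsub>M\<^esub> y \<noteq> \<zero>\<^bsub>factor M Ms i\<^esub>" using RM.coset_eq_self_iff[OF s(1) M(1)] y(2) Q(2) by simp
    then obtain c where c: "c \<in> carrier A" "c \<odot>\<^bsub>factor M Ms i\<^esub> (N i +>\<^bsub>M\<^esub> y) = N i +>\<^bsub>M\<^esub> z"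
      using simple_module_transitive[OF simple[OF i], of "N i +>\<^bsub>M\<^esub> y" "N i +>\<^bsub>M\<^esub> z"] Q(1) y(1) z by blast
    then have "N i +>\<^bsub>M\<^esub> (c \<odot>\<^bsub>M\<^esub> y) = N i +>\<^bsub>M\<^esub> z" using Q(4)[OF c(1) y(1)] by simp
    then show ?thesis using RM.coset_eq_iff[OF s(1) RM.act_closed[OF c(1) M(1)] M(2)] c(1) by blast
  qed
  have "basic_series K A M N m e"
  proof (rule basic_series.intro[OF fd_module_axioms basic_series_axioms.intro])
    show "e \<odot>\<^bsub>M\<^esub> (e \<odot>\<^bsub>M\<^esub> x) = e \<odot>\<^bsub>M\<^esub> x" if "x \<in> carrier M" for x
      using e(3) that unfolding Nm by (rule bspec)
    show "rank_one_on (N i) (N (Suc i)) e" if "i < m" for i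
      using e(2) that by simp
  qed (fact sub N0 Nm mono trans e(1))+
  then show ?thesis by (intro exI)
qed

text \<open>Finiteness is claimed explicitly because \<open>card\<close> is 0 on infinite sets,
  where the inequality would say nothing.\<close>

theorem corollary3p4:
  fixes K :: "'k ring" and A :: "('k, 'a) module" and M :: "('a, 'm) module" and m :: nat
  assumes "fd_algebra K A"
    and "split_algebra K A"
    and "fd_right_module K A M"
    and "has_composition_length K A M m"
  shows "finite {Ms. brick_chain_filtration K A M Ms} \<and> brick_chain_number K A M \<le> 2 ^ (m\<^sup>2)"
proof -
  obtain N e where series: "basic_series K A M N m e"
    using basic_series_exists[OF assms] by (elim exE)
  let ?chains = "basic_series.orth_chains A M {\<zero>\<^bsub>M\<^esub>}"
  have M: "right_module A M" using assms(3) by (simp add: fd_right_module_def)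
  have sub: "{Ms. brick_chain_filtration K A M Ms} \<subseteq> ?chains"
  proof
    fix Ms assume "Ms \<in> {Ms. brick_chain_filtration K A M Ms}"
    then have Ms: "brick_chain_filtration K A M Ms" by simp
    then show "Ms \<in> ?chains"
      using brick_chain_hom_orthogonal[OF M Ms]
      by (simp add: basic_series.orth_chains_def[OF series] brick_chain_filtration_def filtration_def)
  qed
  have zero: "rsubmodule A M {\<zero>\<^bsub>M\<^esub>}"
    using basic_series.N_sub[OF series le0] unfolding basic_series.N_0[OF series] .
  \<comment> \<open>The chains start at zero, whose pivot set is empty; this gives the exponent
    m^2.\<close>
  from basic_series.card_orth_chains[OF series zero]
  have fin: "finite ?chains" and card: "card ?chains \<le> 2 ^ m\<^sup>2"
    unfolding basic_series.pivots_zero[OF series] by simp_all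
  show ?thesis
    unfolding brick_chain_number_def
    using finite_subset[OF sub fin] order_trans[OF card_mono[OF fin sub] card] by (rule conjI)
qed

end
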